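(* Let $N$ be a positive integer, let $w=\mathrm{polylog}(N)$ and $d=O(1)$, and let $f\colon [N]\to [2^{w}]^d$ be a function computable in $\tilde{O}(1)$ time. For any choice of a constant $0<\alpha<1$, one can construct in $\tilde{O}(N)$ time with high probability a data structure using $\tilde{O}(N^{1-\alpha/3})$ words of space which supports the following query: given a $d$-dimensional box $B$, test whether there exists $x\in[N]$ with $f(x)\in B$, and report such an $x$ if it exists, in $\tilde{O}(N^{\alpha})$ time.
   Context: $[M]$ denotes $\{0,1,\dots,M-1\}$. The notation $\tilde{O}(\cdot)$ omits factors polylogarithmic in $N$. A "box" is an axis-aligned box (hyperrectangle with sides parallel to the coordinate axes), here with integer coordinates. Space is measured in machine words (word RAM model), and $f$ is accessed by evaluating it. *)

theory Defs
  imports "HOL-Probability.Probability" "HOL-Library.Landau_Symbols" "HOL-Library.Log_Nat"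
begin

section \<open>Soft-O\<close>

definition soft_O :: "(nat \<Rightarrow> real) \<Rightarrow> (nat \<Rightarrow> real) set" where
  "soft_O g = (\<Union>k::nat. O(\<lambda>N. g N * ln (real N) ^ k))"

section \<open>A randomized word RAM with access to a function\<close>

text \<open>
  Words are natural numbers below \<open>2 ^ word_bits\<close>.  The machine reaches the function
  \<open>fn\<close>, whose values have \<open>fn_dim\<close> coordinates, only by evaluating it; one evaluation at \<open>x\<close>
  takes time \<open>fn_time x\<close>.
\<close>

record machine =
  word_bits :: nat
  fn_dim :: nat
  fn :: "nat \<Rightarrow> nat \<Rightarrow> nat"
  fn_time :: "nat \<Rightarrow> nat"

datatype binop = Plus | Minus | Times | Divide | Modulo
  | BitAnd | BitOr | BitXor | ShiftL | ShiftR | Less | Equal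

text \<open>All arithmetic is modulo \<open>2 ^ b\<close>; in particular subtraction wraps around.\<close>

fun apply_op :: "nat \<Rightarrow> binop \<Rightarrow> nat \<Rightarrow> nat \<Rightarrow> nat" where
  "apply_op b Plus x y = (x + y) mod 2 ^ b"
| "apply_op b Minus x y = nat ((int x - int y) mod 2 ^ b)"
| "apply_op b Times x y = (x * y) mod 2 ^ b"
| "apply_op b Divide x y = x div y"
| "apply_op b Modulo x y = x mod y"
| "apply_op b BitAnd x y = Bit_Operations.and x y"
| "apply_op b BitOr x y = Bit_Operations.or x y"
| "apply_op b BitXor x y = Bit_Operations.xor x y"
| "apply_op b ShiftL x y = push_bit y x mod 2 ^ b"
| "apply_op b ShiftR x y = drop_bit y x"
| "apply_op b Less x y = of_bool (x < y)"
| "apply_op b Equal x y = of_bool (x = y)"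

datatype expr = Const nat | Reg nat | Op binop expr expr

fun expr_val :: "nat \<Rightarrow> (nat \<Rightarrow> nat) \<Rightarrow> expr \<Rightarrow> nat" where
  "expr_val b R (Const n) = n mod 2 ^ b"
| "expr_val b R (Reg r) = R r"
| "expr_val b R (Op g e1 e2) = apply_op b g (expr_val b R e1) (expr_val b R e2)"

datatype com =
    Skip
  | Assign nat expr
  | Load nat expr
  | Store expr expr
  | Rand nat
  | Call nat expr
  | Seq com com
  | Cond expr com com
  | Loop expr com

text \<open>\<open>rand_used\<close> counts the random words consumed so far.\<close>

record state =
  regs :: "nat \<Rightarrow> nat"
  mem :: "nat \<Rightarrow> nat"
  rand_used :: nat

abbreviation evalx :: "machine \<Rightarrow> state \<Rightarrow> expr \<Rightarrow> nat" where
  "evalx M s e \<equiv> expr_val (word_bits M) (regs s) e"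

text \<open>
  \<open>exec M \<omega> c s t s'\<close>: started in \<open>s\<close> with the sequence \<open>\<omega>\<close> of random words, \<open>c\<close> halts in \<open>s'\<close>
  after time \<open>t\<close>.  Expressions cost \<open>O(1)\<close>, because their size is fixed by the program;
  \<open>Call r e\<close> puts the coordinates of the value of \<open>fn\<close> at \<open>e\<close> into consecutive registers,
  starting with \<open>r\<close>.
\<close>

inductive exec :: "machine \<Rightarrow> (nat \<Rightarrow> nat) \<Rightarrow> com \<Rightarrow> state \<Rightarrow> nat \<Rightarrow> state \<Rightarrow> bool"
  for M :: machine and \<omega> :: "nat \<Rightarrow> nat"
where
  Skip: "exec M \<omega> Skip s 1 s"
| Assign: "exec M \<omega> (Assign r e) s 1 (s\<lparr>regs := (regs s)(r := evalx M s e)\<rparr>)"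
| Load: "exec M \<omega> (Load r e) s 1 (s\<lparr>regs := (regs s)(r := mem s (evalx M s e))\<rparr>)"
| Store: "exec M \<omega> (Store e1 e2) s 1 (s\<lparr>mem := (mem s)(evalx M s e1 := evalx M s e2)\<rparr>)"
| Rand: "exec M \<omega> (Rand r) s 1
    (s\<lparr>regs := (regs s)(r := \<omega> (rand_used s) mod 2 ^ word_bits M),
       rand_used := Suc (rand_used s)\<rparr>)"
| Call: "exec M \<omega> (Call r e) s (1 + fn_time M (evalx M s e))
    (s\<lparr>regs := (\<lambda>j. if r \<le> j \<and> j < r + fn_dim M
                    then fn M (evalx M s e) (j - r) mod 2 ^ word_bits M else regs s j)\<rparr>)"
| Seq: "exec M \<omega> c1 s t1 s1 \<Longrightarrow> exec M \<omega> c2 s1 t2 s2 \<Longrightarrow> exec M \<omega> (Seq c1 c2) s (t1 + t2) s2"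
| CondT: "evalx M s e \<noteq> 0 \<Longrightarrow> exec M \<omega> c1 s t s' \<Longrightarrow> exec M \<omega> (Cond e c1 c2) s (1 + t) s'"
| CondF: "evalx M s e = 0 \<Longrightarrow> exec M \<omega> c2 s t s' \<Longrightarrow> exec M \<omega> (Cond e c1 c2) s (1 + t) s'"
| LoopF: "evalx M s e = 0 \<Longrightarrow> exec M \<omega> (Loop e c) s 1 s"
| LoopT: "evalx M s e \<noteq> 0 \<Longrightarrow> exec M \<omega> c s t1 s1 \<Longrightarrow> exec M \<omega> (Loop e c) s1 t2 s2
    \<Longrightarrow> exec M \<omega> (Loop e c) s (1 + t1 + t2) s2"

inductive_cases SkipE: "exec M \<omega> Skip s t s'"
inductive_cases AssignE: "exec M \<omega> (Assign r e) s t s'"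
inductive_cases LoadE: "exec M \<omega> (Load r e) s t s'"
inductive_cases StoreE: "exec M \<omega> (Store e1 e2) s t s'"
inductive_cases RandE: "exec M \<omega> (Rand r) s t s'"
inductive_cases CallE: "exec M \<omega> (Call r e) s t s'"
inductive_cases SeqE: "exec M \<omega> (Seq c1 c2) s t s'"
inductive_cases CondE: "exec M \<omega> (Cond e c1 c2) s t s'"
inductive_cases LoopE: "exec M \<omega> (Loop e c) s t s'"

lemma exec_deterministic:
  "exec M \<omega> c s t s' \<Longrightarrow> exec M \<omega> c s u s'' \<Longrightarrow> u = t \<and> s'' = s'"
proof (induction arbitrary: u s'' rule: exec.induct)
  case (Seq c1 s t1 s1 c2 t2 s2)
  show ?case using Seq.prems
  proof (rule SeqE)
    fix u1 r1 u2
    assume "u = u1 + u2" and 1: "exec M \<omega> c1 s u1 r1" and 2: "exec M \<omega> c2 r1 u2 s''"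
    moreover have "u1 = t1 \<and> r1 = s1" using Seq.IH(1) 1 .
    ultimately show ?thesis using Seq.IH(2)[of u2 s''] by simp
  qed
next
  case (CondT s e c1 t s' c2)
  show ?case using CondT.prems by (rule CondE) (simp_all add: CondT.hyps CondT.IH)
next
  case (CondF s e c2 t s' c1)
  show ?case using CondF.prems by (rule CondE) (simp_all add: CondF.hyps CondF.IH)
next
  case (LoopF s e c)
  show ?case using LoopF.prems by (rule LoopE) (simp_all add: LoopF.hyps)
next
  case (LoopT s e c t1 s1 t2 s2)
  show ?case using LoopT.prems
  proof (rule LoopE)
    fix u1 r1 u2
    assume "u = Suc (u1 + u2)" and 1: "exec M \<omega> c s u1 r1" and 2: "exec M \<omega> (Loop e c) r1 u2 s''"
    moreover have "u1 = t1 \<and> r1 = s1" using LoopT.IH(1) 1 .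
    ultimately show ?thesis using LoopT.IH(2)[of u2 s''] by simp
  qed (simp_all add: LoopT.hyps)
next
  case Skip then show ?case by (rule SkipE) simp
next
  case Assign then show ?case by (rule AssignE) simp
next
  case Load then show ?case by (rule LoadE) simp
next
  case Store then show ?case by (rule StoreE) simp
next
  case Rand then show ?case by (rule RandE) simp
next
  case Call then show ?case by (rule CallE) simp
qed

definition start :: "nat list \<Rightarrow> (nat \<Rightarrow> nat) \<Rightarrow> state" where
  "start inp m = \<lparr>regs = (\<lambda>j. if j < length inp then inp ! j else 0), mem = m, rand_used = 0\<rparr>"

definition random_words :: "nat \<Rightarrow> (nat \<Rightarrow> nat) measure" where
  "random_words b = PiM UNIV (\<lambda>_. measure_pmf (pmf_of_set {..<2 ^ b}))"

section \<open>Data structures for box queries\<close>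

definition int_box :: "nat \<Rightarrow> (nat \<Rightarrow> nat) \<Rightarrow> (nat \<Rightarrow> nat) \<Rightarrow> (nat \<Rightarrow> nat) set" where
  "int_box d lo hi = {y. \<forall>i<d. lo i \<le> y i \<and> y i \<le> hi i}"

text \<open>
  Words have \<open>\<Theta>(w + log N)\<close> bits, so that they hold coordinates in \<open>[2 ^ w]\<close>, elements of \<open>[N]\<close>
  and memory addresses; \<open>K\<close> is the constant factor, and \<open>floorlog 2 N\<close> the bit length of \<open>N\<close>.
\<close>

definition ram :: "nat \<Rightarrow> nat \<Rightarrow> nat \<Rightarrow> nat \<Rightarrow> (nat \<Rightarrow> nat \<Rightarrow> nat) \<Rightarrow> (nat \<Rightarrow> nat) \<Rightarrow> machine" where
  "ram K N w d f tm =
     \<lparr>word_bits = w + K * floorlog 2 N, fn_dim = d, fn = f, fn_time = tm\<rparr>"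

text \<open>
  Programs do not depend on \<open>N\<close> or \<open>w\<close> and get them as input.  They also get the integer
  \<open>\<lceil>N powr \<alpha>\<rceil>\<close>, since \<open>\<alpha>\<close> is an arbitrary, possibly uncomputable, real number.
\<close>

definition params :: "real \<Rightarrow> nat \<Rightarrow> nat \<Rightarrow> nat list" where
  "params \<alpha> N w = [N, w, nat \<lceil>real N powr \<alpha>\<rceil>]"

text \<open>
  The query program \<open>Q\<close> starts with the data structure \<open>D\<close> in its memory and the corners of
  the box in its registers.  On halting, register 0 tells whether a preimage exists, and if so,
  register 1 holds one.  Queries are deterministic: the outcome may not depend on \<open>\<omega>\<close>.
\<close>

definition answers_box ::
  "machine \<Rightarrow> nat \<Rightarrow> nat list \<Rightarrow> com \<Rightarrow> (nat \<Rightarrow> nat) \<Rightarrow> nat \<Rightarrow> (nat \<Rightarrow> nat) \<Rightarrow> (nat \<Rightarrow> nat) \<Rightarrow> bool"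
where
  "answers_box M N ps Q D T lo hi \<longleftrightarrow>
     (\<forall>\<omega>. \<exists>t s. exec M \<omega> Q (start (ps @ map lo [0..<fn_dim M] @ map hi [0..<fn_dim M]) D) t s \<and> t \<le> T \<and>
        (if \<exists>x<N. fn M x \<in> int_box (fn_dim M) lo hi
         then regs s 0 = 1 \<and> regs s 1 < N \<and> fn M (regs s 1) \<in> int_box (fn_dim M) lo hi
         else regs s 0 = 0))"

text \<open>
  With the random words \<open>\<omega>\<close>, the construction program \<open>P\<close> halts within time \<open>Tp\<close>, leaving a
  data structure of at most \<open>S\<close> words (its size in register 0, its contents at the start of the
  memory) that supports every query within time \<open>Tq\<close>.  The corners of the query box range over
  all machine words, hence over all boxes up to intersection with \<open>[2 ^ w]\<^sup>d\<close>.
  Queries see only the data structure: the rest of the memory is erased.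
\<close>

definition builds_box_structure ::
  "machine \<Rightarrow> nat \<Rightarrow> nat list \<Rightarrow> com \<Rightarrow> com \<Rightarrow> nat \<Rightarrow> nat \<Rightarrow> nat \<Rightarrow> (nat \<Rightarrow> nat) \<Rightarrow> bool"
where
  "builds_box_structure M N ps P Q Tp S Tq \<omega> \<longleftrightarrow>
     (\<exists>t s. exec M \<omega> P (start ps (\<lambda>_. 0)) t s \<and> t \<le> Tp \<and> regs s 0 \<le> S \<and>
        (\<forall>lo hi. (\<forall>i<fn_dim M. lo i < 2 ^ word_bits M \<and> hi i < 2 ^ word_bits M) \<longrightarrow>
           answers_box M N ps Q (\<lambda>a. if a < regs s 0 then mem s a else 0) Tq lo hi))"

end

theory Submission
  imports Defs
begin

text \<open>
  Fix a dyadic level \<open>s i\<close> for each coordinate and let \<open>g x\<close> consist of the numbers \<open>f x i div 2 ^ s i\<close>.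
  If \<open>f x\<close> lies in a box, then a maximal dyadic box around it inside the query box is one of
  polylogarithmically many candidates, so it suffices to invert each of the polylogarithmically many
  functions \<open>g\<close> on one key.  This is done by rainbow tables with pairwise independent hashing.

  Let \<open>p\<close> be about \<open>N powr (\<alpha> / 3)\<close>.  Hash tables of about \<open>N / p\<close> random points catch, with high probability,
  every value of \<open>g\<close> with more than about \<open>p\<close> preimages.  In addition there are about \<open>p * log N\<close> tables with
  \<open>N / p\<^sup>2\<close> chains of length \<open>p\<close> each; column \<open>i\<close> of a table moves from \<open>y\<close> to \<open>g (h i y)\<close> unless that value was
  caught.  The other values have few preimages, hence chains rarely merge, and by a second moment
  argument a given \<open>x\<close> lies on a chain with an end slot of its own with probability of the order
  \<open>1 / p\<close>.  So \<open>p * log N\<close> tables cover every \<open>x\<close>.  The end slot stores the number of the chain.  To invert \<open>g\<close> at \<open>y\<close>,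
  guess the table and the column of \<open>y\<close>, walk to the end and replay the chain found there: the
  space is \<open>p * (N / p\<^sup>2)\<close> and the time \<open>p ^ 3\<close>, up to logarithms.
\<close>

section \<open>Lists of independent samples\<close>

text \<open>Each column of a table has its own independent seed, so a chain is analysed by
  conditioning on the columns already passed. Within a column only pairwise independence is
  available; union bounds and Bonferroni's inequality reduce every estimate to at most two keys per
  column. The delicate event is that a chain visits \<open>x\<close> and later shares its end slot
  with another one: the collision bound alone would lose the factor \<open>1 / n\<close> of the
  visit, so \<open>prob_visits_collision\<close> treats both together. This requires that the other
  chain does not already rest at \<open>g x\<close>; therefore keys have an extra leading entry, 0
  for values of \<open>g\<close> and nonzero for chain starts. One random construction must serve
  all boxes. The bridge is \<open>complete\<close>, a property of the memory in which no box occurs.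
  Its failure is covered by at most \<open>D * N\<close> events for each kind of table, where the
  \<open>D\<close> indices encode levels and candidate cells and all share the same random words.
  Once it holds, queries succeed deterministically; and as every reported point is tested against
  the box, hashing can cause misses but no wrong answers.\<close>

lemma prob_bind_le:
  assumes "\<And>x. x \<in> set_pmf p \<Longrightarrow> measure_pmf.prob (f x) E \<le> (if x \<in> B then a else 0) + c" and "0 \<le> a"
  shows "measure_pmf.prob (bind_pmf p f) E \<le> measure_pmf.prob p B * a + c"
proof -
  have "measure_pmf.prob (bind_pmf p f) E = measure_pmf.expectation p (\<lambda>x. measure_pmf.prob (f x) E)"
    unfolding measure_pmf_bind
    by (rule measure_pmf.measure_bind[where N = "count_space UNIV"]) (auto simp: measure_pmf_in_subprob_space)
  also have "\<dots> \<le> measure_pmf.expectation p (\<lambda>x. indicator B x * a + c)"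
  proof (rule integral_mono_AE)
    show "integrable (measure_pmf p) (\<lambda>x. measure_pmf.prob (f x) E)"
      by (rule measure_pmf.integrable_const_bound[where B = 1]) auto
    show "integrable (measure_pmf p) (\<lambda>x. indicator B x * a + c)"
      by (intro Bochner_Integration.integrable_add integrable_mult_left integrable_real_indicator)
        (auto simp: measure_pmf.emeasure_eq_measure)
    show "AE x in measure_pmf p. measure_pmf.prob (f x) E \<le> indicator B x * a + c"
      unfolding AE_measure_pmf_iff
    proof
      fix x assume "x \<in> set_pmf p"
      then show "measure_pmf.prob (f x) E \<le> indicator B x * a + c"
        using assms(1)[of x] by (simp add: indicator_def split: if_splits)
    qed
  qed
  also have "\<dots> = measure_pmf.prob p B * a + c"
    by (subst Bochner_Integration.integral_add)
       (auto intro!: integrable_mult_left integrable_real_indicator simp: measure_pmf.emeasure_eq_measure)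
  finally show ?thesis .
qed

lemma prob_bind_const:
  assumes "\<And>x. x \<in> set_pmf p \<Longrightarrow> measure_pmf.prob (f x) E = (if x \<in> B then a else 0)"
  shows "measure_pmf.prob (bind_pmf p f) E = measure_pmf.prob p B * a"
proof -
  have "measure_pmf.prob (bind_pmf p f) E = measure_pmf.expectation p (\<lambda>x. measure_pmf.prob (f x) E)"
    unfolding measure_pmf_bind
    by (rule measure_pmf.measure_bind[where N = "count_space UNIV"]) (auto simp: measure_pmf_in_subprob_space)
  also have "\<dots> = measure_pmf.expectation p (\<lambda>x. indicator B x * a)"
    by (rule integral_cong_AE) (auto simp: AE_measure_pmf_iff assms)
  also have "\<dots> = measure_pmf.prob p B * a" by simp
  finally show ?thesis .
qed

lemma replicate_pmf_Suc_alt: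
  "replicate_pmf (Suc n) p = bind_pmf p (\<lambda>x. map_pmf ((#) x) (replicate_pmf n p))"
  by (simp add: map_pmf_def)

text \<open>One step of conditioning, shaped for induction over the columns of a table:
  \<open>B\<close> collects the first samples that already spoil the estimate, \<open>a\<close>
  bounds the extra damage they do, and \<open>c\<close> is the bound for the remaining
  columns.\<close>

lemma prob_replicate_Suc_le:
  assumes "\<And>x. x \<in> set_pmf p \<Longrightarrow> measure_pmf.prob (replicate_pmf n p) {xs. x # xs \<in> E} \<le> (if x \<in> B then a else 0) + c"
    and "0 \<le> a"
  shows "measure_pmf.prob (replicate_pmf (Suc n) p) E \<le> measure_pmf.prob p B * a + c"
  unfolding replicate_pmf_Suc_alt
  by (rule prob_bind_le) (use assms in \<open>auto simp: vimage_def\<close>)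

lemma prob_replicate_Suc_const:
  assumes "\<And>x. x \<in> set_pmf p \<Longrightarrow> measure_pmf.prob (replicate_pmf n p) {xs. x # xs \<in> E} = (if x \<in> B then a else 0)"
  shows "measure_pmf.prob (replicate_pmf (Suc n) p) E = measure_pmf.prob p B * a"
  unfolding replicate_pmf_Suc_alt
  by (rule prob_bind_const) (use assms in \<open>auto simp: vimage_def\<close>)

text \<open>Independence of the tables turns the failure probability of one table into a
  power.\<close>

lemma prob_replicate_all:
  "measure_pmf.prob (replicate_pmf n p) {xs. \<forall>i<n. xs ! i \<in> S} = measure_pmf.prob p S ^ n"
proof (induction n)
  case (Suc n)
  have "measure_pmf.prob (replicate_pmf (Suc n) p) {xs. \<forall>i<Suc n. xs ! i \<in> S}
      = measure_pmf.prob p S * measure_pmf.prob p S ^ n"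
    by (rule prob_replicate_Suc_const) (auto simp: Suc[symmetric] less_Suc_eq_0_disj all_conj_distrib
       intro!: arg_cong2[where f = measure] intro: measure_empty)
  then show ?case by simp
qed simp

text \<open>Bonferroni's inequality. Pairs are summed in both orders, which costs a factor 2 in the
  correction term but needs no order on \<open>I\<close>; the second moment arguments below have
  room for it.\<close>

lemma prob_Union_ge:
  assumes "finite I"
  shows "measure_pmf.prob p (\<Union>a\<in>I. A a)
    \<ge> (\<Sum>a\<in>I. measure_pmf.prob p (A a)) - (\<Sum>a\<in>I. \<Sum>b\<in>I - {a}. measure_pmf.prob p (A a \<inter> A b))"
  using assms
proof (induction I)
  case (insert x F)
  let ?P = "measure_pmf.prob p"
  have "?P (\<Union>a\<in>insert x F. A a) = ?P (A x) + ?P (\<Union>a\<in>F. A a) - ?P (\<Union>b\<in>F. A x \<inter> A b)"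
    using measure_Un3[of "A x" "measure_pmf p" "\<Union>a\<in>F. A a"]
    by (simp add: measure_pmf.fmeasurable_eq_sets)
  moreover have "?P (\<Union>b\<in>F. A x \<inter> A b) \<le> (\<Sum>b\<in>F. ?P (A x \<inter> A b))"
    by (rule measure_pmf.finite_measure_subadditive_finite) (use insert in auto)
  moreover have "(\<Sum>a\<in>insert x F. \<Sum>b\<in>insert x F - {a}. ?P (A a \<inter> A b))
      = (\<Sum>b\<in>F. ?P (A x \<inter> A b)) + (\<Sum>a\<in>F. \<Sum>b\<in>insert x F - {a}. ?P (A a \<inter> A b))"
    using insert by simp
  moreover have "(\<Sum>a\<in>F. \<Sum>b\<in>insert x F - {a}. ?P (A a \<inter> A b)) \<ge> (\<Sum>a\<in>F. \<Sum>b\<in>F - {a}. ?P (A a \<inter> A b))"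
    by (intro sum_mono sum_mono2) (use insert in auto)
  ultimately show ?case using insert by simp
qed simp

text \<open>The machine draws one flat sequence of words; cutting it into blocks of length
  \<open>n\<close> yields independent seeds.\<close>

lemma replicate_pmf_chunks:
  "map_pmf (\<lambda>ws. map (\<lambda>i. take n (drop (i * n) ws)) [0..<F]) (replicate_pmf (F * n) p)
    = replicate_pmf F (replicate_pmf n p)"
proof (induction F)
  case (Suc F)
  have eq: "map (\<lambda>i. take n (drop (i * n) (xs @ ys))) [0..<Suc F]
      = xs # map (\<lambda>i. take n (drop (i * n) ys)) [0..<F]" if "length xs = n" for xs ys :: "'a list"
    using that by (simp add: upt_conv_Cons map_Suc_upt[symmetric] o_def del: upt_Suc)
  have "map_pmf (\<lambda>ws. map (\<lambda>i. take n (drop (i * n) ws)) [0..<Suc F]) (replicate_pmf (Suc F * n) p)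
    = bind_pmf (replicate_pmf n p) (\<lambda>xs. bind_pmf (replicate_pmf (F * n) p)
        (\<lambda>ys. return_pmf (map (\<lambda>i. take n (drop (i * n) (xs @ ys))) [0..<Suc F])))"
    by (simp add: replicate_pmf_distrib map_bind_pmf map_pmf_def bind_assoc_pmf bind_return_pmf del: upt_Suc)
  also have "\<dots> = bind_pmf (replicate_pmf n p) (\<lambda>xs. bind_pmf (replicate_pmf (F * n) p)
        (\<lambda>ys. return_pmf (xs # map (\<lambda>i. take n (drop (i * n) ys)) [0..<F])))"
    by (intro bind_pmf_cong refl arg_cong[where f = return_pmf] eq) (simp add: set_replicate_pmf)
  also have "\<dots> = replicate_pmf (Suc F) (replicate_pmf n p)"
    by (simp add: Suc[symmetric] map_pmf_def bind_assoc_pmf bind_return_pmf)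
  finally show ?case .
qed simp

section \<open>Pairwise independent hashing\<close>

locale hash_family =
  fixes p :: "'s pmf" and hx :: "'s \<Rightarrow> 'k \<Rightarrow> nat" and n :: nat and Keys :: "'k set"
  assumes n_pos: "0 < n"
    and hx_less: "\<sigma> \<in> set_pmf p \<Longrightarrow> y \<in> Keys \<Longrightarrow> hx \<sigma> y < n"
    and hx_uniform: "y \<in> Keys \<Longrightarrow> x < n \<Longrightarrow> measure_pmf.prob p {\<sigma>. hx \<sigma> y = x} = 1 / n"
    and hx_pairwise: "y \<in> Keys \<Longrightarrow> y' \<in> Keys \<Longrightarrow> y \<noteq> y' \<Longrightarrow> x < n \<Longrightarrow> x' < n \<Longrightarrow>
      measure_pmf.prob p {\<sigma>. hx \<sigma> y = x \<and> hx \<sigma> y' = x'} = 1 / real n ^ 2"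
begin

abbreviation "P \<equiv> measure_pmf.prob p"

lemma prob_hx_in:
  assumes "y \<in> Keys" "A \<subseteq> {..<n}"
  shows "P {\<sigma>. hx \<sigma> y \<in> A} = card A / n"
proof -
  have "{\<sigma>. hx \<sigma> y \<in> A} = (\<Union>x\<in>A. {\<sigma>. hx \<sigma> y = x})" by auto
  also have "P \<dots> = (\<Sum>x\<in>A. P {\<sigma>. hx \<sigma> y = x})"
    using assms(2) finite_subset
    by (intro measure_pmf.finite_measure_finite_Union) (auto simp: disjoint_family_on_def)
  also have "\<dots> = (\<Sum>x\<in>A. 1 / n)"
    using assms by (intro sum.cong refl hx_uniform) auto
  finally show ?thesis by simp
qed

text \<open>The set \<open>B\<close> may depend on the first hash value. This covers events such as
  both points lying in the same fibre of \<open>g\<close> or in the same residue class, not only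
  product events.\<close>

lemma prob_hx_pair_le:
  fixes k :: real
  assumes "y \<in> Keys" "y' \<in> Keys" "y \<noteq> y'" "A \<subseteq> {..<n}"
    and "\<And>x. x \<in> A \<Longrightarrow> B x \<subseteq> {..<n}" and "\<And>x. x \<in> A \<Longrightarrow> real (card (B x)) \<le> k"
  shows "P {\<sigma>. hx \<sigma> y \<in> A \<and> hx \<sigma> y' \<in> B (hx \<sigma> y)} \<le> real (card A) * k / real n ^ 2"
proof -
  have fin: "finite A" using assms(4) finite_subset by auto
  have finB: "finite (B x)" if "x \<in> A" for x using assms(5)[OF that] finite_subset by auto
  have "{\<sigma>. hx \<sigma> y \<in> A \<and> hx \<sigma> y' \<in> B (hx \<sigma> y)}
      = (\<Union>x\<in>A. \<Union>x'\<in>B x. {\<sigma>. hx \<sigma> y = x \<and> hx \<sigma> y' = x'})" by auto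
  also have "P \<dots> \<le> (\<Sum>x\<in>A. P (\<Union>x'\<in>B x. {\<sigma>. hx \<sigma> y = x \<and> hx \<sigma> y' = x'}))"
    by (rule measure_pmf.finite_measure_subadditive_finite) (use fin in auto)
  also have "\<dots> \<le> (\<Sum>x\<in>A. k / real n ^ 2)"
  proof (rule sum_mono)
    fix x assume x: "x \<in> A"
    have "P (\<Union>x'\<in>B x. {\<sigma>. hx \<sigma> y = x \<and> hx \<sigma> y' = x'})
        \<le> (\<Sum>x'\<in>B x. P {\<sigma>. hx \<sigma> y = x \<and> hx \<sigma> y' = x'})"
      by (rule measure_pmf.finite_measure_subadditive_finite) (use finB x in auto)
    also have "\<dots> = (\<Sum>x'\<in>B x. 1 / real n ^ 2)"
      using x assms by (intro sum.cong refl hx_pairwise) auto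
    also have "\<dots> = card (B x) / real n ^ 2" by simp
    also have "\<dots> \<le> k / real n ^ 2" using assms(6)[OF x] by (intro divide_right_mono) auto
    finally show "P (\<Union>x'\<in>B x. {\<sigma>. hx \<sigma> y = x \<and> hx \<sigma> y' = x'}) \<le> k / real n ^ 2" .
  qed
  also have "\<dots> = card A * k / real n ^ 2" by simp
  finally show ?thesis .
qed

lemma card_residue_class_le: "card {x'. x' < n \<and> x' mod m = r} \<le> n div m + 1" if "0 < m" for m r :: nat
proof -
  have "inj_on (\<lambda>x. x div m) {x'. x' < n \<and> x' mod m = r}"
    by (rule inj_onI) (metis (mono_tags, lifting) div_mult_mod_eq mem_Collect_eq)
  moreover have "(\<lambda>x. x div m) ` {x'. x' < n \<and> x' mod m = r} \<subseteq> {..n div m}"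
    by (auto intro: div_le_mono)
  ultimately have "card {x'. x' < n \<and> x' mod m = r} \<le> card {..n div m}"
    by (intro card_inj_on_le[where f = "\<lambda>x. x div m"]) auto
  then show ?thesis by simp
qed

text \<open>\<open>m\<close> need not divide \<open>n\<close>, so slots are not exactly uniform: a
  residue class has at most \<open>n div m + 1\<close> elements, and \<open>m \<le> n\<close> turns
  this into the factor 2.\<close>

lemma prob_slot_collision:
  assumes "y \<in> Keys" "y' \<in> Keys" "y \<noteq> y'" "0 < m" "m \<le> n"
  shows "P {\<sigma>. hx \<sigma> y mod m = hx \<sigma> y' mod m} \<le> 2 / m"
proof -
  have "P {\<sigma>. hx \<sigma> y mod m = hx \<sigma> y' mod m}
      \<le> P {\<sigma>. hx \<sigma> y \<in> {..<n} \<and> hx \<sigma> y' \<in> {x'. x' < n \<and> x' mod m = hx \<sigma> y mod m}}"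
    by (rule measure_pmf.finite_measure_mono_AE)
       (use assms in \<open>auto simp: AE_measure_pmf_iff intro: hx_less\<close>)
  also have "\<dots> \<le> card {..<n} * (2 * real n / m) / real n ^ 2"
  proof (rule prob_hx_pair_le[where B = "\<lambda>x. {x'. x' < n \<and> x' mod m = x mod m}"])
    fix x
    have "real (card {x'. x' < n \<and> x' mod m = x mod m}) \<le> real (n div m) + 1"
      using card_residue_class_le[OF \<open>0 < m\<close>, of "x mod m"] by linarith
    also have "\<dots> \<le> n / m + n / m"
      using assms(4,5) by (intro add_mono of_nat_div_le_of_nat) (auto simp: field_simps)
    finally show "real (card {x'. x' < n \<and> x' mod m = x mod m}) \<le> 2 * real n / m" by simp
  qed (use assms in auto)
  also have "\<dots> = 2 / m" using n_pos by (simp add: power2_eq_square)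
  finally show ?thesis .
qed

end

section \<open>Walks on the values of a function\<close>

text \<open>Column \<open>i\<close> uses its own seed \<open>ss ! i\<close>, as in a rainbow table:
  two chains merge only if they reach the same key in the same column.\<close>

definition walk :: "('s \<Rightarrow> 'k \<Rightarrow> 'k) \<Rightarrow> 's list \<Rightarrow> nat \<Rightarrow> 'k \<Rightarrow> 'k" where
  "walk f ss t y = fold (\<lambda>i. f (ss ! i)) [0..<t] y"

lemma walk_0 [simp]: "walk f ss 0 y = y"
  by (simp add: walk_def)

lemma walk_Suc: "walk f ss (Suc t) y = f (ss ! t) (walk f ss t y)"
  by (simp add: walk_def)

lemma walk_Cons: "walk f (s # ss) (Suc t) y = walk f ss t (f s y)"
  by (induction t) (simp_all add: walk_Suc)

text \<open>
  \<open>L\<close> are the values caught by the sample tables.  Chains never enter them, so that every value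
  on a chain has at most \<open>k\<close> preimages.
\<close>

locale rainbow = hash_family p hx n Keys
  for p :: "'s pmf" and hx :: "'s \<Rightarrow> 'k \<Rightarrow> nat" and n and Keys +
  fixes N :: nat and g :: "nat \<Rightarrow> 'k" and L :: "'k set" and k :: nat
  assumes N_le: "N \<le> n" and g_Keys: "x < N \<Longrightarrow> g x \<in> Keys"
    and light: "v \<notin> L \<Longrightarrow> card {x. x < N \<and> g x = v} \<le> k"
begin

text \<open>Hash values range over \<open>n\<close>, a power of two in the application, so a walk
  also rests when the hash value is not a point of \<open>[N]\<close>.\<close>

definition step :: "'s \<Rightarrow> 'k \<Rightarrow> 'k" where
  "step \<sigma> y = (let x = hx \<sigma> y in if x < N \<and> g x \<notin> L then g x else y)"

lemma step_Keys: "y \<in> Keys \<Longrightarrow> step \<sigma> y \<in> Keys"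
  by (simp add: step_def Let_def g_Keys)

lemma prob_enter:
  assumes "y \<in> Keys" "y \<noteq> v" "v \<notin> L"
  shows "P {\<sigma>. step \<sigma> y = v} \<le> k / n"
proof -
  have "P {\<sigma>. step \<sigma> y = v} \<le> P {\<sigma>. hx \<sigma> y \<in> {x. x < N \<and> g x = v}}"
    by (rule measure_pmf.finite_measure_mono) (use assms in \<open>auto simp: step_def Let_def split: if_splits\<close>)
  also have "\<dots> = card {x. x < N \<and> g x = v} / n"
    by (rule prob_hx_in) (use assms N_le in auto)
  also have "\<dots> \<le> k / n"
    by (intro divide_right_mono) (use light assms in auto)
  finally show ?thesis .
qed

text \<open>Since \<open>y \<noteq> y'\<close>, a merge needs a move: either both keys move into the
  same fibre of \<open>g\<close>, or one rests and the other moves onto it, in two ways. Each of the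
  three events has probability at most \<open>k / n\<close>.\<close>

lemma prob_merge:
  assumes "y \<in> Keys" "y' \<in> Keys" "y \<noteq> y'"
  shows "P {\<sigma>. step \<sigma> y = step \<sigma> y'} \<le> 3 * k / n"
proof -
  let ?A = "{x. x < N \<and> g x \<notin> L}"
  let ?B = "\<lambda>x. {x'. x' < N \<and> g x' = g x}"
  let ?both = "{\<sigma>. hx \<sigma> y \<in> ?A \<and> hx \<sigma> y' \<in> ?B (hx \<sigma> y)}"
  let ?in = "\<lambda>z v. {\<sigma>. v \<notin> L \<and> hx \<sigma> z \<in> {x. x < N \<and> g x = v}}"
  have "P ?both \<le> real (card ?A) * k / real n ^ 2"
    by (rule prob_hx_pair_le) (use assms N_le light in auto)
  also have "\<dots> \<le> real n * k / real n ^ 2"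
  proof -
    have "card ?A \<le> card {..<n}" using N_le by (intro card_mono) auto
    then show ?thesis by (intro divide_right_mono mult_right_mono) (auto simp del: of_nat_less_0_iff)
  qed
  also have "\<dots> = k / n" using n_pos by (simp add: power2_eq_square)
  finally have both: "P ?both \<le> k / n" .
  have one: "P (?in z v) \<le> k / n" if "z \<in> Keys" for z v
  proof (cases "v \<in> L")
    case False
    have "P (?in z v) = card {x. x < N \<and> g x = v} / n"
      using prob_hx_in[OF that, of "{x. x < N \<and> g x = v}"] N_le False by (simp add: subset_iff)
    then show ?thesis using light[OF False] by (simp add: divide_right_mono)
  qed simp
  have "P {\<sigma>. step \<sigma> y = step \<sigma> y'} \<le> P (?both \<union> (?in y y' \<union> ?in y' y))"
    by (rule measure_pmf.finite_measure_mono)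
       (use assms(3) in \<open>auto simp: step_def Let_def split: if_splits\<close>)
  also have "\<dots> \<le> P ?both + (P (?in y y') + P (?in y' y))"
    by (intro order.trans[OF measure_Un_le] add_left_mono
          measure_Un_le) auto
  also have "\<dots> \<le> 3 * k / n" using both one[OF assms(1), of y'] one[OF assms(2), of y] by simp
  finally show ?thesis .
qed

abbreviation R :: "nat \<Rightarrow> 's list set \<Rightarrow> real" where
  "R t \<equiv> measure_pmf.prob (replicate_pmf t p)"

text \<open>Seed number \<open>t\<close>, behind the \<open>t\<close> columns of the walk, serves
  only to hash the end of the chain to a slot; hence the lists of length \<open>Suc t\<close>
  below.\<close>

definition endslot :: "nat \<Rightarrow> nat \<Rightarrow> 's list \<Rightarrow> 'k \<Rightarrow> nat" where
  "endslot m t ss y = hx (ss ! t) (walk step ss t y) mod m"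

definition visits :: "nat \<Rightarrow> 's list \<Rightarrow> 'k \<Rightarrow> nat" where
  "visits i ss y = hx (ss ! i) (walk step ss i y)"

lemma endslot_Cons: "endslot m (Suc t) (s # ss) y = endslot m t ss (step s y)"
  by (simp add: endslot_def walk_Cons)

lemma visits_Cons: "visits (Suc i) (s # ss) y = visits i ss (step s y)"
  by (simp add: visits_def walk_Cons)

lemma visits_0: "visits 0 (s # ss) y = hx s y"
  by (simp add: visits_def)

text \<open>The key reached in column \<open>i\<close> depends on earlier seeds only, and a fresh
  seed hashes any fixed key uniformly.\<close>

lemma prob_visits:
  assumes "y \<in> Keys" "x < n" "i < t"
  shows "R t {ss. visits i ss y = x} = 1 / n"
  using assms
proof (induction t arbitrary: y i)
  case (Suc t)
  show ?case
  proof (cases i)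
    case 0
    have "R (Suc t) {ss. visits i ss y = x} = P {\<sigma>. hx \<sigma> y = x} * 1"
      by (rule prob_replicate_Suc_const) (simp add: 0 visits_0)
    then show ?thesis using Suc.prems hx_uniform by simp
  next
    case (Suc i')
    have "R (Suc t) {ss. visits i ss y = x} = P UNIV * (1 / n)"
      by (rule prob_replicate_Suc_const)
         (use Suc.prems Suc.IH step_Keys Suc in \<open>simp add: visits_Cons\<close>)
    then show ?thesis by simp
  qed
qed simp

text \<open>The seed of the later column is independent of the visit in the earlier one, so
  uniformity alone gives the product. The two chains may be the same.\<close>

lemma prob_visits_twice:
  assumes "y \<in> Keys" "y' \<in> Keys" "x < n" "i < i'" "i' < t"
  shows "R t {ss. visits i ss y = x \<and> visits i' ss y' = x} = 1 / real n ^ 2"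
  using assms
proof (induction t arbitrary: y y' i i')
  case (Suc t)
  obtain i'' where i'': "i' = Suc i''" using Suc.prems by (cases i') auto
  show ?case
  proof (cases i)
    case 0
    have "R (Suc t) {ss. visits i ss y = x \<and> visits i' ss y' = x} = P {\<sigma>. hx \<sigma> y = x} * (1 / n)"
      by (rule prob_replicate_Suc_const)
         (use Suc.prems i'' in \<open>simp add: 0 visits_0 visits_Cons prob_visits step_Keys\<close>)
    then show ?thesis using Suc.prems hx_uniform by (simp add: power2_eq_square)
  next
    case (Suc j)
    have "R (Suc t) {ss. visits i ss y = x \<and> visits i' ss y' = x} = P UNIV * (1 / real n ^ 2)"
      by (rule prob_replicate_Suc_const)
         (use Suc.prems Suc.IH step_Keys Suc i'' in \<open>simp add: visits_Cons\<close>)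
    then show ?thesis by simp
  qed
qed simp

text \<open>Merged chains would visit the same points together. Different end slots exclude this:
  the chains are still at distinct keys in column \<open>i\<close>, where pairwise independence
  applies.\<close>

lemma prob_visits_same_column:
  assumes "y \<in> Keys" "y' \<in> Keys" "y \<noteq> y'" "x < n" "i < t"
  shows "R (Suc t) {ss. visits i ss y = x \<and> visits i ss y' = x \<and> endslot m t ss y \<noteq> endslot m t ss y'}
    \<le> 1 / real n ^ 2"
  using assms
proof (induction t arbitrary: y y' i)
  case (Suc t)
  let ?E = "\<lambda>i t y y'. {ss. visits i ss y = x \<and> visits i ss y' = x \<and> endslot m t ss y \<noteq> endslot m t ss y'}"
  show ?case
  proof (cases i)
    case 0
    have "R (Suc (Suc t)) (?E i (Suc t) y y') \<le> P {\<sigma>. hx \<sigma> y = x \<and> hx \<sigma> y' = x} * 1 + 0"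
      by (rule prob_replicate_Suc_le) (auto simp: 0 visits_0)
    then show ?thesis using Suc.prems hx_pairwise by simp
  next
    case (Suc i')
    have "R (Suc (Suc t)) (?E i (Suc t) y y') \<le> P {} * 1 + 1 / real n ^ 2"
    proof (rule prob_replicate_Suc_le)
      fix \<sigma>
      have "R (Suc t) {ss. \<sigma> # ss \<in> ?E i (Suc t) y y'} \<le> 1 / real n ^ 2"
      proof (cases "step \<sigma> y = step \<sigma> y'")
        case False
        then show ?thesis
          using Suc.prems Suc.IH[of "step \<sigma> y" "step \<sigma> y'" i'] step_Keys Suc
          by (simp add: visits_Cons endslot_Cons)
      qed (simp add: endslot_Cons)
      then show "R (Suc t) {ss. \<sigma> # ss \<in> ?E i (Suc t) y y'} \<le> (if \<sigma> \<in> {} then 1 else 0) + 1 / real n ^ 2"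
        by simp
    qed simp
    then show ?thesis by simp
  qed
qed simp

text \<open>Union bound over the column in which the chains merge, at most \<open>3 * k / n\<close>
  each by \<open>prob_merge\<close>, plus a collision of distinct ends in the last hash.\<close>

lemma prob_endslot_collision:
  assumes "y \<in> Keys" "y' \<in> Keys" "y \<noteq> y'" "0 < m" "m \<le> n"
  shows "R (Suc t) {ss. endslot m t ss y = endslot m t ss y'} \<le> t * (3 * k / n) + 2 / m"
  using assms
proof (induction t arbitrary: y y')
  case 0
  have "R (Suc 0) {ss. endslot m 0 ss y = endslot m 0 ss y'}
      \<le> P {\<sigma>. hx \<sigma> y mod m = hx \<sigma> y' mod m} * 1 + 0"
    by (rule prob_replicate_Suc_le) (auto simp: endslot_def)
  then show ?case using prob_slot_collision[OF 0] by simp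
next
  case (Suc t)
  let ?M = "{\<sigma>. step \<sigma> y = step \<sigma> y'}"
  have "R (Suc (Suc t)) {ss. endslot m (Suc t) ss y = endslot m (Suc t) ss y'}
      \<le> P ?M * 1 + (t * (3 * k / n) + 2 / m)"
  proof (rule prob_replicate_Suc_le)
    fix \<sigma>
    show "R (Suc t) {ss. \<sigma> # ss \<in> {ss. endslot m (Suc t) ss y = endslot m (Suc t) ss y'}}
      \<le> (if \<sigma> \<in> ?M then 1 else 0) + (t * (3 * k / n) + 2 / m)"
    proof (cases "\<sigma> \<in> ?M")
      case False
      then show ?thesis
        using Suc.IH[of "step \<sigma> y" "step \<sigma> y'"] Suc.prems step_Keys by (simp add: endslot_Cons)
    qed (simp add: endslot_Cons add_increasing2)
  qed simp
  also have "\<dots> \<le> 3 * k / n * 1 + (t * (3 * k / n) + 2 / m)"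
    by (intro add_right_mono mult_right_mono prob_merge Suc.prems) simp
  also have "\<dots> = Suc t * (3 * k / n) + 2 / m" by (simp add: distrib_right add_divide_distrib)
  finally show ?case .
qed

text \<open>Visit and collision together cost the product of the two bounds, although both depend on
  the same seeds. The invariant \<open>y' \<noteq> g x\<close> makes this possible: at the visit the
  first chain jumps to \<open>g x\<close>, so a second chain resting there would merge for
  free.\<close>

lemma prob_visits_collision:
  assumes "y \<in> Keys" "y' \<in> Keys" "y \<noteq> y'" "0 < m" "m \<le> n"
    and "x < N" "g x \<notin> L" "y' \<noteq> g x" "i < t"
  shows "R (Suc t) {ss. visits i ss y = x \<and> endslot m t ss y = endslot m t ss y'}
    \<le> 1 / n * (t * (4 * k / n) + 2 / m)"
  using assms
proof (induction t arbitrary: y y' i)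
  case (Suc t)
  let ?E = "\<lambda>i t y y'. {ss. visits i ss y = x \<and> endslot m t ss y = endslot m t ss y'}"
  have xn: "x < n" using Suc.prems N_le by simp
  show ?case
  proof (cases i)
    case 0
    \<comment> \<open>The merge in the very column of the visit: the other chain enters
      \<open>g x\<close>. Both hash values lie in fixed sets, so pairwise independence yields
      \<open>1 / n\<close> times \<open>k / n\<close>.\<close>
    let ?T = "{\<sigma>. hx \<sigma> y = x \<and> step \<sigma> y' = g x}"
    let ?X = "{\<sigma>. hx \<sigma> y = x}"
    have T: "P ?T \<le> 1 / n * (k / n)"
    proof -
      have "P ?T \<le> P {\<sigma>. hx \<sigma> y \<in> {x} \<and> hx \<sigma> y' \<in> {x'. x' < N \<and> g x' = g x}}"
        by (rule measure_pmf.finite_measure_mono)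
           (use Suc.prems in \<open>auto simp: step_def Let_def split: if_splits\<close>)
      also have "\<dots> \<le> real (card {x}) * k / real n ^ 2"
        by (rule prob_hx_pair_le[where B = "\<lambda>_. {x'. x' < N \<and> g x' = g x}"])
           (use Suc.prems N_le light xn in auto)
      finally show ?thesis by (simp add: power2_eq_square)
    qed
    have "R (Suc (Suc t)) (?E i (Suc t) y y') \<le> R (Suc (Suc t)) ({ss. hd ss \<in> ?T} \<union>
       {ss. hd ss \<in> ?X - ?T \<and> endslot m (Suc t) ss y = endslot m (Suc t) ss y'})"
      by (rule measure_pmf.finite_measure_mono_AE)
         (auto simp: AE_measure_pmf_iff set_replicate_pmf 0 visits_def hd_conv_nth length_greater_0_conv[symmetric]
           simp del: length_greater_0_conv)
    also have "\<dots> \<le> R (Suc (Suc t)) {ss. hd ss \<in> ?T} +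
      R (Suc (Suc t)) {ss. hd ss \<in> ?X - ?T \<and> endslot m (Suc t) ss y = endslot m (Suc t) ss y'}"
      by (rule measure_Un_le) auto
    also have "R (Suc (Suc t)) {ss. hd ss \<in> ?T} \<le> P ?T * 1 + 0"
      by (rule prob_replicate_Suc_le) auto
    also have "R (Suc (Suc t)) {ss. hd ss \<in> ?X - ?T \<and> endslot m (Suc t) ss y = endslot m (Suc t) ss y'}
      \<le> P ?X * (t * (3 * k / n) + 2 / m) + 0"
    proof (rule prob_replicate_Suc_le)
      fix \<sigma>
      show "R (Suc t) {ss. \<sigma> # ss \<in> {ss. hd ss \<in> ?X - ?T \<and> endslot m (Suc t) ss y = endslot m (Suc t) ss y'}}
        \<le> (if \<sigma> \<in> ?X then t * (3 * k / n) + 2 / m else 0) + 0"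
      proof (cases "\<sigma> \<in> ?X - ?T")
        case True
        then have "step \<sigma> y = g x" "g x \<noteq> step \<sigma> y'" using Suc.prems by (auto simp: step_def)
        then show ?thesis
          using True prob_endslot_collision[of "step \<sigma> y" "step \<sigma> y'" m t] Suc.prems step_Keys g_Keys
          by (simp add: endslot_Cons)
      qed (auto simp: measure_empty)
    qed simp
    finally have "R (Suc (Suc t)) (?E i (Suc t) y y') \<le> P ?T + 1 / n * (t * (3 * k / n) + 2 / m)"
      using hx_uniform[OF Suc.prems(1) xn] by simp
    also have "\<dots> \<le> 1 / n * (k / n) + 1 / n * (t * (3 * k / n) + 2 / m)"
      using T by simp
    also have "\<dots> \<le> 1 / n * (Suc t * (4 * k / n) + 2 / m)"
    proof -
      define r where "r = real k / n"
      have "0 \<le> r" "0 \<le> t * r" by (simp_all add: r_def)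
      then have "r + (t * (3 * r) + 2 / m) \<le> Suc t * (4 * r) + 2 / m"
        by (simp add: algebra_simps)
      then show ?thesis
        unfolding distrib_left[symmetric] by (intro mult_left_mono) (simp_all add: r_def)
    qed
    finally show ?thesis .
  next
    case (Suc i')
    \<comment> \<open>Seeds that break a premise of the induction hypothesis: a merge, at most
      \<open>3 * k / n\<close>, or the second chain entering \<open>g x\<close>, at most
      \<open>k / n\<close>; hence the 4. Even then the later visit keeps its factor
      \<open>1 / n\<close>.\<close>
    let ?M = "{\<sigma>. step \<sigma> y = step \<sigma> y'} \<union> {\<sigma>. step \<sigma> y' = g x}"
    have "P ?M \<le> 3 * k / n + k / n"
      using prob_merge[OF Suc.prems(1,2,3)] prob_enter[OF Suc.prems(2), of "g x"] Suc.prems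
      by (intro order.trans[OF measure_Un_le]) auto
    then have M: "P ?M \<le> 4 * k / n" by simp
    have "R (Suc (Suc t)) (?E i (Suc t) y y') \<le> P ?M * (1 / n) + 1 / n * (t * (4 * k / n) + 2 / m)"
    proof (rule prob_replicate_Suc_le)
      fix \<sigma>
      have i': "i' < t" using Suc Suc.prems by simp
      have E: "{ss. \<sigma> # ss \<in> ?E i (Suc t) y y'} = ?E i' t (step \<sigma> y) (step \<sigma> y')"
        by (simp add: Suc visits_Cons endslot_Cons)
      have "R (Suc t) (?E i' t (step \<sigma> y) (step \<sigma> y')) \<le> R (Suc t) {ss. visits i' ss (step \<sigma> y) = x}"
        by (rule measure_pmf.finite_measure_mono) auto
      also have "\<dots> = 1 / n" using i' Suc.prems xn step_Keys by (intro prob_visits) auto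
      finally have 1: "R (Suc t) (?E i' t (step \<sigma> y) (step \<sigma> y')) \<le> 1 / n" .
      have 2: "R (Suc t) (?E i' t (step \<sigma> y) (step \<sigma> y')) \<le> 1 / n * (t * (4 * k / n) + 2 / m)"
        if "\<sigma> \<notin> ?M" using that Suc.IH[of "step \<sigma> y" "step \<sigma> y'" i'] i' Suc.prems step_Keys by simp
      have nonneg: "0 \<le> 1 / n * (t * (4 * k / n) + 2 / m)" by simp
      show "R (Suc t) {ss. \<sigma> # ss \<in> ?E i (Suc t) y y'}
        \<le> (if \<sigma> \<in> ?M then 1 / n else 0) + 1 / n * (t * (4 * k / n) + 2 / m)"
      proof (cases "\<sigma> \<in> ?M")
        case True
        show ?thesis unfolding E if_P[OF True] using 1 nonneg by linarith
      next
        case False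
        show ?thesis unfolding E if_not_P[OF False] using 2[OF False] by linarith
      qed
    qed simp
    also have "\<dots> \<le> 4 * k / n * (1 / n) + 1 / n * (t * (4 * k / n) + 2 / m)"
      by (intro add_right_mono mult_right_mono M) simp
    also have "\<dots> = 1 / n * (Suc t * (4 * k / n) + 2 / m)"
      using n_pos by (simp add: field_simps)
    finally show ?thesis .
  qed
qed simp

end

section \<open>Sample tables: the chance that one of them loses a heavy value\<close>

context hash_family
begin

text \<open>Second moment: with \<open>u\<close> the expected number of hits, a hit has probability
  at least \<open>u - u ^ 2\<close>. For \<open>u\<close> between \<open>1 / 8\<close> and
  \<open>1 / 4\<close> this is at least \<open>3 / 32\<close>.\<close>

lemma prob_no_hit:
  assumes "finite I" "\<And>c. c \<in> I \<Longrightarrow> key c \<in> Keys" "inj_on key I" "Y \<subseteq> {..<n}"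
    and "card I * card Y / n \<le> 1 / 4" "1 / 8 \<le> card I * card Y / n"
  shows "P {\<sigma>. \<forall>c\<in>I. hx \<sigma> (key c) \<notin> Y} \<le> 29 / 32"
proof -
  define u where "u = card I * card Y / n"
  let ?A = "\<lambda>c. {\<sigma>. hx \<sigma> (key c) \<in> Y}"
  have "(\<Sum>c\<in>I. P (?A c)) = (\<Sum>c\<in>I. card Y / n)"
    by (intro sum.cong refl prob_hx_in assms)
  then have 1: "(\<Sum>c\<in>I. P (?A c)) = u" by (simp add: u_def)
  have pair: "P (?A c \<inter> ?A c') \<le> (card Y / n) ^ 2" if "c \<in> I" "c' \<in> I" "c' \<noteq> c" for c c'
  proof -
    have "P (?A c \<inter> ?A c') = P {\<sigma>. hx \<sigma> (key c) \<in> Y \<and> hx \<sigma> (key c') \<in> Y}"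
      by (simp add: Int_def)
    also have "\<dots> \<le> real (card Y) * card Y / real n ^ 2"
      by (rule prob_hx_pair_le[where B = "\<lambda>_. Y"]) (use assms that in \<open>auto dest: inj_onD\<close>)
    finally show ?thesis by (simp add: power2_eq_square)
  qed
  have "(\<Sum>c\<in>I. \<Sum>c'\<in>I - {c}. P (?A c \<inter> ?A c')) \<le> (\<Sum>c\<in>I. \<Sum>c'\<in>I. (card Y / n) ^ 2)"
    by (intro sum_mono order.trans[OF sum_mono[OF pair] sum_mono2]) (use assms(1) in auto)
  also have "\<dots> = u ^ 2" by (simp add: u_def power2_eq_square)
  finally have "P (\<Union>c\<in>I. ?A c) \<ge> u - u ^ 2"
    using prob_Union_ge[OF assms(1), of p ?A] 1 by linarith
  moreover have "u ^ 2 \<le> u * (1 / 4)"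
    unfolding power2_eq_square using assms(5,6) by (intro mult_left_mono) (auto simp: u_def)
  ultimately have "P (\<Union>c\<in>I. ?A c) \<ge> 3 / 32"
    using assms(6) by (simp add: u_def)
  moreover have "{\<sigma>. \<forall>c\<in>I. hx \<sigma> (key c) \<notin> Y} = UNIV - (\<Union>c\<in>I. ?A c)" by auto
  ultimately show ?thesis using measure_pmf.prob_compl[of "\<Union>c\<in>I. ?A c" p] by simp
qed

text \<open>The first seed draws the sample points, the second hashes their values to slots. A loss
  means that no sample lies in \<open>Y\<close>, or that another value shares the slot of
  \<open>y\<close>; given a hit, the latter has probability at most
  \<open>M * (2 / m) \<le> 1 / 2\<close>. Samples of value \<open>y\<close> itself may share the
  slot harmlessly.\<close>

lemma prob_sample_lost:
  assumes key: "\<And>c. c < M \<Longrightarrow> key c \<in> Keys" "inj_on key {..<M}"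
    and Y: "Y \<subseteq> {..<n}" "M * card Y / n \<le> 1 / 4" "1 / 8 \<le> M * card Y / n"
    and g: "y \<in> Keys" "\<And>x. x < N \<Longrightarrow> g x \<in> Keys" and m: "4 * M \<le> m" "0 < m" "m \<le> n"
  shows "measure_pmf.prob (replicate_pmf 2 p)
     {ss. \<not> ((\<exists>c<M. hx (ss ! 0) (key c) \<in> Y) \<and>
            (\<forall>c<M. hx (ss ! 0) (key c) < N \<longrightarrow> g (hx (ss ! 0) (key c)) \<noteq> y \<longrightarrow>
               hx (ss ! 1) (g (hx (ss ! 0) (key c))) mod m \<noteq> hx (ss ! 1) y mod m))} \<le> 31 / 32"
    (is "measure_pmf.prob _ ?E \<le> _")
proof -
  let ?B = "{\<sigma>. \<forall>c\<in>{..<M}. hx \<sigma> (key c) \<notin> Y}"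
  \<comment> \<open>Without a hit the trivial bound 1 is split as \<open>1 / 2 + 1 / 2\<close>; with
    a hit the slot collisions account for the second \<open>1 / 2\<close>.\<close>
  have "measure_pmf.prob (replicate_pmf (Suc (Suc 0)) p) ?E \<le> P ?B * (1 / 2) + 1 / 2"
  proof (rule prob_replicate_Suc_le)
    fix \<sigma>
    show "measure_pmf.prob (replicate_pmf (Suc 0) p) {ss. \<sigma> # ss \<in> ?E} \<le> (if \<sigma> \<in> ?B then 1 / 2 else 0) + 1 / 2"
    proof (cases "\<sigma> \<in> ?B")
      case False
      define C where "C = {c. c < M \<and> hx \<sigma> (key c) < N \<and> g (hx \<sigma> (key c)) \<noteq> y}"
      let ?D = "\<Union>c\<in>C. {\<sigma>'. hx \<sigma>' (g (hx \<sigma> (key c))) mod m = hx \<sigma>' y mod m}"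
      have "measure_pmf.prob (replicate_pmf (Suc 0) p) {ss. \<sigma> # ss \<in> ?E} \<le> P ?D * 1 + 0"
        by (rule prob_replicate_Suc_le) (use False in \<open>auto simp: C_def\<close>)
      also have "P ?D \<le> (\<Sum>c\<in>C. P {\<sigma>'. hx \<sigma>' (g (hx \<sigma> (key c))) mod m = hx \<sigma>' y mod m})"
        by (rule measure_pmf.finite_measure_subadditive_finite) (auto simp: C_def)
      also have "\<dots> \<le> (\<Sum>c\<in>C. 2 / m)"
        by (intro sum_mono prob_slot_collision) (use g m in \<open>auto simp: C_def\<close>)
      also have "\<dots> \<le> M * (2 / m)"
      proof -
        have "card C \<le> card {..<M}" by (rule card_mono) (auto simp: C_def)
        then show ?thesis using m by (simp add: divide_right_mono)
      qed
      also have "\<dots> \<le> 1 / 2" using m by (simp add: field_simps)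
      finally show ?thesis using False by simp
    qed simp
  qed simp
  also have "\<dots> \<le> 29 / 32 * (1 / 2) + 1 / 2"
    by (intro add_right_mono mult_right_mono prob_no_hit) (use key Y in auto)
  finally show ?thesis by (simp add: numeral_2_eq_2 del: replicate_pmf.simps)
qed

end

section \<open>Coverage of a point by one rainbow table\<close>

context rainbow
begin

text \<open>A chain that merges with the covering one also violates the isolation of its end slot,
  so this slot identifies the chain uniquely.\<close>

definition covers :: "(nat \<Rightarrow> 'k) \<Rightarrow> nat \<Rightarrow> nat \<Rightarrow> nat \<Rightarrow> nat \<Rightarrow> 's list \<Rightarrow> bool" where
  "covers key M t m x ss \<longleftrightarrow> (\<exists>c<M. \<exists>i<t. visits i ss (key c) = x \<and>
     (\<forall>c'<M. c' \<noteq> c \<longrightarrow> endslot m t ss (key c') \<noteq> endslot m t ss (key c)))"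

text \<open>Bonferroni over all pairs of chain and column. By \<open>few\<close>, collisions spend
  at most half of the visit probability \<open>1 / n\<close>, so a single event has probability at
  least \<open>1 / (2 * n)\<close>. With \<open>u = M * t / n \<le> 1 / 4\<close> this leaves
  \<open>u / 2 - u ^ 2 \<ge> u / 4\<close>.\<close>

lemma prob_covers:
  assumes key: "\<And>c. c < M \<Longrightarrow> key c \<in> Keys" "inj_on key {..<M}" "\<And>c. c < M \<Longrightarrow> key c \<noteq> g x"
    and m: "0 < m" "m \<le> n" and x: "x < N" "g x \<notin> L"
    and few: "M * (t * (4 * k / n) + 2 / m) \<le> 1 / 2" and small: "M * t / n \<le> 1 / 4"
  shows "M * t / (4 * n) \<le> R (Suc t) {ss. covers key M t m x ss}"
proof -
  let ?I = "{..<M} \<times> {..<t}"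
  let ?A = "\<lambda>(c, i). {ss. visits i ss (key c) = x \<and>
     (\<forall>c'<M. c' \<noteq> c \<longrightarrow> endslot m t ss (key c') \<noteq> endslot m t ss (key c))}"
  define q where "q = t * (4 * k / n) + 2 / m"
  have xn: "x < n" using x N_le by simp
  have neq: "key c \<noteq> key c'" if "c < M" "c' < M" "c \<noteq> c'" for c c'
    using that key(2) by (auto dest: inj_onD)
  have one: "R (Suc t) (?A (c, i)) \<ge> 1 / (2 * n)" if ci: "c < M" "i < t" for c i
  proof -
    let ?V = "{ss. visits i ss (key c) = x}"
    let ?B = "\<Union>c'\<in>{..<M} - {c}. {ss. visits i ss (key c) = x \<and> endslot m t ss (key c) = endslot m t ss (key c')}"
    have "R (Suc t) ?B \<le> (\<Sum>c'\<in>{..<M} - {c}.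
        R (Suc t) {ss. visits i ss (key c) = x \<and> endslot m t ss (key c) = endslot m t ss (key c')})"
      by (rule measure_pmf.finite_measure_subadditive_finite) auto
    also have "\<dots> \<le> (\<Sum>c'\<in>{..<M} - {c}. 1 / n * q)"
      unfolding q_def
      by (intro sum_mono prob_visits_collision) (use key neq ci m x in auto)
    also have "\<dots> \<le> (\<Sum>c'\<in>{..<M}. 1 / n * q)"
      by (rule sum_mono2) (auto simp: q_def)
    also have "\<dots> = 1 / n * (M * q)" by simp
    also have "\<dots> \<le> 1 / n * (1 / 2)"
      using few unfolding q_def[symmetric] by (intro mult_left_mono) auto
    finally have B: "R (Suc t) ?B \<le> 1 / (2 * n)" by simp
    have "1 / n = R (Suc t) ?V" using prob_visits[of "key c" x i "Suc t"] key ci xn by simp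
    also have "\<dots> \<le> R (Suc t) (?A (c, i) \<union> ?B)"
    proof (rule measure_pmf.finite_measure_mono)
      show "?V \<subseteq> ?A (c, i) \<union> ?B"
      proof
        fix ss assume "ss \<in> ?V"
        then show "ss \<in> ?A (c, i) \<union> ?B"
          by (cases "\<exists>c'<M. c' \<noteq> c \<and> endslot m t ss (key c') = endslot m t ss (key c)") fastforce+
      qed
    qed simp
    also have "\<dots> \<le> R (Suc t) (?A (c, i)) + R (Suc t) ?B"
      by (rule measure_Un_le) auto
    finally show ?thesis using B by simp
  qed
  have pair: "R (Suc t) (?A a \<inter> ?A b) \<le> 1 / real n ^ 2" if "a \<in> ?I" "b \<in> ?I - {a}" for a b
  proof -
    obtain c i c' i' where ab: "a = (c, i)" "b = (c', i')" by fastforce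
    have lt: "c < M" "c' < M" "i < t" "i' < t" using that ab by auto
    have twice: "R (Suc t) (?A (c, i) \<inter> ?A (c', i')) \<le> 1 / real n ^ 2"
      if "c < M" "c' < M" "i < i'" "i' < t" for c c' i i'
    proof -
      have "R (Suc t) (?A (c, i) \<inter> ?A (c', i'))
          \<le> R (Suc t) {ss. visits i ss (key c) = x \<and> visits i' ss (key c') = x}"
        by (rule measure_pmf.finite_measure_mono) auto
      also have "\<dots> = 1 / real n ^ 2" by (rule prob_visits_twice) (use that key xn in auto)
      finally show ?thesis .
    qed
    have "i = i' \<Longrightarrow> c \<noteq> c'" using that ab by auto
    then consider "i < i'" | "i' < i" | "i = i'" "c \<noteq> c'"
      by (cases i i' rule: linorder_cases) auto
    then show ?thesis
    proof cases
      case 1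
      then show ?thesis using twice[of c c' i i'] lt ab by simp
    next
      case 2
      then show ?thesis using twice[of c' c i' i] lt ab by (simp add: Int_commute)
    next
      case 3
      \<comment> \<open>Isolation of the two chains makes their end slots different, as
        \<open>prob_visits_same_column\<close> asks for.\<close>
      have "R (Suc t) (?A a \<inter> ?A b) \<le> R (Suc t) {ss. visits i ss (key c) = x \<and> visits i ss (key c') = x
          \<and> endslot m t ss (key c) \<noteq> endslot m t ss (key c')}"
        by (rule measure_pmf.finite_measure_mono) (use ab 3 lt in auto)
      also have "\<dots> \<le> 1 / real n ^ 2"
        by (rule prob_visits_same_column) (use key neq lt 3 xn in auto)
      finally show ?thesis .
    qed
  qed
  define u where "u = real M * t / n"
  have "(\<Sum>a\<in>?I. R (Suc t) (?A a)) \<ge> (\<Sum>a\<in>?I. 1 / (2 * n))"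
    by (rule sum_mono) (use one in auto)
  then have 1: "(\<Sum>a\<in>?I. R (Suc t) (?A a)) \<ge> u / 2" by (simp add: u_def)
  have "(\<Sum>a\<in>?I. \<Sum>b\<in>?I - {a}. R (Suc t) (?A a \<inter> ?A b)) \<le> (\<Sum>a\<in>?I. \<Sum>b\<in>?I. 1 / real n ^ 2)"
    by (intro sum_mono order.trans[OF sum_mono[OF pair] sum_mono2]) auto
  also have "\<dots> = u ^ 2" by (simp add: u_def power2_eq_square)
  also have "\<dots> \<le> u * (1 / 4)"
    unfolding power2_eq_square using small by (intro mult_left_mono) (auto simp: u_def)
  finally have "R (Suc t) (\<Union>a\<in>?I. ?A a) \<ge> u / 4"
    using prob_Union_ge[of ?I "replicate_pmf (Suc t) p" ?A] 1 by simp
  moreover have "(\<Union>a\<in>?I. ?A a) = {ss. covers key M t m x ss}"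
    by (auto simp: covers_def)
  ultimately show ?thesis by (simp add: u_def)
qed

end

section \<open>Multiply-shift hashing\<close>

lemma bij_betw_add_mod: "bij_betw (\<lambda>a. (v + a) mod B) {..<B} {..<B}" for v B :: nat
proof -
  have "inj_on (\<lambda>a. (v + a) mod B) {..<B}"
  proof (rule inj_onI)
    have le: "a = a'" if "a' \<le> a" "a < B" "(v + a) mod B = (v + a') mod B" for a a'
    proof -
      have "B dvd a - a'" using that mod_eq_dvd_iff_nat[of "v + a'" "v + a" B] by simp
      then show ?thesis using that by (auto dest: dvd_imp_le)
    qed
    fix a a' assume "a \<in> {..<B}" "a' \<in> {..<B}" "(v + a) mod B = (v + a') mod B"
    then show "a = a'" using le[of a a'] le[of a' a] by (metis lessThan_iff nat_le_linear)
  qed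
  moreover have "(\<lambda>a. (v + a) mod B) ` {..<B} \<subseteq> {..<B}" by auto
  ultimately show ?thesis
    unfolding bij_betw_def using endo_inj_surj[of "{..<B}" "\<lambda>a. (v + a) mod B"] by blast
qed

lemma bij_betw_mult_mod:
  fixes o' B :: nat
  assumes "coprime o' B"
  shows "bij_betw (\<lambda>a. a * o' mod B) {..<B} {..<B}"
proof -
  have "inj_on (\<lambda>a. a * o' mod B) {..<B}"
  proof (rule inj_onI)
    have le: "a = a'" if "a' \<le> a" "a < B" "a * o' mod B = a' * o' mod B" for a a'
    proof -
      have "B dvd (a - a') * o'"
        using that mod_eq_dvd_iff_nat[of "a' * o'" "a * o'" B] by (simp add: diff_mult_distrib)
      then have "B dvd a - a'"
        using assms by (simp add: coprime_dvd_mult_left_iff coprime_commute)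
      then show ?thesis using that by (auto dest: dvd_imp_le)
    qed
    fix a a' assume "a \<in> {..<B}" "a' \<in> {..<B}" "a * o' mod B = a' * o' mod B"
    then show "a = a'" using le[of a a'] le[of a' a] by (metis lessThan_iff nat_le_linear)
  qed
  moreover have "(\<lambda>a. a * o' mod B) ` {..<B} \<subseteq> {..<B}" by auto
  ultimately show ?thesis
    unfolding bij_betw_def using endo_inj_surj[of "{..<B}" "\<lambda>a. a * o' mod B"] by blast
qed

lemma card_Collect_bij:
  fixes B :: nat
  assumes "bij_betw h {..<B} {..<B}"
  shows "card {a. a < B \<and> Q (h a)} = card {a. a < B \<and> Q a}"
proof -
  have "h ` {a. a < B \<and> Q (h a)} = {a. a < B \<and> Q a}"
  proof (intro equalityI subsetI)
    fix a assume a: "a \<in> {a. a < B \<and> Q a}"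
    then have "a \<in> h ` {..<B}" using assms by (simp add: bij_betw_def)
    then show "a \<in> h ` {a. a < B \<and> Q (h a)}" using a by auto
  qed (use bij_betw_apply[OF assms] in auto)
  moreover have "inj_on h {a. a < B \<and> Q (h a)}"
    using assms by (auto simp: bij_betw_def inj_on_def)
  ultimately show ?thesis by (metis card_image)
qed

text \<open>The \<open>s\<close> bits above and the \<open>r\<close> bits below the prescribed
  window are free.\<close>

lemma card_middle_bits:
  fixes x :: nat
  assumes "x < 2 ^ l"
  shows "card {a. a < 2 ^ (s + l + r) \<and> a mod 2 ^ (l + r) div 2 ^ r = x} = 2 ^ (s + r)"
proof -
  let ?f = "\<lambda>(h, lo). h * 2 ^ (l + r) + (x * 2 ^ r + lo)"
  have lt: "x * 2 ^ r + lo < 2 ^ (l + r)" if "lo < 2 ^ r" for lo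
  proof -
    have "x * 2 ^ r + lo < (x + 1) * 2 ^ r" using that by simp
    also have "\<dots> \<le> 2 ^ l * 2 ^ r" using assms by (intro mult_right_mono) auto
    finally show ?thesis by (simp add: power_add)
  qed
  have "{a. a < 2 ^ (s + l + r) \<and> a mod 2 ^ (l + r) div 2 ^ r = x} = ?f ` ({..<2 ^ s} \<times> {..<2 ^ r})"
    (is "?A = _")
  proof (intro equalityI subsetI)
    fix a assume a: "a \<in> ?A"
    then have "a = ?f (a div 2 ^ (l + r), a mod 2 ^ (l + r) mod 2 ^ r)"
      using div_mult_mod_eq[of a "2 ^ (l + r)"] div_mult_mod_eq[of "a mod 2 ^ (l + r)" "2 ^ r"] by simp
    moreover have "a div 2 ^ (l + r) < 2 ^ s"
      using a by (intro less_mult_imp_div_less) (simp add: power_add ac_simps)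
    ultimately show "a \<in> ?f ` ({..<2 ^ s} \<times> {..<2 ^ r})"
      by (intro image_eqI[where x = "(a div 2 ^ (l + r), a mod 2 ^ (l + r) mod 2 ^ r)"]) auto
  next
    fix a assume "a \<in> ?f ` ({..<2 ^ s} \<times> {..<2 ^ r})"
    then obtain h lo where *: "a = h * 2 ^ (l + r) + (x * 2 ^ r + lo)" "h < 2 ^ s" "lo < 2 ^ r" by auto
    have "a < (h + 1) * 2 ^ (l + r)" using * lt[of lo] by simp
    also have "\<dots> \<le> 2 ^ s * 2 ^ (l + r)" using * by (intro mult_right_mono) auto
    finally show "a \<in> ?A" using * lt[of lo] by (simp add: power_add mult.assoc)
  qed
  moreover have "inj_on ?f ({..<2 ^ s} \<times> {..<2 ^ r})"
  proof (rule inj_onI)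
    fix p p' assume pp: "p \<in> {..<2 ^ s} \<times> {..<2 ^ r}" "p' \<in> {..<2 ^ s} \<times> {..<2 ^ r}" "?f p = ?f p'"
    obtain h lo h' lo' where p: "p = (h, lo)" "p' = (h', lo')" by fastforce
    have *: "lo < 2 ^ r" "lo' < 2 ^ r"
      "h * 2 ^ (l + r) + (x * 2 ^ r + lo) = h' * 2 ^ (l + r) + (x * 2 ^ r + lo')"
      using pp p by auto
    have "h = (h * 2 ^ (l + r) + (x * 2 ^ r + lo)) div 2 ^ (l + r)" using * lt[of lo] by simp
    moreover have "h' = (h' * 2 ^ (l + r) + (x * 2 ^ r + lo')) div 2 ^ (l + r)" using * lt[of lo'] by simp
    ultimately have "h = h'" using * by simp
    then show "p = p'" using * p by simp
  qed
  ultimately show ?thesis by (simp add: card_image power_add)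
qed

text \<open>Write \<open>\<delta> = 2 ^ s * o'\<close> with \<open>o'\<close> odd. Multiplication by
  \<open>o'\<close> permutes the residues, and the factor \<open>2 ^ s\<close> moves the output
  window down by \<open>s\<close> bits. Since \<open>\<delta> < 2 ^ sh\<close> forces
  \<open>s < sh\<close>, the window still lies inside the random word; this is why key coordinates
  are bounded by \<open>2 ^ sh\<close>.\<close>

lemma card_top_bits_affine:
  fixes \<delta> v x :: nat
  assumes "0 < \<delta>" "\<delta> < 2 ^ sh" "x < 2 ^ l"
  shows "card {a. a < 2 ^ (sh + l) \<and> (v + a * \<delta>) mod 2 ^ (sh + l) div 2 ^ sh = x} = 2 ^ sh"
proof -
  let ?B = "2 ^ (sh + l) :: nat"
  obtain s o' where \<delta>: "\<delta> = 2 ^ s * o'" and odd: "odd o'"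
    using multiplicity_decompose'[of \<delta> 2] assms(1) by (metis not_prime_unit nat_neq_iff prime_nat_iff two_is_prime_nat)
  have "2 ^ s \<le> \<delta>" using \<delta> odd by (cases o') auto
  then have "(2::nat) ^ s < 2 ^ sh" using assms(2) by (rule le_less_trans)
  then have s: "s < sh" by simp
  define r where "r = sh - s"
  have B: "sh + l = s + l + r" and sh: "sh = s + r" using s by (simp_all add: r_def)
  have "coprime o' ?B" using odd by simp
  then have bij: "bij_betw (\<lambda>a. a * o' mod ?B) {..<?B} {..<?B}" by (rule bij_betw_mult_mod)
  have "(v + a * \<delta>) mod ?B = (v + a * o' mod ?B * 2 ^ s) mod ?B" for a
  proof -
    have "a * o' mod ?B * 2 ^ s mod ?B = a * \<delta> mod ?B"
      by (subst mod_mult_left_eq) (simp add: \<delta> mult_ac)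
    then show ?thesis by (metis mod_add_right_eq)
  qed
  then have "card {a. a < ?B \<and> (v + a * \<delta>) mod ?B div 2 ^ sh = x}
      = card {a. a < ?B \<and> (v + a * 2 ^ s) mod ?B div 2 ^ sh = x}"
    using card_Collect_bij[OF bij, of "\<lambda>a. (v + a * 2 ^ s) mod ?B div 2 ^ sh = x"] by simp
  also have "\<dots> = card {a. a < ?B \<and> (v div 2 ^ s + a) mod ?B mod 2 ^ (l + r) div 2 ^ r = x}"
  proof -
    have "(v + a * 2 ^ s) mod ?B div 2 ^ sh = (v div 2 ^ s + a) mod ?B mod 2 ^ (l + r) div 2 ^ r" for a
    proof -
      have "?B = 2 ^ s * 2 ^ (l + r)" "(2::nat) ^ sh = 2 ^ s * 2 ^ r" by (simp_all add: B sh power_add)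
      then have "(v + a * 2 ^ s) mod ?B div 2 ^ sh = (v + a * 2 ^ s) mod (2 ^ s * 2 ^ (l + r)) div 2 ^ s div 2 ^ r"
        by (simp only: div_mult2_eq)
      also have "\<dots> = (v div 2 ^ s + a) mod 2 ^ (l + r) div 2 ^ r"
        by (simp add: mod_mult2_eq add.commute)
      finally show ?thesis by (simp add: B mod_mod_cancel le_imp_power_dvd)
    qed
    then show ?thesis by simp
  qed
  also have "\<dots> = card {a. a < ?B \<and> a mod 2 ^ (l + r) div 2 ^ r = x}"
    by (rule card_Collect_bij) (rule bij_betw_add_mod)
  also have "\<dots> = 2 ^ sh" using card_middle_bits[OF assms(3), of s r] unfolding B[symmetric] sh[symmetric] .
  finally show ?thesis .
qed

text \<open>The multiply-add-shift scheme for vectors: the top \<open>l\<close> bits of an affine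
  form modulo \<open>2 ^ (sh + l)\<close>. The entry of \<open>\<sigma>\<close> after the
  coefficients is the additive word.\<close>

definition mshift :: "nat \<Rightarrow> nat \<Rightarrow> nat list \<Rightarrow> nat list \<Rightarrow> nat" where
  "mshift sh l \<sigma> y = ((\<Sum>i<length y. \<sigma> ! i * y ! i) + \<sigma> ! length y) mod 2 ^ (sh + l) div 2 ^ sh"

abbreviation uniform_words :: "nat \<Rightarrow> nat pmf" where
  "uniform_words b \<equiv> pmf_of_set {..<2 ^ b}"

lemma uniform_words_ne [simp]: "{..<(2::nat) ^ b} \<noteq> {}"
proof -
  have "0 \<in> {..<(2::nat) ^ b}" by simp
  then show ?thesis by blast
qed

lemma prob_uniform_words: "measure_pmf.prob (uniform_words b) A = card {a. a < 2 ^ b \<and> a \<in> A} / 2 ^ b"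
  by (subst measure_pmf_of_set) (simp_all add: Int_def)

definition dotp :: "nat list \<Rightarrow> nat list \<Rightarrow> nat" where
  "dotp \<sigma> y = (\<Sum>i<length y. \<sigma> ! i * y ! i)"

lemma dotp_Cons: "dotp (a # \<sigma>) (v # y) = a * v + dotp \<sigma> y"
  unfolding dotp_def by (simp add: sum.lessThan_Suc_shift del: sum.lessThan_Suc)

text \<open>Uniformity comes from the additive word alone, for any coefficients. The offset
  \<open>u\<close> absorbs the coordinates peeled off by the induction; periodicity of
  \<open>Q\<close> stands for reduction modulo the word size.\<close>

lemma prob_periodic:
  assumes "\<And>z. Q (z mod 2 ^ b) = Q z"
  shows "measure_pmf.prob (replicate_pmf (Suc (length y)) (uniform_words b)) {\<sigma>. Q (u + dotp \<sigma> y + \<sigma> ! length y)}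
    = card {z. z < 2 ^ b \<and> Q z} / 2 ^ b"
proof (induction y arbitrary: u)
  case Nil
  have "measure_pmf.prob (replicate_pmf (Suc 0) (uniform_words b)) {\<sigma>. Q (u + dotp \<sigma> [] + \<sigma> ! 0)}
    = measure_pmf.prob (uniform_words b) {z. Q (u + z)} * 1"
    by (rule prob_replicate_Suc_const) (simp add: dotp_def)
  also have "\<dots> = card {z. z < 2 ^ b \<and> Q ((u + z) mod 2 ^ b)} / 2 ^ b"
    using assms by (simp add: prob_uniform_words)
  also have "\<dots> = card {z. z < 2 ^ b \<and> Q z} / 2 ^ b"
    by (subst card_Collect_bij[OF bij_betw_add_mod]) (rule refl)
  finally show ?case by simp
next
  case (Cons v y)
  have "measure_pmf.prob (replicate_pmf (Suc (Suc (length y))) (uniform_words b))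
      {\<sigma>. Q (u + dotp \<sigma> (v # y) + \<sigma> ! Suc (length y))}
    = measure_pmf.prob (uniform_words b) UNIV * (card {z. z < 2 ^ b \<and> Q z} / 2 ^ b)"
  proof (rule prob_replicate_Suc_const)
    fix a
    show "measure_pmf.prob (replicate_pmf (Suc (length y)) (uniform_words b))
        {\<sigma>. a # \<sigma> \<in> {\<sigma>. Q (u + dotp \<sigma> (v # y) + \<sigma> ! Suc (length y))}}
      = (if a \<in> UNIV then card {z. z < 2 ^ b \<and> Q z} / 2 ^ b else 0)"
      using Cons.IH[of "u + a * v"] by (simp add: dotp_Cons add.assoc del: replicate_pmf.simps)
  qed
  then show ?case by simp
qed

text \<open>Substituting the first affine value for \<open>z\<close> turns the second into
  \<open>v + a * (c' - c) + z\<close>. Then \<open>x\<close> leaves \<open>2 ^ sh\<close> choices of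
  \<open>z\<close>, and for each of them \<open>x'\<close> leaves \<open>2 ^ sh\<close> choices of
  \<open>a\<close> by the affine count.\<close>

lemma card_affine_pair:
  fixes c c' x x' u u' :: nat
  assumes "c < c'" "c' < 2 ^ sh" "x < 2 ^ l" "x' < 2 ^ l"
  shows "(\<Sum>a<2 ^ (sh + l). card {z. z < 2 ^ (sh + l) \<and>
      (u + a * c + z) mod 2 ^ (sh + l) div 2 ^ sh = x \<and> (u' + a * c' + z) mod 2 ^ (sh + l) div 2 ^ sh = x'})
    = 2 ^ (2 * sh)"
proof -
  let ?B = "2 ^ (sh + l) :: nat"
  define top where "top z = z mod ?B div 2 ^ sh" for z
  \<comment> \<open>\<open>e\<close> represents \<open>- u\<close> modulo \<open>?B\<close> within
    the naturals.\<close>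
  obtain e where e: "?B * u = u + e" using le_Suc_ex[of u "?B * u"] by auto
  obtain \<delta> where \<delta>: "c' = c + \<delta>" using assms(1) less_imp_add_positive by blast
  define v where "v = u' + e"
  have shift: "(u' + a * c' + z) mod ?B = (v + a * (c' - c) + (u + a * c + z)) mod ?B" for a z
  proof -
    have "v + a * (c' - c) + (u + a * c + z) = ?B * u + (u' + a * c' + z)"
      unfolding e by (simp add: v_def \<delta> algebra_simps)
    then show ?thesis by (simp only: mod_mult_self4)
  qed
  have "(\<Sum>a<?B. card {z. z < ?B \<and> top (u + a * c + z) = x \<and> top (u' + a * c' + z) = x'})
      = (\<Sum>a<?B. card {z. z < ?B \<and> top z = x \<and> top (v + a * (c' - c) + z) = x'})"
  proof (rule sum.cong[OF refl])
    fix a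
    have "card {z. z < ?B \<and> top (u + a * c + z) = x \<and> top (u' + a * c' + z) = x'}
      = card {z. z < ?B \<and> (\<lambda>z. top z = x \<and> top (v + a * (c' - c) + z) = x') ((u + a * c + z) mod ?B)}"
      by (simp add: top_def shift mod_simps)
    also have "\<dots> = card {z. z < ?B \<and> top z = x \<and> top (v + a * (c' - c) + z) = x'}"
      by (rule card_Collect_bij) (rule bij_betw_add_mod)
    finally show "card {z. z < ?B \<and> top (u + a * c + z) = x \<and> top (u' + a * c' + z) = x'}
      = card {z. z < ?B \<and> top z = x \<and> top (v + a * (c' - c) + z) = x'}" .
  qed
  also have "\<dots> = (\<Sum>a<?B. \<Sum>z<?B. if top z = x \<and> top (v + a * (c' - c) + z) = x' then 1 else 0)"
    by (intro sum.cong refl) (simp add: sum.If_cases Int_def lessThan_def)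
  also have "\<dots> = (\<Sum>z<?B. \<Sum>a<?B. if top z = x \<and> top (v + a * (c' - c) + z) = x' then 1 else 0)"
    by (rule sum.swap)
  also have "\<dots> = (\<Sum>z<?B. if top z = x then card {a. a < ?B \<and> top (v + a * (c' - c) + z) = x'} else 0)"
    by (intro sum.cong refl) (auto simp: sum.If_cases Int_def lessThan_def)
  also have "\<dots> = (\<Sum>z<?B. if top z = x then 2 ^ sh else 0)"
  proof (intro sum.cong refl)
    fix z
    have "card {a. a < ?B \<and> top (v + a * (c' - c) + z) = x'} = 2 ^ sh"
      using card_top_bits_affine[of "c' - c" sh x' l "v + z"] assms by (simp add: top_def ac_simps)
    then show "(if top z = x then card {a. a < ?B \<and> top (v + a * (c' - c) + z) = x'} else 0)
        = (if top z = x then 2 ^ sh else 0)" by simp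
  qed
  also have "\<dots> = card {z. z < ?B \<and> top z = x} * 2 ^ sh"
    by (simp add: sum.If_cases Int_def lessThan_def)
  also have "card {z. z < ?B \<and> top z = x} = 2 ^ sh"
    using card_middle_bits[OF assms(3), of 0 sh] by (simp add: top_def add.commute)
  finally show ?thesis unfolding top_def by (simp add: power_add mult_2)
qed

lemma prob_uniform_expectation:
  assumes "\<And>a. measure_pmf.prob (replicate_pmf n (uniform_words b)) {xs. a # xs \<in> E} = real (k a) / 2 ^ b"
  shows "measure_pmf.prob (replicate_pmf (Suc n) (uniform_words b)) E = real (\<Sum>a<2 ^ b. k a) / (2 ^ b) ^ 2"
proof -
  have "measure_pmf.prob (replicate_pmf (Suc n) (uniform_words b)) E
      = measure_pmf.expectation (uniform_words b) (\<lambda>a. real (k a) / 2 ^ b)"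
    unfolding replicate_pmf_Suc_alt measure_pmf_bind
    by (subst measure_pmf.measure_bind[where N = "count_space UNIV"])
       (auto simp: measure_pmf_in_subprob_space vimage_def assms)
  also have "\<dots> = (\<Sum>a<2 ^ b. real (k a) / 2 ^ b) / 2 ^ b"
    by (subst integral_pmf_of_set) auto
  also have "\<dots> = real (\<Sum>a<2 ^ b. k a) / (2 ^ b) ^ 2"
    by (simp add: power2_eq_square sum_divide_distrib[symmetric])
  finally show ?thesis .
qed

text \<open>If the tails differ, condition on the head coefficient. Otherwise the heads differ; the
  common tail and the additive word form one uniform word, which together with the head coefficient
  is counted by \<open>card_affine_pair\<close>.\<close>

lemma prob_affine_pair:
  fixes x x' u u' :: nat
  assumes "length y = length y'" "y \<noteq> y'" "\<forall>c\<in>set y. c < 2 ^ sh" "\<forall>c\<in>set y'. c < 2 ^ sh"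
    and "x < 2 ^ l" "x' < 2 ^ l"
  shows "measure_pmf.prob (replicate_pmf (Suc (length y)) (uniform_words (sh + l)))
      {\<sigma>. (u + dotp \<sigma> y + \<sigma> ! length y) mod 2 ^ (sh + l) div 2 ^ sh = x \<and>
          (u' + dotp \<sigma> y' + \<sigma> ! length y) mod 2 ^ (sh + l) div 2 ^ sh = x'} = 1 / (2 ^ l) ^ 2"
  using assms(1-4)
proof (induction y y' arbitrary: u u' rule: list_induct2)
  case (Cons c y c' y')
  let ?B = "2 ^ (sh + l) :: nat"
  let ?E = "\<lambda>u u' y y'. {\<sigma>. (u + dotp \<sigma> y + \<sigma> ! length y) mod ?B div 2 ^ sh = x \<and>
          (u' + dotp \<sigma> y' + \<sigma> ! length y) mod ?B div 2 ^ sh = x'}"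
  have E: "{\<sigma>. a # \<sigma> \<in> ?E u u' (c # y) (c' # y')} = ?E (u + a * c) (u' + a * c') y y'" for a
    by (simp add: dotp_Cons add.assoc)
  show ?case
  proof (cases "y = y'")
    case False
    have "measure_pmf.prob (replicate_pmf (Suc (Suc (length y))) (uniform_words (sh + l))) (?E u u' (c # y) (c' # y'))
      = measure_pmf.prob (uniform_words (sh + l)) UNIV * (1 / (2 ^ l) ^ 2)"
    proof (rule prob_replicate_Suc_const)
      fix a
      show "measure_pmf.prob (replicate_pmf (Suc (length y)) (uniform_words (sh + l)))
          {\<sigma>. a # \<sigma> \<in> ?E u u' (c # y) (c' # y')} = (if a \<in> UNIV then 1 / (2 ^ l) ^ 2 else 0)"
        unfolding E using Cons.IH[of "u + a * c" "u' + a * c'"] False Cons.prems by simp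
    qed
    then show ?thesis by simp
  next
    case True
    define k where "k a = card {z. z < ?B \<and> (u + a * c + z) mod ?B div 2 ^ sh = x \<and>
        (u' + a * c' + z) mod ?B div 2 ^ sh = x'}" for a
    have "measure_pmf.prob (replicate_pmf (Suc (Suc (length y))) (uniform_words (sh + l))) (?E u u' (c # y) (c' # y'))
      = real (\<Sum>a<?B. k a) / (2 ^ (sh + l)) ^ 2"
    proof (rule prob_uniform_expectation)
      fix a
      have "measure_pmf.prob (replicate_pmf (Suc (length y)) (uniform_words (sh + l)))
         {\<sigma>. (\<lambda>z. (u + a * c + z) mod ?B div 2 ^ sh = x \<and> (u' + a * c' + z) mod ?B div 2 ^ sh = x')
           (0 + dotp \<sigma> y + \<sigma> ! length y)} = k a / 2 ^ (sh + l)"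
        unfolding k_def by (rule prob_periodic) (simp add: mod_simps)
      then show "measure_pmf.prob (replicate_pmf (Suc (length y)) (uniform_words (sh + l)))
          {\<sigma>. a # \<sigma> \<in> ?E u u' (c # y) (c' # y')} = real (k a) / 2 ^ (sh + l)"
        unfolding E unfolding True[symmetric] by (simp add: add.assoc del: replicate_pmf.simps)
    qed
    also have "(\<Sum>a<?B. k a) = 2 ^ (2 * sh)"
    proof (cases "c < c'")
      case True
      then show ?thesis unfolding k_def using Cons.prems assms by (intro card_affine_pair) auto
    next
      case False
      then have "c' < c" using Cons.prems True by simp
      have "k a = card {z. z < ?B \<and> (u' + a * c' + z) mod ?B div 2 ^ sh = x' \<and> (u + a * c + z) mod ?B div 2 ^ sh = x}" for a
        unfolding k_def by (intro arg_cong[where f = card]) auto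
      then show ?thesis using card_affine_pair[OF \<open>c' < c\<close>, of sh x' l x u' u] Cons.prems assms by simp
    qed
    finally show ?thesis by (simp add: power_add power_mult_distrib power_mult[symmetric] mult.commute)
  qed
qed simp

text \<open>
  Two keys differ in some coordinate.  Conditioned on the coefficients of all the others, that
  coefficient and the additive word make the two hash values independent.
\<close>

lemma hash_family_mshift:
  "hash_family (replicate_pmf (Suc m) (uniform_words (sh + l))) (mshift sh l) (2 ^ l)
     {y. length y = m \<and> (\<forall>c\<in>set y. c < 2 ^ sh)}"
proof
  have m: "mshift sh l \<sigma> y = (0 + dotp \<sigma> y + \<sigma> ! length y) mod 2 ^ (sh + l) div 2 ^ sh" for \<sigma> y
    by (simp add: mshift_def dotp_def)
  show "mshift sh l \<sigma> y < 2 ^ l" for \<sigma> y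
    unfolding m by (rule less_mult_imp_div_less) (simp add: power_add mult.commute)
  show "measure_pmf.prob (replicate_pmf (Suc m) (uniform_words (sh + l)))
      {\<sigma>. mshift sh l \<sigma> y = x \<and> mshift sh l \<sigma> y' = x'} = 1 / real (2 ^ l) ^ 2"
    if "y \<in> {y. length y = m \<and> (\<forall>c\<in>set y. c < 2 ^ sh)}" "y' \<in> {y. length y = m \<and> (\<forall>c\<in>set y. c < 2 ^ sh)}"
      "y \<noteq> y'" "x < 2 ^ l" "x' < 2 ^ l" for y y' x x'
    using prob_affine_pair[of y y' sh x l x' 0 0] that unfolding m by (simp del: replicate_pmf.simps)
  show "measure_pmf.prob (replicate_pmf (Suc m) (uniform_words (sh + l))) {\<sigma>. mshift sh l \<sigma> y = x} = 1 / real (2 ^ l)"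
    if "y \<in> {y. length y = m \<and> (\<forall>c\<in>set y. c < 2 ^ sh)}" "x < 2 ^ l" for y x
  proof -
    have "measure_pmf.prob (replicate_pmf (Suc m) (uniform_words (sh + l))) {\<sigma>. mshift sh l \<sigma> y = x}
       = card {z. z < 2 ^ (sh + l) \<and> z mod 2 ^ (sh + l) div 2 ^ sh = x} / 2 ^ (sh + l)"
      using prob_periodic[of "\<lambda>z. z mod 2 ^ (sh + l) div 2 ^ sh = x" "sh + l" y 0] that unfolding m
      by (simp del: replicate_pmf.simps)
    also have "\<dots> = 2 ^ sh / 2 ^ (sh + l)"
      using card_middle_bits[OF that(2), of 0 sh] by (simp add: add.commute)
    finally show ?thesis by (simp add: power_add)
  qed
qed simp_all

section \<open>Weakest preconditions with time\<close>

text \<open>Total correctness with running time. The existential form suffices because execution is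
  deterministic for fixed \<open>\<omega>\<close>.\<close>

definition wp :: "machine \<Rightarrow> (nat \<Rightarrow> nat) \<Rightarrow> com \<Rightarrow> (nat \<Rightarrow> state \<Rightarrow> bool) \<Rightarrow> state \<Rightarrow> bool" where
  "wp M \<omega> c Q s \<longleftrightarrow> (\<exists>t s'. exec M \<omega> c s t s' \<and> Q t s')"

lemma wp_mono: "wp M \<omega> c Q s \<Longrightarrow> (\<And>t s'. Q t s' \<Longrightarrow> Q' t s') \<Longrightarrow> wp M \<omega> c Q' s"
  by (auto simp: wp_def)

lemma wp_Skip [simp]: "wp M \<omega> Skip Q s \<longleftrightarrow> Q 1 s"
  by (auto simp: wp_def intro: exec.Skip[unfolded One_nat_def] elim: SkipE)

lemma wp_Assign [simp]:
  "wp M \<omega> (Assign r e) Q s \<longleftrightarrow> Q 1 (s\<lparr>regs := (regs s)(r := evalx M s e)\<rparr>)"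
  by (auto simp: wp_def intro: exec.Assign[unfolded One_nat_def] elim: AssignE)

lemma wp_Load [simp]:
  "wp M \<omega> (Load r e) Q s \<longleftrightarrow> Q 1 (s\<lparr>regs := (regs s)(r := mem s (evalx M s e))\<rparr>)"
  by (auto simp: wp_def intro: exec.Load[unfolded One_nat_def] elim: LoadE)

lemma wp_Store [simp]:
  "wp M \<omega> (Store e1 e2) Q s \<longleftrightarrow> Q 1 (s\<lparr>mem := (mem s)(evalx M s e1 := evalx M s e2)\<rparr>)"
  by (auto simp: wp_def intro: exec.Store[unfolded One_nat_def] elim: StoreE)

lemma wp_Rand [simp]:
  "wp M \<omega> (Rand r) Q s \<longleftrightarrow> Q 1 (s\<lparr>regs := (regs s)(r := \<omega> (rand_used s) mod 2 ^ word_bits M),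
       rand_used := Suc (rand_used s)\<rparr>)"
  by (auto simp: wp_def intro: exec.Rand[unfolded One_nat_def] elim: RandE)

lemma wp_Call [simp]:
  "wp M \<omega> (Call r e) Q s \<longleftrightarrow> Q (1 + fn_time M (evalx M s e))
    (s\<lparr>regs := (\<lambda>j. if r \<le> j \<and> j < r + fn_dim M
                    then fn M (evalx M s e) (j - r) mod 2 ^ word_bits M else regs s j)\<rparr>)"
proof
  assume "wp M \<omega> (Call r e) Q s"
  then obtain t s' where "exec M \<omega> (Call r e) s t s'" "Q t s'" by (auto simp: wp_def)
  then show "Q (1 + fn_time M (evalx M s e)) (s\<lparr>regs := (\<lambda>j. if r \<le> j \<and> j < r + fn_dim M
                    then fn M (evalx M s e) (j - r) mod 2 ^ word_bits M else regs s j)\<rparr>)"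
    by (elim CallE) simp
qed (unfold wp_def, blast intro: exec.Call)

lemma wp_Seq [simp]: "wp M \<omega> (Seq c1 c2) Q s \<longleftrightarrow> wp M \<omega> c1 (\<lambda>t1. wp M \<omega> c2 (\<lambda>t2. Q (t1 + t2))) s"
  by (auto simp: wp_def intro: exec.Seq elim!: SeqE)

lemma wp_Cond [simp]:
  "wp M \<omega> (Cond e c1 c2) Q s \<longleftrightarrow>
    (if evalx M s e \<noteq> 0 then wp M \<omega> c1 (\<lambda>t. Q (1 + t)) s else wp M \<omega> c2 (\<lambda>t. Q (1 + t)) s)"
proof -
  have "wp M \<omega> (Cond e c1 c2) Q s"
    if "if evalx M s e \<noteq> 0 then wp M \<omega> c1 (\<lambda>t. Q (1 + t)) s else wp M \<omega> c2 (\<lambda>t. Q (1 + t)) s"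
    using that unfolding wp_def by (auto split: if_splits intro: exec.CondT exec.CondF simp del: One_nat_def)
  moreover have "if evalx M s e \<noteq> 0 then wp M \<omega> c1 (\<lambda>t. Q (1 + t)) s else wp M \<omega> c2 (\<lambda>t. Q (1 + t)) s"
    if "wp M \<omega> (Cond e c1 c2) Q s"
    using that unfolding wp_def by (auto elim!: CondE)
  ultimately show ?thesis by blast
qed

fun mods :: "nat \<Rightarrow> com \<Rightarrow> nat set" where
  "mods d Skip = {}"
| "mods d (Assign r e) = {r}"
| "mods d (Load r e) = {r}"
| "mods d (Store e1 e2) = {}"
| "mods d (Rand r) = {r}"
| "mods d (Call r e) = {r..<r + d}"
| "mods d (Seq c1 c2) = mods d c1 \<union> mods d c2"
| "mods d (Cond e c1 c2) = mods d c1 \<union> mods d c2"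
| "mods d (Loop e c) = mods d c"

fun no_store :: "com \<Rightarrow> bool" where
  "no_store (Store e1 e2) = False"
| "no_store (Seq c1 c2) = (no_store c1 \<and> no_store c2)"
| "no_store (Cond e c1 c2) = (no_store c1 \<and> no_store c2)"
| "no_store (Loop e c) = no_store c"
| "no_store _ = True"

fun no_rand :: "com \<Rightarrow> bool" where
  "no_rand (Rand r) = False"
| "no_rand (Seq c1 c2) = (no_rand c1 \<and> no_rand c2)"
| "no_rand (Cond e c1 c2) = (no_rand c1 \<and> no_rand c2)"
| "no_rand (Loop e c) = no_rand c"
| "no_rand _ = True"

lemma exec_mods: "exec M \<omega> c s t s' \<Longrightarrow> r \<notin> mods (fn_dim M) c \<Longrightarrow> regs s' r = regs s r"
  by (induction rule: exec.induct) auto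

lemma exec_no_store: "exec M \<omega> c s t s' \<Longrightarrow> no_store c \<Longrightarrow> mem s' = mem s"
  by (induction rule: exec.induct) auto

lemma exec_no_rand: "exec M \<omega> c s t s' \<Longrightarrow> no_rand c \<Longrightarrow> rand_used s' = rand_used s"
  by (induction rule: exec.induct) auto

lemma exec_rand_used_mono: "exec M \<omega> c s t s' \<Longrightarrow> rand_used s \<le> rand_used s'"
  by (induction rule: exec.induct) auto

text \<open>A run reads only the first \<open>rand_used s'\<close> random words. This later makes
  the success event depend on finitely many coordinates.\<close>

lemma exec_random_cong:
  "exec M \<omega> c s t s' \<Longrightarrow> (\<And>k. k < rand_used s' \<Longrightarrow> \<omega> k = \<omega>' k) \<Longrightarrow> exec M \<omega>' c s t s'"
proof (induction rule: exec.induct)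
  case (Rand r s)
  then have "\<omega> (rand_used s) = \<omega>' (rand_used s)" by simp
  then show ?case using exec.Rand[of M \<omega>' r s] by simp
next
  case (Seq c1 s t1 s1 c2 t2 s2)
  then show ?case by (meson exec.Seq exec_rand_used_mono less_le_trans)
next
  case (LoopT s e c t1 s1 t2 s2)
  then show ?case by (meson exec.LoopT exec_rand_used_mono less_le_trans)
qed (auto intro: exec.intros simp del: One_nat_def)

definition unmodified :: "machine \<Rightarrow> com \<Rightarrow> state \<Rightarrow> state \<Rightarrow> bool" where
  "unmodified M c s s' \<longleftrightarrow> (\<forall>r. r \<notin> mods (fn_dim M) c \<longrightarrow> regs s' r = regs s r) \<and>
     (no_store c \<longrightarrow> mem s' = mem s) \<and> (no_rand c \<longrightarrow> rand_used s' = rand_used s)"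

text \<open>Frame rule: specifications mention only what a program computes; preservation of
  everything else follows from the syntactic checks \<open>mods\<close>, \<open>no_store\<close> and
  \<open>no_rand\<close>.\<close>

lemma wp_use:
  assumes "wp M \<omega> c A s"
    and "\<And>t s'. A t s' \<Longrightarrow> unmodified M c s s' \<Longrightarrow> Q t s'"
  shows "wp M \<omega> c Q s"
  using assms exec_mods exec_no_store exec_no_rand unfolding wp_def unmodified_def by metis

definition For :: "nat \<Rightarrow> expr \<Rightarrow> expr \<Rightarrow> com \<Rightarrow> com" where
  "For r e0 e1 c = Seq (Assign r e0) (Loop (Op Less (Reg r) e1) (Seq c (Assign r (Op Plus (Reg r) (Const 1)))))"

lemma mods_For [simp]: "mods d (For r e0 e1 c) = insert r (mods d c)"
  by (auto simp: For_def)

lemma no_store_For [simp]: "no_store (For r e0 e1 c) = no_store c"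
  by (simp add: For_def)

lemma no_rand_For [simp]: "no_rand (For r e0 e1 c) = no_rand c"
  by (simp add: For_def)

fun vars :: "expr \<Rightarrow> nat set" where
  "vars (Const n) = {}"
| "vars (Reg r) = {r}"
| "vars (Op g e1 e2) = vars e1 \<union> vars e2"

lemma expr_val_cong: "(\<And>r. r \<in> vars e \<Longrightarrow> R r = R' r) \<Longrightarrow> expr_val b R e = expr_val b R' e"
  by (induction e) auto

text \<open>\<open>J k\<close> holds with the counter at \<open>k\<close>. An iteration pays 2 for
  test and increment, the 2 outside pays for initialisation and the failing test;
  \<open>n < 2 ^ word_bits M\<close> keeps the counter from wrapping around.\<close>

lemma wp_For:
  assumes bound: "vars e1 \<inter> insert r (mods (fn_dim M) c) = {}" "r \<notin> mods (fn_dim M) c"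
    and range: "evalx M s e0 = a" "evalx M s e1 = n" "a \<le> n" "n < 2 ^ word_bits M"
    and init: "J a (s\<lparr>regs := (regs s)(r := a)\<rparr>)"
    and step: "\<And>k s'. a \<le> k \<Longrightarrow> k < n \<Longrightarrow> regs s' r = k \<Longrightarrow>
        (\<And>x. x \<noteq> r \<Longrightarrow> x \<notin> mods (fn_dim M) c \<Longrightarrow> regs s' x = regs s x) \<Longrightarrow>
        (no_store c \<Longrightarrow> mem s' = mem s) \<Longrightarrow> J k s' \<Longrightarrow>
        wp M \<omega> c (\<lambda>t s''. t \<le> T \<and> J (Suc k) (s''\<lparr>regs := (regs s'')(r := Suc k)\<rparr>)) s'"
  shows "wp M \<omega> (For r e0 e1 c) (\<lambda>t s'. t \<le> 2 + (n - a) * (T + 2) \<and> J n s') s"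
proof -
  let ?B = "Seq c (Assign r (Op Plus (Reg r) (Const 1)))"
  let ?L = "Loop (Op Less (Reg r) e1) ?B"
  have e1: "evalx M s' e1 = n" if "\<And>x. x \<noteq> r \<Longrightarrow> x \<notin> mods (fn_dim M) c \<Longrightarrow> regs s' x = regs s x" for s'
    unfolding range(2)[symmetric]
  proof (rule expr_val_cong)
    fix x assume "x \<in> vars e1"
    then have "x \<noteq> r" "x \<notin> mods (fn_dim M) c" using bound(1) by auto
    then show "regs s' x = regs s x" by (rule that)
  qed
  have loop: "wp M \<omega> ?L (\<lambda>t s''. t \<le> 1 + (n - k) * (T + 2) \<and> J n s'') s'"
    if "a \<le> k" "k \<le> n" "regs s' r = k" "J k s'" "no_store c \<Longrightarrow> mem s' = mem s"
      "\<And>x. x \<noteq> r \<Longrightarrow> x \<notin> mods (fn_dim M) c \<Longrightarrow> regs s' x = regs s x" for k s'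
    using that
  proof (induction "n - k" arbitrary: k s')
    case 0
    have "evalx M s' (Op Less (Reg r) e1) = 0" using e1[OF 0(7)] 0(1,3,4) by simp
    then have "exec M \<omega> ?L s' 1 s'" by (rule exec.LoopF)
    then show ?case using 0 unfolding wp_def by force
  next
    case (Suc m)
    have cond: "evalx M s' (Op Less (Reg r) e1) \<noteq> 0" using e1[OF Suc(8)] Suc(2,4,5) by simp
    have "wp M \<omega> c (\<lambda>t s''. t \<le> T \<and> J (Suc k) (s''\<lparr>regs := (regs s'')(r := Suc k)\<rparr>)) s'"
      by (rule step) (use Suc in auto)
    then obtain t s1 where 1: "exec M \<omega> c s' t s1" "t \<le> T" "J (Suc k) (s1\<lparr>regs := (regs s1)(r := Suc k)\<rparr>)"
      unfolding wp_def by blast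
    let ?s2 = "s1\<lparr>regs := (regs s1)(r := Suc k)\<rparr>"
    have "(1::nat) \<noteq> 2 ^ word_bits M" using Suc range by auto
    then have "evalx M s1 (Op Plus (Reg r) (Const 1)) = Suc k"
      using exec_mods[OF 1(1) bound(2)] Suc range
      by (cases "word_bits M") (simp_all add: mod_simps)
    then have 2: "exec M \<omega> ?B s' (t + 1) ?s2"
      using exec.Seq[OF 1(1) exec.Assign[of M \<omega> r "Op Plus (Reg r) (Const 1)" s1]] by simp
    have "wp M \<omega> ?L (\<lambda>t s''. t \<le> 1 + (n - Suc k) * (T + 2) \<and> J n s'') ?s2"
    proof (rule Suc.hyps(1))
      show "no_store c \<Longrightarrow> mem ?s2 = mem s" using exec_no_store[OF 1(1)] Suc by simp
      show "x \<noteq> r \<Longrightarrow> x \<notin> mods (fn_dim M) c \<Longrightarrow> regs ?s2 x = regs s x" for x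
        using exec_mods[OF 1(1)] Suc by simp
    qed (use Suc 1 in auto)
    then obtain t' s3 where 3: "exec M \<omega> ?L ?s2 t' s3" "t' \<le> 1 + (n - Suc k) * (T + 2)" "J n s3"
      unfolding wp_def by blast
    have "exec M \<omega> ?L s' (1 + (t + 1) + t') s3"
      by (rule exec.LoopT[OF cond 2 3(1)])
    moreover have "1 + (t + 1) + t' \<le> 1 + (n - k) * (T + 2)"
    proof -
      have "n - k = Suc (n - Suc k)" using Suc by simp
      then show ?thesis using 1 3 by simp
    qed
    ultimately show ?case using 3 unfolding wp_def by blast
  qed
  let ?s = "s\<lparr>regs := (regs s)(r := a)\<rparr>"
  have "wp M \<omega> ?L (\<lambda>t s''. t \<le> 1 + (n - a) * (T + 2) \<and> J n s'') ?s"
    by (rule loop) (use range init in auto)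
  then show ?thesis unfolding For_def using range(1)
    by (simp del: fun_upd_apply)
qed

text \<open>Registers have no indirect addressing, so loops over the constantly many coordinates are
  unrolled into the program text.\<close>

fun seqs :: "com list \<Rightarrow> com" where
  "seqs [] = Skip"
| "seqs (c # cs) = Seq c (seqs cs)"

lemma mods_seqs [simp]: "mods d (seqs cs) = (\<Union>c\<in>set cs. mods d c)"
  by (induction cs) auto

lemma no_store_seqs [simp]: "no_store (seqs cs) \<longleftrightarrow> (\<forall>c\<in>set cs. no_store c)"
  by (induction cs) auto

lemma no_rand_seqs [simp]: "no_rand (seqs cs) \<longleftrightarrow> (\<forall>c\<in>set cs. no_rand c)"
  by (induction cs) auto

lemma wp_seqs:
  assumes "I 0 s"
    and "\<And>i s'. i < n \<Longrightarrow> I i s' \<Longrightarrow> wp M \<omega> (f i) (\<lambda>t s''. t \<le> T \<and> I (Suc i) s'') s'"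
  shows "wp M \<omega> (seqs (map f [0..<n])) (\<lambda>t s'. t \<le> 1 + n * T \<and> I n s') s"
proof -
  have "wp M \<omega> (seqs (map f [a..<n])) (\<lambda>t s'. t \<le> 1 + (n - a) * T \<and> I n s') s'"
    if "a \<le> n" "I a s'" for a s'
    using that
  proof (induction "n - a" arbitrary: a s')
    case (Suc m)
    have "n - a = Suc (n - Suc a)" using Suc by simp
    then show ?case
      using Suc by (auto simp: upt_conv_Cons intro!: wp_mono[OF assms(2)[of a s']] wp_mono[OF Suc.hyps(1)[of "Suc a"]])
  qed auto
  from this[of 0 s] assms(1) show ?thesis by simp
qed

section \<open>The programs\<close>

locale layout =
  fixes d :: nat
begin

text \<open>
  The input occupies registers 0 to \<open>2 + 2 * d\<close>.  Four vectors of \<open>d + 1\<close> registers follow: the last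
  computed value of \<open>g\<close>, the position of the current walk, the key that the query looks for, and a
  scratch area.  The scalar registers come last.
\<close>

abbreviation "rlo i \<equiv> 3 + i"
abbreviation "rhi i \<equiv> 3 + d + i"
abbreviation "vV \<equiv> 3 + 2 * d"
abbreviation "vY \<equiv> 4 + 3 * d"
abbreviation "vU \<equiv> 5 + 4 * d"
abbreviation "vX \<equiv> 6 + 5 * d"
abbreviation "sc k \<equiv> 7 + 6 * d + k"
abbreviation "rlen \<equiv> sc 0"
abbreviation "rsh \<equiv> sc 1"
abbreviation "rp \<equiv> sc 2"
abbreviation "rR0 \<equiv> sc 3"
abbreviation "rR1 \<equiv> sc 4"
abbreviation "rM1 \<equiv> sc 5"
abbreviation "rM0 \<equiv> sc 6"
abbreviation "rm0 \<equiv> sc 7"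
abbreviation "rm1 \<equiv> sc 8"
abbreviation "rH \<equiv> sc 9"
abbreviation "rZ \<equiv> sc 10"
abbreviation "rD \<equiv> sc 11"
abbreviation "rW \<equiv> sc 12"
abbreviation "rj \<equiv> sc 13"
abbreviation "rbase \<equiv> sc 14"
abbreviation "rq \<equiv> sc 15"
abbreviation "rptr \<equiv> sc 16"
abbreviation "racc \<equiv> sc 17"
abbreviation "rtmp \<equiv> sc 18"
abbreviation "rx \<equiv> sc 19"
abbreviation "rx2 \<equiv> sc 20"
abbreviation "rflag \<equiv> sc 21"
abbreviation "rT \<equiv> sc 22"
abbreviation "rc \<equiv> sc 23"
abbreviation "ri \<equiv> sc 24"
abbreviation "ri0 \<equiv> sc 25"
abbreviation "rfound \<equiv> sc 26"
abbreviation "rans \<equiv> sc 27"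
abbreviation "ra \<equiv> sc 28"

text \<open>Machine arithmetic is already modulo the word size \<open>2 ^ (sh + l)\<close>, so one
  right shift by \<open>sh\<close> completes \<open>mshift\<close>.\<close>

definition hash :: "nat \<Rightarrow> com" where
  "hash v = Seq (Assign racc (Const 0)) (Seq
     (seqs (map (\<lambda>i. Seq (Load rtmp (Op Plus (Reg rptr) (Const i)))
        (Assign racc (Op Plus (Reg racc) (Op Times (Reg rtmp) (Reg (v + i)))))) [0..<Suc d]))
     (Seq (Load rtmp (Op Plus (Reg rptr) (Const (Suc d))))
        (Assign racc (Op ShiftR (Op Plus (Reg racc) (Reg rtmp)) (Reg rsh)))))"

fun powE :: "nat \<Rightarrow> expr" where
  "powE 0 = Const 1"
| "powE (Suc i) = Op Times (powE i) (Reg rW)"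

text \<open>
  The base \<open>W\<close> digits of \<open>j\<close> are \<open>4 * s + c\<close> with a dyadic level \<open>s \<le> w\<close> and one of four candidate
  cells \<open>c\<close> of that level; only the query uses \<open>c\<close>.
\<close>

definition digitE :: "nat \<Rightarrow> expr" where
  "digitE i = Op Modulo (Op Divide (Reg rj) (powE i)) (Reg rW)"

definition levE :: "nat \<Rightarrow> expr" where
  "levE i = Op Divide (digitE i) (Const 4)"

text \<open>\<open>Call\<close> fills the registers after \<open>v\<close>; \<open>v\<close> itself
  gets the tag 0 that separates values of \<open>g\<close> from chain starts.\<close>

definition geval :: "nat \<Rightarrow> nat \<Rightarrow> com" where
  "geval r v = Seq (Call (Suc v) (Reg r)) (Seq
     (seqs (map (\<lambda>i. Assign (Suc v + i) (Op ShiftR (Reg (Suc v + i)) (levE i))) [0..<d]))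
     (Assign v (Const 0)))"

fun eqE :: "nat \<Rightarrow> nat \<Rightarrow> nat \<Rightarrow> expr" where
  "eqE v v' 0 = Const 1"
| "eqE v v' (Suc n) = Op BitAnd (eqE v v' n) (Op Equal (Reg (v + n)) (Reg (v' + n)))"

definition copy :: "nat \<Rightarrow> nat \<Rightarrow> com" where
  "copy v v' = seqs (map (\<lambda>i. Assign (v + i) (Reg (v' + i))) [0..<Suc d])"

text \<open>Seed \<open>2 * q\<close> draws the samples of table \<open>q\<close>, seed
  \<open>2 * q + 1\<close> hashes values to its slots; a lookup reads only the latter.\<close>

definition lookup0 :: "nat \<Rightarrow> com \<Rightarrow> com" where
  "lookup0 v c = For rq (Const 0) (Reg rR0)
    (Seq (Assign rptr (Op Times (Op Plus (Op Times (Const 2) (Reg rq)) (Const 1)) (Const (d + 2))))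
    (Seq (hash v)
    (Seq (Load rx2 (Op Plus (Op Plus (Reg rbase) (Op Times (Reg rq) (Reg rm0))) (Op Modulo (Reg racc) (Reg rm0))))
      (Cond (Op Less (Reg rx2) (Reg 0)) c Skip))))"

text \<open>A slot stores a point, not its value, so membership is decided by evaluating
  \<open>g\<close> there again.\<close>

definition member :: com where
  "member = Seq (Assign rflag (Const 0))
     (lookup0 vV (Seq (geval rx2 vX) (Assign rflag (Op BitOr (Reg rflag) (eqE vX vV (Suc d))))))"

definition stepc :: com where
  "stepc = Seq (hash vY) (Seq (Assign rx (Reg racc))
     (Cond (Op Less (Reg rx) (Reg 0))
        (Seq (geval rx vV) (Seq member (Cond (Reg rflag) Skip (copy vY vV)))) Skip))"

definition ptrE :: "expr \<Rightarrow> expr" where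
  "ptrE e = Op Times (Op Plus (Op Plus (Op Times (Const 2) (Reg rR0))
      (Op Times (Reg rT) (Op Plus (Reg rp) (Const 1)))) e) (Const (d + 2))"

definition walkc :: "expr \<Rightarrow> com \<Rightarrow> com" where
  "walkc e c = For ri e (Reg rp) (Seq (Assign rptr (ptrE (Reg ri))) (Seq stepc c))"

definition startc :: com where
  "startc = Seq (Assign vY (Op Plus (Reg rc) (Const 1)))
     (seqs (map (\<lambda>i. Assign (Suc vY + i) (Const 0)) [0..<d]))"

definition slot1E :: expr where
  "slot1E = Op Plus (Op Plus (Op Plus (Reg rbase) (Op Times (Reg rR0) (Reg rm0)))
      (Op Times (Reg rT) (Reg rm1))) (Op Modulo (Reg racc) (Reg rm1))"

definition build0 :: com where
  "build0 = For rT (Const 0) (Reg rR0) (For rc (Const 0) (Reg rM0)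
     (Seq startc
     (Seq (Assign rptr (Op Times (Op Times (Const 2) (Reg rT)) (Const (d + 2))))
     (Seq (hash vY) (Seq (Assign rx (Reg racc))
       (Cond (Op Less (Reg rx) (Reg 0))
         (Seq (geval rx vV)
         (Seq (Assign rptr (Op Times (Op Plus (Op Times (Const 2) (Reg rT)) (Const 1)) (Const (d + 2))))
         (Seq (hash vV)
           (Store (Op Plus (Op Plus (Reg rbase) (Op Times (Reg rT) (Reg rm0))) (Op Modulo (Reg racc) (Reg rm0)))
             (Reg rx))))) Skip))))))"

definition build1 :: com where
  "build1 = For rT (Const 0) (Reg rR1) (For rc (Const 0) (Reg rM1)
     (Seq startc (Seq (walkc (Const 0) Skip)
       (Seq (Assign rptr (ptrE (Reg rp))) (Seq (hash vY) (Store slot1E (Reg rc)))))))"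

text \<open>All \<open>D\<close> functions reuse the same seeds below address \<open>rH\<close>;
  each gets a block of \<open>rZ\<close> words of its own.\<close>

definition build :: com where
  "build = For rj (Const 0) (Reg rD)
     (Seq (Assign rbase (Op Plus (Reg rH) (Op Times (Reg rj) (Reg rZ)))) (Seq build0 build1))"

definition rands :: com where
  "rands = For ra (Const 0) (Reg rH) (Seq (Rand rtmp) (Store (Reg ra) (Reg rtmp)))"

fun inboxE :: "nat \<Rightarrow> expr" where
  "inboxE 0 = Const 1"
| "inboxE (Suc n) = Op BitAnd (inboxE n) (Op BitAnd
     (Op Equal (Op Less (Reg (Suc vX + n)) (Reg (rlo n))) (Const 0))
     (Op Equal (Op Less (Reg (rhi n)) (Reg (Suc vX + n))) (Const 0)))"

text \<open>Every reported point has passed this test against the box, so soundness of an answer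
  does not rest on the hashing.\<close>

definition check :: "nat \<Rightarrow> com" where
  "check r = Seq (Call (Suc vX) (Reg r))
     (Cond (inboxE d) (Seq (Assign rfound (Const 1)) (Assign rans (Reg r))) Skip)"

definition choiceE :: "nat \<Rightarrow> expr" where
  "choiceE i = Op Modulo (digitE i) (Const 4)"

definition target :: com where
  "target = Seq (Assign vU (Const 0)) (seqs (map (\<lambda>i.
     Cond (Op Less (choiceE i) (Const 2))
       (Assign (Suc vU + i) (Op Plus (Op ShiftR (Reg (rlo i)) (levE i)) (choiceE i)))
       (Assign (Suc vU + i) (Op Minus (Op Plus (Op ShiftR (Reg (rhi i)) (levE i)) (Const 2)) (choiceE i)))) [0..<d]))"

text \<open>If the key is the value entered in column \<open>ri0\<close>, its walk resumes in column
  \<open>ri0 + 1\<close>. The end slot yields a chain number, and the replay checks every point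
  along that chain, whether or not the guess was right.\<close>

definition query1 :: com where
  "query1 = For rT (Const 0) (Reg rR1) (For ri0 (Const 0) (Reg rp)
     (Seq (copy vY vU) (Seq (walkc (Op Plus (Reg ri0) (Const 1)) Skip)
     (Seq (Assign rptr (ptrE (Reg rp))) (Seq (hash vY) (Seq (Load rc slot1E)
     (Seq startc (walkc (Const 0) (Cond (Op Less (Reg rx) (Reg 0)) (check rx) Skip)))))))))"

definition query :: com where
  "query = For rj (Const 0) (Reg rD)
     (Seq (Assign rbase (Op Plus (Reg rH) (Op Times (Reg rj) (Reg rZ))))
     (Seq target (Seq (lookup0 vU (check rx2)) query1)))"

definition brute :: com where
  "brute = For rx (Const 0) (Reg 0) (check rx)"

lemma UN_offset: "(\<Union>x\<in>{0..<n}. {v + x}) = {v..<v + n}" for v n :: nat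
proof (intro equalityI subsetI)
  fix x assume "x \<in> {v..<v + n}"
  then show "x \<in> (\<Union>x\<in>{0..<n}. {v + x})" by (intro UN_I[of "x - v"]) auto
qed auto

lemma mods_hash [simp]: "mods d (hash v) = {racc, rtmp}"
  by (auto simp: hash_def)
lemma mods_geval [simp]: "mods d (geval r v) = {v..v + d}"
  using UN_offset[of "Suc v" d] by (auto simp: geval_def)
lemma mods_copy [simp]: "mods d (copy v v') = {v..v + d}"
  using UN_offset[of v "Suc d"] by (auto simp: copy_def simp del: upt_Suc)
lemma mods_lookup0 [simp]: "mods d (lookup0 v c) = {rq, rptr, racc, rtmp, rx2} \<union> mods d c"
  by (auto simp: lookup0_def)
lemma mods_member [simp]: "mods d member = {rq, rptr, racc, rtmp, rx2, rflag} \<union> {vX..vX + d}"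
  by (auto simp: member_def)
lemma mods_stepc [simp]:
  "mods d stepc = {rq, rptr, racc, rtmp, rx, rx2, rflag} \<union> {vX..vX + d} \<union> {vV..vV + d} \<union> {vY..vY + d}"
  by (auto simp: stepc_def)
lemma mods_walkc [simp]: "mods d (walkc e c) = insert ri (mods d stepc) \<union> mods d c"
  by (auto simp: walkc_def)
lemma mods_startc [simp]: "mods d startc = {vY..vY + d}"
  using UN_offset[of "Suc vY" d] by (auto simp: startc_def)
lemma mods_build0 [simp]:
  "mods d build0 = {rT, rc, rptr, racc, rtmp, rx} \<union> {vV..vV + d} \<union> {vY..vY + d}"
  by (auto simp: build0_def)
lemma mods_build1 [simp]: "mods d build1 = {rT, rc, ri} \<union> mods d stepc"
  by (auto simp: build1_def)
lemma mods_build: "mods d build = {rj, rbase, rT, rc, ri} \<union> mods d stepc"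
  by (auto simp: build_def)
lemma mods_check [simp]: "mods d (check r) = {rfound, rans} \<union> {vX<..vX + d}"
  by (auto simp: check_def)
lemma mods_target [simp]: "mods d target = {vU..vU + d}"
  using UN_offset[of "Suc vU" d] by (auto simp: target_def)

lemma no_store_simps [simp]:
  "no_store (hash v)" "no_store (geval r v)" "no_store (copy v v')" "no_store (lookup0 v c) = no_store c"
  "no_store member" "no_store stepc" "no_store (walkc e c) = no_store c" "no_store startc"
  "no_store (check r)" "no_store target"
  by (simp_all add: hash_def geval_def copy_def lookup0_def member_def stepc_def walkc_def startc_def
      check_def target_def)

lemma no_rand_simps [simp]:
  "no_rand (hash v)" "no_rand (geval r v)" "no_rand (copy v v')" "no_rand (lookup0 v c) = no_rand c"
  "no_rand member" "no_rand stepc" "no_rand (walkc e c) = no_rand c" "no_rand startc"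
  "no_rand build"
  by (simp_all add: hash_def geval_def copy_def lookup0_def member_def stepc_def walkc_def startc_def
      build_def build0_def build1_def)

definition vec :: "state \<Rightarrow> nat \<Rightarrow> nat list" where
  "vec s v = map (\<lambda>i. regs s (v + i)) [0..<Suc d]"

lemma length_vec [simp]: "length (vec s v) = Suc d"
  by (simp add: vec_def)

lemma nth_vec [simp]: "i < Suc d \<Longrightarrow> vec s v ! i = regs s (v + i)"
  by (simp add: vec_def del: upt_Suc)

lemma vec_cong: "(\<And>i. i \<le> d \<Longrightarrow> regs s' (v + i) = regs s (v + i)) \<Longrightarrow> vec s' v = vec s v"
  by (simp add: vec_def)

end

section \<open>Semantics of the building blocks\<close>

locale ram_run = layout d for d :: nat +
  fixes M :: machine and \<omega> :: "nat \<Rightarrow> nat" and N w \<tau> sh l p r0 r1 M1 M0 m0 m1 H Z D W :: nat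
  assumes word_bits: "word_bits M = sh + l" and fn_dim: "fn_dim M = d"
    and N_pos: "0 < N"
    and fn_less: "\<And>x i. x < N \<Longrightarrow> i < d \<Longrightarrow> fn M x i < 2 ^ w" and w_le: "w \<le> sh"
    and fn_time: "\<And>x. x < N \<Longrightarrow> fn_time M x \<le> \<tau>"
    and W: "W = 4 * (w + 1)" and D: "D = W ^ d"
    and H: "H = (2 * r0 + r1 * (p + 1)) * (d + 2)" and Z: "Z = r0 * m0 + r1 * m1"
    and m_pos: "0 < m0" "0 < m1"
    and bound: "H + D * Z < 2 ^ (sh + l)" "d + 4 < 2 ^ (sh + l)" "4 * D < 2 ^ (sh + l)" "sh < 2 ^ (sh + l)"
      "M0 < 2 ^ (sh + l)" "M1 < 2 ^ (sh + l)" "N < 2 ^ (sh + l)" "W < 2 ^ (sh + l)"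
begin

declare word_bits [simp] fn_dim [simp]

abbreviation "B \<equiv> (2::nat) ^ (sh + l)"

definition env :: "state \<Rightarrow> bool" where
  "env s \<longleftrightarrow> regs s 0 = N \<and> regs s rsh = sh \<and> regs s rp = p \<and> regs s rR0 = r0 \<and> regs s rR1 = r1 \<and>
     regs s rM1 = M1 \<and> regs s rM0 = M0 \<and> regs s rm0 = m0 \<and> regs s rm1 = m1 \<and> regs s rH = H \<and>
     regs s rZ = Z \<and> regs s rD = D \<and> regs s rW = W"

definition hv :: "(nat \<Rightarrow> nat) \<Rightarrow> nat \<Rightarrow> nat list \<Rightarrow> nat" where
  "hv h q y = mshift sh l (map h [q..<q + d + 2]) y"

definition lev :: "nat \<Rightarrow> nat \<Rightarrow> nat" where
  "lev j i = j div W ^ i mod W div 4"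

definition gk :: "nat \<Rightarrow> nat \<Rightarrow> nat list" where
  "gk j x = 0 # map (\<lambda>i. fn M x i div 2 ^ lev j i) [0..<d]"

definition slot0 :: "(nat \<Rightarrow> nat) \<Rightarrow> nat \<Rightarrow> nat \<Rightarrow> nat list \<Rightarrow> nat" where
  "slot0 h j q y = H + j * Z + q * m0 + hv h ((2 * q + 1) * (d + 2)) y mod m0"

definition stored :: "(nat \<Rightarrow> nat) \<Rightarrow> nat \<Rightarrow> nat list set" where
  "stored h j = {y. \<exists>q<r0. h (slot0 h j q y) < N \<and> gk j (h (slot0 h j q y)) = y}"

definition stp :: "(nat \<Rightarrow> nat) \<Rightarrow> nat \<Rightarrow> nat \<Rightarrow> nat list \<Rightarrow> nat list" where
  "stp h j q y = (let x = hv h q y in if x < N \<and> gk j x \<notin> stored h j then gk j x else y)"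

definition cptr :: "nat \<Rightarrow> nat \<Rightarrow> nat" where
  "cptr k i = (2 * r0 + k * (p + 1) + i) * (d + 2)"

text \<open>Counterpart of \<open>walk\<close> on the memory image, with a free first column, since
  queries enter a chain in the middle.\<close>

definition wk :: "(nat \<Rightarrow> nat) \<Rightarrow> nat \<Rightarrow> nat \<Rightarrow> nat \<Rightarrow> nat \<Rightarrow> nat list \<Rightarrow> nat list" where
  "wk h j k a n y = fold (\<lambda>i. stp h j (cptr k i)) [a..<n] y"

definition slot1 :: "(nat \<Rightarrow> nat) \<Rightarrow> nat \<Rightarrow> nat \<Rightarrow> nat list \<Rightarrow> nat" where
  "slot1 h j k y = H + j * Z + r0 * m0 + k * m1 + hv h (cptr k p) y mod m1"

text \<open>The first entry is nonzero, so that no chain starts at a value of \<open>gk j\<close>.\<close>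

definition start_key :: "nat \<Rightarrow> nat list" where
  "start_key c = (c + 1) mod B # replicate d 0"

lemma unmod_regs: "unmodified M c s s' \<Longrightarrow> r \<notin> mods d c \<Longrightarrow> regs s' r = regs s r"
  by (simp add: unmodified_def fn_dim)

lemma unmod_mem: "unmodified M c s s' \<Longrightarrow> no_store c \<Longrightarrow> mem s' = mem s"
  by (simp add: unmodified_def)

lemma env_cong:
  assumes "env s" "\<And>r. r = 0 \<or> sc 1 \<le> r \<and> r \<le> sc 12 \<Longrightarrow> regs s' r = regs s r"
  shows "env s'"
  using assms(1) unfolding env_def by (simp add: assms(2))

lemma hv_eq: "length y = Suc d \<Longrightarrow>
  hv h q y = ((\<Sum>i<Suc d. h (q + i) * y ! i) + h (q + Suc d)) mod B div 2 ^ sh"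
  by (simp add: hv_def mshift_def del: upt_Suc sum.lessThan_Suc)

lemma ptr_bound:
  "k < r0 \<Longrightarrow> (2 * k + 1) * (d + 2) + (d + 2) \<le> H"
  "k < r0 \<Longrightarrow> (2 * k) * (d + 2) + (d + 2) \<le> H"
  "k < r1 \<Longrightarrow> i \<le> p \<Longrightarrow> cptr k i + (d + 2) \<le> H"
proof -
  assume "k < r0"
  then have "2 * k + 1 + 1 \<le> 2 * r0 + r1 * (p + 1)" by simp
  then have *: "(2 * k + 1 + 1) * (d + 2) \<le> H" unfolding H by (rule mult_right_mono) simp
  then show "(2 * k + 1) * (d + 2) + (d + 2) \<le> H" by (simp add: algebra_simps)
  show "(2 * k) * (d + 2) + (d + 2) \<le> H" using * by (simp add: algebra_simps)
next
  assume "k < r1" "i \<le> p"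
  then have "k * (p + 1) + i + 1 \<le> (k + 1) * (p + 1)" by (simp add: algebra_simps)
  also have "\<dots> \<le> r1 * (p + 1)" using \<open>k < r1\<close> by (intro mult_right_mono) auto
  finally have "(2 * r0 + k * (p + 1) + i + 1) * (d + 2) \<le> H" unfolding H by (intro mult_right_mono) auto
  then show "cptr k i + (d + 2) \<le> H" unfolding cptr_def by (simp only: distrib_right mult_1)
qed

lemma block_bound: "j < D \<Longrightarrow> o' < Z \<Longrightarrow> H + j * Z + o' < H + D * Z"
proof -
  assume "j < D" "o' < Z"
  then have "j * Z + o' < (j + 1) * Z" by simp
  also have "\<dots> \<le> D * Z" using \<open>j < D\<close> by (intro mult_right_mono) auto
  finally show ?thesis by simp
qed

lemma slot0_less: "j < D \<Longrightarrow> q < r0 \<Longrightarrow> s < m0 \<Longrightarrow> H + j * Z + q * m0 + s < H + D * Z"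
proof -
  assume a: "j < D" "q < r0" "s < m0"
  then have "q * m0 + s < (q + 1) * m0" by simp
  also have "\<dots> \<le> r0 * m0" using a by (intro mult_right_mono) auto
  finally have "q * m0 + s < Z" by (simp add: Z)
  from block_bound[OF a(1) this] show ?thesis by (simp add: add.assoc)
qed

lemma slot1_less: "j < D \<Longrightarrow> k < r1 \<Longrightarrow> s < m1 \<Longrightarrow> H + j * Z + r0 * m0 + k * m1 + s < H + D * Z"
proof -
  assume a: "j < D" "k < r1" "s < m1"
  then have "k * m1 + s < (k + 1) * m1" by simp
  also have "\<dots> \<le> r1 * m1" using a by (intro mult_right_mono) auto
  finally have "r0 * m0 + k * m1 + s < Z" by (simp add: Z)
  from block_bound[OF a(1) this] show ?thesis by (simp add: add.assoc)
qed

lemma wp_hash: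
  assumes "env s" "regs s rptr = q" "q + (d + 2) \<le> H" "vec s v = y" "v + d < sc 0"
  shows "wp M \<omega> (hash v) (\<lambda>t s'. t \<le> 2 * d + 6 \<and> regs s' racc = hv (mem s) q y) s"
proof -
  let ?I = "\<lambda>i (s' :: state). regs s' racc = (\<Sum>k<i. mem s (q + k) * y ! k) mod B \<and> mem s' = mem s \<and>
    (\<forall>r. r \<noteq> racc \<longrightarrow> r \<noteq> rtmp \<longrightarrow> regs s' r = regs s r)"
  let ?f = "\<lambda>i. Seq (Load rtmp (Op Plus (Reg rptr) (Const i)))
        (Assign racc (Op Plus (Reg racc) (Op Times (Reg rtmp) (Reg (v + i)))))"
  have small: "q + k < B" "k < B" if "k < d + 2" for k using that assms(3) bound(1) by auto
  have loop: "wp M \<omega> (seqs (map ?f [0..<Suc d])) (\<lambda>t s'. t \<le> 1 + Suc d * 2 \<and> ?I (Suc d) s') s'" if "?I 0 s'" for s'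
  proof (rule wp_seqs[where I = ?I, OF that])
    fix i s' assume i: "i < Suc d" and I: "?I i s'"
    have "y ! i = regs s (v + i)" using i assms(4) nth_vec by auto
    then show "wp M \<omega> (?f i) (\<lambda>t s''. t \<le> 2 \<and> ?I (Suc i) s'') s'"
      using I i assms small[of i] by (simp add: word_bits mod_simps)
  qed
  have y: "length y = Suc d" using assms(4) length_vec by metis
  show ?thesis
    unfolding hash_def wp_Seq wp_Assign
    apply (rule wp_mono[OF loop])
     apply simp
    apply (use assms small[of "Suc d"] y in \<open>simp add: mod_simps hv_eq drop_bit_eq_div env_def del: sum.lessThan_Suc\<close>)
    done
qed

lemma powE_val: "regs s rW = W \<Longrightarrow> i \<le> d \<Longrightarrow> expr_val (sh + l) (regs s) (powE i) = W ^ i"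
proof (induction i)
  case 0
  have "sh + l \<noteq> 0" using bound(2) by (intro notI) simp
  then show ?case by simp
next
  case (Suc i)
  have "W ^ Suc i \<le> W ^ d" using Suc W by (intro power_increasing) auto
  then have "W ^ Suc i < B" using bound(3) by (simp add: D)
  then show ?case using Suc by (simp add: word_bits mult.commute)
qed

lemma digitE_val: "regs s rW = W \<Longrightarrow> regs s rj = j \<Longrightarrow> i < d \<Longrightarrow> expr_val (sh + l) (regs s) (digitE i) = j div W ^ i mod W"
  by (simp add: digitE_def powE_val)

lemma levE_val: "regs s rW = W \<Longrightarrow> regs s rj = j \<Longrightarrow> i < d \<Longrightarrow> expr_val (sh + l) (regs s) (levE i) = lev j i"
  using bound(2) by (simp add: levE_def digitE_val lev_def word_bits)

lemma wp_geval:
  assumes "env s" "regs s rj = j" "regs s r = x" "x < N" "v + d < sc 0"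
  shows "wp M \<omega> (geval r v) (\<lambda>t s'. t \<le> \<tau> + d + 3 \<and> vec s' v = gk j x) s"
proof -
  let ?f = "\<lambda>i. Assign (Suc v + i) (Op ShiftR (Reg (Suc v + i)) (levE i))"
  let ?I = "\<lambda>k (s' :: state). (\<forall>i<d. regs s' (Suc v + i) = (if i < k then fn M x i div 2 ^ lev j i else fn M x i)) \<and>
    (\<forall>r\<ge>sc 0. regs s' r = regs s r)"
  have loop: "wp M \<omega> (seqs (map ?f [0..<d])) (\<lambda>t s'. t \<le> 1 + d * 1 \<and> ?I d s') s'" if "?I 0 s'" for s'
  proof (rule wp_seqs[where I = ?I, OF that])
    fix i s' assume i: "i < d" and I: "?I i s'"
    have W': "regs s' rW = W" "regs s' rj = j" using I assms by (auto simp: env_def)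
    have e: "expr_val (sh + l) (regs s') (levE i) = lev j i" by (rule levE_val[OF W' i])
    show "wp M \<omega> (?f i) (\<lambda>t s''. t \<le> 1 \<and> ?I (Suc i) s'') s'"
      using I i assms(5) by (auto simp: e drop_bit_eq_div)
  qed
  have "fn M x i mod B = fn M x i" if "i < d" for i
  proof -
    have "fn M x i < 2 ^ w" using that assms(4) fn_less by simp
    also have "\<dots> \<le> 2 ^ (sh + l)" using w_le by (intro power_increasing) auto
    finally show ?thesis by simp
  qed
  moreover have "vec s' v = gk j x"
    if "regs s' v = 0" "\<forall>i<d. regs s' (Suc v + i) = fn M x i div 2 ^ lev j i" for s'
  proof (rule nth_equalityI)
    show "vec s' v ! i = gk j x ! i" if "i < length (vec s' v)" for i
      using that \<open>regs s' v = 0\<close> \<open>\<forall>i<d. _\<close> by (cases i) (auto simp: gk_def)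
  qed (simp add: gk_def)
  ultimately show ?thesis
    unfolding geval_def wp_Seq wp_Call
    using assms fn_time[OF assms(4)]
    apply -
    apply (rule wp_mono[OF loop])
     apply simp
    apply auto
    done
qed

end

fun nval :: "(nat \<Rightarrow> nat) \<Rightarrow> expr \<Rightarrow> nat" where
  "nval R (Const n) = n"
| "nval R (Reg r) = R r"
| "nval R (Op Plus e1 e2) = nval R e1 + nval R e2"
| "nval R (Op Times e1 e2) = nval R e1 * nval R e2"
| "nval R (Op Modulo (Reg a) (Reg b)) = R a mod R b"
| "nval R e = 0"

fun polyE :: "expr \<Rightarrow> bool" where
  "polyE (Const n) = True"
| "polyE (Reg r) = True"
| "polyE (Op Plus e1 e2) = (polyE e1 \<and> polyE e2)"
| "polyE (Op Times e1 e2) = (polyE e1 \<and> polyE e2)"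
| "polyE (Op Modulo (Reg a) (Reg b)) = True"
| "polyE e = False"

text \<open>Sums and products respect congruence modulo \<open>2 ^ b\<close>, so only the final
  value has to fit into a word; intermediate overflow is harmless.\<close>

lemma expr_val_polyE:
  assumes "polyE e" "nval R e < 2 ^ b"
  shows "expr_val b R e = nval R e"
proof -
  have mod: "expr_val b R e mod 2 ^ b = nval R e mod 2 ^ b" if "polyE e" for e
    using that
  proof (induction e rule: polyE.induct)
    case (3 e1 e2)
    then show ?case by (simp, metis mod_add_eq)
  next
    case (4 e1 e2)
    then show ?case by (simp, metis mod_mult_eq)
  qed simp_all
  consider (Const) n where "e = Const n" | (Reg) r where "e = Reg r"
    | (Plus) e1 e2 where "e = Op Plus e1 e2" | (Times) e1 e2 where "e = Op Times e1 e2"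
    | (Mod) r r' where "e = Op Modulo (Reg r) (Reg r')"
    using assms(1) by (cases e rule: polyE.cases) auto
  then show ?thesis
    using mod[OF assms(1)] assms(2) by cases simp_all
qed

context ram_run
begin

lemma r0_bound: "2 * r0 * (d + 2) \<le> H" "r0 \<le> H" "r1 \<le> H" "r1 * p \<le> H"
proof -
  show "2 * r0 * (d + 2) \<le> H" unfolding H by (intro mult_right_mono) auto
  have *: "2 * r0 + r1 * (p + 1) \<le> H" unfolding H by simp
  then show "r0 \<le> H" by simp
  show "r1 \<le> H" "r1 * p \<le> H" using * by simp_all
qed

lemma H_less: "H < B" using bound(1) by linarith

text \<open>Shared by the membership test and the query, whence the abstract invariant
  \<open>J\<close>; \<open>cong\<close> states that it ignores the registers clobbered by hashing
  and loading.\<close>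

lemma wp_lookup0:
  assumes env: "env s" and base: "regs s rbase = H + j * Z" and j: "j < D"
    and v: "vec s v = y" "v = vV \<or> v = vU"
    and c: "no_store c" "mods d c \<subseteq> {vX..vX + d} \<union> {rflag, rfound, rans}" and T: "1 \<le> T"
    and init: "J 0 s"
    and cong: "\<And>k s' s''. J k s' \<Longrightarrow> (\<And>r. r \<notin> {rq, rptr, racc, rtmp, rx2} \<Longrightarrow> regs s'' r = regs s' r) \<Longrightarrow> J k s''"
    and step: "\<And>k s'. k < r0 \<Longrightarrow> env s' \<Longrightarrow> (\<And>r. r < vX \<or> sc 0 \<le> r \<and> r < rq \<Longrightarrow> regs s' r = regs s r) \<Longrightarrow>
      mem s' = mem s \<Longrightarrow> J k s' \<Longrightarrow> regs s' rx2 = mem s (slot0 (mem s) j k y) \<Longrightarrow> regs s' rx2 < N \<Longrightarrow>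
      wp M \<omega> c (\<lambda>t s''. t \<le> T \<and> J (Suc k) s'') s'"
    and skip: "\<And>k s'. k < r0 \<Longrightarrow> J k s' \<Longrightarrow> \<not> mem s (slot0 (mem s) j k y) < N \<Longrightarrow> J (Suc k) s'"
  shows "wp M \<omega> (lookup0 v c) (\<lambda>t s'. t \<le> 2 + r0 * (2 * d + T + 11) \<and> J r0 s') s"
proof -
  let ?ptr = "Assign rptr (Op Times (Op Plus (Op Times (Const 2) (Reg rq)) (Const 1)) (Const (d + 2)))"
  let ?load = "Load rx2 (Op Plus (Op Plus (Reg rbase) (Op Times (Reg rq) (Reg rm0))) (Op Modulo (Reg racc) (Reg rm0)))"
  let ?body = "Seq ?ptr (Seq (hash v) (Seq ?load (Cond (Op Less (Reg rx2) (Reg 0)) c Skip)))"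
  have mc: "r \<notin> mods d c" if "r < vX \<or> sc 0 \<le> r \<and> r < rflag \<or> rT \<le> r \<and> r < rfound" for r
    using c(2) that by auto
  have "wp M \<omega> (For rq (Const 0) (Reg rR0) ?body)
    (\<lambda>t s'. t \<le> 2 + (r0 - 0) * (2 * d + T + 9 + 2) \<and> J r0 s') s"
  proof (rule wp_For)
    show "vars (Reg rR0) \<inter> insert rq (mods (fn_dim M) ?body) = {}" "rq \<notin> mods (fn_dim M) ?body"
      using mc[of rR0] mc[of rq] by auto
    show "evalx M s (Reg rR0) = r0" using env by (simp add: env_def)
    show "r0 < 2 ^ word_bits M" using r0_bound(2) H_less by simp
    show "J 0 (s\<lparr>regs := (regs s)(rq := 0)\<rparr>)" by (rule cong[OF init]) simp
  next
    fix k s'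
    assume k: "k < r0" and rq: "regs s' rq = k"
      and same: "\<And>x. x \<noteq> rq \<Longrightarrow> x \<notin> mods (fn_dim M) ?body \<Longrightarrow> regs s' x = regs s x"
      and mem: "no_store ?body \<Longrightarrow> mem s' = mem s" and J: "J k s'"
    have mem: "mem s' = mem s" using mem c(1) by simp
    have same: "regs s' r = regs s r" if "r < vX \<or> sc 0 \<le> r \<and> r < rq" for r
      using same[of r] mc[of r] that by auto
    have env': "env s'" by (rule env_cong[OF env]) (use same in auto)
    let ?q = "(2 * k + 1) * (d + 2)"
    define s1 where "s1 = s'\<lparr>regs := (regs s')(rptr := ?q)\<rparr>"
    have qH: "?q + (d + 2) \<le> H" using ptr_bound(1)[OF k] .
    have s1: "wp M \<omega> ?ptr Q s' \<longleftrightarrow> Q 1 s1" for Q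
    proof -
      have "evalx M s' (Op Times (Op Plus (Op Times (Const 2) (Reg rq)) (Const 1)) (Const (d + 2))) = ?q"
        by (subst expr_val_polyE) (use qH H_less rq in \<open>simp_all add: algebra_simps\<close>)
      then show ?thesis unfolding wp_Assign s1_def by simp
    qed
    have hash: "wp M \<omega> (hash v) (\<lambda>t s''. t \<le> 2 * d + 6 \<and> regs s'' racc = hv (mem s1) ?q y) s1"
    proof (rule wp_hash)
      show "env s1" by (rule env_cong[OF env']) (auto simp: s1_def)
      have "vec s1 v = vec s v"
        by (rule vec_cong) (use same v(2) in \<open>auto simp: s1_def\<close>)
      then show "vec s1 v = y" using v by simp
    qed (use qH v(2) in \<open>auto simp: s1_def\<close>)
    show "wp M \<omega> ?body (\<lambda>t s''. t \<le> 2 * d + T + 9 \<and> J (Suc k) (s''\<lparr>regs := (regs s'')(rq := Suc k)\<rparr>)) s'"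
      unfolding wp_Seq s1
    proof (rule wp_use[OF hash])
      fix t1 s2
      assume t1: "t1 \<le> 2 * d + 6 \<and> regs s2 racc = hv (mem s1) ?q y" and um: "unmodified M (hash v) s1 s2"
      have m2: "mem s2 = mem s" using unmod_mem[OF um] by (simp add: s1_def mem)
      have r2: "regs s2 r = regs s' r" if "r \<notin> {rptr, racc, rtmp}" for r
        using unmod_regs[OF um, of r] that by (simp add: s1_def)
      define a where "a = slot0 (mem s) j k y"
      define s3 where "s3 = s2\<lparr>regs := (regs s2)(rx2 := mem s a)\<rparr>"
      have a: "a < B"
        using slot0_less[OF j k, of "hv (mem s) ?q y mod m0"] bound(1) m_pos by (simp add: a_def slot0_def)
      have s3: "wp M \<omega> ?load Q s2 \<longleftrightarrow> Q 1 s3" for Q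
      proof -
        have "regs s2 rbase = H + j * Z" "regs s2 rq = k" "regs s2 rm0 = m0" "regs s2 racc = hv (mem s) ?q y"
          using r2[of rbase] r2[of rq] r2[of rm0] same[of rbase] base rq env' t1 mem
          by (simp_all add: env_def s1_def)
        then have "evalx M s2 (Op Plus (Op Plus (Reg rbase) (Op Times (Reg rq) (Reg rm0))) (Op Modulo (Reg racc) (Reg rm0))) = a"
          by (subst expr_val_polyE) (use a in \<open>simp_all add: a_def slot0_def\<close>)
        then show ?thesis unfolding wp_Load s3_def using m2 by simp
      qed
      have J3: "J k s3" by (rule cong[OF J]) (use r2 in \<open>simp add: s3_def\<close>)
      have env3: "env s3" by (rule env_cong[OF env']) (use r2 in \<open>auto simp: s3_def\<close>)
      show "wp M \<omega> ?load (\<lambda>t2. wp M \<omega> (Cond (Op Less (Reg rx2) (Reg 0)) c Skip)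
           (\<lambda>t2a s''. 1 + (t1 + (t2 + t2a)) \<le> 2 * d + T + 9 \<and> J (Suc k) (s''\<lparr>regs := (regs s'')(rq := Suc k)\<rparr>))) s2"
        unfolding s3
      proof (cases "mem s a < N")
        case True
        have "wp M \<omega> c (\<lambda>t s''. t \<le> T \<and> J (Suc k) s'') s3"
          by (rule step[OF k env3]) (use r2 same m2 J3 True in \<open>auto simp: s3_def a_def\<close>)
        then show "wp M \<omega> (Cond (Op Less (Reg rx2) (Reg 0)) c Skip)
           (\<lambda>t2a s''. 1 + (t1 + (1 + t2a)) \<le> 2 * d + T + 9 \<and> J (Suc k) (s''\<lparr>regs := (regs s'')(rq := Suc k)\<rparr>)) s3"
          using env3 t1 True by (auto simp: env_def s3_def elim!: wp_mono intro: cong)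
      next
        case False
        have "J (Suc k) s3" by (rule skip[OF k J3]) (use False in \<open>simp add: a_def\<close>)
        then have "J (Suc k) (s3\<lparr>regs := (regs s3)(rq := Suc k)\<rparr>)" by (rule cong) simp
        then show "wp M \<omega> (Cond (Op Less (Reg rx2) (Reg 0)) c Skip)
           (\<lambda>t2a s''. 1 + (t1 + (1 + t2a)) \<le> 2 * d + T + 9 \<and> J (Suc k) (s''\<lparr>regs := (regs s'')(rq := Suc k)\<rparr>)) s3"
          using env3 t1 False T by (simp add: env_def s3_def)
      qed
    qed
  qed simp_all
  moreover have "(r0 - 0) * (2 * d + T + 9 + 2) = r0 * (2 * d + T + 11)" by simp
  ultimately show ?thesis unfolding lookup0_def by (simp only:)
qed

lemma eqE_val:
  "n \<le> Suc d \<Longrightarrow> expr_val (sh + l) (regs s) (eqE v v' n) = of_bool (\<forall>i<n. regs s (v + i) = regs s (v' + i))"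
proof (induction n)
  case 0
  have "sh + l \<noteq> 0" using bound(2) by (intro notI) simp
  then show ?case by simp
next
  case (Suc n)
  then show ?case by (auto simp: less_Suc_eq)
qed

lemma wp_member:
  assumes env: "env s" and base: "regs s rbase = H + j * Z" and j: "regs s rj = j" "j < D"
    and v: "vec s vV = y"
  shows "wp M \<omega> member (\<lambda>t s'. t \<le> 3 + r0 * (3 * d + \<tau> + 15) \<and>
    regs s' rflag = of_bool (y \<in> stored (mem s) j)) s"
proof -
  let ?x = "\<lambda>q. mem s (slot0 (mem s) j q y)"
  let ?s = "s\<lparr>regs := (regs s)(rflag := 0)\<rparr>"
  let ?J = "\<lambda>k (s' :: state). regs s' rflag = of_bool (\<exists>q<k. ?x q < N \<and> gk j (?x q) = y)"
  have env': "env ?s" by (rule env_cong[OF env]) auto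
  have "wp M \<omega> (lookup0 vV (Seq (geval rx2 vX) (Assign rflag (Op BitOr (Reg rflag) (eqE vX vV (Suc d))))))
    (\<lambda>t s'. t \<le> 2 + r0 * (2 * d + (\<tau> + d + 4) + 11) \<and> ?J r0 s') ?s"
  proof (rule wp_lookup0[OF env'])
    show "vec ?s vV = y" unfolding v[symmetric] by (rule vec_cong) auto
  next
    fix k s'
    assume k: "k < r0" and env'': "env s'"
      and same: "\<And>r. r < vX \<or> sc 0 \<le> r \<and> r < rq \<Longrightarrow> regs s' r = regs ?s r"
      and J: "?J k s'" and x2: "regs s' rx2 = mem ?s (slot0 (mem ?s) j k y)" "regs s' rx2 < N"
    have g: "wp M \<omega> (geval rx2 vX) (\<lambda>t s'. t \<le> \<tau> + d + 3 \<and> vec s' vX = gk j (regs s' rx2)) s'"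
      by (rule wp_use[OF wp_geval[OF env'' _ refl x2(2)]])
        (use same[of rj] j unmod_regs[of "geval rx2 vX", simplified] in auto)
    show "wp M \<omega> (Seq (geval rx2 vX) (Assign rflag (Op BitOr (Reg rflag) (eqE vX vV (Suc d)))))
       (\<lambda>t s''. t \<le> \<tau> + d + 4 \<and> ?J (Suc k) s'') s'"
      unfolding wp_Seq wp_Assign
    proof (rule wp_use[OF g])
      fix t s2
      assume t: "t \<le> \<tau> + d + 3 \<and> vec s2 vX = gk j (regs s2 rx2)" and um: "unmodified M (geval rx2 vX) s' s2"
      have r2: "regs s2 r = regs s' r" if "r < vX \<or> sc 0 \<le> r" for r
        using unmod_regs[OF um, of r] that by auto
      have "vec s2 vV = vec ?s vV" by (rule vec_cong) (use r2 same in auto)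
      also have "\<dots> = y" unfolding v[symmetric] by (rule vec_cong) auto
      finally have y: "vec s2 vV = y" .
      have "(\<forall>i<Suc d. regs s2 (vX + i) = regs s2 (vV + i)) \<longleftrightarrow> vec s2 vX = vec s2 vV"
        by (auto simp: list_eq_iff_nth_eq)
      also have "\<dots> \<longleftrightarrow> gk j (?x k) = y" using t r2[of rx2] x2 y by simp
      finally have e: "expr_val (sh + l) (regs s2) (eqE vX vV (Suc d)) = of_bool (gk j (?x k) = y)"
        by (subst eqE_val) simp_all
      show "t + 1 \<le> \<tau> + d + 4 \<and> ?J (Suc k) (s2\<lparr>regs := (regs s2)(rflag :=
            evalx M s2 (Op BitOr (Reg rflag) (eqE vX vV (Suc d))))\<rparr>)"
        using t J r2[of rflag] x2 e by (auto simp: less_Suc_eq simp del: eqE.simps)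
    qed
  qed (use base j in \<open>auto simp: less_Suc_eq\<close>)
  moreover have "2 * d + (\<tau> + d + 4) + 11 = 3 * d + \<tau> + 15" by simp
  ultimately have "wp M \<omega> (lookup0 vV (Seq (geval rx2 vX) (Assign rflag (Op BitOr (Reg rflag) (eqE vX vV (Suc d))))))
    (\<lambda>t s'. t \<le> 2 + r0 * (3 * d + \<tau> + 15) \<and> ?J r0 s') ?s" by (simp only:)
  then show ?thesis
    unfolding member_def wp_Seq wp_Assign expr_val.simps mod_0
    by (rule wp_mono) (auto simp: stored_def)
qed

lemma wp_copy:
  assumes "v + d < v' \<or> v' + d < v"
  shows "wp M \<omega> (copy v v') (\<lambda>t s'. t \<le> d + 2 \<and> vec s' v = vec s v') s"
proof -
  let ?I = "\<lambda>k (s' :: state). (\<forall>i<Suc d. regs s' (v' + i) = regs s (v' + i)) \<and> (\<forall>i<k. regs s' (v + i) = regs s (v' + i))"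
  have "wp M \<omega> (copy v v') (\<lambda>t s'. t \<le> 1 + Suc d * 1 \<and> ?I (Suc d) s') s"
    unfolding copy_def
  proof (rule wp_seqs[where I = ?I])
    fix i s' assume "i < Suc d" "?I i s'"
    then show "wp M \<omega> (Assign (v + i) (Reg (v' + i))) (\<lambda>t s''. t \<le> 1 \<and> ?I (Suc i) s'') s'"
      using assms by (auto simp: less_Suc_eq)
  qed simp
  then show ?thesis by (rule wp_mono) (auto simp: vec_def)
qed

definition stepT :: nat where
  "stepT = (2 * d + 6) + 1 + 1 + (\<tau> + d + 3) + (3 + r0 * (3 * d + \<tau> + 15)) + 1 + (d + 2)"

lemma wp_stepc:
  assumes env: "env s" and base: "regs s rbase = H + j * Z" and j: "regs s rj = j" "j < D"
    and q: "regs s rptr = q" "q + (d + 2) \<le> H" and v: "vec s vY = y"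
  shows "wp M \<omega> stepc (\<lambda>t s'. t \<le> stepT \<and> vec s' vY = stp (mem s) j q y \<and>
    regs s' rx = hv (mem s) q y) s"
  unfolding stepc_def wp_Seq
proof (rule wp_use[OF wp_hash[OF env q v]])
  fix t1 s1
  assume t1: "t1 \<le> 2 * d + 6 \<and> regs s1 racc = hv (mem s) q y" and um: "unmodified M (hash vY) s s1"
  let ?x = "hv (mem s) q y"
  have m1: "mem s1 = mem s" using unmod_mem[OF um] by simp
  have r1: "regs s1 r = regs s r" if "r \<notin> {racc, rtmp}" for r
    using unmod_regs[OF um, of r] that by simp
  let ?s1 = "s1\<lparr>regs := (regs s1)(rx := regs s1 racc)\<rparr>"
  have env1: "env ?s1" by (rule env_cong[OF env]) (use r1 in auto)
  have y1: "vec ?s1 vY = y" using v vec_cong[of ?s1 vY s] r1 by simp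
  have main: "wp M \<omega> (Cond (Op Less (Reg rx) (Reg 0)) (Seq (geval rx vV) (Seq member (Cond (Reg rflag) Skip (copy vY vV)))) Skip)
      (\<lambda>t s'. 2 * d + 6 + 1 + t \<le> stepT \<and> vec s' vY = stp (mem s) j q y \<and> regs s' rx = ?x) ?s1"
  proof (cases "?x < N")
    case False
    then show ?thesis using env1 t1 y1
      by (simp add: env_def stp_def stepT_def)
  next
    case True
    have g: "wp M \<omega> (geval rx vV) (\<lambda>t s'. t \<le> \<tau> + d + 3 \<and> vec s' vV = gk j ?x) ?s1"
      by (rule wp_geval[OF env1]) (use r1 t1 True j in auto)
    have "wp M \<omega> (Seq (geval rx vV) (Seq member (Cond (Reg rflag) Skip (copy vY vV))))
      (\<lambda>t s'. 2 * d + 6 + 1 + (1 + t) \<le> stepT \<and> vec s' vY = stp (mem s) j q y \<and> regs s' rx = ?x) ?s1"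
      unfolding wp_Seq
    proof (rule wp_use[OF g])
      fix t2 s2
      assume t2: "t2 \<le> \<tau> + d + 3 \<and> vec s2 vV = gk j ?x" and um2: "unmodified M (geval rx vV) ?s1 s2"
      have m2: "mem s2 = mem s" using unmod_mem[OF um2] m1 by simp
      have r2: "regs s2 r = regs ?s1 r" if "r < vV \<or> vV + d < r" for r
        using unmod_regs[OF um2, of r] that by auto
      have env2: "env s2" by (rule env_cong[OF env1]) (rule r2, auto)
      have "regs s2 rbase = H + j * Z" "regs s2 rj = j" using r2[of rbase] r2[of rj] r1 base j by auto
      from wp_member[OF env2 this j(2), of "gk j ?x"] t2 m2
      have mb: "wp M \<omega> member (\<lambda>t s'. t \<le> 3 + r0 * (3 * d + \<tau> + 15) \<and>
        regs s' rflag = of_bool (gk j ?x \<in> stored (mem s) j)) s2" by simp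
      show "wp M \<omega> member (\<lambda>t2a. wp M \<omega> (Cond (Reg rflag) Skip (copy vY vV))
          (\<lambda>t2b s'. 2 * d + 6 + 1 + (1 + (t2 + (t2a + t2b))) \<le> stepT \<and> vec s' vY = stp (mem s) j q y \<and> regs s' rx = ?x)) s2"
      proof (rule wp_use[OF mb])
        fix t3 s3
        assume t3: "t3 \<le> 3 + r0 * (3 * d + \<tau> + 15) \<and> regs s3 rflag = of_bool (gk j ?x \<in> stored (mem s) j)"
          and um3: "unmodified M member s2 s3"
        have r3: "regs s3 r = regs s2 r" if "r < vX \<or> r = rx" for r
          using unmod_regs[OF um3, of r] that by auto
        have V3: "vec s3 vV = gk j ?x" using t2 vec_cong[of s3 vV s2] r3 by simp
        have Y3: "vec s3 vY = y" using y1 vec_cong[of s3 vY ?s1] r3 r2 by simp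
        have x3: "regs s3 rx = ?x" using r3[of rx] r2[of rx] t1 by simp
        show "wp M \<omega> (Cond (Reg rflag) Skip (copy vY vV))
          (\<lambda>t2b s'. 2 * d + 6 + 1 + (1 + (t2 + (t3 + t2b))) \<le> stepT \<and> vec s' vY = stp (mem s) j q y \<and> regs s' rx = ?x) s3"
        proof (cases "gk j ?x \<in> stored (mem s) j")
          case True
          then show ?thesis using t2 t3 Y3 x3 by (simp add: stp_def stepT_def)
        next
          case False
          have "wp M \<omega> (copy vY vV) (\<lambda>t2b s'. 2 * d + 6 + 1 + (1 + (t2 + (t3 + (1 + t2b)))) \<le> stepT \<and>
              vec s' vY = stp (mem s) j q y \<and> regs s' rx = ?x) s3"
            by (rule wp_use[OF wp_copy])
              (use False t2 t3 V3 x3 \<open>?x < N\<close> unmod_regs[of "copy vY vV" _ _ rx] in \<open>auto simp: stp_def stepT_def\<close>)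
          then show ?thesis using False t3 by simp
        qed
      qed
    qed
    then show ?thesis using env1 t1 True by (simp add: env_def)
  qed
  show "wp M \<omega> (Assign rx (Reg racc)) (\<lambda>t2. wp M \<omega> (Cond (Op Less (Reg rx) (Reg 0))
      (Seq (geval rx vV) (Seq member (Cond (Reg rflag) Skip (copy vY vV)))) Skip)
      (\<lambda>t2a s'. t1 + (t2 + t2a) \<le> stepT \<and> vec s' vY = stp (mem s) j q y \<and> regs s' rx = ?x)) s1"
    unfolding wp_Assign expr_val.simps
    by (rule wp_mono[OF main]) (use t1 in auto)
qed simp

end

text \<open>Content of a slot when later writes overwrite earlier ones. The default 0 is the initial
  memory content; it is harmless because whatever is read from a slot is verified before it
  counts.\<close>

primrec last_write :: "(nat \<Rightarrow> bool) \<Rightarrow> (nat \<Rightarrow> nat) \<Rightarrow> nat \<Rightarrow> nat" where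
  "last_write P v 0 = 0"
| "last_write P v (Suc n) = (if P n then v n else last_write P v n)"

section \<open>Contents of the tables and the programs that fill them\<close>

context ram_run
begin

lemma cptr_val:
  assumes "env s" "regs s rT = k" "k < r1" "nval (regs s) e = i" "polyE e" "i \<le> p"
  shows "evalx M s (ptrE e) = cptr k i"
proof -
  have "cptr k i < B" using ptr_bound(3)[OF assms(3,6)] H_less by linarith
  then show ?thesis
    using assms unfolding ptrE_def by (subst expr_val_polyE) (simp_all add: env_def cptr_def)
qed

lemma wk_Suc: "a \<le> i \<Longrightarrow> wk h j k a (Suc i) y = stp h j (cptr k i) (wk h j k a i y)"
  by (simp add: wk_def)

text \<open>The command \<open>c\<close> runs after each step: \<open>Skip\<close> in plain walks, a
  box check in the replay. Hence the invariant \<open>J\<close> may depend only on the two result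
  registers.\<close>

lemma wp_walkc:
  assumes env: "env s" and base: "regs s rbase = H + j * Z" and j: "regs s rj = j" "j < D"
    and k: "regs s rT = k" "k < r1" and e: "evalx M s e = a" "a \<le> p" and v: "vec s vY = y"
    and c: "no_store c" "mods d c \<subseteq> {vX..vX + d} \<union> {rfound, rans}"
    and init: "J a s"
    and cong: "\<And>i s' s''. J i s' \<Longrightarrow> regs s'' rfound = regs s' rfound \<Longrightarrow> regs s'' rans = regs s' rans \<Longrightarrow> J i s''"
    and step: "\<And>i s'. a \<le> i \<Longrightarrow> i < p \<Longrightarrow> env s' \<Longrightarrow> (\<And>r. r < vV \<Longrightarrow> regs s' r = regs s r) \<Longrightarrow> J i s' \<Longrightarrow>
      regs s' rx = hv (mem s) (cptr k i) (wk (mem s) j k a i y) \<Longrightarrow>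
      wp M \<omega> c (\<lambda>t s''. t \<le> T \<and> J (Suc i) s'') s'"
  shows "wp M \<omega> (walkc e c) (\<lambda>t s'. t \<le> 2 + (p - a) * (stepT + T + 3) \<and> vec s' vY = wk (mem s) j k a p y \<and> J p s') s"
proof -
  let ?ptr = "Assign rptr (ptrE (Reg ri))"
  let ?body = "Seq ?ptr (Seq stepc c)"
  let ?J = "\<lambda>i (s' :: state). vec s' vY = wk (mem s) j k a i y \<and> J i s'"
  have mc: "r \<notin> mods d c" if "r < vX \<or> sc 0 \<le> r \<and> r < rfound" for r
    using c(2) that by auto
  have ri: "?J i (s'\<lparr>regs := (regs s')(ri := n)\<rparr>)" if "?J i s'" for i n s'
  proof
    show "vec (s'\<lparr>regs := (regs s')(ri := n)\<rparr>) vY = wk (mem s) j k a i y"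
      using that vec_cong[of "s'\<lparr>regs := (regs s')(ri := n)\<rparr>" vY s'] by simp
    show "J i (s'\<lparr>regs := (regs s')(ri := n)\<rparr>)" using that cong[of i s'] by simp
  qed
  have "p \<le> r1 * p" using k by simp
  then have pB: "p < B" using r0_bound(4) H_less by linarith
  have "wp M \<omega> (For ri e (Reg rp) ?body)
    (\<lambda>t s'. t \<le> 2 + (p - a) * (stepT + T + 1 + 2) \<and> ?J p s') s"
  proof (rule wp_For[where J = ?J])
    show "vars (Reg rp) \<inter> insert ri (mods (fn_dim M) ?body) = {}" "ri \<notin> mods (fn_dim M) ?body"
      using mc[of rp] mc[of ri] by auto
    show "evalx M s (Reg rp) = p" using env by (simp add: env_def)
    show "?J a (s\<lparr>regs := (regs s)(ri := a)\<rparr>)"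
      by (rule ri) (use v init in \<open>simp add: wk_def\<close>)
  next
    fix i s'
    assume i: "a \<le> i" "i < p" and ri': "regs s' ri = i"
      and same: "\<And>x. x \<noteq> ri \<Longrightarrow> x \<notin> mods (fn_dim M) ?body \<Longrightarrow> regs s' x = regs s x"
      and mem: "no_store ?body \<Longrightarrow> mem s' = mem s" and J: "?J i s'"
    have mem: "mem s' = mem s" using mem c(1) by simp
    have same: "regs s' r = regs s r" if "r < vV \<or> sc 0 \<le> r \<and> r < rq \<or> r = rT" for r
      using same[of r] mc[of r] that by auto
    have env': "env s'" by (rule env_cong[OF env]) (use same in auto)
    let ?q = "cptr k i"
    define s1 where "s1 = s'\<lparr>regs := (regs s')(rptr := ?q)\<rparr>"
    have s1: "wp M \<omega> ?ptr Q s' \<longleftrightarrow> Q 1 s1" for Q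
    proof -
      have "evalx M s' (ptrE (Reg ri)) = ?q"
        by (rule cptr_val[OF env']) (use same[of rT] k ri' i in auto)
      then show ?thesis unfolding wp_Assign s1_def by simp
    qed
    have sp: "wp M \<omega> stepc (\<lambda>t s'. t \<le> stepT \<and> vec s' vY = stp (mem s1) j ?q (wk (mem s) j k a i y) \<and>
        regs s' rx = hv (mem s1) ?q (wk (mem s) j k a i y)) s1"
    proof (rule wp_stepc)
      show "env s1" by (rule env_cong[OF env']) (auto simp: s1_def)
      show "vec s1 vY = wk (mem s) j k a i y"
        using J vec_cong[of s1 vY s'] by (simp add: s1_def)
      show "?q + (d + 2) \<le> H" by (rule ptr_bound(3)) (use k i in auto)
    qed (use same[of rbase] same[of rj] base j in \<open>auto simp: s1_def\<close>)
    show "wp M \<omega> ?body (\<lambda>t s''. t \<le> stepT + T + 1 \<and> ?J (Suc i) (s''\<lparr>regs := (regs s'')(ri := Suc i)\<rparr>)) s'"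
      unfolding wp_Seq s1
    proof (rule wp_use[OF sp])
      fix t1 s2
      assume t1: "t1 \<le> stepT \<and> vec s2 vY = stp (mem s1) j ?q (wk (mem s) j k a i y) \<and>
          regs s2 rx = hv (mem s1) ?q (wk (mem s) j k a i y)" and um: "unmodified M stepc s1 s2"
      have m1: "mem s1 = mem s" by (simp add: s1_def mem)
      have r2: "regs s2 r = regs s' r" if "r < vV \<or> sc 0 \<le> r \<and> r < rq \<or> rT \<le> r" for r
        using unmod_regs[OF um, of r] that by (auto simp: s1_def)
      have env2: "env s2" by (rule env_cong[OF env']) (rule r2, auto)
      have J2: "J i s2" using J cong[of i s' s2] r2[of rfound] r2[of rans] by simp
      have post: "wp M \<omega> c (\<lambda>t s''. t \<le> T \<and> J (Suc i) s'') s2"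
        by (rule step[OF i env2 _ J2]) (use r2 same t1 m1 in auto)
      show "wp M \<omega> c (\<lambda>t2 s''. 1 + (t1 + t2) \<le> stepT + T + 1 \<and>
          ?J (Suc i) (s''\<lparr>regs := (regs s'')(ri := Suc i)\<rparr>)) s2"
      proof (rule wp_use[OF post])
        fix t3 s3
        assume t3: "t3 \<le> T \<and> J (Suc i) s3" and um3: "unmodified M c s2 s3"
        have "vec s3 vY = vec s2 vY"
          by (rule vec_cong) (use unmod_regs[OF um3] mc in auto)
        then have "?J (Suc i) s3" using t1 t3 m1 i by (simp add: wk_Suc)
        then show "1 + (t1 + t3) \<le> stepT + T + 1 \<and> ?J (Suc i) (s3\<lparr>regs := (regs s3)(ri := Suc i)\<rparr>)"
          using t1 t3 ri by simp
      qed
    qed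
  qed (use e pB in simp_all)
  moreover have "stepT + T + 1 + 2 = stepT + T + 3" by simp
  ultimately show ?thesis unfolding walkc_def by (simp only:)
qed

lemma wp_startc:
  assumes "regs s rc = c"
  shows "wp M \<omega> startc (\<lambda>t s'. t \<le> d + 2 \<and> vec s' vY = start_key c) s"
proof -
  let ?I = "\<lambda>k (s' :: state). regs s' vY = (c + 1) mod B \<and> (\<forall>i<k. regs s' (Suc vY + i) = 0)"
  have zero: "wp M \<omega> (seqs (map (\<lambda>i. Assign (Suc vY + i) (Const 0)) [0..<d]))
      (\<lambda>t s'. t \<le> 1 + d * 1 \<and> ?I d s') s'" if "?I 0 s'" for s'
    by (rule wp_seqs[where I = ?I, OF that]) (auto simp: less_Suc_eq)
  have "vec s' vY = start_key c" if "?I d s'" for s'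
  proof (rule nth_equalityI)
    show "vec s' vY ! i = start_key c ! i" if "i < length (vec s' vY)" for i
      using that \<open>?I d s'\<close> by (cases i) (auto simp: start_key_def add.assoc)
  qed (simp add: start_key_def)
  then show ?thesis
    unfolding startc_def wp_Seq wp_Assign
    by (intro wp_mono[OF zero]) (use assms in \<open>auto simp: mod_simps\<close>)
qed

lemma hv_cong: "(\<And>a. a < H \<Longrightarrow> h a = h' a) \<Longrightarrow> q + (d + 2) \<le> H \<Longrightarrow> hv h q y = hv h' q y"
  unfolding hv_def by (intro arg_cong[where f = "\<lambda>\<sigma>. mshift sh l \<sigma> y"] map_cong) auto

definition x0 :: "(nat \<Rightarrow> nat) \<Rightarrow> nat \<Rightarrow> nat \<Rightarrow> nat" where
  "x0 h k c = hv h (2 * k * (d + 2)) (start_key c)"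

text \<open>The contents are described through the seeds in the same image \<open>h\<close>, which
  makes this a property of memory alone that survives the hand-over from construction to
  query.\<close>

definition built0 :: "(nat \<Rightarrow> nat) \<Rightarrow> nat \<Rightarrow> nat \<Rightarrow> bool" where
  "built0 h j k \<longleftrightarrow> (\<forall>\<sigma><m0. h (H + j * Z + k * m0 + \<sigma>) =
     last_write (\<lambda>c. x0 h k c < N \<and> hv h ((2 * k + 1) * (d + 2)) (gk j (x0 h k c)) mod m0 = \<sigma>) (x0 h k) M0)"

definition built1 :: "(nat \<Rightarrow> nat) \<Rightarrow> nat \<Rightarrow> nat \<Rightarrow> bool" where
  "built1 h j k \<longleftrightarrow> (\<forall>\<sigma><m1. h (H + j * Z + r0 * m0 + k * m1 + \<sigma>) =
     last_write (\<lambda>c. hv h (cptr k p) (wk h j k 0 p (start_key c)) mod m1 = \<sigma>) (\<lambda>c. c) M1)"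

lemma x0_cong: "(\<And>a. a < H \<Longrightarrow> h a = h' a) \<Longrightarrow> k < r0 \<Longrightarrow> x0 h k c = x0 h' k c"
  unfolding x0_def by (rule hv_cong) (use ptr_bound(2) in auto)

text \<open>Tables are laid out by increasing address and refer only downwards, so writes beyond the
  end of a table preserve it.\<close>

lemma built0_cong:
  assumes "\<And>a. a < H + j * Z + (k + 1) * m0 \<Longrightarrow> h a = h' a" "k < r0"
  shows "built0 h j k = built0 h' j k"
proof -
  have H: "h a = h' a" if "a < H" for a using assms(1) that by simp
  have "h (H + j * Z + k * m0 + \<sigma>) = h' (H + j * Z + k * m0 + \<sigma>)" if "\<sigma> < m0" for \<sigma>
    using assms(1) that by simp
  moreover have "x0 h k = x0 h' k" using x0_cong[of h h', OF H assms(2)] by auto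
  ultimately show ?thesis
    unfolding built0_def using hv_cong[of h h', OF H ptr_bound(1)[OF assms(2)]] by simp
qed

lemma stored_cong:
  assumes "\<And>a. a < H + j * Z + r0 * m0 \<Longrightarrow> h a = h' a"
  shows "stored h j = stored h' j"
proof -
  have "h (slot0 h j q y) = h' (slot0 h' j q y)" if q: "q < r0" for q y
  proof -
    have "slot0 h j q y = slot0 h' j q y"
      unfolding slot0_def using hv_cong[of h h' "(2 * q + 1) * (d + 2)"] ptr_bound(1)[OF q] assms by simp
    moreover have "slot0 h' j q y < H + j * Z + r0 * m0"
    proof -
      have "q * m0 + hv h' ((2 * q + 1) * (d + 2)) y mod m0 < (q + 1) * m0" using m_pos by simp
      also have "\<dots> \<le> r0 * m0" using q by (intro mult_right_mono) auto
      finally show ?thesis by (simp add: slot0_def)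
    qed
    ultimately show ?thesis using assms by simp
  qed
  then show ?thesis unfolding stored_def by auto
qed

lemma wk_cong:
  assumes "\<And>a. a < H + j * Z + r0 * m0 \<Longrightarrow> h a = h' a" "k < r1" "n \<le> p"
  shows "wk h j k a n y = wk h' j k a n y"
  unfolding wk_def
proof (rule fold_cong)
  fix i assume "i \<in> set [a..<n]"
  then have q: "cptr k i + (d + 2) \<le> H" by (intro ptr_bound(3)) (use assms in auto)
  show "stp h j (cptr k i) = stp h' j (cptr k i)"
    unfolding stp_def using stored_cong[OF assms(1)] hv_cong[of h h', OF _ q] assms(1) by (intro ext) simp
qed simp_all

lemma built1_cong:
  assumes "\<And>a. a < H + j * Z + r0 * m0 + (k + 1) * m1 \<Longrightarrow> h a = h' a" "k < r1"
  shows "built1 h j k = built1 h' j k"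
proof -
  have H: "h a = h' a" if "a < H" for a using assms(1) that by simp
  have H': "h a = h' a" if "a < H + j * Z + r0 * m0" for a using assms(1) that by simp
  have "h (H + j * Z + r0 * m0 + k * m1 + \<sigma>) = h' (H + j * Z + r0 * m0 + k * m1 + \<sigma>)" if "\<sigma> < m1" for \<sigma>
    using assms(1) that by simp
  then show ?thesis
    unfolding built1_def using wk_cong[of j h h', OF H' assms(2)] hv_cong[of h h', OF H ptr_bound(3)[OF assms(2)]]
    by simp
qed

abbreviation "fill0T \<equiv> 6 * d + \<tau> + 22"

text \<open>The invariant splits memory at the current table: below it nothing changes, inside it
  slots hold their last write, above it all is still zero. Seeds lie below, so hash values stay
  constant during the loop.\<close>

lemma wp_fill0:
  assumes env: "env s" and base: "regs s rbase = H + j * Z" and j: "regs s rj = j" "j < D"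
    and k: "regs s rT = k" "k < r0" and zero: "\<And>a. H + j * Z + k * m0 \<le> a \<Longrightarrow> mem s a = 0"
  shows "wp M \<omega> (For rc (Const 0) (Reg rM0)
     (Seq startc
     (Seq (Assign rptr (Op Times (Op Times (Const 2) (Reg rT)) (Const (d + 2))))
     (Seq (hash vY) (Seq (Assign rx (Reg racc))
       (Cond (Op Less (Reg rx) (Reg 0))
         (Seq (geval rx vV)
         (Seq (Assign rptr (Op Times (Op Plus (Op Times (Const 2) (Reg rT)) (Const 1)) (Const (d + 2))))
         (Seq (hash vV)
           (Store (Op Plus (Op Plus (Reg rbase) (Op Times (Reg rT) (Reg rm0))) (Op Modulo (Reg racc) (Reg rm0)))
             (Reg rx))))) Skip))))))
    (\<lambda>t s'. t \<le> 2 + M0 * (fill0T + 2) \<and> (\<forall>a<H + j * Z + k * m0. mem s' a = mem s a) \<and>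
      built0 (mem s') j k \<and> (\<forall>a\<ge>H + j * Z + (k + 1) * m0. mem s' a = 0)) s"
    (is "wp M \<omega> (For rc _ _ (Seq startc (Seq ?a1 (Seq (hash vY) (Seq ?a2
      (Cond ?g (Seq (geval rx vV) (Seq ?a3 (Seq (hash vV) ?st))) Skip)))))) _ _")
proof -
  let ?tl = "Seq ?a3 (Seq (hash vV) ?st)"
  let ?cond = "Cond ?g (Seq (geval rx vV) ?tl) Skip"
  let ?body = "Seq startc (Seq ?a1 (Seq (hash vY) (Seq ?a2 ?cond)))"
  let ?cur = "H + j * Z + k * m0"
  let ?h = "mem s"
  let ?sl = "\<lambda>c. hv ?h ((2 * k + 1) * (d + 2)) (gk j (x0 ?h k c)) mod m0"
  let ?J = "\<lambda>c (s' :: state). (\<forall>a<?cur. mem s' a = ?h a) \<and>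
    (\<forall>\<sigma><m0. mem s' (?cur + \<sigma>) = last_write (\<lambda>c. x0 ?h k c < N \<and> ?sl c = \<sigma>) (x0 ?h k) c) \<and>
    (\<forall>a\<ge>?cur + m0. mem s' a = 0)"
  note qH = ptr_bound(1)[OF k(2)] ptr_bound(2)[OF k(2)]
  have "wp M \<omega> (For rc (Const 0) (Reg rM0) ?body) (\<lambda>t s'. t \<le> 2 + (M0 - 0) * (fill0T + 2) \<and> ?J M0 s') s"
  proof (rule wp_For[where J = ?J])
    fix c s'
    assume c: "c < M0" and rc: "regs s' rc = c"
      and same: "\<And>x. x \<noteq> rc \<Longrightarrow> x \<notin> mods (fn_dim M) ?body \<Longrightarrow> regs s' x = regs s x" and J: "?J c s'"
    have same: "regs s' r = regs s r" if "r < vV \<or> sc 0 \<le> r \<and> r < rptr \<or> r = rT" for r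
      using same[of r] that by auto
    have env': "env s'" by (rule env_cong[OF env]) (use same in auto)
    have low: "mem s' a = ?h a" if "a < H" for a using J that by simp
    have x0': "hv (mem s') (2 * k * (d + 2)) (start_key c) = x0 ?h k c"
      unfolding x0_def by (rule hv_cong) (use low qH in auto)
    let ?x = "x0 ?h k c"
    have tail: "wp M \<omega> ?tl (\<lambda>t s''. t \<le> 2 * d + 8 \<and> ?J (Suc c) s'') s2"
      if s2: "env s2" "mem s2 = mem s'" "regs s2 rx = ?x" "regs s2 rT = k" "regs s2 rbase = H + j * Z"
        "vec s2 vV = gk j ?x" "?x < N" for s2
    proof -
      let ?q = "(2 * k + 1) * (d + 2)"
      define s3 where "s3 = s2\<lparr>regs := (regs s2)(rptr := ?q)\<rparr>"
      have "evalx M s2 (Op Times (Op Plus (Op Times (Const 2) (Reg rT)) (Const 1)) (Const (d + 2))) = ?q"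
        by (subst expr_val_polyE) (use qH H_less s2 in \<open>simp_all add: algebra_simps\<close>)
      then have s3: "wp M \<omega> ?a3 Q s2 \<longleftrightarrow> Q 1 s3" for Q
        unfolding wp_Assign s3_def by simp
      have env3: "env s3" by (rule env_cong[OF s2(1)]) (auto simp: s3_def)
      have "vec s3 vV = gk j ?x" unfolding s2(6)[symmetric] by (rule vec_cong) (auto simp: s3_def)
      then have hs: "wp M \<omega> (hash vV) (\<lambda>t s'. t \<le> 2 * d + 6 \<and> regs s' racc = hv (mem s3) ?q (gk j ?x)) s3"
        by (intro wp_hash[OF env3]) (use qH in \<open>auto simp: s3_def\<close>)
      have hv3: "hv (mem s3) ?q (gk j ?x) mod m0 = ?sl c"
      proof -
        have "hv (mem s3) ?q (gk j ?x) = hv ?h ?q (gk j ?x)"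
          by (rule hv_cong) (use low qH in \<open>auto simp: s3_def s2(2)\<close>)
        then show ?thesis by simp
      qed
      show ?thesis
        unfolding wp_Seq s3
      proof (rule wp_use[OF hs])
        fix t4 s4
        assume t4: "t4 \<le> 2 * d + 6 \<and> regs s4 racc = hv (mem s3) ?q (gk j ?x)" and um: "unmodified M (hash vV) s3 s4"
        have r4: "regs s4 r = regs s2 r" if "r \<notin> {rptr, racc, rtmp}" for r
          using unmod_regs[OF um, of r] that by (simp add: s3_def)
        have m4: "mem s4 = mem s'" using unmod_mem[OF um] s2(2) by (simp add: s3_def)
        have sl: "?sl c < m0" using m_pos by simp
        have "?cur + ?sl c < B" using slot0_less[OF j(2) k(2) sl] bound(1) by linarith
        then have addr: "evalx M s4 (Op Plus (Op Plus (Reg rbase) (Op Times (Reg rT) (Reg rm0))) (Op Modulo (Reg racc) (Reg rm0))) = ?cur + ?sl c"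
          using t4 hv3 r4[of rbase] r4[of rT] r4[of rm0] s2 by (subst expr_val_polyE) (simp_all add: env_def)
        have J': "?J (Suc c) (s4\<lparr>mem := (mem s4)(?cur + ?sl c := ?x)\<rparr>)"
          using J sl s2(7) by (auto simp: m4)
        show "wp M \<omega> ?st
           (\<lambda>t s''. 1 + (t4 + t) \<le> 2 * d + 8 \<and> ?J (Suc c) s'') s4"
          unfolding wp_Store addr using J' t4 r4[of rx] s2(3) by simp
      qed
    qed
    show "wp M \<omega> ?body (\<lambda>t s''. t \<le> fill0T \<and> ?J (Suc c) (s''\<lparr>regs := (regs s'')(rc := Suc c)\<rparr>)) s'"
      unfolding wp_Seq
    proof (rule wp_use[OF wp_startc[OF rc]])
      fix t1 s1
      assume t1: "t1 \<le> d + 2 \<and> vec s1 vY = start_key c" and um1: "unmodified M startc s' s1"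
      have r1: "regs s1 r = regs s' r" if "r < vY \<or> vY + d < r" for r
        using unmod_regs[OF um1, of r] that by auto
      have m1: "mem s1 = mem s'" using unmod_mem[OF um1] by simp
      let ?q = "2 * k * (d + 2)"
      define s2 where "s2 = s1\<lparr>regs := (regs s1)(rptr := ?q)\<rparr>"
      have rT: "regs s1 rT = k" using r1[of rT] same[of rT] k by simp
      have "evalx M s1 (Op Times (Op Times (Const 2) (Reg rT)) (Const (d + 2))) = ?q"
        by (subst expr_val_polyE) (use qH H_less rT in \<open>simp_all add: algebra_simps\<close>)
      then have s2: "wp M \<omega> ?a1 Q s1 \<longleftrightarrow> Q 1 s2" for Q
        unfolding wp_Assign s2_def by simp
      have env2: "env s2" by (rule env_cong[OF env']) (use r1 in \<open>auto simp: s2_def\<close>)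
      have "vec s2 vY = vec s1 vY" by (rule vec_cong) (auto simp: s2_def)
      then have hs: "wp M \<omega> (hash vY) (\<lambda>t s'. t \<le> 2 * d + 6 \<and> regs s' racc = hv (mem s2) ?q (start_key c)) s2"
        by (intro wp_hash[OF env2]) (use qH t1 in \<open>auto simp: s2_def\<close>)
      have hv2: "hv (mem s2) ?q (start_key c) = ?x" using x0' by (simp add: s2_def m1)
      show "wp M \<omega> ?a1 (\<lambda>t2. wp M \<omega> (hash vY) (\<lambda>t3.
           wp M \<omega> ?a2 (\<lambda>t4. wp M \<omega> ?cond (\<lambda>t5 s''. t1 + (t2 + (t3 + (t4 + t5))) \<le> fill0T \<and>
               ?J (Suc c) (s''\<lparr>regs := (regs s'')(rc := Suc c)\<rparr>))))) s1"
        unfolding s2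
      proof (rule wp_use[OF hs])
        fix t3 s3
        assume t3: "t3 \<le> 2 * d + 6 \<and> regs s3 racc = hv (mem s2) ?q (start_key c)" and um3: "unmodified M (hash vY) s2 s3"
        have r3: "regs s3 r = regs s1 r" if "r \<notin> {rptr, racc, rtmp}" for r
          using unmod_regs[OF um3, of r] that by (simp add: s2_def)
        have m3: "mem s3 = mem s'" using unmod_mem[OF um3] m1 by (simp add: s2_def)
        define s4 where "s4 = s3\<lparr>regs := (regs s3)(rx := ?x)\<rparr>"
        have s4: "wp M \<omega> ?a2 Q s3 \<longleftrightarrow> Q 1 s4" for Q
          using t3 hv2 by (simp add: s4_def)
        have env4: "env s4" by (rule env_cong[OF env2]) (use r3 in \<open>auto simp: s4_def s2_def\<close>)
        have m4: "mem s4 = mem s'" by (simp add: s4_def m3)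
        show "wp M \<omega> ?a2 (\<lambda>t4. wp M \<omega> ?cond (\<lambda>t5 s''. t1 + (1 + (t3 + (t4 + t5))) \<le> fill0T \<and>
               ?J (Suc c) (s''\<lparr>regs := (regs s'')(rc := Suc c)\<rparr>))) s3"
          unfolding s4
        proof (cases "?x < N")
          case False
          have "?J (Suc c) (s4\<lparr>regs := (regs s4)(rc := Suc c)\<rparr>)" using J m4 False by simp
          then show "wp M \<omega> ?cond (\<lambda>t5 s''. t1 + (1 + (t3 + (1 + t5))) \<le> fill0T \<and>
               ?J (Suc c) (s''\<lparr>regs := (regs s'')(rc := Suc c)\<rparr>)) s4"
            using False env4 t1 t3 by (simp add: env_def s4_def)
        next
          case True
          have g: "wp M \<omega> (geval rx vV) (\<lambda>t s'. t \<le> \<tau> + d + 3 \<and> vec s' vV = gk j ?x) s4"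
            by (rule wp_geval[OF env4]) (use r3[of rj] r1[of rj] same[of rj] True j in \<open>auto simp: s4_def\<close>)
          have "wp M \<omega> (Seq (geval rx vV)
            ?tl) (\<lambda>t s''. t \<le> (\<tau> + d + 3) + (2 * d + 8) \<and> ?J (Suc c) s'') s4"
            unfolding wp_Seq[of _ _ "geval rx vV"]
          proof (rule wp_use[OF g])
            fix t5 s5
            assume t5: "t5 \<le> \<tau> + d + 3 \<and> vec s5 vV = gk j ?x" and um5: "unmodified M (geval rx vV) s4 s5"
            have r5: "regs s5 r = regs s4 r" if "r < vV \<or> vV + d < r" for r
              using unmod_regs[OF um5, of r] that by auto
            have env5: "env s5" by (rule env_cong[OF env4]) (rule r5, auto)
            have m5: "mem s5 = mem s'" using unmod_mem[OF um5] m4 by simp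
            have regs5: "regs s5 rx = ?x" "regs s5 rT = k" "regs s5 rbase = H + j * Z"
              using r5[of rx] r5[of rT] r5[of rbase] r3[of rT] r3[of rbase] r1[of rbase] rT same[of rbase] base
              by (simp_all add: s4_def)
            show "wp M \<omega> ?tl (\<lambda>t s''. t5 + t \<le> (\<tau> + d + 3) + (2 * d + 8) \<and> ?J (Suc c) s'') s5"
              by (rule wp_mono[OF tail[OF env5 m5 regs5 _ True]]) (use t5 in auto)
          qed
          then show "wp M \<omega> ?cond (\<lambda>t5 s''. t1 + (1 + (t3 + (1 + t5))) \<le> fill0T \<and>
               ?J (Suc c) (s''\<lparr>regs := (regs s'')(rc := Suc c)\<rparr>)) s4"
            unfolding wp_Cond using True env4 t1 t3
            by (auto simp: env_def s4_def simp del: wp_Seq wp_Assign elim!: wp_mono)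
        qed
      qed
    qed
  qed (use env bound zero in \<open>auto simp: env_def\<close>)
  then show ?thesis
  proof (rule wp_mono)
    fix t s'
    assume a: "t \<le> 2 + (M0 - 0) * (fill0T + 2) \<and> ?J M0 s'"
    have "mem s' a = ?h a" if "a < H" for a using a that by simp
    then have "x0 (mem s') k = x0 ?h k" "hv (mem s') ((2 * k + 1) * (d + 2)) y = hv ?h ((2 * k + 1) * (d + 2)) y" for y
      using x0_cong[of "mem s'" ?h k] hv_cong[of "mem s'" ?h] qH k by auto
    then have "built0 (mem s') j k" using a by (simp add: built0_def)
    then show "t \<le> 2 + M0 * (fill0T + 2) \<and> (\<forall>a<?cur. mem s' a = ?h a) \<and>
      built0 (mem s') j k \<and> (\<forall>a\<ge>H + j * Z + (k + 1) * m0. mem s' a = 0)"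
      using a by (simp add: add_ac)
  qed
qed

end

context ram_run
begin

abbreviation "build0T \<equiv> 2 + r0 * (2 + M0 * (fill0T + 2) + 2)"

lemma wp_build0:
  assumes env: "env s" and base: "regs s rbase = H + j * Z" and j: "regs s rj = j" "j < D"
    and zero: "\<And>a. H + j * Z \<le> a \<Longrightarrow> mem s a = 0"
  shows "wp M \<omega> build0 (\<lambda>t s'. t \<le> build0T \<and> (\<forall>a<H + j * Z. mem s' a = mem s a) \<and>
      (\<forall>k<r0. built0 (mem s') j k) \<and> (\<forall>a\<ge>H + j * Z + r0 * m0. mem s' a = 0)) s"
proof -
  let ?J = "\<lambda>k (s' :: state). (\<forall>a<H + j * Z. mem s' a = mem s a) \<and>
      (\<forall>k'<k. built0 (mem s') j k') \<and> (\<forall>a\<ge>H + j * Z + k * m0. mem s' a = 0)"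
  have "wp M \<omega> build0 (\<lambda>t s'. t \<le> 2 + (r0 - 0) * ((2 + M0 * (fill0T + 2)) + 2) \<and> ?J r0 s') s"
    unfolding build0_def
  proof (rule wp_For[where J = ?J], goal_cases)
    case (8 k s')
    have same: "regs s' r = regs s r" if "r < vV \<or> sc 0 \<le> r \<and> r < rptr" for r
      using 8(4)[of r] that by auto
    have env': "env s'" by (rule env_cong[OF env]) (use same in auto)
    have "regs s' rbase = H + j * Z" "regs s' rj = j" using same base j by auto
    note fill = wp_fill0[OF env' this j(2) 8(3,2)]
    show ?case
    proof (rule wp_mono[OF fill], goal_cases)
      case (1 a)
      then show ?case using 8(6) by simp
    next
      case (2 t s'')
      have "built0 (mem s'') j k'" if "k' < Suc k" for k'
      proof (cases "k' = k")
        case False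
        then have "k' < k" using that by simp
        then have "k' + 1 \<le> k" by simp
        then have "(k' + 1) * m0 \<le> k * m0" by (rule mult_le_mono1)
        then have "built0 (mem s'') j k' = built0 (mem s') j k'"
          by (intro built0_cong) (use 2 \<open>k' < k\<close> 8(2) in auto)
        then show ?thesis using 8(6) \<open>k' < k\<close> by blast
      qed (use 2 in simp)
      then show ?case using 2 8(6) by simp
    qed
  qed (use env zero r0_bound(2) H_less in \<open>auto simp: env_def\<close>)
  then show ?thesis by simp
qed

abbreviation "fill1T \<equiv> (d + 2) + (2 + p * (stepT + 4)) + 1 + (2 * d + 6) + 1"

lemma wp_fill1:
  assumes env: "env s" and base: "regs s rbase = H + j * Z" and j: "regs s rj = j" "j < D"
    and k: "regs s rT = k" "k < r1" and zero: "\<And>a. H + j * Z + r0 * m0 + k * m1 \<le> a \<Longrightarrow> mem s a = 0"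
  shows "wp M \<omega> (For rc (Const 0) (Reg rM1)
     (Seq startc (Seq (walkc (Const 0) Skip)
       (Seq (Assign rptr (ptrE (Reg rp))) (Seq (hash vY) (Store slot1E (Reg rc)))))))
    (\<lambda>t s'. t \<le> 2 + M1 * (fill1T + 2) \<and> (\<forall>a<H + j * Z + r0 * m0 + k * m1. mem s' a = mem s a) \<and>
      built1 (mem s') j k \<and> (\<forall>a\<ge>H + j * Z + r0 * m0 + (k + 1) * m1. mem s' a = 0)) s"
    (is "wp M \<omega> (For rc _ _ ?body) _ _")
proof -
  let ?cur = "H + j * Z + r0 * m0 + k * m1"
  let ?h = "mem s"
  let ?sl = "\<lambda>c. hv ?h (cptr k p) (wk ?h j k 0 p (start_key c)) mod m1"
  let ?J = "\<lambda>c (s' :: state). (\<forall>a<?cur. mem s' a = ?h a) \<and>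
    (\<forall>\<sigma><m1. mem s' (?cur + \<sigma>) = last_write (\<lambda>c. ?sl c = \<sigma>) (\<lambda>c. c) c) \<and>
    (\<forall>a\<ge>?cur + m1. mem s' a = 0)"
  have qH: "cptr k p + (d + 2) \<le> H" by (rule ptr_bound(3)) (use k in auto)
  have "wp M \<omega> (For rc (Const 0) (Reg rM1) ?body) (\<lambda>t s'. t \<le> 2 + (M1 - 0) * (fill1T + 2) \<and> ?J M1 s') s"
  proof (rule wp_For[where J = ?J])
    fix c s'
    assume c: "c < M1" and rc: "regs s' rc = c"
      and same: "\<And>x. x \<noteq> rc \<Longrightarrow> x \<notin> mods (fn_dim M) ?body \<Longrightarrow> regs s' x = regs s x" and J: "?J c s'"
    have same: "regs s' r = regs s r" if "r < vV \<or> sc 0 \<le> r \<and> r < rq \<or> r = rT" for r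
      using same[of r] that by auto
    have env': "env s'" by (rule env_cong[OF env]) (use same in auto)
    have low: "mem s' a = ?h a" if "a < H + j * Z + r0 * m0" for a using J that by simp
    have wk: "wk (mem s') j k 0 p y = wk ?h j k 0 p y" for y
      by (rule wk_cong) (use low k in auto)
    have hv': "hv (mem s') (cptr k p) y = hv ?h (cptr k p) y" for y
      by (rule hv_cong) (use low qH in auto)
    show "wp M \<omega> ?body (\<lambda>t s''. t \<le> fill1T \<and> ?J (Suc c) (s''\<lparr>regs := (regs s'')(rc := Suc c)\<rparr>)) s'"
      unfolding wp_Seq
    proof (rule wp_use[OF wp_startc[OF rc]])
      fix t1 s1
      assume t1: "t1 \<le> d + 2 \<and> vec s1 vY = start_key c" and um1: "unmodified M startc s' s1"
      have r1: "regs s1 r = regs s' r" if "r < vY \<or> vY + d < r" for r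
        using unmod_regs[OF um1, of r] that by auto
      have m1: "mem s1 = mem s'" using unmod_mem[OF um1] by simp
      have env1: "env s1" by (rule env_cong[OF env']) (use r1 in auto)
      have regs1: "regs s1 rbase = H + j * Z" "regs s1 rj = j" "regs s1 rT = k" "regs s1 rc = c"
        using r1 same base j k rc by auto
      have walk: "wp M \<omega> (walkc (Const 0) Skip) (\<lambda>t s'. t \<le> 2 + (p - 0) * (stepT + 1 + 3) \<and>
          vec s' vY = wk (mem s1) j k 0 p (start_key c) \<and> True) s1"
        by (rule wp_walkc[where J = "\<lambda>_ _. True", OF env1 regs1(1,2) j(2) regs1(3) k(2)]) (use t1 in auto)
      show "wp M \<omega> (walkc (Const 0) Skip) (\<lambda>t2. wp M \<omega> (Assign rptr (ptrE (Reg rp)))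
          (\<lambda>t3. wp M \<omega> (hash vY) (\<lambda>t4. wp M \<omega> (Store slot1E (Reg rc))
            (\<lambda>t5 s''. t1 + (t2 + (t3 + (t4 + t5))) \<le> fill1T \<and> ?J (Suc c) (s''\<lparr>regs := (regs s'')(rc := Suc c)\<rparr>))))) s1"
      proof (rule wp_use[OF walk])
        fix t2 s2
        assume t2: "t2 \<le> 2 + (p - 0) * (stepT + 1 + 3) \<and> vec s2 vY = wk (mem s1) j k 0 p (start_key c) \<and> True"
          and um2: "unmodified M (walkc (Const 0) Skip) s1 s2"
        have t2': "t2 \<le> 2 + p * (stepT + 4)" using t2 by (simp add: add.commute)
        have r2: "regs s2 r = regs s1 r" if "sc 0 \<le> r \<and> r < rq \<or> r = rT \<or> r = rc \<or> r = 0" for r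
          using unmod_regs[OF um2, of r] that by auto
        have m2: "mem s2 = mem s'" using unmod_mem[OF um2] m1 by simp
        have env2: "env s2" by (rule env_cong[OF env1]) (use r2 in auto)
        let ?q = "cptr k p"
        define s3 where "s3 = s2\<lparr>regs := (regs s2)(rptr := ?q)\<rparr>"
        have "evalx M s2 (ptrE (Reg rp)) = ?q"
          by (rule cptr_val[OF env2]) (use r2 regs1 k env2 in \<open>auto simp: env_def\<close>)
        then have s3: "wp M \<omega> (Assign rptr (ptrE (Reg rp))) Q s2 \<longleftrightarrow> Q 1 s3" for Q
          unfolding wp_Assign s3_def by simp
        have env3: "env s3" by (rule env_cong[OF env2]) (auto simp: s3_def)
        have "vec s3 vY = vec s2 vY" by (rule vec_cong) (auto simp: s3_def)
        then have Y3: "vec s3 vY = wk ?h j k 0 p (start_key c)" using t2 m1 wk by simp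
        have hs: "wp M \<omega> (hash vY) (\<lambda>t s'. t \<le> 2 * d + 6 \<and> regs s' racc = hv (mem s3) ?q (wk ?h j k 0 p (start_key c))) s3"
          by (rule wp_hash[OF env3 _ qH Y3]) (auto simp: s3_def)
        show "wp M \<omega> (Assign rptr (ptrE (Reg rp))) (\<lambda>t3. wp M \<omega> (hash vY) (\<lambda>t4. wp M \<omega> (Store slot1E (Reg rc))
            (\<lambda>t5 s''. t1 + (t2 + (t3 + (t4 + t5))) \<le> fill1T \<and> ?J (Suc c) (s''\<lparr>regs := (regs s'')(rc := Suc c)\<rparr>)))) s2"
          unfolding s3
        proof (rule wp_use[OF hs])
          fix t4 s4
          assume t4: "t4 \<le> 2 * d + 6 \<and> regs s4 racc = hv (mem s3) ?q (wk ?h j k 0 p (start_key c))"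
            and um4: "unmodified M (hash vY) s3 s4"
          have r4: "regs s4 r = regs s2 r" if "r \<notin> {rptr, racc, rtmp}" for r
            using unmod_regs[OF um4, of r] that by (simp add: s3_def)
          have m4: "mem s4 = mem s'" using unmod_mem[OF um4] m2 by (simp add: s3_def)
          have acc: "regs s4 racc mod m1 = ?sl c" using t4 hv' by (simp add: s3_def m2)
          have sl: "?sl c < m1" using m_pos by simp
          have "?cur + ?sl c < B" using slot1_less[OF j(2) k(2) sl] bound(1) by linarith
          then have addr: "evalx M s4 slot1E = ?cur + ?sl c"
            unfolding slot1E_def
            using acc r4[of rbase] r4[of rT] r4[of rm0] r4[of rm1] r4[of rR0] r2 regs1 env2
            by (subst expr_val_polyE) (simp_all add: env_def)
          have J': "?J (Suc c) (s4\<lparr>mem := (mem s4)(?cur + ?sl c := c)\<rparr>)"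
            using J sl by (auto simp: m4)
          show "wp M \<omega> (Store slot1E (Reg rc)) (\<lambda>t5 s''. t1 + (t2 + (1 + (t4 + t5))) \<le> fill1T \<and>
              ?J (Suc c) (s''\<lparr>regs := (regs s'')(rc := Suc c)\<rparr>)) s4"
            unfolding wp_Store addr using J' t4 t2' t1 r4[of rc] r2[of rc] regs1 by simp
        qed
      qed
    qed
  qed (use env bound zero in \<open>auto simp: env_def\<close>)
  then show ?thesis
  proof (rule wp_mono)
    fix t s'
    assume a: "t \<le> 2 + (M1 - 0) * (fill1T + 2) \<and> ?J M1 s'"
    have low: "mem s' a = ?h a" if "a < H + j * Z + r0 * m0" for a using a that by simp
    have "wk (mem s') j k 0 p y = wk ?h j k 0 p y" for y
      by (rule wk_cong) (use low k in auto)
    moreover have "hv (mem s') (cptr k p) y = hv ?h (cptr k p) y" for y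
      by (rule hv_cong) (use low qH in auto)
    ultimately have "built1 (mem s') j k" using a by (simp add: built1_def)
    then show "t \<le> 2 + M1 * (fill1T + 2) \<and> (\<forall>a<?cur. mem s' a = ?h a) \<and>
      built1 (mem s') j k \<and> (\<forall>a\<ge>H + j * Z + r0 * m0 + (k + 1) * m1. mem s' a = 0)"
      using a by (simp add: add_ac)
  qed
qed

abbreviation "build1T \<equiv> 2 + r1 * (2 + M1 * (fill1T + 2) + 2)"

lemma wp_build1:
  assumes env: "env s" and base: "regs s rbase = H + j * Z" and j: "regs s rj = j" "j < D"
    and zero: "\<And>a. H + j * Z + r0 * m0 \<le> a \<Longrightarrow> mem s a = 0"
  shows "wp M \<omega> build1 (\<lambda>t s'. t \<le> build1T \<and> (\<forall>a<H + j * Z + r0 * m0. mem s' a = mem s a) \<and>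
      (\<forall>k<r1. built1 (mem s') j k) \<and> (\<forall>a\<ge>H + j * Z + Z. mem s' a = 0)) s"
proof -
  let ?J = "\<lambda>k (s' :: state). (\<forall>a<H + j * Z + r0 * m0. mem s' a = mem s a) \<and>
      (\<forall>k'<k. built1 (mem s') j k') \<and> (\<forall>a\<ge>H + j * Z + r0 * m0 + k * m1. mem s' a = 0)"
  have "wp M \<omega> build1 (\<lambda>t s'. t \<le> 2 + (r1 - 0) * ((2 + M1 * (fill1T + 2)) + 2) \<and> ?J r1 s') s"
    unfolding build1_def
  proof (rule wp_For[where J = ?J], goal_cases)
    case (8 k s')
    have same: "regs s' r = regs s r" if "r < vV \<or> sc 0 \<le> r \<and> r < rq" for r
      using 8(4)[of r] that by auto
    have env': "env s'" by (rule env_cong[OF env]) (use same in auto)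
    have "regs s' rbase = H + j * Z" "regs s' rj = j" using same base j by auto
    note fill = wp_fill1[OF env' this j(2) 8(3,2)]
    show ?case
    proof (rule wp_mono[OF fill], goal_cases)
      case (1 a)
      then show ?case using 8(6) by simp
    next
      case (2 t s'')
      have "built1 (mem s'') j k'" if "k' < Suc k" for k'
      proof (cases "k' = k")
        case False
        then have "k' < k" using that by simp
        then have "k' + 1 \<le> k" by simp
        then have "(k' + 1) * m1 \<le> k * m1" by (rule mult_le_mono1)
        then have "built1 (mem s'') j k' = built1 (mem s') j k'"
          by (intro built1_cong) (use 2 \<open>k' < k\<close> 8(2) in auto)
        then show ?thesis using 8(6) \<open>k' < k\<close> by blast
      qed (use 2 in simp)
      then show ?case using 2 8(6) by simp
    qed
  qed (use env zero r0_bound(3) H_less in \<open>auto simp: env_def\<close>)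
  then show ?thesis by (simp add: Z add.assoc)
qed

definition all_built :: "(nat \<Rightarrow> nat) \<Rightarrow> nat \<Rightarrow> bool" where
  "all_built h j \<longleftrightarrow> (\<forall>k<r0. built0 h j k) \<and> (\<forall>k<r1. built1 h j k)"

lemma all_built_cong:
  assumes "\<And>a. a < H + (j + 1) * Z \<Longrightarrow> h a = h' a"
  shows "all_built h j = all_built h' j"
proof -
  have "built0 h j k = built0 h' j k" if "k < r0" for k
  proof (rule built0_cong[OF assms that])
    fix a assume a: "a < H + j * Z + (k + 1) * m0"
    have "(k + 1) * m0 \<le> r0 * m0" using that by (intro mult_le_mono1) simp
    then show "a < H + (j + 1) * Z" using a by (simp add: Z)
  qed
  moreover have "built1 h j k = built1 h' j k" if "k < r1" for k
  proof (rule built1_cong[OF assms that])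
    fix a assume a: "a < H + j * Z + r0 * m0 + (k + 1) * m1"
    have "(k + 1) * m1 \<le> r1 * m1" using that by (intro mult_le_mono1) simp
    then show "a < H + (j + 1) * Z" using a by (simp add: Z)
  qed
  ultimately show ?thesis by (simp add: all_built_def)
qed

abbreviation "buildT \<equiv> 2 + D * (1 + build0T + build1T + 2)"

lemma wp_build:
  assumes env: "env s" and zero: "\<And>a. H \<le> a \<Longrightarrow> mem s a = 0"
  shows "wp M \<omega> build (\<lambda>t s'. t \<le> buildT \<and> (\<forall>a<H. mem s' a = mem s a) \<and> (\<forall>j<D. all_built (mem s') j)) s"
proof -
  let ?J = "\<lambda>j (s' :: state). (\<forall>a<H. mem s' a = mem s a) \<and>
      (\<forall>j'<j. all_built (mem s') j') \<and> (\<forall>a\<ge>H + j * Z. mem s' a = 0)"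
  have DB: "D < B" using bound(3) by simp
  have "wp M \<omega> build (\<lambda>t s'. t \<le> 2 + (D - 0) * ((1 + build0T + build1T) + 2) \<and> ?J D s') s"
    unfolding build_def
  proof (rule wp_For[where J = ?J], goal_cases)
    case (8 j s')
    have same: "regs s' r = regs s r" if "r < vV \<or> sc 0 \<le> r \<and> r < rj" for r
      using 8(4)[of r] that by auto
    have env': "env s'" by (rule env_cong[OF env]) (use same in auto)
    define s1 where "s1 = s'\<lparr>regs := (regs s')(rbase := H + j * Z)\<rparr>"
    have "j * Z \<le> D * Z" using 8(2) by (intro mult_le_mono1) simp
    then have "H + j * Z < B" using bound(1) by linarith
    then have "evalx M s' (Op Plus (Reg rH) (Op Times (Reg rj) (Reg rZ))) = H + j * Z"
      using env' 8(3) by (subst expr_val_polyE) (simp_all add: env_def)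
    then have s1: "wp M \<omega> (Assign rbase (Op Plus (Reg rH) (Op Times (Reg rj) (Reg rZ)))) Q s' \<longleftrightarrow> Q 1 s1" for Q
      unfolding wp_Assign s1_def by simp
    have env1: "env s1" by (rule env_cong[OF env']) (auto simp: s1_def)
    have regs1: "regs s1 rbase = H + j * Z" "regs s1 rj = j" using 8(3) by (simp_all add: s1_def)
    have m1: "mem s1 = mem s'" by (simp add: s1_def)
    note b0 = wp_build0[OF env1 regs1 8(2)]
    show ?case
      unfolding wp_Seq s1
    proof (rule wp_use[OF b0], goal_cases)
      case (1 a)
      then show ?case using 8(6) m1 by simp
    next
      case (2 t2 s2)
      have r2: "regs s2 r = regs s1 r" if "r < vV \<or> sc 0 \<le> r \<and> r < rptr" for r
        using unmod_regs[OF 2(2), of r] that by auto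
      have env2: "env s2" by (rule env_cong[OF env1]) (use r2 in auto)
      have regs2: "regs s2 rbase = H + j * Z" "regs s2 rj = j" using r2 regs1 by auto
      note b1 = wp_build1[OF env2 regs2 8(2)]
      show ?case
      proof (rule wp_mono[OF b1], goal_cases)
        case (1 a)
        then show ?case using 2(1) by simp
      next
        case (2 t3 s3)
        note 20 = \<open>t2 \<le> build0T \<and> _\<close>
        have "built0 (mem s3) j k = built0 (mem s2) j k" if k: "k < r0" for k
        proof (rule built0_cong[OF _ k])
          fix a assume a: "a < H + j * Z + (k + 1) * m0"
          have "(k + 1) * m0 \<le> r0 * m0" using k by (intro mult_le_mono1) simp
          then have "a < H + j * Z + r0 * m0" using a by simp
          then show "mem s3 a = mem s2 a" using 2 by blast
        qed
        then have now: "all_built (mem s3) j" using 2 20 by (simp add: all_built_def)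
        have low: "mem s3 a = mem s' a" if "a < H + j * Z" for a
        proof -
          have "a < H + j * Z + r0 * m0" using that by simp
          then show ?thesis using 2 20 that m1 by simp
        qed
        have old: "all_built (mem s3) j'" if "j' < j" for j'
        proof -
          have "j' + 1 \<le> j" using that by simp
          then have "(j' + 1) * Z \<le> j * Z" by (rule mult_le_mono1)
          then have "all_built (mem s3) j' = all_built (mem s') j'"
            by (intro all_built_cong low) simp
          then show ?thesis using 8(6) that by blast
        qed
        have "all_built (mem s3) j'" if "j' < Suc j" for j'
          using that now old by (cases "j' = j") auto
        moreover have "mem s3 a = mem s a" if "a < H" for a using low[of a] 8(6) that by simp
        ultimately show ?case using 2 20 by (simp add: add_ac)
      qed
    qed
  qed (use env zero DB in \<open>auto simp: env_def\<close>)
  then show ?thesis by (rule wp_mono) simp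
qed

text \<open>Address \<open>a\<close> receives random word number \<open>a\<close>, so the seeds in
  memory are a prefix of \<open>\<omega>\<close>.\<close>

lemma wp_rands:
  assumes env: "env s" and zero: "\<And>a. mem s a = 0" and used: "rand_used s = 0"
  shows "wp M \<omega> rands (\<lambda>t s'. t \<le> 2 + H * 4 \<and> rand_used s' = H \<and> (\<forall>a<H. mem s' a = \<omega> a mod B) \<and>
    (\<forall>a\<ge>H. mem s' a = 0)) s"
proof -
  let ?J = "\<lambda>k (s' :: state). rand_used s' = k \<and> (\<forall>a<k. mem s' a = \<omega> a mod B) \<and> (\<forall>a\<ge>k. mem s' a = 0)"
  have "wp M \<omega> rands (\<lambda>t s'. t \<le> 2 + (H - 0) * (2 + 2) \<and> ?J H s') s"
    unfolding rands_def
    by (rule wp_For[where J = ?J]) (use env zero used H_less in \<open>auto simp: env_def less_Suc_eq\<close>)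
  then show ?thesis by simp
qed

end

section \<open>Dyadic covers of boxes\<close>

text \<open>
  \<open>cand\<close> lists the first two cells of level \<open>s\<close> counted from \<open>lo\<close> and the last two counted from \<open>hi\<close>,
  in the wrap-around arithmetic of the machine.
\<close>

definition cand :: "nat \<Rightarrow> nat \<Rightarrow> nat \<Rightarrow> nat \<Rightarrow> nat \<Rightarrow> nat" where
  "cand B lo hi s e = (if e < 2 then (lo div 2 ^ s + e) mod B
     else nat ((int ((hi div 2 ^ s + 2) mod B) - int e) mod int B))"

lemma cand_up: "e < 2 \<Longrightarrow> lo div 2 ^ s + e = u \<Longrightarrow> u < B \<Longrightarrow> cand B lo hi s e = u"
  by (simp add: cand_def)

lemma cand_down:
  assumes "2 \<le> e" "hi div 2 ^ s + 2 = u + e" "u < B"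
  shows "cand B lo hi s e = u"
proof -
  have "(int ((hi div 2 ^ s + 2) mod B) - int e) mod int B = (int (u + e) - int e) mod int B"
    unfolding assms(2) by (simp add: zmod_int mod_simps)
  also have "\<dots> = int u" using assms(3) by simp
  finally show ?thesis using assms(1) by (simp add: cand_def)
qed

text \<open>A maximal dyadic interval inside \<open>[lo, hi]\<close> is the first or the last one of its level there.\<close>

lemma dyadic_cand:
  fixes y lo hi w B :: nat
  assumes "lo \<le> y" "y \<le> hi" "y < 2 ^ w" "2 ^ w \<le> B"
  obtains s e where "s \<le> w" "e < 4" "cand B lo hi s e = y div 2 ^ s"
    "\<And>y'. y' div 2 ^ s = y div 2 ^ s \<Longrightarrow> lo \<le> y' \<and> y' \<le> hi"
proof -
  note result = that
  define P where "P s \<longleftrightarrow> (\<forall>y'. y' div 2 ^ s = y div 2 ^ s \<longrightarrow> lo \<le> y' \<and> y' \<le> hi)" for s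
  define s where "s = (GREATEST s. s \<le> w \<and> P s)"
  have "0 \<le> w \<and> P 0" using assms by (simp add: P_def)
  then have s: "s \<le> w \<and> P s"
    unfolding s_def by (rule GreatestI_nat[where b = w]) simp
  have max: "s' \<le> s" if "s' \<le> w" "P s'" for s'
    unfolding s_def by (rule Greatest_le_nat[where b = w]) (use that in auto)
  define u where "u = y div 2 ^ s"
  have "u \<le> y" by (simp add: u_def)
  then have uB: "u < B" using assms by linarith
  have "lo \<le> u * 2 ^ s" "u * 2 ^ s \<le> hi" using s by (auto simp: P_def u_def)
  have lo: "lo div 2 ^ s \<le> u"
    using div_le_mono[OF \<open>lo \<le> u * 2 ^ s\<close>, of "2 ^ s"] by simp
  have hi: "u \<le> hi div 2 ^ s"
    using div_le_mono[OF \<open>u * 2 ^ s \<le> hi\<close>, of "2 ^ s"] by simp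
  have fin: thesis if "e < 4" "cand B lo hi s e = u" for e
    using result[of s e] s that by (auto simp: P_def u_def)
  show thesis
  proof (cases "s = w")
    case True
    then have "u = 0" using assms by (simp add: u_def)
    then have "cand B lo hi s 0 = u" using lo uB by (intro cand_up) auto
    then show ?thesis by (rule fin[rotated]) simp
  next
    case False
    then have "\<not> P (Suc s)" using max[of "Suc s"] s by auto
    then obtain y' where y': "y' div 2 ^ Suc s = y div 2 ^ Suc s" "\<not> (lo \<le> y' \<and> y' \<le> hi)"
      unfolding P_def by blast
    \<comment> \<open>By maximality the parent cell leaves the interval, so the sibling
      \<open>u'\<close> of \<open>u\<close> contains the point \<open>y'\<close> outside.\<close>
    define u' where "u' = y' div 2 ^ s"
    have half: "u' div 2 = u div 2"
      using y'(1) by (simp add: u_def u'_def div_mult2_eq power_Suc2 del: power_Suc)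
    have "u' \<noteq> u" using y'(2) s by (auto simp: P_def u_def u'_def)
    then consider "u' = u + 1" | "u = u' + 1" using half by linarith
    then show ?thesis
    proof cases
      case 1
      then have "y < y'" using div_le_mono[of y' y "2 ^ s"] by (force simp: u_def u'_def not_le[symmetric])
      then have "hi < y'" using y'(2) assms by linarith
      \<comment> \<open>With the sibling on the right, \<open>hi\<close> lies in the cell
        \<open>u\<close> or \<open>u + 1\<close>; candidates 2 and 3 are the cell of
        \<open>hi\<close> and the one before it.\<close>
      then have "hi div 2 ^ s \<le> u + 1" using div_le_mono[of hi y' "2 ^ s"] 1 by (simp add: u'_def)
      then consider "hi div 2 ^ s = u" | "hi div 2 ^ s = u + 1" using hi by linarith
      then show ?thesis
      proof cases
        case 1
        then have "cand B lo hi s 2 = u" using uB by (intro cand_down) auto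
        then show ?thesis by (rule fin[rotated]) simp
      next
        case 2
        then have "cand B lo hi s 3 = u" using uB by (intro cand_down) auto
        then show ?thesis by (rule fin[rotated]) simp
      qed
    next
      case 2
      then have "y' < y" using div_le_mono[of y y' "2 ^ s"] by (force simp: u_def u'_def not_le[symmetric])
      then have "y' < lo" using y'(2) assms by linarith
      then have "u \<le> lo div 2 ^ s + 1" using div_le_mono[of y' lo "2 ^ s"] 2 by (simp add: u'_def)
      then consider "lo div 2 ^ s = u" | "lo div 2 ^ s + 1 = u" using lo by linarith
      then show ?thesis
      proof cases
        case 1
        then have "cand B lo hi s 0 = u" using uB by (intro cand_up) auto
        then show ?thesis by (rule fin[rotated]) simp
      next
        case 2
        then have "cand B lo hi s 1 = u" using uB by (intro cand_up) auto
        then show ?thesis by (rule fin[rotated]) simp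
      qed
    qed
  qed
qed

lemma digits_exist:
  fixes W :: nat
  assumes "\<And>i. i < d \<Longrightarrow> \<delta> i < W"
  shows "\<exists>j<W ^ d. \<forall>i<d. j div W ^ i mod W = \<delta> i"
  using assms
proof (induction d)
  case (Suc d)
  then obtain j where j: "j < W ^ d" "\<forall>i<d. j div W ^ i mod W = \<delta> i" by auto
  have \<delta>: "\<delta> d < W" using Suc by simp
  have "\<delta> d * W ^ d + j < (\<delta> d + 1) * W ^ d" using j by simp
  also have "\<dots> \<le> W * W ^ d" using \<delta> by (intro mult_le_mono1) simp
  finally have "\<delta> d * W ^ d + j < W ^ Suc d" by simp
  moreover have "(\<delta> d * W ^ d + j) div W ^ i mod W = \<delta> i" if "i < Suc d" for i
  proof (cases "i = d")
    case True
    then show ?thesis using j \<delta> by simp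
  next
    case False
    then have i: "i < d" using that by simp
    have "W ^ d = W ^ i * (W ^ (d - Suc i) * W)"
      using i by (metis Suc_diff_Suc power_Suc2 power_add le_add_diff_inverse less_imp_le)
    then have eq: "\<delta> d * W ^ d + j = j + W ^ i * (W * (\<delta> d * W ^ (d - Suc i)))" by (simp add: ac_simps)
    have "W ^ i \<noteq> 0" using \<delta> by simp
    then have "(\<delta> d * W ^ d + j) div W ^ i = j div W ^ i + W * (\<delta> d * W ^ (d - Suc i))"
      unfolding eq by (subst div_mult_self2) (simp_all add: add.commute)
    then show ?thesis using j i by simp
  qed
  ultimately show ?case by blast
qed simp

section \<open>Queries\<close>

text \<open>Only what concerns the box and \<open>f\<close>, without the table parameters, so that
  exhaustive search when the guard fails can share it.\<close>

locale ram_box = layout d for d :: nat +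
  fixes M :: machine and \<omega> :: "nat \<Rightarrow> nat" and N w \<tau> b :: nat and lo hi :: "nat \<Rightarrow> nat"
  assumes box_word_bits: "word_bits M = b" and box_fn_dim: "fn_dim M = d"
    and box_fn_less: "\<And>x i. x < N \<Longrightarrow> i < d \<Longrightarrow> fn M x i < 2 ^ w" and box_w_le: "w \<le> b"
    and box_fn_time: "\<And>x. x < N \<Longrightarrow> fn_time M x \<le> \<tau>"
    and box_b: "0 < b" "N < 2 ^ b"
begin

definition inbox :: "nat \<Rightarrow> bool" where
  "inbox x \<longleftrightarrow> (\<forall>i<d. lo i \<le> fn M x i \<and> fn M x i \<le> hi i)"

definition corners :: "state \<Rightarrow> bool" where
  "corners s \<longleftrightarrow> (\<forall>i<d. regs s (rlo i) = lo i \<and> regs s (rhi i) = hi i)"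

text \<open>\<open>a\<close> stands for the claim that some point tested so far lies in the box. The
  first conjunct is independent of it: a reported point is always valid.\<close>

definition found :: "bool \<Rightarrow> state \<Rightarrow> bool" where
  "found a s \<longleftrightarrow> (regs s rfound = 0 \<or> regs s rfound = 1 \<and> regs s rans < N \<and> inbox (regs s rans)) \<and>
     (a \<longrightarrow> regs s rfound = 1)"

lemma corners_cong: "corners s \<Longrightarrow> (\<And>r. r < vV \<Longrightarrow> regs s' r = regs s r) \<Longrightarrow> corners s'"
  by (simp add: corners_def)

lemma found_cong: "found a s \<Longrightarrow> regs s' rfound = regs s rfound \<Longrightarrow> regs s' rans = regs s rans \<Longrightarrow> found a s'"
  by (simp add: found_def)

lemma found_weaken: "found a s \<Longrightarrow> (a' \<Longrightarrow> a) \<Longrightarrow> found a' s"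
  by (auto simp: found_def)

lemma fn_mod: "x < N \<Longrightarrow> i < d \<Longrightarrow> fn M x i mod 2 ^ b = fn M x i"
proof -
  assume a: "x < N" "i < d"
  have "fn M x i < 2 ^ w" using a box_fn_less by simp
  also have "\<dots> \<le> 2 ^ b" using box_w_le by (intro power_increasing) auto
  finally show ?thesis by simp
qed

lemma inboxE_val:
  "n \<le> d \<Longrightarrow> expr_val b (regs s) (inboxE n) =
    of_bool (\<forall>i<n. regs s (rlo i) \<le> regs s (Suc vX + i) \<and> regs s (Suc vX + i) \<le> regs s (rhi i))"
proof (induction n)
  case 0
  show ?case using box_b by simp
next
  case (Suc n)
  then show ?case by (auto simp: less_Suc_eq)
qed

lemma wp_check:
  assumes q: "corners s" and x: "regs s r = x" "x < N" and r: "sc 0 \<le> r" "r < rfound" and f: "found a s"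
  shows "wp M \<omega> (check r) (\<lambda>t s'. t \<le> \<tau> + 4 \<and> found (a \<or> inbox x) s') s"
proof -
  let ?s = "s\<lparr>regs := \<lambda>j. if Suc vX \<le> j \<and> j < Suc vX + d then fn M x (j - Suc vX) mod 2 ^ b else regs s j\<rparr>"
  have e: "expr_val b (regs ?s) (inboxE d) = of_bool (inbox x)"
    unfolding inboxE_val[OF order_refl] inbox_def
    using q x fn_mod by (auto simp: corners_def)
  have "wp M \<omega> (check r) Q s \<longleftrightarrow> (if inbox x
      then Q (1 + fn_time M x + (1 + (1 + 1))) (?s\<lparr>regs := (regs ?s)(rfound := 1, rans := x)\<rparr>)
      else Q (1 + fn_time M x + (1 + 1)) ?s)" for Q
  proof -
    have "(s\<lparr>regs := (\<lambda>j. if Suc vX \<le> j \<and> j < Suc vX + fn_dim M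
        then fn M (evalx M s (Reg r)) (j - Suc vX) mod 2 ^ word_bits M else regs s j)\<rparr>) = ?s"
      using x by (simp cong: if_cong add: box_word_bits box_fn_dim)
    moreover have "1 + fn_time M (evalx M s (Reg r)) = 1 + fn_time M x" using x by simp
    ultimately show ?thesis
      unfolding check_def wp_Seq wp_Call using e r x box_b
      by (simp cong: if_cong add: box_word_bits box_fn_dim)
  qed
  then show ?thesis using f box_fn_time[OF x(2)] x by (auto simp: found_def)
qed

lemma wp_brute:
  assumes "corners s" "regs s 0 = N" "found False s"
  shows "wp M \<omega> brute (\<lambda>t s'. t \<le> 2 + N * (\<tau> + 6) \<and> found (\<exists>x<N. inbox x) s') s"
proof -
  let ?J = "\<lambda>k. found (\<exists>x<k. inbox x)"
  have "wp M \<omega> brute (\<lambda>t s'. t \<le> 2 + (N - 0) * (\<tau> + 4 + 2) \<and> ?J N s') s"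
    unfolding brute_def
  proof (rule wp_For[where J = ?J], goal_cases)
    case 7
    show ?case using found_cong[OF assms(3)] by simp
  next
    case (8 k s')
    have "corners s'"
      by (rule corners_cong[OF assms(1)]) (use 8(4) in \<open>auto simp: box_fn_dim\<close>)
    moreover have "found (\<exists>x<Suc k. inbox x) (s''\<lparr>regs := (regs s'')(rx := Suc k)\<rparr>)"
      if "found ((\<exists>x<k. inbox x) \<or> inbox k) s''" for s''
      by (rule found_cong[OF found_weaken[OF that]]) (auto simp: less_Suc_eq)
    ultimately show ?case
      by (intro wp_mono[OF wp_check[OF _ 8(3,2) _ _ 8(6)]]) auto
  qed (use assms box_b in \<open>auto simp: box_fn_dim box_word_bits intro: found_cong\<close>)
  then show ?thesis by (rule wp_mono) (simp add: add.commute)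
qed

end

locale ram_query = ram_run d M \<omega> N w \<tau> sh l p r0 r1 M1 M0 m0 m1 H Z D W
  for d M \<omega> N w \<tau> sh l p r0 r1 M1 M0 m0 m1 H Z D W +
  fixes lo hi :: "nat \<Rightarrow> nat"
begin

sublocale ram_box d M \<omega> N w \<tau> "sh + l" lo hi
proof
  show "0 < sh + l" using bound(2) by (intro notI gr0I) simp
qed (use fn_less fn_time w_le bound in auto)

definition qenv :: "state \<Rightarrow> bool" where
  "qenv s \<longleftrightarrow> env s \<and> corners s"

definition tgt :: "nat \<Rightarrow> nat list" where
  "tgt j = 0 # map (\<lambda>i. cand B (lo i) (hi i) (lev j i) (j div W ^ i mod W mod 4)) [0..<d]"

lemma qenv_cong:
  assumes "qenv s" "\<And>r. r < vV \<or> sc 1 \<le> r \<and> r \<le> sc 12 \<Longrightarrow> regs s' r = regs s r"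
  shows "qenv s'"
proof -
  have "env s'" by (rule env_cong[of s]) (use assms in \<open>auto simp: qenv_def\<close>)
  moreover have "corners s'" by (rule corners_cong[of s]) (use assms in \<open>auto simp: qenv_def\<close>)
  ultimately show ?thesis by (simp add: qenv_def)
qed

lemma wp_target:
  assumes q: "qenv s" and j: "regs s rj = j"
  shows "wp M \<omega> target (\<lambda>t s'. t \<le> 2 * d + 2 \<and> vec s' vU = tgt j) s"
proof -
  let ?f = "\<lambda>i. Cond (Op Less (choiceE i) (Const 2))
       (Assign (Suc vU + i) (Op Plus (Op ShiftR (Reg (rlo i)) (levE i)) (choiceE i)))
       (Assign (Suc vU + i) (Op Minus (Op Plus (Op ShiftR (Reg (rhi i)) (levE i)) (Const 2)) (choiceE i)))"
  let ?c = "\<lambda>i. cand B (lo i) (hi i) (lev j i) (j div W ^ i mod W mod 4)"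
  let ?I = "\<lambda>k (s' :: state). qenv s' \<and> regs s' rj = j \<and> regs s' vU = 0 \<and> (\<forall>i<k. regs s' (Suc vU + i) = ?c i)"
  have loop: "wp M \<omega> (seqs (map ?f [0..<d])) (\<lambda>t s'. t \<le> 1 + d * 2 \<and> ?I d s') s'" if "?I 0 s'" for s'
  proof (rule wp_seqs[where I = ?I, OF that])
    fix i s' assume i: "i < d" and I: "?I i s'"
    have W': "regs s' rW = W" "regs s' rj = j" using I by (auto simp: qenv_def env_def)
    have e: "expr_val (sh + l) (regs s') (levE i) = lev j i" by (rule levE_val[OF W' i])
    have c: "expr_val (sh + l) (regs s') (choiceE i) = j div W ^ i mod W mod 4"
      using bound(2) digitE_val[OF W' i] by (simp add: choiceE_def)
    have lohi: "regs s' (rlo i) = lo i" "regs s' (rhi i) = hi i" using I i by (auto simp: qenv_def corners_def)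
    have keep: "?I (Suc i) (s'\<lparr>regs := (regs s')(Suc vU + i := ?c i)\<rparr>)"
    proof -
      have "qenv (s'\<lparr>regs := (regs s')(Suc vU + i := ?c i)\<rparr>)"
        by (rule qenv_cong[of s']) (use I i in auto)
      then show ?thesis using I i by (auto simp: less_Suc_eq)
    qed
    have two: "2 mod B = 2" using bound(2) by simp
    show "wp M \<omega> (?f i) (\<lambda>t s''. t \<le> 2 \<and> ?I (Suc i) s'') s'"
    proof (cases "j div W ^ i mod W mod 4 < 2")
      case True
      then have "?c i = (lo i div 2 ^ lev j i + j div W ^ i mod W mod 4) mod B" by (simp add: cand_def)
      then show ?thesis using keep True e c lohi two by (simp add: drop_bit_eq_div)
    next
      case False
      then have "?c i = nat ((int ((hi i div 2 ^ lev j i + 2) mod B) - int (j div W ^ i mod W mod 4)) mod int B)"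
        by (simp add: cand_def)
      then show ?thesis using keep False e c lohi two by (simp add: drop_bit_eq_div)
    qed
  qed
  have "vec s' vU = tgt j" if "?I d s'" for s'
  proof (rule nth_equalityI)
    show "vec s' vU ! i = tgt j ! i" if "i < length (vec s' vU)" for i
    proof (cases i)
      case (Suc i')
      then have "regs s' (Suc vU + i') = ?c i'" using \<open>?I d s'\<close> that by simp
      then show ?thesis using Suc that by (simp add: tgt_def add.assoc)
    qed (use \<open>?I d s'\<close> in \<open>simp add: tgt_def\<close>)
  qed (simp add: tgt_def)
  moreover have "?I 0 (s\<lparr>regs := (regs s)(vU := 0)\<rparr>)"
  proof -
    have "qenv (s\<lparr>regs := (regs s)(vU := 0)\<rparr>)" by (rule qenv_cong[OF q]) auto
    then show ?thesis using j by simp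
  qed
  ultimately show ?thesis
    unfolding target_def wp_Seq wp_Assign expr_val.simps mod_0
    by (intro wp_mono[OF loop]) auto
qed

end

section \<open>Completeness of a memory image and correctness of queries\<close>

context ram_run
begin

text \<open>The chain number found in the end slot under the guess that \<open>u\<close> was entered
  in column \<open>a\<close>.\<close>

definition chain_end :: "(nat \<Rightarrow> nat) \<Rightarrow> nat \<Rightarrow> nat list \<Rightarrow> nat \<Rightarrow> nat \<Rightarrow> nat" where
  "chain_end h j u k a = h (slot1 h j k (wk h j k (Suc a) p u))"

definition chain_val :: "(nat \<Rightarrow> nat) \<Rightarrow> nat \<Rightarrow> nat \<Rightarrow> nat \<Rightarrow> nat \<Rightarrow> nat" where
  "chain_val h j k c i = hv h (cptr k i) (wk h j k 0 i (start_key c))"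

text \<open>A property of the memory image that suffices for all queries at once. It asks for some
  preimage of \<open>gk j x\<close>, not for \<open>x\<close> itself.\<close>

definition complete :: "(nat \<Rightarrow> nat) \<Rightarrow> bool" where
  "complete h \<longleftrightarrow> (\<forall>j<D. \<forall>x<N. gk j x \<in> stored h j \<or>
     (\<exists>k<r1. \<exists>a<p. \<exists>i<p. chain_val h j k (chain_end h j (gk j x) k a) i < N \<and>
        gk j (chain_val h j k (chain_end h j (gk j x) k a) i) = gk j x))"

end

context ram_query
begin

lemma qenv_env: "qenv s \<Longrightarrow> env s"
  by (simp add: qenv_def)

definition hit1 :: "(nat \<Rightarrow> nat) \<Rightarrow> nat \<Rightarrow> nat list \<Rightarrow> nat \<Rightarrow> nat \<Rightarrow> bool" where
  "hit1 h j u k a \<longleftrightarrow> (\<exists>i<p. chain_val h j k (chain_end h j u k a) i < N \<and>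
     inbox (chain_val h j k (chain_end h j u k a) i))"

definition hit :: "(nat \<Rightarrow> nat) \<Rightarrow> nat \<Rightarrow> bool" where
  "hit h j \<longleftrightarrow> (\<exists>q<r0. h (slot0 h j q (tgt j)) < N \<and> inbox (h (slot0 h j q (tgt j)))) \<or>
     (\<exists>k<r1. \<exists>a<p. hit1 h j (tgt j) k a)"

text \<open>The dyadic cells that \<open>dyadic_cand\<close> supplies for the coordinates are the
  digits of some \<open>j < D\<close>. Its target is \<open>gk j x\<close>, and all preimages of the
  target lie in the box because the cells lie in its sides.\<close>

lemma complete_hit:
  assumes "complete h" "x < N" "inbox x"
  shows "\<exists>j<D. hit h j"
proof -
  have "\<forall>i. \<exists>s e. i < d \<longrightarrow> s \<le> w \<and> e < 4 \<and> cand B (lo i) (hi i) s e = fn M x i div 2 ^ s \<and>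
      (\<forall>y'. y' div 2 ^ s = fn M x i div 2 ^ s \<longrightarrow> lo i \<le> y' \<and> y' \<le> hi i)"
  proof
    fix i
    show "\<exists>s e. i < d \<longrightarrow> s \<le> w \<and> e < 4 \<and> cand B (lo i) (hi i) s e = fn M x i div 2 ^ s \<and>
      (\<forall>y'. y' div 2 ^ s = fn M x i div 2 ^ s \<longrightarrow> lo i \<le> y' \<and> y' \<le> hi i)"
    proof (cases "i < d")
      case True
      have "(2::nat) ^ w \<le> B" using w_le by (intro power_increasing) auto
      then obtain s e where "s \<le> w" "e < 4" "cand B (lo i) (hi i) s e = fn M x i div 2 ^ s"
        "\<And>y'. y' div 2 ^ s = fn M x i div 2 ^ s \<Longrightarrow> lo i \<le> y' \<and> y' \<le> hi i"
        using dyadic_cand[of "lo i" "fn M x i" "hi i" w B] True assms fn_less by (auto simp: inbox_def)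
      then show ?thesis by blast
    qed simp
  qed
  then obtain s e where se: "\<And>i. i < d \<Longrightarrow> s i \<le> w \<and> e i < 4 \<and> cand B (lo i) (hi i) (s i) (e i) = fn M x i div 2 ^ s i \<and>
      (\<forall>y'. y' div 2 ^ s i = fn M x i div 2 ^ s i \<longrightarrow> lo i \<le> y' \<and> y' \<le> hi i)"
    by metis
  have "\<exists>j<W ^ d. \<forall>i<d. j div W ^ i mod W = 4 * s i + e i"
    by (rule digits_exist) (use se in \<open>fastforce simp: W\<close>)
  then obtain j where j: "j < D" "\<And>i. i < d \<Longrightarrow> j div W ^ i mod W = 4 * s i + e i" by (auto simp: D)
  have le: "lev j i = s i" "j div W ^ i mod W mod 4 = e i" if "i < d" for i
    using j(2)[OF that] se[OF that] by (simp_all add: lev_def)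
  have t: "tgt j = gk j x" unfolding tgt_def gk_def using le se by simp
  have box: "inbox x'" if "gk j x' = gk j x" for x'
    using that se le unfolding gk_def inbox_def by simp
  have "hit h j"
    using assms(1,2) j(1) box unfolding complete_def hit_def hit1_def t stored_def by blast
  then show ?thesis using j(1) by blast
qed

abbreviation "probeT \<equiv> (d + 2) + (2 + p * (stepT + 4)) + 1 + (2 * d + 6) + 1 + (d + 2) + (2 + p * (stepT + (\<tau> + 5) + 3))"

lemma wp_probe:
  assumes q: "qenv s" and base: "regs s rbase = H + j * Z" and j: "regs s rj = j" "j < D"
    and k: "regs s rT = k" "k < r1" and a: "regs s ri0 = a" "a < p" and u: "vec s vU = u" "length u = Suc d"
    and f: "found b s"
  shows "wp M \<omega> (Seq (copy vY vU) (Seq (walkc (Op Plus (Reg ri0) (Const 1)) Skip)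
     (Seq (Assign rptr (ptrE (Reg rp))) (Seq (hash vY) (Seq (Load rc slot1E)
     (Seq startc (walkc (Const 0) (Cond (Op Less (Reg rx) (Reg 0)) (check rx) Skip))))))))
    (\<lambda>t s'. t \<le> probeT \<and> found (b \<or> hit1 (mem s) j u k a) s') s"
proof -
  let ?h = "mem s"
  let ?q = "cptr k p"
  have qH: "?q + (d + 2) \<le> H" by (rule ptr_bound(3)) (use k in auto)
  have "p \<le> r1 * p" using k by simp
  then have pB: "p < B" using r0_bound(4) H_less by linarith
  show ?thesis
    unfolding wp_Seq
  proof (rule wp_use[OF wp_copy], goal_cases)
    case (2 t1 s1)
    have r1: "regs s1 r = regs s r" if "r < vY \<or> vY + d < r" for r
      using unmod_regs[OF 2(2), of r] that by auto
    have m1: "mem s1 = ?h" using unmod_mem[OF 2(2)] by simp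
    have env1: "env s1" by (rule env_cong[of s]) (use r1 q in \<open>auto simp: qenv_def\<close>)
    have regs1: "regs s1 rbase = H + j * Z" "regs s1 rj = j" "regs s1 rT = k"
      using r1 base j k by auto
    have e: "evalx M s1 (Op Plus (Reg ri0) (Const 1)) = Suc a"
      using r1[of ri0] a pB by (subst expr_val_polyE) simp_all
    have walk: "wp M \<omega> (walkc (Op Plus (Reg ri0) (Const 1)) Skip) (\<lambda>t s'. t \<le> 2 + (p - Suc a) * (stepT + 1 + 3) \<and>
          vec s' vY = wk (mem s1) j k (Suc a) p u \<and> True) s1"
      by (rule wp_walkc[where J = "\<lambda>_ _. True", OF env1 regs1(1,2) j(2) regs1(3) k(2) e]) (use 2 u a in auto)
    show ?case
    proof (rule wp_use[OF walk], goal_cases)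
      case (1 t2 s2)
      have t2': "t2 \<le> 2 + p * (stepT + 4)"
      proof -
        have "(p - Suc a) * (stepT + 4) \<le> p * (stepT + 4)" by (intro mult_le_mono1) simp
        moreover have "t2 \<le> 2 + (p - Suc a) * (stepT + 4)" using 1 by (simp add: add.commute)
        ultimately show ?thesis by linarith
      qed
      have r2: "regs s2 r = regs s1 r" if "r < vV \<or> vY + d < r \<and> r < vX \<or> sc 0 \<le> r \<and> r < rq \<or> r = rT \<or> r = rfound \<or> r = rans" for r
        using unmod_regs[OF 1(2), of r] that by auto
      have m2: "mem s2 = ?h" using unmod_mem[OF 1(2)] m1 by simp
      have env2: "env s2" by (rule env_cong[OF env1]) (use r2 in auto)
      define s3 where "s3 = s2\<lparr>regs := (regs s2)(rptr := ?q)\<rparr>"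
      have "evalx M s2 (ptrE (Reg rp)) = ?q"
        by (rule cptr_val[OF env2]) (use r2 regs1 k env2 in \<open>auto simp: env_def\<close>)
      then have s3: "wp M \<omega> (Assign rptr (ptrE (Reg rp))) Q s2 \<longleftrightarrow> Q 1 s3" for Q
        unfolding wp_Assign s3_def by simp
      have env3: "env s3" by (rule env_cong[OF env2]) (auto simp: s3_def)
      have "vec s3 vY = vec s2 vY" by (rule vec_cong) (auto simp: s3_def)
      then have Y3: "vec s3 vY = wk ?h j k (Suc a) p u" using 1 m1 by simp
      have hs: "wp M \<omega> (hash vY) (\<lambda>t s'. t \<le> 2 * d + 6 \<and> regs s' racc = hv (mem s3) ?q (wk ?h j k (Suc a) p u)) s3"
        by (rule wp_hash[OF env3 _ qH Y3]) (auto simp: s3_def)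
      note t1 = 2(1) and 1 = 1
      show ?case
        unfolding s3
      proof (rule wp_use[OF hs], goal_cases)
        case (1 t4 s4)
        have r4: "regs s4 r = regs s2 r" if "r \<notin> {rptr, racc, rtmp}" for r
          using unmod_regs[OF 1(2), of r] that by (simp add: s3_def)
        have m4: "mem s4 = ?h" using unmod_mem[OF 1(2)] m2 by (simp add: s3_def)
        let ?a = "slot1 ?h j k (wk ?h j k (Suc a) p u)"
        have "?a < B" using slot1_less[OF j(2) k(2), of "hv ?h ?q (wk ?h j k (Suc a) p u) mod m1"] m_pos bound(1)
          by (simp add: slot1_def)
        then have addr: "evalx M s4 slot1E = ?a"
          unfolding slot1E_def
          using 1(1) r4[of rbase] r4[of rT] r4[of rm0] r4[of rm1] r4[of rR0] r2 regs1 env2 m2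
          by (subst expr_val_polyE) (simp_all add: env_def slot1_def s3_def)
        define c where "c = chain_end ?h j u k a"
        define s5 where "s5 = s4\<lparr>regs := (regs s4)(rc := c)\<rparr>"
        have s5: "wp M \<omega> (Load rc slot1E) Q s4 \<longleftrightarrow> Q 1 s5" for Q
          unfolding wp_Load addr s5_def c_def chain_end_def m4 ..
        have rc5: "regs s5 rc = c" by (simp add: s5_def)
        note t4 = 1(1)
        show ?case
          unfolding s5
        proof (rule wp_use[OF wp_startc[OF rc5]], goal_cases)
          case (1 t6 s6)
          have r6: "regs s6 r = regs s r" if "r < vV \<or> sc 0 \<le> r \<and> r < rq \<or> r = rT \<or> r = rfound \<or> r = rans" for r
          proof -
            have "regs s6 r = regs s5 r" using unmod_regs[OF 1(2), of r] that by auto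
            also have "\<dots> = regs s2 r" using r4[of r] that by (auto simp: s5_def)
            also have "\<dots> = regs s r" using r2[of r] r1[of r] that by auto
            finally show ?thesis .
          qed
          have m6: "mem s6 = ?h" using unmod_mem[OF 1(2)] m4 by (simp add: s5_def)
          have q6: "qenv s6" by (rule qenv_cong[OF q]) (use r6 in auto)
          have regs6: "regs s6 rbase = H + j * Z" "regs s6 rj = j" "regs s6 rT = k"
            using r6 base j k by auto
          let ?P = "\<lambda>i. chain_val ?h j k c i < N \<and> inbox (chain_val ?h j k c i)"
          let ?J = "\<lambda>i. found (b \<or> (\<exists>i'<i. ?P i'))"
          have last: "wp M \<omega> (walkc (Const 0) (Cond (Op Less (Reg rx) (Reg 0)) (check rx) Skip))
             (\<lambda>t s'. t \<le> 2 + (p - 0) * (stepT + (\<tau> + 5) + 3) \<and> vec s' vY = wk (mem s6) j k 0 p (start_key c) \<and> ?J p s') s6"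
          proof (rule wp_walkc[where J = ?J, OF _ regs6(1,2) j(2) regs6(3) k(2)], goal_cases)
            case 1 show ?case using q6 by (simp add: qenv_def)
          next
            case 7 show ?case using found_cong[OF f] r6 by simp
          next
            case (8 i s' s'') then show ?case by (rule found_cong)
          next
            case (9 i s')
            have x: "regs s' rx = chain_val ?h j k c i" using 9(6) m6 by (simp add: chain_val_def)
            have N0: "regs s' 0 = N" using 9(3) by (simp add: env_def)
            have co: "corners s'" by (rule corners_cong[of s6]) (use 9(4) q6 in \<open>auto simp: qenv_def\<close>)
            show ?case
            proof (cases "chain_val ?h j k c i < N")
              case True
              have "found (b \<or> (\<exists>i'<Suc i. ?P i')) s''"
                if "found ((b \<or> (\<exists>i'<i. ?P i')) \<or> inbox (chain_val ?h j k c i)) s''" for s''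
                by (rule found_weaken[OF that]) (auto simp: less_Suc_eq)
              then have "wp M \<omega> (check rx) (\<lambda>t s''. t \<le> \<tau> + 4 \<and> ?J (Suc i) s'') s'"
                by (intro wp_mono[OF wp_check[OF co x True _ _ 9(5)]]) auto
              then show ?thesis using x N0 True by (auto elim!: wp_mono)
            next
              case False
              then have "?J (Suc i) s'" by (intro found_weaken[OF 9(5)]) (auto simp: less_Suc_eq)
              then show ?thesis using x N0 False by simp
            qed
          qed (use 1(1) in auto)
          show ?case
          proof (rule wp_mono[OF last], goal_cases)
            case (1 t7 s7)
            have "?J p s7 = found (b \<or> hit1 ?h j u k a) s7" by (simp add: hit1_def c_def)
            moreover have "t7 \<le> 2 + p * (stepT + (\<tau> + 5) + 3)" using 1 by simp
            ultimately show ?case using 1 t1 t2' t4 \<open>t6 \<le> d + 2 \<and> _\<close> by linarith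
          qed
        qed
      qed
    qed
  qed simp
qed

abbreviation "query1T \<equiv> 2 + r1 * (2 + p * (probeT + 2) + 2)"

lemma wp_query1:
  assumes q: "qenv s" and base: "regs s rbase = H + j * Z" and j: "regs s rj = j" "j < D"
    and u: "vec s vU = u" and f: "found b s"
  shows "wp M \<omega> query1 (\<lambda>t s'. t \<le> query1T \<and> found (b \<or> (\<exists>k<r1. \<exists>a<p. hit1 (mem s) j u k a)) s') s"
proof -
  let ?hit = "hit1 (mem s) j u"
  let ?J = "\<lambda>k. found (b \<or> (\<exists>k'<k. \<exists>a<p. ?hit k' a))"
  let ?probe = "Seq (copy vY vU) (Seq (walkc (Op Plus (Reg ri0) (Const 1)) Skip)
     (Seq (Assign rptr (ptrE (Reg rp))) (Seq (hash vY) (Seq (Load rc slot1E)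
     (Seq startc (walkc (Const 0) (Cond (Op Less (Reg rx) (Reg 0)) (check rx) Skip)))))))"
  have m: "r \<notin> mods (fn_dim M) ?probe" if "r < vV \<or> vU \<le> r \<and> r < vX \<or> sc 0 \<le> r \<and> r < rq \<or> r = rT \<or> r = ri0" for r
    using that by auto
  have "wp M \<omega> query1 (\<lambda>t s'. t \<le> 2 + (r1 - 0) * ((2 + p * (probeT + 2)) + 2) \<and> ?J r1 s') s"
    unfolding query1_def
  proof (rule wp_For[where J = ?J], goal_cases)
    case 7
    show ?case using found_cong[OF f] by simp
  next
    case (8 k s')
    have same: "regs s' r = regs s r" if "r < vV \<or> vU \<le> r \<and> r < vX \<or> sc 0 \<le> r \<and> r < rq" for r
      using 8(4)[of r] m[of r] that by auto
    have q': "qenv s'" by (rule qenv_cong[OF q]) (use same in auto)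
    let ?b = "b \<or> (\<exists>k'<k. \<exists>a<p. ?hit k' a)"
    let ?J' = "\<lambda>i. found (?b \<or> (\<exists>a<i. ?hit k a))"
    have "p \<le> r1 * p" using 8(2) by simp
    then have pB: "p < B" using r0_bound(4) H_less by linarith
    have mem': "mem s' = mem s" using 8(5) by simp
    have "wp M \<omega> (For ri0 (Const 0) (Reg rp) ?probe) (\<lambda>t s''. t \<le> 2 + (p - 0) * (probeT + 2) \<and> ?J' p s'') s'"
    proof (rule wp_For[where J = ?J'], goal_cases)
      case 7
      show ?case using found_cong[OF 8(6)] by simp
    next
      case (8 i s1)
      have same1: "regs s1 r = regs s' r" if "r < vV \<or> vU \<le> r \<and> r < vX \<or> sc 0 \<le> r \<and> r < rq \<or> r = rT" for r
        using 8(4)[of r] m[of r] that by auto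
      have q1: "qenv s1" by (rule qenv_cong[OF q']) (use same1 in auto)
      have u1: "vec s1 vU = u" unfolding u[symmetric] by (rule vec_cong) (use same same1 in auto)
      have mem1: "mem s1 = mem s" using 8(5) mem' by simp
      have regs1: "regs s1 rbase = H + j * Z" "regs s1 rj = j" "regs s1 rT = k"
        using same1 same base j \<open>regs s' rT = k\<close> by auto
      have len: "length u = Suc d" using u length_vec by metis
      have "?J' (Suc i) (s''\<lparr>regs := (regs s'')(ri0 := Suc i)\<rparr>)"
        if "found ((?b \<or> (\<exists>a<i. ?hit k a)) \<or> ?hit k i) s''" for s''
        by (rule found_cong[OF found_weaken[OF that]]) (auto simp: less_Suc_eq)
      then show ?case
        using wp_probe[OF q1 regs1(1,2) j(2) regs1(3) \<open>k < r1\<close> 8(3,2) u1 len 8(6)]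
        unfolding mem1 by (elim wp_mono) blast
    qed (use q' pB in \<open>auto simp: qenv_def env_def\<close>)
    moreover have "?J (Suc k) (s''\<lparr>regs := (regs s'')(rT := Suc k)\<rparr>)" if "?J' p s''" for s''
      by (rule found_cong[OF found_weaken[OF that]]) (auto simp: less_Suc_eq)
    ultimately show ?case by (elim wp_mono) simp
  qed (use q r0_bound(3) H_less in \<open>auto simp: qenv_def env_def\<close>)
  then show ?thesis by (rule wp_mono) simp
qed

abbreviation "queryT \<equiv> 2 + D * ((1 + (2 * d + 2) + (2 + r0 * (2 * d + (\<tau> + 4) + 11)) + query1T) + 2)"

lemma wp_query:
  assumes q: "qenv s" and f: "found False s"
  shows "wp M \<omega> query (\<lambda>t s'. t \<le> queryT \<and> found (\<exists>j<D. hit (mem s) j) s') s"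
proof -
  let ?J = "\<lambda>k. found (\<exists>j<k. hit (mem s) j)"
  let ?bd = "Seq (Assign rbase (Op Plus (Reg rH) (Op Times (Reg rj) (Reg rZ))))
     (Seq target (Seq (lookup0 vU (check rx2)) query1))"
  have mq: "r \<notin> mods d query1" "r \<notin> mods d ?bd" if "r < vV \<or> sc 0 \<le> r \<and> r < rbase" for r
    using that by (auto simp: query1_def)
  have DB: "D < B" using bound(3) by simp
  have "wp M \<omega> query (\<lambda>t s'. t \<le> 2 + (D - 0) * ((1 + (2 * d + 2) + (2 + r0 * (2 * d + (\<tau> + 4) + 11)) + query1T) + 2) \<and> ?J D s') s"
    unfolding query_def
  proof (rule wp_For[where J = ?J], goal_cases)
    case 1 show ?case using mq(2)[of rD] by auto
  next
    case 2 show ?case using mq(2)[of rj] by simp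
  next
    case 7
    show ?case using found_cong[OF f] by simp
  next
    case (8 j s')
    have same: "regs s' r = regs s r" if "r < vV \<or> sc 0 \<le> r \<and> r < rj" for r
      using 8(4)[of r] mq(2)[of r] that by auto
    have q': "qenv s'" by (rule qenv_cong[OF q]) (use same in auto)
    have mem': "mem s' = mem s" using 8(5) by (simp add: query1_def)
    define s1 where "s1 = s'\<lparr>regs := (regs s')(rbase := H + j * Z)\<rparr>"
    have "j * Z \<le> D * Z" using 8(2) by (intro mult_le_mono1) simp
    then have "H + j * Z < B" using bound(1) by linarith
    then have "evalx M s' (Op Plus (Reg rH) (Op Times (Reg rj) (Reg rZ))) = H + j * Z"
      using q' 8(3) by (subst expr_val_polyE) (simp_all add: qenv_def env_def)
    then have s1: "wp M \<omega> (Assign rbase (Op Plus (Reg rH) (Op Times (Reg rj) (Reg rZ)))) Q s' \<longleftrightarrow> Q 1 s1" for Q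
      unfolding wp_Assign s1_def by simp
    have q1: "qenv s1" by (rule qenv_cong[OF q']) (auto simp: s1_def)
    have j1: "regs s1 rj = j" using 8(3) by (simp add: s1_def)
    let ?b = "\<exists>j'<j. hit (mem s) j'"
    have f1: "found ?b s1" by (rule found_cong[OF 8(6)]) (simp_all add: s1_def)
    note j = \<open>j < D\<close>
    show ?case
      unfolding wp_Seq s1
    proof (rule wp_use[OF wp_target[OF q1 j1]], goal_cases)
      case (1 t2 s2)
      note t2 = 1(1)
      have r2: "regs s2 r = regs s1 r" if "r < vU \<or> vU + d < r" for r
        using unmod_regs[OF 1(2), of r] that by auto
      have m2: "mem s2 = mem s" using unmod_mem[OF 1(2)] mem' by (simp add: s1_def)
      have q2: "qenv s2" by (rule qenv_cong[OF q1]) (use r2 in auto)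
      have regs2: "regs s2 rbase = H + j * Z" "regs s2 rj = j" using r2 j1 by (auto simp: s1_def)
      have f2: "found ?b s2" by (rule found_cong[OF f1]) (use r2 in auto)
      let ?x = "\<lambda>q. mem s (slot0 (mem s) j q (tgt j))"
      let ?J0 = "\<lambda>k. found (?b \<or> (\<exists>q<k. ?x q < N \<and> inbox (?x q)))"
      have "wp M \<omega> (lookup0 vU (check rx2)) (\<lambda>t s'. t \<le> 2 + r0 * (2 * d + (\<tau> + 4) + 11) \<and> ?J0 r0 s') s2"
      proof (rule wp_lookup0[where J = ?J0 and y = "tgt j", OF qenv_env[OF q2] regs2(1) j], goal_cases)
        case 6 show ?case using f2 by simp
      next
        case (7 k s3 s4) then show ?case by (intro found_cong[OF 7(1)]) auto
      next
        case (8 k s3)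
        have x: "regs s3 rx2 = ?x k" "?x k < N" using 8(6,7) m2 by auto
        have co: "corners s3" by (rule corners_cong[of s2]) (use 8(3) q2 in \<open>auto simp: qenv_def\<close>)
        have "?J0 (Suc k) s''" if "found ((?b \<or> (\<exists>q<k. ?x q < N \<and> inbox (?x q))) \<or> inbox (?x k)) s''" for s''
          by (rule found_weaken[OF that]) (auto simp: less_Suc_eq)
        then show ?case by (intro wp_mono[OF wp_check[OF co x _ _ 8(5)]]) auto
      next
        case (9 k s3)
        then show ?case by (intro found_weaken[OF 9(2)]) (auto simp: less_Suc_eq m2)
      qed (use t2 in auto)
      then show ?case
      proof (rule wp_use, goal_cases)
        case (1 t3 s3)
        note t3 = 1(1)
        have r3: "regs s3 r = regs s2 r" if "r < vX \<or> sc 0 \<le> r \<and> r < rq" for r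
          using unmod_regs[OF 1(2), of r] that by auto
        have m3: "mem s3 = mem s" using unmod_mem[OF 1(2)] m2 by simp
        have q3: "qenv s3" by (rule qenv_cong[OF q2]) (use r3 in auto)
        have regs3: "regs s3 rbase = H + j * Z" "regs s3 rj = j" using r3 regs2 by auto
        have u3: "vec s3 vU = tgt j" using t2 vec_cong[of s3 vU s2] r3 by simp
        have fin: "found (\<exists>j'<Suc j. hit (mem s) j') (s''\<lparr>regs := (regs s'')(rj := Suc j)\<rparr>)"
          if "found ((?b \<or> (\<exists>q<r0. ?x q < N \<and> inbox (?x q))) \<or> (\<exists>k<r1. \<exists>a<p. hit1 (mem s3) j (tgt j) k a)) s''" for s''
          by (rule found_cong[OF found_weaken[OF that]]) (auto simp: less_Suc_eq hit_def m3)
        show ?case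
        proof (rule wp_mono[OF wp_query1[OF q3 regs3 j u3 conjunct2[OF t3]]], goal_cases)
          case (1 t4 s4)
          then show ?case using fin[of s4] t2 t3 by linarith
        qed
      qed
    qed
  qed (use q DB in \<open>auto simp: qenv_def env_def\<close>)
  then show ?thesis by (rule wp_mono) simp
qed

end

section \<open>Construction and query programs\<close>

lemma wp_count:
  assumes "regs s r = 0" and "n < 2 ^ word_bits M"
    and "\<And>k. k < n \<Longrightarrow> evalx M (s\<lparr>regs := (regs s)(r := k)\<rparr>) e \<noteq> 0"
    and "evalx M (s\<lparr>regs := (regs s)(r := n)\<rparr>) e = 0"
  shows "wp M \<omega> (Loop e (Assign r (Op Plus (Reg r) (Const 1))))
    (\<lambda>t s'. t = 1 + 2 * n \<and> s' = s\<lparr>regs := (regs s)(r := n)\<rparr>) s"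
proof -
  let ?c = "Assign r (Op Plus (Reg r) (Const 1))"
  let ?s = "\<lambda>k. s\<lparr>regs := (regs s)(r := k)\<rparr>"
  have "exec M \<omega> (Loop e ?c) (?s k) (1 + 2 * (n - k)) (?s n)" if "k \<le> n" for k
    using that
  proof (induction "n - k" arbitrary: k)
    case 0
    then have "k = n" by simp
    then show ?case using exec.LoopF[OF assms(4), of \<omega> ?c] by (simp only: diff_self_eq_0 mult_0_right add_0_right)
  next
    case (Suc m)
    then have k: "k < n" by simp
    have "word_bits M \<noteq> 0" using k assms(2) by (intro notI) simp
    then have "evalx M (?s k) (Op Plus (Reg r) (Const 1)) = Suc k"
      using k assms(2) by (subst expr_val_polyE) simp_all
    then have 1: "exec M \<omega> ?c (?s k) 1 (?s (Suc k))"
      using exec.Assign[of M \<omega> r "Op Plus (Reg r) (Const 1)" "?s k"] by simp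
    have 2: "exec M \<omega> (Loop e ?c) (?s (Suc k)) (1 + 2 * (n - Suc k)) (?s n)"
      using Suc.hyps(1)[of "Suc k"] Suc.hyps(2) k by simp
    have "1 + 1 + (1 + 2 * (n - Suc k)) = 1 + 2 * (n - k)" using k by simp
    then show ?case using exec.LoopT[OF assms(3)[OF k] 1 2] by simp
  qed
  from this[of 0] have "exec M \<omega> (Loop e ?c) (?s 0) (1 + 2 * n) (?s n)" by simp
  moreover have "?s 0 = s" using assms(1) by (simp add: fun_upd_idem)
  ultimately show ?thesis unfolding wp_def by auto
qed

locale box_programs = layout d for d :: nat +
  fixes e K :: nat
begin

text \<open>
  The guard fails for finitely many \<open>N\<close> only.  For these the data structure is empty and queries
  evaluate \<open>f\<close> everywhere.
\<close>

definition G :: nat where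
  "G = 1024 * e + d + 16"

text \<open>\<open>rp\<close> is the least integer whose cube reaches the third input, found by
  linear search in \<open>O(p)\<close> steps. This fits the query time, as every query recomputes
  these numbers.\<close>

definition initc :: com where
  "initc = Seq (Assign rlen (Const 0))
    (Seq (Loop (Op ShiftR (Reg 0) (Reg rlen)) (Assign rlen (Op Plus (Reg rlen) (Const 1))))
    (Seq (Assign rsh (Op Plus (Reg 1) (Op Times (Const (K - 1)) (Reg rlen))))
    (Seq (Assign rp (Const 0))
    (Seq (Loop (Op Less (Op Times (Op Times (Reg rp) (Reg rp)) (Reg rp)) (Reg 2)) (Assign rp (Op Plus (Reg rp) (Const 1))))
      (Assign rW (Op Times (Const 4) (Op Plus (Reg 1) (Const 1))))))))"

abbreviation "pp64E \<equiv> Op Times (Const 64) (Op Times (Reg rp) (Reg rp))"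

text \<open>Iterated division decides \<open>W ^ d \<le> N\<close> without computing the power,
  which may exceed a word.\<close>

fun divE :: "nat \<Rightarrow> expr" where
  "divE 0 = Reg 0"
| "divE (Suc i) = Op Divide (divE i) (Reg rW)"

definition guardE :: expr where
  "guardE = Op BitAnd (Op BitAnd (Op Equal (Op Less (Reg 0) (Const G)) (Const 0))
     (Op Equal (Op Less (Reg 0) pp64E) (Const 0))) (Op Less (Const 0) (divE d))"

text \<open>\<open>M0 = 4 * p * M1\<close> matches the merge bound
  \<open>M1 * (p * (4 * k / n))\<close>, so that a threshold \<open>k\<close> of order
  \<open>n / (8 * M0)\<close> makes it a small constant. The slot counts \<open>4 * M0\<close> and
  \<open>8 * M1\<close> bound collisions by \<open>1 / 2\<close> and \<open>1 / 4\<close>. The table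
  counts contain 32 and \<open>1024 * p\<close>, the inverses of the success bounds of one table,
  times \<open>e * rlen\<close> for failure \<open>N powr (- e)\<close>.\<close>

definition paramsc :: com where
  "paramsc = Seq (Assign rR0 (Op Times (Const (32 * e)) (Reg rlen)))
    (Seq (Assign rR1 (Op Times (Op Times (Const (1024 * e)) (Reg rp)) (Reg rlen)))
    (Seq (Assign rM1 (Op Divide (Reg 0) pp64E))
    (Seq (Assign rM0 (Op Times (Op Times (Const 4) (Reg rp)) (Reg rM1)))
    (Seq (Assign rm0 (Op Times (Const 4) (Reg rM0)))
    (Seq (Assign rm1 (Op Times (Const 8) (Reg rM1)))
    (Seq (Assign rH (Op Times (Op Plus (Op Times (Const 2) (Reg rR0))
       (Op Times (Reg rR1) (Op Plus (Reg rp) (Const 1)))) (Const (d + 2))))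
    (Seq (Assign rZ (Op Plus (Op Times (Reg rR0) (Reg rm0)) (Op Times (Reg rR1) (Reg rm1))))
      (Assign rD (powE d)))))))))"

definition construct :: com where
  "construct = Seq initc (Cond guardE
     (Seq paramsc (Seq rands (Seq build (Assign 0 (Op Plus (Reg rH) (Op Times (Reg rD) (Reg rZ)))))))
     (Assign 0 (Const 0)))"

definition answer :: com where
  "answer = Seq initc (Seq (Assign rfound (Const 0))
     (Seq (Cond guardE (Seq paramsc query) brute)
     (Seq (Assign 0 (Reg rfound)) (Assign 1 (Reg rans)))))"

end

section \<open>Parameters for a given \<open>N\<close>, and absence of overflow\<close>

locale box_instance = box_programs d e K for d e K :: nat +
  fixes N w \<tau> A :: nat and f :: "nat \<Rightarrow> nat \<Rightarrow> nat" and tm :: "nat \<Rightarrow> nat"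
  assumes N0: "0 < N" and K: "G + 8 \<le> K" and A: "1 \<le> A" "A \<le> N"
    and f: "\<And>x i. x < N \<Longrightarrow> i < d \<Longrightarrow> f x i < 2 ^ w" and tm: "\<And>x. x < N \<Longrightarrow> tm x \<le> \<tau>"
begin

definition "len = floorlog 2 N"
definition "sh = w + (K - 1) * len"
definition "p = (LEAST p. A \<le> p ^ 3)"
definition "W = 4 * (w + 1)"
definition "D = W ^ d"
definition "r0 = 32 * e * len"
definition "r1 = 1024 * e * p * len"
definition "M1 = N div (64 * (p * p))"
definition "M0 = 4 * p * M1"
definition "m0 = 4 * M0"
definition "m1 = 8 * M1"
definition "H = (2 * r0 + r1 * (p + 1)) * (d + 2)"
definition "Z = r0 * m0 + r1 * m1"
definition "guard \<longleftrightarrow> G \<le> N \<and> 64 * (p * p) \<le> N \<and> D \<le> N"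
definition "M = ram K N w d f tm"

lemma len_bounds: "N < 2 ^ len" "2 ^ (len - 1) \<le> N" "1 \<le> len" "len \<le> N"
proof -
  show a: "N < 2 ^ len" "2 ^ (len - 1) \<le> N"
    using floorlog_bounds[of N 2] N0 by (auto simp: len_def)
  show "1 \<le> len" using a(1) N0 by (cases len) auto
  have "len - 1 < 2 ^ (len - 1)" by (rule less_exp)
  then show "len \<le> N" using a(2) by linarith
qed

lemma sh_len: "sh + len = w + K * len"
proof -
  have "(k - 1) * len + len = k * len" if "0 < k" for k using that by (cases k) auto
  from this[of K] show ?thesis using K by (simp add: sh_def)
qed

lemma word_bits_M: "word_bits M = sh + len"
  using sh_len by (simp add: M_def ram_def len_def)

lemma pow_len_le: "2 ^ (k * len) \<le> (2::nat) ^ (sh + len)" if "k \<le> K"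
  unfolding sh_len using that by (intro power_increasing) (auto intro: trans_le_add2)

lemma N_pow_less: "1 \<le> k \<Longrightarrow> k \<le> K \<Longrightarrow> N ^ k < 2 ^ (sh + len)"
proof -
  assume k: "1 \<le> k" "k \<le> K"
  have "N ^ k < (2 ^ len) ^ k" using len_bounds(1) k by (intro power_strict_mono) auto
  also have "\<dots> \<le> 2 ^ (sh + len)" using pow_len_le[OF k(2)] by (simp add: power_mult[symmetric] mult.commute)
  finally show ?thesis .
qed

text \<open>Program constants grow with \<open>e\<close> and \<open>d\<close>, but so does
  \<open>K\<close>, and \<open>K < 2 ^ K\<close> is below the word size.\<close>

lemma consts_less: "c \<le> G + 8 \<Longrightarrow> c < 2 ^ (sh + len)"
proof -
  assume c: "c \<le> G + 8"
  have "K < 2 ^ K" by (rule less_exp)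
  also have "\<dots> \<le> (2::nat) ^ (K * len)" using len_bounds(3) by (intro power_increasing) auto
  also have "\<dots> \<le> 2 ^ (sh + len)" by (rule pow_len_le) simp
  finally show ?thesis using c K by linarith
qed

lemma p_props: "A \<le> p ^ 3" "p \<le> A" "k < p \<Longrightarrow> k ^ 3 < A" "1 \<le> p" "p \<le> N"
proof -
  have "A \<le> A ^ 3" using A by (intro self_le_power) auto
  then show "A \<le> p ^ 3" "p \<le> A"
    unfolding p_def by (rule LeastI, rule Least_le)
  then show "1 \<le> p" "p \<le> N" using A by (cases p; simp)+
  show "k < p \<Longrightarrow> k ^ 3 < A" unfolding p_def using not_less_Least by fastforce
qed

lemma W_less: "W < 2 ^ (sh + len)" "sh < 2 ^ (sh + len)" "w < 2 ^ (sh + len)"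
proof -
  have "w + 1 \<le> 2 ^ w" using less_exp[of w] by (simp add: Suc_leI)
  then have "W \<le> 2 ^ (w + 2)" by (simp add: W_def power_add)
  also have "\<dots> < 2 ^ (sh + len)"
  proof -
    have "8 * 1 \<le> K * len" using K len_bounds(3) by (intro mult_le_mono) auto
    then have "w + 2 < w + K * len" by linarith
    then show ?thesis unfolding sh_len by (rule power_strict_increasing) simp
  qed
  finally show "W < 2 ^ (sh + len)" .
  then show "w < 2 ^ (sh + len)" by (simp add: W_def)
  have "sh < 2 ^ sh" by (rule less_exp)
  also have "(2::nat) ^ sh \<le> 2 ^ (sh + len)" by (intro power_increasing) auto
  finally show "sh < 2 ^ (sh + len)" .
qed

text \<open>Everything is bounded by a power of \<open>N\<close>: the guard puts the constants,
  \<open>64 * (p * p)\<close> and \<open>D\<close> below or at \<open>N\<close>, and the total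
  extent is at most \<open>6 * N ^ 5 \<le> N ^ 6\<close>, which a word holds.\<close>

lemma guard_bounds:
  assumes guard
  shows "H + D * Z < 2 ^ (sh + len)" "4 * D < 2 ^ (sh + len)" "M0 < 2 ^ (sh + len)" "M1 < 2 ^ (sh + len)"
    "r0 < 2 ^ (sh + len)" "r1 < 2 ^ (sh + len)" "m0 \<le> N" "m1 \<le> N" "1 \<le> M1"
proof -
  have N: "G \<le> N" "64 * (p * p) \<le> N" "D \<le> N" using assms by (auto simp: guard_def)
  have N16: "1024 * e \<le> N" "d + 2 \<le> N" "16 \<le> N" using N(1) by (auto simp: G_def)
  show "1 \<le> M1" using N(2) p_props(4) div_le_mono[of "64 * (p * p)" N "64 * (p * p)"] by (simp add: M1_def)
  have M1: "64 * (p * p) * M1 \<le> N" unfolding M1_def by simp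
  have "16 * p * M1 \<le> 64 * (p * p) * M1" using p_props(4) by (intro mult_le_mono) auto
  moreover have "m0 = 16 * p * M1" by (simp add: m0_def M0_def)
  ultimately show m0: "m0 \<le> N" using M1 by linarith
  have "8 * M1 \<le> 64 * (p * p) * M1" using p_props(4) by (intro mult_le_mono) auto
  then show m1: "m1 \<le> N" unfolding m1_def using M1 by linarith
  have N1: "N < 2 ^ (sh + len)" using N_pow_less[of 1] K by simp
  show "M0 < 2 ^ (sh + len)" "M1 < 2 ^ (sh + len)" using m0 m1 N1 by (auto simp: m0_def m1_def)
  have "4 * D \<le> N * N" using N(3) N16 by (intro mult_le_mono) auto
  then show "4 * D < 2 ^ (sh + len)" using N_pow_less[of 2] K by (simp add: power2_eq_square)
  have "32 * e * len \<le> N * N" using N16(1) len_bounds by (intro mult_le_mono) auto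
  then have r0: "r0 \<le> N ^ 2" by (simp add: r0_def power2_eq_square)
  then show "r0 < 2 ^ (sh + len)" using N_pow_less[of 2] K by simp
  have "1024 * e * p * len \<le> N * N * N" using N16(1) p_props(5) len_bounds(4) by (intro mult_le_mono) auto
  then have r1: "r1 \<le> N ^ 3" by (simp add: r1_def power3_eq_cube)
  then show "r1 < 2 ^ (sh + len)" using N_pow_less[of 3] K by simp
  have "H \<le> (2 * N ^ 2 + N ^ 3 * (2 * N)) * N"
    unfolding H_def using r0 r1 p_props(5) N0 N16(2)
    by (intro mult_le_mono add_le_mono) auto
  also have "\<dots> \<le> (2 * N ^ 4 + 2 * N ^ 4) * N"
  proof -
    have "N ^ 2 \<le> N ^ 4" using N0 by (intro power_increasing) auto
    moreover have "N ^ 3 * (2 * N) = 2 * N ^ 4" by (simp add: eval_nat_numeral algebra_simps)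
    ultimately show ?thesis by (intro mult_le_mono1) simp
  qed
  also have "\<dots> = 4 * N ^ 5" by (simp add: eval_nat_numeral algebra_simps)
  finally have H: "H \<le> 4 * N ^ 5" .
  have "Z \<le> N ^ 2 * N + N ^ 3 * N"
    unfolding Z_def using r0 r1 m0 m1 by (intro add_le_mono mult_le_mono) auto
  also have "\<dots> \<le> N ^ 4 + N ^ 4"
  proof -
    have "N ^ 3 \<le> N ^ 4" using N0 by (intro power_increasing) auto
    then show ?thesis by (simp add: eval_nat_numeral)
  qed
  finally have Z: "Z \<le> 2 * N ^ 4" by simp
  have "D * Z \<le> N * (2 * N ^ 4)" using N(3) Z by (intro mult_le_mono)
  moreover have "N * (2 * N ^ 4) = 2 * N ^ 5" by (simp add: eval_nat_numeral algebra_simps)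
  ultimately have "H + D * Z \<le> 6 * N ^ 5" using H by linarith
  also have "\<dots> \<le> N * N ^ 5" using N16(3) by (intro mult_le_mono1) simp
  also have "\<dots> = N ^ 6" by (simp add: eval_nat_numeral)
  also have "\<dots> < 2 ^ (sh + len)" using K by (intro N_pow_less) auto
  finally show "H + D * Z < 2 ^ (sh + len)" .
qed

lemma ram_run_guard:
  assumes guard
  shows "ram_run d M N w \<tau> sh len p r0 r1 M1 M0 m0 m1 H Z D W"
proof
  show "word_bits M = sh + len" by (rule word_bits_M)
  show "w \<le> sh" by (simp add: sh_def)
  show "0 < m0" "0 < m1" using guard_bounds(9)[OF assms] p_props(4) by (simp_all add: m0_def M0_def m1_def)
  show "d + 4 < 2 ^ (sh + len)" by (rule consts_less) (simp add: G_def)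
  show "N < 2 ^ (sh + len)" using N_pow_less[of 1] K by simp
qed (use guard_bounds[OF assms] W_less f tm N0 in \<open>auto simp: M_def ram_def H_def Z_def D_def W_def\<close>)

lemma wp_initc:
  assumes "regs s 0 = N" "regs s 1 = w" "regs s 2 = A"
  shows "wp M \<omega> initc (\<lambda>t s'. t = 2 * len + 2 * p + 6 \<and>
    s' = s\<lparr>regs := (regs s)(rlen := len, rsh := sh, rp := p, rW := W)\<rparr>) s"
proof -
  let ?b = "sh + len"
  let ?s1 = "s\<lparr>regs := (regs s)(rlen := 0)\<rparr>"
  have len: "wp M \<omega> (Loop (Op ShiftR (Reg 0) (Reg rlen)) (Assign rlen (Op Plus (Reg rlen) (Const 1))))
    (\<lambda>t s'. t = 1 + 2 * len \<and> s' = ?s1\<lparr>regs := (regs ?s1)(rlen := len)\<rparr>) ?s1"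
  proof (rule wp_count)
    show "len < 2 ^ word_bits M" unfolding word_bits_M using less_exp[of "sh + len"] by linarith
    fix k assume "k < len"
    then have "(2::nat) ^ k \<le> 2 ^ (len - 1)" by (intro power_increasing) auto
    then have "2 ^ k \<le> N" using len_bounds(2) by linarith
    then have "N div 2 ^ k \<noteq> 0" by (simp add: div_eq_0_iff)
    then show "evalx M (?s1\<lparr>regs := (regs ?s1)(rlen := k)\<rparr>) (Op ShiftR (Reg 0) (Reg rlen)) \<noteq> 0"
      using assms by (simp add: drop_bit_eq_div)
  next
    show "evalx M (?s1\<lparr>regs := (regs ?s1)(rlen := len)\<rparr>) (Op ShiftR (Reg 0) (Reg rlen)) = 0"
      using assms len_bounds(1) by (simp add: drop_bit_eq_div)
  qed simp
  let ?s2 = "s\<lparr>regs := (regs s)(rlen := len)\<rparr>"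
  have sh: "evalx M ?s2 (Op Plus (Reg 1) (Op Times (Const (K - 1)) (Reg rlen))) = sh"
    using assms W_less(2) by (subst expr_val_polyE) (simp_all add: word_bits_M sh_def)
  let ?s3 = "s\<lparr>regs := (regs s)(rlen := len, rsh := sh, rp := 0)\<rparr>"
  let ?s4 = "s\<lparr>regs := (regs s)(rlen := len, rsh := sh, rp := p)\<rparr>"
  let ?e = "Op Less (Op Times (Op Times (Reg rp) (Reg rp)) (Reg rp)) (Reg 2)"
  have p: "wp M \<omega> (Loop ?e (Assign rp (Op Plus (Reg rp) (Const 1))))
    (\<lambda>t s'. t = 1 + 2 * p \<and> s' = ?s3\<lparr>regs := (regs ?s3)(rp := p)\<rparr>) ?s3"
  proof (rule wp_count)
    have N1: "N < 2 ^ (sh + len)" using N_pow_less[of 1] K by simp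
    then show "p < 2 ^ word_bits M" using p_props(5) by (simp add: word_bits_M)
    have cube: "expr_val (sh + len) (regs (?s3\<lparr>regs := (regs ?s3)(rp := k)\<rparr>)) (Op Times (Op Times (Reg rp) (Reg rp)) (Reg rp)) = k ^ 3"
      if "k \<le> p" for k
    proof -
      have "k ^ 3 \<le> N ^ 3" using that p_props(5) by (intro power_mono) auto
      also have "\<dots> < 2 ^ (sh + len)" by (rule N_pow_less) (use K in auto)
      finally have "k ^ 3 < 2 ^ (sh + len)" .
      then show ?thesis by (subst expr_val_polyE) (simp_all add: power3_eq_cube)
    qed
    show "evalx M (?s3\<lparr>regs := (regs ?s3)(rp := k)\<rparr>) ?e \<noteq> 0" if "k < p" for k
      using cube[of k] that p_props(3)[OF that] assms by (simp add: word_bits_M)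
    show "evalx M (?s3\<lparr>regs := (regs ?s3)(rp := p)\<rparr>) ?e = 0"
      using cube[of p] p_props(1) assms by (simp add: word_bits_M)
  qed simp
  have W: "evalx M ?s4 (Op Times (Const 4) (Op Plus (Reg 1) (Const 1))) = W"
    using assms W_less(1) by (subst expr_val_polyE) (simp_all add: word_bits_M W_def)
  have p': "wp M \<omega> (Loop ?e (Assign rp (Op Plus (Reg rp) (Const 1)))) (\<lambda>t s'. t = 1 + 2 * p \<and> s' = ?s4) ?s3"
    by (rule wp_mono[OF p]) simp
  have len': "wp M \<omega> (Loop (Op ShiftR (Reg 0) (Reg rlen)) (Assign rlen (Op Plus (Reg rlen) (Const 1))))
    (\<lambda>t s'. t = 1 + 2 * len \<and> s' = ?s2) ?s1"
    by (rule wp_mono[OF len]) simp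
  have s1: "s\<lparr>regs := (regs s)(rlen := evalx M s (Const 0))\<rparr> = ?s1" by simp
  have s3: "?s2\<lparr>regs := (regs ?s2)(rsh := sh)\<rparr>\<lparr>regs := (regs (?s2\<lparr>regs := (regs ?s2)(rsh := sh)\<rparr>))
      (rp := evalx M (?s2\<lparr>regs := (regs ?s2)(rsh := sh)\<rparr>) (Const 0))\<rparr> = ?s3" by simp
  show ?thesis
    unfolding initc_def wp_Seq wp_Assign s1
  proof (rule wp_mono[OF len'], elim conjE, goal_cases)
    case (1 t1 s1)
    show ?case
      unfolding \<open>s1 = ?s2\<close> sh s3
    proof (rule wp_mono[OF p'], elim conjE, goal_cases)
      case (1 t2 s2)
      show ?case unfolding \<open>s2 = ?s4\<close> W using \<open>t1 = _\<close> \<open>t2 = _\<close> by simp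
    qed
  qed
qed

lemma guardE_val:
  assumes "regs s 0 = N" "regs s rp = p" "regs s rW = W"
  shows "evalx M s guardE = of_bool guard"
proof -
  have div: "expr_val (sh + len) (regs s) (divE n) = N div W ^ n" for n
    by (induction n) (use assms in \<open>simp_all add: div_mult2_eq[symmetric] mult.commute\<close>)
  have G: "expr_val (sh + len) (regs s) (Const G) = G"
    using consts_less[of G] by simp
  have "64 * (p * p) < 2 ^ (sh + len)"
  proof -
    have "p < 2 ^ len" using p_props(5) len_bounds(1) by linarith
    then have "p * p < 2 ^ len * 2 ^ len" by (intro mult_strict_mono) auto
    then have "64 * (p * p) < 64 * (2 ^ len * 2 ^ len)" by (rule mult_strict_left_mono) simp
    also have "\<dots> = 2 ^ 6 * (2 ^ len * 2 ^ len)" by simp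
    also have "\<dots> = 2 ^ (6 + 2 * len)" by (simp only: power_add mult_2)
    also have "\<dots> \<le> 2 ^ (8 * len)" using len_bounds(3) by (intro power_increasing) auto
    also have "\<dots> \<le> 2 ^ (sh + len)" using pow_len_le[of 8] K by simp
    finally show ?thesis .
  qed
  then have pp: "expr_val (sh + len) (regs s) pp64E = 64 * (p * p)"
    using assms by (subst expr_val_polyE) simp_all
  have "0 < W ^ d" by (simp add: W_def)
  then have "0 < N div W ^ d \<longleftrightarrow> D \<le> N" by (simp add: D_def div_greater_zero_iff)
  then show ?thesis
    using G assms(1) div[of d] pp unfolding guardE_def
    by (simp add: word_bits_M guard_def not_less of_bool_conj)
qed

end

context box_instance
begin

text \<open>This has to hold before the guard is known, as the guard evaluates the expression:
  \<open>64 * (p * p)\<close> is below \<open>2 ^ (6 + 2 * len)\<close>, and \<open>8 * len\<close>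
  bits are always available.\<close>

lemma pp64E_val:
  assumes "regs s rp = p"
  shows "evalx M s pp64E = 64 * (p * p)"
proof -
  have "p < 2 ^ len" using p_props(5) len_bounds(1) by linarith
  then have "p * p < 2 ^ len * 2 ^ len" by (intro mult_strict_mono) auto
  then have "64 * (p * p) < 64 * (2 ^ len * 2 ^ len)" by (rule mult_strict_left_mono) simp
  also have "\<dots> = 2 ^ 6 * (2 ^ len * 2 ^ len)" by simp
  also have "\<dots> = 2 ^ (6 + 2 * len)" by (simp only: power_add mult_2)
  also have "\<dots> \<le> 2 ^ (8 * len)" using len_bounds(3) by (intro power_increasing) auto
  also have "\<dots> \<le> 2 ^ (sh + len)" using pow_len_le[of 8] K by simp
  finally show ?thesis using assms by (subst expr_val_polyE) (simp_all add: word_bits_M)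
qed

lemma powE_val: "regs s rW = W \<Longrightarrow> D \<le> N \<Longrightarrow> i \<le> d \<Longrightarrow> evalx M s (powE i) = W ^ i"
proof (induction i)
  case 0
  then show ?case using len_bounds(3) by (simp add: word_bits_M)
next
  case (Suc i)
  have "W ^ Suc i \<le> W ^ d" using Suc by (intro power_increasing) (auto simp: W_def)
  also have "\<dots> < 2 ^ (sh + len)" using Suc.prems(2) N_pow_less[of 1] K by (simp add: D_def)
  finally show ?case using Suc by (simp add: word_bits_M mult.commute)
qed

end

locale box_guard = box_instance d e K N w \<tau> A f tm
  for d e K N w \<tau> A f tm +
  fixes \<omega> :: "nat \<Rightarrow> nat"
  assumes guard: guard
begin

sublocale ram_run d M \<omega> N w \<tau> sh len p r0 r1 M1 M0 m0 m1 H Z D W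
  by (rule ram_run_guard[OF guard])

lemma wp_paramsc:
  assumes "regs s 0 = N" "regs s rlen = len" "regs s rsh = sh" "regs s rp = p" "regs s rW = W"
  shows "wp M \<omega>' paramsc (\<lambda>t s'. t = 9 \<and> env s') s"
proof -
  note gb = guard_bounds[OF guard]
  have N1: "N < 2 ^ (sh + len)" using N_pow_less[of 1] K by simp
  have mB: "m0 < 2 ^ (sh + len)" "m1 < 2 ^ (sh + len)" using gb N1 by linarith+
  have HZ: "H < 2 ^ (sh + len)" "Z < 2 ^ (sh + len)"
  proof -
    show "H < 2 ^ (sh + len)" using gb(1) by linarith
    have "0 < D" by (simp add: D_def W_def)
    then have "1 * Z \<le> D * Z" by (intro mult_le_mono1) simp
    then show "Z < 2 ^ (sh + len)" using gb(1) by linarith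
  qed
  have v1: "evalx M s (Op Times (Const (32 * e)) (Reg rlen)) = r0"
    by (subst expr_val_polyE) (use gb HZ mB assms in \<open>simp_all add: r0_def\<close>)
  define s1 where "s1 = s\<lparr>regs := (regs s)(rR0 := r0)\<rparr>"
  have k1: "regs s1 0 = N" "regs s1 rlen = len" "regs s1 rsh = sh" "regs s1 rp = p" "regs s1 rW = W" "regs s1 rR0 = r0"
    using assms by (simp_all add: s1_def)
  have v2: "evalx M s1 (Op Times (Op Times (Const (1024 * e)) (Reg rp)) (Reg rlen)) = r1"
    by (subst expr_val_polyE) (use gb HZ mB k1 in \<open>simp_all add: r1_def\<close>)
  define s2 where "s2 = s1\<lparr>regs := (regs s1)(rR1 := r1)\<rparr>"
  have k2: "regs s2 0 = N" "regs s2 rlen = len" "regs s2 rsh = sh" "regs s2 rp = p" "regs s2 rW = W" "regs s2 rR0 = r0" "regs s2 rR1 = r1"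
    using k1 by (simp_all add: s2_def)
  have v3: "evalx M s2 (Op Divide (Reg 0) pp64E) = M1"
    using pp64E_val[of s2] k2 by (simp add: M1_def)
  define s3 where "s3 = s2\<lparr>regs := (regs s2)(rM1 := M1)\<rparr>"
  have k3: "regs s3 0 = N" "regs s3 rlen = len" "regs s3 rsh = sh" "regs s3 rp = p" "regs s3 rW = W" "regs s3 rR0 = r0" "regs s3 rR1 = r1" "regs s3 rM1 = M1"
    using k2 by (simp_all add: s3_def)
  have v4: "evalx M s3 (Op Times (Op Times (Const 4) (Reg rp)) (Reg rM1)) = M0"
    by (subst expr_val_polyE) (use gb HZ mB k3 in \<open>simp_all add: M0_def\<close>)
  define s4 where "s4 = s3\<lparr>regs := (regs s3)(rM0 := M0)\<rparr>"
  have k4: "regs s4 0 = N" "regs s4 rlen = len" "regs s4 rsh = sh" "regs s4 rp = p" "regs s4 rW = W" "regs s4 rR0 = r0" "regs s4 rR1 = r1" "regs s4 rM1 = M1" "regs s4 rM0 = M0"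
    using k3 by (simp_all add: s4_def)
  have v5: "evalx M s4 (Op Times (Const 4) (Reg rM0)) = m0"
    by (subst expr_val_polyE) (use gb HZ mB k4 in \<open>simp_all add: m0_def\<close>)
  define s5 where "s5 = s4\<lparr>regs := (regs s4)(rm0 := m0)\<rparr>"
  have k5: "regs s5 0 = N" "regs s5 rlen = len" "regs s5 rsh = sh" "regs s5 rp = p" "regs s5 rW = W" "regs s5 rR0 = r0" "regs s5 rR1 = r1" "regs s5 rM1 = M1" "regs s5 rM0 = M0" "regs s5 rm0 = m0"
    using k4 by (simp_all add: s5_def)
  have v6: "evalx M s5 (Op Times (Const 8) (Reg rM1)) = m1"
    by (subst expr_val_polyE) (use gb HZ mB k5 in \<open>simp_all add: m1_def\<close>)
  define s6 where "s6 = s5\<lparr>regs := (regs s5)(rm1 := m1)\<rparr>"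
  have k6: "regs s6 0 = N" "regs s6 rlen = len" "regs s6 rsh = sh" "regs s6 rp = p" "regs s6 rW = W" "regs s6 rR0 = r0" "regs s6 rR1 = r1" "regs s6 rM1 = M1" "regs s6 rM0 = M0" "regs s6 rm0 = m0" "regs s6 rm1 = m1"
    using k5 by (simp_all add: s6_def)
  have v7: "evalx M s6 (Op Times (Op Plus (Op Times (Const 2) (Reg rR0)) (Op Times (Reg rR1) (Op Plus (Reg rp) (Const 1)))) (Const (d + 2))) = H"
    by (subst expr_val_polyE) (use gb HZ mB k6 in \<open>simp_all add: H_def\<close>)
  define s7 where "s7 = s6\<lparr>regs := (regs s6)(rH := H)\<rparr>"
  have k7: "regs s7 0 = N" "regs s7 rlen = len" "regs s7 rsh = sh" "regs s7 rp = p" "regs s7 rW = W" "regs s7 rR0 = r0" "regs s7 rR1 = r1" "regs s7 rM1 = M1" "regs s7 rM0 = M0" "regs s7 rm0 = m0" "regs s7 rm1 = m1" "regs s7 rH = H"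
    using k6 by (simp_all add: s7_def)
  have v8: "evalx M s7 (Op Plus (Op Times (Reg rR0) (Reg rm0)) (Op Times (Reg rR1) (Reg rm1))) = Z"
    by (subst expr_val_polyE) (use gb HZ mB k7 in \<open>simp_all add: Z_def\<close>)
  define s8 where "s8 = s7\<lparr>regs := (regs s7)(rZ := Z)\<rparr>"
  have k8: "regs s8 0 = N" "regs s8 rlen = len" "regs s8 rsh = sh" "regs s8 rp = p" "regs s8 rW = W" "regs s8 rR0 = r0" "regs s8 rR1 = r1" "regs s8 rM1 = M1" "regs s8 rM0 = M0" "regs s8 rm0 = m0" "regs s8 rm1 = m1" "regs s8 rH = H" "regs s8 rZ = Z"
    using k7 by (simp_all add: s8_def)
  have v9: "evalx M s8 (powE d) = D"
    using powE_val[of s8 d] k8 guard by (simp add: D_def guard_def)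
  define s9 where "s9 = s8\<lparr>regs := (regs s8)(rD := D)\<rparr>"
  have k9: "regs s9 0 = N" "regs s9 rlen = len" "regs s9 rsh = sh" "regs s9 rp = p" "regs s9 rW = W" "regs s9 rR0 = r0" "regs s9 rR1 = r1" "regs s9 rM1 = M1" "regs s9 rM0 = M0" "regs s9 rm0 = m0" "regs s9 rm1 = m1" "regs s9 rH = H" "regs s9 rZ = Z" "regs s9 rD = D"
    using k8 by (simp_all add: s9_def)
  have "env s9" using k9 by (simp add: env_def)
  then show ?thesis
    unfolding paramsc_def wp_Seq wp_Assign v1 s1_def[symmetric] v2 s2_def[symmetric] v3 s3_def[symmetric]
      v4 s4_def[symmetric] v5 s5_def[symmetric] v6 s6_def[symmetric] v7 s7_def[symmetric]
      v8 s8_def[symmetric] v9 s9_def[symmetric]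
    by simp
qed

lemma mods_paramsc [simp]: "mods d' paramsc = {rR0, rR1, rM1, rM0, rm0, rm1, rH, rZ, rD}"
  by (auto simp: paramsc_def)

lemma no_store_paramsc [simp]: "no_store paramsc" "no_rand paramsc"
  by (simp_all add: paramsc_def)

abbreviation "initT \<equiv> 2 * len + 2 * p + 6"

lemma start_regs: "regs (start [N, w, A] m) 0 = N" "regs (start [N, w, A] m) 1 = w" "regs (start [N, w, A] m) 2 = A"
  "mem (start [N, w, A] m) = m" "rand_used (start [N, w, A] m) = 0"
  by (simp_all add: start_def)

lemma wp_construct:
  "wp M \<omega> construct (\<lambda>t s'. t \<le> initT + 1 + (9 + (2 + H * 4) + buildT + 1) \<and> regs s' 0 = H + D * Z \<and>
     rand_used s' = H \<and> (\<forall>a<H. mem s' a = \<omega> a mod B) \<and> (\<forall>j<D. all_built (mem s') j)) (start [N, w, A] (\<lambda>_. 0))"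
    (is "wp M \<omega> construct ?Q ?s")
proof -
  let ?s1 = "?s\<lparr>regs := (regs ?s)(rlen := len, rsh := sh, rp := p, rW := W)\<rparr>"
  have g: "evalx M ?s1 guardE = 1"
    using guardE_val[of ?s1] guard by (simp add: start_def)
  have regs1: "regs ?s1 0 = N" "regs ?s1 rlen = len" "regs ?s1 rsh = sh" "regs ?s1 rp = p" "regs ?s1 rW = W"
    by (simp_all add: start_def)
  have body: "wp M \<omega> (Seq paramsc (Seq rands (Seq build (Assign 0 (Op Plus (Reg rH) (Op Times (Reg rD) (Reg rZ)))))))
    (\<lambda>t. ?Q (initT + (1 + t))) ?s1"
    unfolding wp_Seq
  proof (rule wp_use[OF wp_paramsc[OF regs1]], goal_cases)
    case (1 t2 s2)
    have m2: "mem s2 a = 0" for a using unmod_mem[OF 1(2)] by (simp add: start_def)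
    have u2: "rand_used s2 = 0" using 1(2) by (simp add: unmodified_def start_def)
    note s2 = 1(1)
    from conjunct2[OF s2] have env2: "env s2" .
    show ?case
    proof (rule wp_use[OF wp_rands[OF env2 m2 u2]], goal_cases)
      case (1 t3 s3)
      have env3: "env s3" by (rule env_cong[OF env2], rule unmod_regs[OF 1(2)]) (auto simp: rands_def)
      note s3 = 1(1)
      show ?case
      proof (rule wp_use[OF wp_build[OF env3]], goal_cases)
        case (1 a)
        then show ?case using s3 by simp
      next
        case (2 t4 s4)
        have r4: "regs s4 r = regs s3 r" if "sc 1 \<le> r \<and> r \<le> sc 12" for r
          by (rule unmod_regs[OF 2(2)]) (use that in \<open>auto simp: mods_build\<close>)
        have "rand_used s4 = rand_used s3" using 2(2) by (simp add: unmodified_def)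
        moreover have "evalx M s4 (Op Plus (Reg rH) (Op Times (Reg rD) (Reg rZ))) = H + D * Z"
          using r4[of rH] r4[of rD] r4[of rZ] env3 bound(1)
          by (subst expr_val_polyE) (simp_all add: env_def)
        ultimately show ?case unfolding wp_Assign using 2(1) s3 s2 by simp
      qed
    qed
  qed
  show ?thesis
    unfolding construct_def wp_Seq
  proof (rule wp_mono[OF wp_initc[OF start_regs(1-3)]], elim conjE, goal_cases)
    case (1 t s')
    show ?case unfolding \<open>t = _\<close> \<open>s' = _\<close> wp_Cond g using body by simp
  qed
qed

end

context box_instance
begin

lemma wp_construct_small:
  assumes "\<not> guard"
  shows "wp M \<omega> construct (\<lambda>t s'. t \<le> 2 * len + 2 * p + 8 \<and> regs s' 0 = 0 \<and> rand_used s' = 0) (start [N, w, A] m)"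
    (is "wp M \<omega> construct ?Q ?s")
proof -
  let ?s1 = "?s\<lparr>regs := (regs ?s)(rlen := len, rsh := sh, rp := p, rW := W)\<rparr>"
  have g: "evalx M ?s1 guardE = 0"
    using guardE_val[of ?s1] assms by (simp add: start_def)
  show ?thesis
    unfolding construct_def wp_Seq
  proof (rule wp_mono[OF wp_initc], goal_cases)
    case (4 t s')
    then have t: "t = 2 * len + 2 * p + 6" and s': "s' = ?s1" by auto
    show ?case unfolding wp_Cond s' g t by (simp add: start_def)
  qed (simp_all add: start_def)
qed

lemma wp_answer:
  assumes body: "\<And>s. regs s 0 = N \<Longrightarrow> regs s rlen = len \<Longrightarrow> regs s rsh = sh \<Longrightarrow> regs s rp = p \<Longrightarrow> regs s rW = W \<Longrightarrow>
      regs s rfound = 0 \<Longrightarrow> mem s = m \<Longrightarrow> (\<And>i. i < d \<Longrightarrow> regs s (rlo i) = lo i \<and> regs s (rhi i) = hi i) \<Longrightarrow>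
      wp M \<omega> (if guard then Seq paramsc query else brute) (\<lambda>t s'. t \<le> T \<and> Q (regs s' rfound) (regs s' rans)) s"
  shows "\<exists>t s. exec M \<omega> answer (start ([N, w, A] @ map lo [0..<fn_dim M] @ map hi [0..<fn_dim M]) m) t s \<and>
    t \<le> 2 * len + 2 * p + 10 + T \<and> Q (regs s 0) (regs s 1)"
proof -
  have dim: "fn_dim M = d" by (simp add: M_def ram_def)
  let ?s = "start ([N, w, A] @ map lo [0..<fn_dim M] @ map hi [0..<fn_dim M]) m"
  let ?s1 = "?s\<lparr>regs := (regs ?s)(rlen := len, rsh := sh, rp := p, rW := W)\<rparr>"
  let ?s2 = "?s1\<lparr>regs := (regs ?s1)(rfound := 0)\<rparr>"
  have lohi: "regs ?s2 (rlo i) = lo i \<and> regs ?s2 (rhi i) = hi i" if "i < d" for i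
    using that by (auto simp: start_def dim nth_append nth_Cons')
  have g: "evalx M ?s2 guardE = of_bool guard"
    by (rule guardE_val) (simp_all add: start_def)
  have b: "wp M \<omega> (if guard then Seq paramsc query else brute) (\<lambda>t s'. t \<le> T \<and> Q (regs s' rfound) (regs s' rans)) ?s2"
    by (rule body) (use lohi in \<open>auto simp: start_def\<close>)
  have "wp M \<omega> answer (\<lambda>t s'. t \<le> 2 * len + 2 * p + 10 + T \<and> Q (regs s' 0) (regs s' 1)) ?s"
    unfolding answer_def wp_Seq
  proof (rule wp_mono[OF wp_initc], goal_cases)
    case (4 t s')
    then have t: "t = 2 * len + 2 * p + 6" and s': "s' = ?s1" by auto
    have s2: "s'\<lparr>regs := (regs s')(rfound := evalx M s' (Const 0))\<rparr> = ?s2" by (simp add: s')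
    show ?case
      unfolding wp_Assign s2 wp_Cond g
      using b t by (cases guard) (auto simp del: wp_Seq elim!: wp_mono)
  qed (simp_all add: start_def)
  then show ?thesis unfolding wp_def .
qed

lemma answers_box_small:
  assumes "\<not> guard"
  shows "answers_box M N [N, w, A] answer m (2 * len + 2 * p + 10 + (2 + N * (\<tau> + 6))) lo hi"
  unfolding answers_box_def
proof
  fix \<omega>
  interpret ram_box d M \<omega> N w \<tau> "sh + len" lo hi
  proof
    show "word_bits M = sh + len" by (rule word_bits_M)
    show "N < 2 ^ (sh + len)" using N_pow_less[of 1] K by simp
    show "0 < sh + len" using len_bounds(3) by simp
    show "w \<le> sh + len" by (simp add: sh_def)
  qed (use f tm in \<open>auto simp: M_def ram_def\<close>)
  have box: "fn M x \<in> int_box (fn_dim M) lo hi \<longleftrightarrow> inbox x" for x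
    by (simp add: int_box_def inbox_def box_fn_dim)
  show "\<exists>t s. exec M \<omega> answer (start ([N, w, A] @ map lo [0..<fn_dim M] @ map hi [0..<fn_dim M]) m) t s \<and>
      t \<le> 2 * len + 2 * p + 10 + (2 + N * (\<tau> + 6)) \<and>
      (if \<exists>x<N. fn M x \<in> int_box (fn_dim M) lo hi
       then regs s 0 = 1 \<and> regs s 1 < N \<and> fn M (regs s 1) \<in> int_box (fn_dim M) lo hi
       else regs s 0 = 0)"
    unfolding box
  proof (rule wp_answer)
    fix s :: state
    assume a: "regs s 0 = N" "regs s rfound = 0" "\<And>i. i < d \<Longrightarrow> regs s (rlo i) = lo i \<and> regs s (rhi i) = hi i"
    have "corners s" "found False s" using a by (auto simp: corners_def found_def)
    then have "wp M \<omega> brute (\<lambda>t s'. t \<le> 2 + N * (\<tau> + 6) \<and> found (\<exists>x<N. inbox x) s') s"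
      using a by (intro wp_brute) auto
    then show "wp M \<omega> (if guard then Seq paramsc query else brute) (\<lambda>t s'. t \<le> 2 + N * (\<tau> + 6) \<and>
      (if \<exists>x<N. inbox x then regs s' rfound = 1 \<and> regs s' rans < N \<and> inbox (regs s' rans) else regs s' rfound = 0)) s"
      using assms by (auto simp: found_def elim!: wp_mono)
  qed
qed

end

locale box_query = box_guard d e K N w \<tau> A f tm \<omega>
  for d e K N w \<tau> A f tm \<omega> +
  fixes lo hi :: "nat \<Rightarrow> nat"
begin

sublocale ram_query d M \<omega> N w \<tau> sh len p r0 r1 M1 M0 m0 m1 H Z D W lo hi ..

end

context box_guard
begin

text \<open>The query runs with an arbitrary sequence \<open>\<omega>'\<close>; all that matters
  about the construction is that it left a complete memory.\<close>

lemma answers_box_guard: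
  assumes "complete m"
  shows "answers_box M N [N, w, A] answer m (2 * len + 2 * p + 10 + (9 +
    ram_query.queryT d \<tau> p r0 r1 D)) lo hi"
  unfolding answers_box_def
proof
  fix \<omega>'
  interpret Q: box_query d e K N w \<tau> A f tm \<omega>' lo hi
    by (unfold_locales) (rule guard)
  have box: "fn M x \<in> int_box (fn_dim M) lo hi \<longleftrightarrow> Q.inbox x" for x
    by (simp add: int_box_def Q.inbox_def)
  show "\<exists>t s. exec M \<omega>' answer (start ([N, w, A] @ map lo [0..<fn_dim M] @ map hi [0..<fn_dim M]) m) t s \<and>
      t \<le> 2 * len + 2 * p + 10 + (9 + Q.queryT) \<and>
      (if \<exists>x<N. fn M x \<in> int_box (fn_dim M) lo hi
       then regs s 0 = 1 \<and> regs s 1 < N \<and> fn M (regs s 1) \<in> int_box (fn_dim M) lo hi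
       else regs s 0 = 0)"
    unfolding box
  proof (rule wp_answer)
    fix s :: state
    assume a: "regs s 0 = N" "regs s rlen = len" "regs s rsh = sh" "regs s rp = p" "regs s rW = W"
      "regs s rfound = 0" "mem s = m" "\<And>i. i < d \<Longrightarrow> regs s (rlo i) = lo i \<and> regs s (rhi i) = hi i"
    have "wp M \<omega>' (Seq paramsc query) (\<lambda>t s'. t \<le> 9 + Q.queryT \<and> Q.found (\<exists>j<D. Q.hit m j) s') s"
      unfolding wp_Seq
    proof (rule wp_use[OF wp_paramsc[OF a(1-5)]], goal_cases)
      case (1 t1 s1)
      have r1: "regs s1 r = regs s r" if "r < vV \<or> r = rfound" for r
        by (rule unmod_regs[OF 1(2)]) (use that in auto)
      have "Q.corners s1" using a(8) r1 by (simp add: Q.corners_def)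
      then have q: "Q.qenv s1" using 1(1) by (simp add: Q.qenv_def)
      have "Q.found False s1" using a(6) r1[of rfound] by (simp add: Q.found_def)
      moreover have "mem s1 = m" using unmod_mem[OF 1(2)] a(7) by simp
      ultimately show ?case using Q.wp_query[OF q] 1(1) by (auto elim!: wp_mono)
    qed
    moreover have "\<exists>j<D. Q.hit m j" if "\<exists>x<N. Q.inbox x"
      using Q.complete_hit[OF assms] that by blast
    ultimately show "wp M \<omega>' (if guard then Seq paramsc query else brute) (\<lambda>t s'. t \<le> 9 + Q.queryT \<and>
      (if \<exists>x<N. Q.inbox x then regs s' rfound = 1 \<and> regs s' rans < N \<and> Q.inbox (regs s' rans) else regs s' rfound = 0)) s"
      using guard by (auto simp: Q.found_def elim!: wp_mono)
  qed
qed

end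

section \<open>Random words\<close>

lemma pmf_replicate_pmf:
  "pmf (replicate_pmf n p) l = (if length l = n then (\<Prod>i<n. pmf p (l ! i)) else 0)"
proof (induction n arbitrary: l)
  case 0
  then show ?case by (cases l) auto
next
  case (Suc n)
  show ?case
  proof (cases l)
    case Nil
    then have "l \<notin> set_pmf (replicate_pmf (Suc n) p)" unfolding set_replicate_pmf by auto
    then show ?thesis using Nil by (simp add: set_pmf_iff del: replicate_pmf.simps)
  next
    case (Cons a l')
    have "measure_pmf.prob (replicate_pmf (Suc n) p) {l} = measure_pmf.prob p {a} * pmf (replicate_pmf n p) l'"
    proof (rule prob_replicate_Suc_const)
      fix x
      have "{xs. x # xs \<in> {l}} = (if x \<in> {a} then {l'} else {})" using Cons by auto
      then show "measure_pmf.prob (replicate_pmf n p) {xs. x # xs \<in> {l}} = (if x \<in> {a} then pmf (replicate_pmf n p) l' else 0)"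
        by (simp add: measure_pmf_single)
    qed
    then show ?thesis using Cons Suc.IH[of l']
      by (simp add: measure_pmf_single prod.lessThan_Suc_shift del: replicate_pmf.simps prod.lessThan_Suc)
  qed
qed

text \<open>Passage from the infinite product measure to lists: a list of length \<open>n\<close>
  corresponds to a cylinder, and lists are countable, so singletons determine the distribution of
  the prefix.\<close>

lemma
  fixes E :: "nat list set"
  shows prefix_measurable: "{\<omega>. map \<omega> [0..<n] \<in> E} \<in> sets (random_words b)"
    and prob_prefix: "measure (random_words b) {\<omega>. map \<omega> [0..<n] \<in> E}
      = measure_pmf.prob (replicate_pmf n (uniform_words b)) E"
proof -
  let ?U = "measure_pmf (uniform_words b)"
  let ?X = "\<lambda>\<omega>. map \<omega> [0..<n]"
  interpret product_prob_space "\<lambda>_. ?U" "UNIV :: nat set" ..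
  have space: "space (random_words b) = UNIV"
    by (simp add: random_words_def space_PiM)
  have point: "?X -` {l} = (if length l = n then prod_emb UNIV (\<lambda>_. ?U) {..<n} (Pi\<^sub>E {..<n} (\<lambda>i. {l ! i})) else {})"
    for l :: "nat list"
  proof -
    have 1: "?X \<omega> = l \<longleftrightarrow> length l = n \<and> (\<forall>i<n. \<omega> i = l ! i)" for \<omega>
      by (auto simp: list_eq_iff_nth_eq)
    have 2: "\<omega> \<in> prod_emb UNIV (\<lambda>_. ?U) {..<n} (Pi\<^sub>E {..<n} (\<lambda>i. {l ! i})) \<longleftrightarrow> (\<forall>i<n. \<omega> i = l ! i)" for \<omega>
      by (simp add: prod_emb_def restrict_PiE_iff PiE_UNIV_domain Pi_iff Ball_def)
    show ?thesis using 1 2 by auto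
  qed
  have sets1: "?X -` {l} \<in> sets (random_words b)" for l :: "nat list"
    unfolding point random_words_def by (auto intro!: sets_PiM_I)
  have meas: "?X \<in> measurable (random_words b) (count_space UNIV)"
    by (rule measurable_count_space_eq2_countable[THEN iffD2]) (use sets1 space in auto)
  have "distr (random_words b) (count_space UNIV) ?X = measure_pmf (replicate_pmf n (uniform_words b))"
  proof (rule measure_eqI_countable[where A = UNIV])
    fix l :: "nat list"
    have "emeasure (distr (random_words b) (count_space UNIV) ?X) {l} = emeasure (random_words b) (?X -` {l})"
      by (subst emeasure_distr[OF meas]) (auto simp: space)
    also have "\<dots> = (if length l = n then (\<Prod>i<n. emeasure ?U {l ! i}) else 0)"
    proof (cases "length l = n")
      case True
      then show ?thesis unfolding point random_words_def by (simp add: emeasure_PiM_emb)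
    next
      case False
      then show ?thesis unfolding point by simp
    qed
    also have "\<dots> = emeasure (measure_pmf (replicate_pmf n (uniform_words b))) {l}"
      by (simp add: emeasure_pmf_single pmf_replicate_pmf prod_ennreal)
    finally show "emeasure (distr (random_words b) (count_space UNIV) ?X) {l}
      = emeasure (measure_pmf (replicate_pmf n (uniform_words b))) {l}" .
  qed auto
  moreover have "measure (distr (random_words b) (count_space UNIV) ?X) E = measure (random_words b) {\<omega>. ?X \<omega> \<in> E}"
    by (subst measure_distr[OF meas]) (auto simp: space vimage_def)
  ultimately show "measure (random_words b) {\<omega>. ?X \<omega> \<in> E} = measure_pmf.prob (replicate_pmf n (uniform_words b)) E"
    by simp
  have "?X -` E \<inter> space (random_words b) \<in> sets (random_words b)"
    by (rule measurable_sets[OF meas]) simp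
  then show "{\<omega>. ?X \<omega> \<in> E} \<in> sets (random_words b)" by (simp add: space vimage_def)
qed

definition chunks :: "nat \<Rightarrow> nat \<Rightarrow> 'a list \<Rightarrow> 'a list list" where
  "chunks n F xs = map (\<lambda>i. take n (drop (i * n) xs)) [0..<F]"

lemma chunks_append: "length xs = F * n \<Longrightarrow> chunks n F (xs @ ys) = chunks n F xs"
  unfolding chunks_def
proof (rule map_cong[OF refl])
  fix i assume xs: "length xs = F * n" and i: "i \<in> set [0..<F]"
  then have "(i + 1) * n \<le> F * n" by (intro mult_le_mono1) auto
  then show "take n (drop (i * n) (xs @ ys)) = take n (drop (i * n) xs)" using xs by simp
qed

lemma nth_chunks: "i < F \<Longrightarrow> length xs = F * n \<Longrightarrow> j < n \<Longrightarrow> chunks n F xs ! i ! j = xs ! (i * n + j)"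
proof -
  assume a: "i < F" "length xs = F * n" "j < n"
  then have "(i + 1) * n \<le> F * n" by (intro mult_le_mono1) auto
  then show ?thesis using a by (simp add: chunks_def)
qed

lemma length_chunk: "i < F \<Longrightarrow> length xs = F * n \<Longrightarrow> length (chunks n F xs ! i) = n"
proof -
  assume a: "i < F" "length xs = F * n"
  then have "(i + 1) * n \<le> F * n" by (intro mult_le_mono1) auto
  then show ?thesis using a by (simp add: chunks_def)
qed

lemma map_pmf_chunks: "map_pmf (chunks n F) (replicate_pmf (F * n) p) = replicate_pmf F (replicate_pmf n p)"
  unfolding chunks_def by (rule replicate_pmf_chunks)

text \<open>Arranges the flat word list as pairs of seeds for the sample tables, followed by groups
  of \<open>n\<close> seeds for the rainbow tables. The bind form separates two stages because the
  second analysis is conditioned on the caught values.\<close>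

lemma prob_two_level:
  fixes p :: "'a pmf"
  shows "measure_pmf.prob (replicate_pmf ((r * 2 + r' * n) * m) p)
     {ws. let ss = chunks m (r * 2 + r' * n) ws in (chunks 2 r ss, chunks n r' (drop (r * 2) ss)) \<in> E}
   = measure_pmf.prob (bind_pmf (replicate_pmf r (replicate_pmf 2 (replicate_pmf m p)))
       (\<lambda>A. map_pmf (Pair A) (replicate_pmf r' (replicate_pmf n (replicate_pmf m p))))) E"
proof -
  let ?s = "replicate_pmf m p"
  let ?F = "r * 2 + r' * n"
  let ?f = "\<lambda>ss. (chunks 2 r ss, chunks n r' (drop (r * 2) ss))"
  have "measure_pmf.prob (replicate_pmf (?F * m) p) {ws. let ss = chunks m ?F ws in ?f ss \<in> E}
      = measure_pmf.prob (map_pmf ?f (map_pmf (chunks m ?F) (replicate_pmf (?F * m) p))) E"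
    by (simp add: vimage_def Let_def)
  also have "map_pmf (chunks m ?F) (replicate_pmf (?F * m) p) = replicate_pmf ?F ?s"
    by (rule map_pmf_chunks)
  also have "map_pmf ?f (replicate_pmf ?F ?s) = bind_pmf (replicate_pmf (r * 2) ?s)
      (\<lambda>xs. bind_pmf (replicate_pmf (r' * n) ?s) (\<lambda>ys. return_pmf (?f (xs @ ys))))"
    by (simp add: replicate_pmf_distrib map_bind_pmf)
  also have "\<dots> = bind_pmf (replicate_pmf (r * 2) ?s)
      (\<lambda>xs. bind_pmf (replicate_pmf (r' * n) ?s) (\<lambda>ys. return_pmf (chunks 2 r xs, chunks n r' ys)))"
    by (intro bind_pmf_cong refl arg_cong[where f = return_pmf])
       (auto simp: set_replicate_pmf chunks_append)
  also have "\<dots> = bind_pmf (map_pmf (chunks 2 r) (replicate_pmf (r * 2) ?s))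
      (\<lambda>A. map_pmf (Pair A) (map_pmf (chunks n r') (replicate_pmf (r' * n) ?s)))"
    by (simp add: map_pmf_def bind_assoc_pmf bind_return_pmf)
  finally show ?thesis by (simp only: map_pmf_chunks)
qed

section \<open>Success probability\<close>

declare replicate_pmf.simps [simp del]

lemma last_write_cases:
  assumes "\<exists>c<n. P c"
  obtains c where "c < n" "P c" "last_write P v n = v c"
  using assms
proof (induction n arbitrary: thesis)
  case (Suc n)
  show ?case
  proof (cases "P n")
    case True
    then show ?thesis using Suc.prems(1)[of n] by simp
  next
    case False
    then have "\<exists>c<n. P c" using Suc.prems(2) less_Suc_eq by auto
    then obtain c where "c < n" "P c" "last_write P v n = v c" using Suc.IH by blast
    then show ?thesis using Suc.prems(1)[of c] False by simp
  qed
qed simp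

context box_guard
begin

abbreviation "Keys \<equiv> {y. length y = Suc d \<and> (\<forall>c\<in>set y. c < 2 ^ sh)}"
abbreviation "hx \<equiv> mshift sh len"
abbreviation "seedp \<equiv> replicate_pmf (d + 2) (uniform_words (sh + len))"
abbreviation "n \<equiv> (2::nat) ^ len"

text \<open>Large enough that \<open>M0\<close> samples hit a fibre of this size at least
  \<open>1 / 8\<close> times on average, small enough that merges through lighter fibres stay
  rare.\<close>

definition heavy_threshold :: nat where
  "heavy_threshold = n div (8 * M0) + 1"

sublocale fam: hash_family seedp hx n Keys
  using hash_family_mshift[of "Suc d" sh len] by simp

lemma sh_ge: "len \<le> sh" "w \<le> sh"
proof -
  have "1 * len \<le> (K - 1) * len" using K by (intro mult_le_mono1) simp
  then show "len \<le> sh" unfolding sh_def by linarith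
  show "w \<le> sh" by (simp add: sh_def)
qed

lemma n_le: "N \<le> n" "n \<le> 2 * N"
proof -
  show "N \<le> n" using len_bounds(1) by simp
  have "n = 2 * 2 ^ (len - 1)" using len_bounds(3) by (cases len) auto
  then show "n \<le> 2 * N" using len_bounds(2) by simp
qed

lemma M_le: "M0 \<le> N" "M1 \<le> N" "0 < M0" "M1 * (64 * (p * p)) \<le> N" "16 * M0 \<le> N"
proof -
  note gb = guard_bounds[OF guard]
  show "M0 \<le> N" "M1 \<le> N" using gb(7,8) by (auto simp: m0_def m1_def)
  show "0 < M0" using gb(9) p_props(4) by (simp add: M0_def)
  show 1: "M1 * (64 * (p * p)) \<le> N" unfolding M1_def by simp
  have "16 * M0 = M1 * (64 * p)" by (simp add: M0_def)
  also have "\<dots> \<le> M1 * (64 * (p * p))" using p_props(4) by (intro mult_le_mono2) auto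
  finally show "16 * M0 \<le> N" using 1 by linarith
qed

lemma start_key_eq: "c < N \<Longrightarrow> start_key c = Suc c # replicate d 0"
proof -
  assume "c < N"
  then have "c + 1 < B" using N_pow_less[of 1] K by simp
  then show ?thesis by (simp add: start_key_def)
qed

lemma start_key_Keys: "c < N \<Longrightarrow> start_key c \<in> Keys"
proof -
  assume c: "c < N"
  have "Suc c \<le> N" using c by simp
  also have "N < 2 ^ len" by (rule len_bounds(1))
  also have "(2::nat) ^ len \<le> 2 ^ sh" using sh_ge by (intro power_increasing) auto
  finally show ?thesis using c by (simp add: start_key_eq)
qed

lemma start_key_inj: "m \<le> N \<Longrightarrow> inj_on start_key {..<m}"
  by (rule inj_onI) (simp add: start_key_eq)

lemma gk_Keys: "x < N \<Longrightarrow> gk j x \<in> Keys"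
proof -
  assume x: "x < N"
  have "fn M x i div 2 ^ lev j i < 2 ^ sh" if "i < d" for i
  proof -
    have "fn M x i div 2 ^ lev j i \<le> fn M x i" by simp
    also have "\<dots> < 2 ^ w" using fn_less x that by simp
    also have "(2::nat) ^ w \<le> 2 ^ sh" using sh_ge by (intro power_increasing) auto
    finally show ?thesis .
  qed
  then show ?thesis by (auto simp: gk_def)
qed

lemma start_neq_gk: "c < N \<Longrightarrow> start_key c \<noteq> gk j x"
  by (simp add: start_key_eq gk_def)

text \<open>A slot of a filled sample table as a function of its two seeds alone: the bridge between
  \<open>built0\<close> and the probability space.\<close>

definition content0 :: "nat \<Rightarrow> nat list list \<Rightarrow> nat \<Rightarrow> nat" where
  "content0 j ss \<sigma> = last_write (\<lambda>c. hx (ss ! 0) (start_key c) < N \<and>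
     hx (ss ! 1) (gk j (hx (ss ! 0) (start_key c))) mod m0 = \<sigma>) (\<lambda>c. hx (ss ! 0) (start_key c)) M0"

definition covered0 :: "nat \<Rightarrow> nat list list list \<Rightarrow> nat list set" where
  "covered0 j S = {y. \<exists>q<r0. content0 j (S ! q) (hx (S ! q ! 1) y mod m0) < N \<and>
     gk j (content0 j (S ! q) (hx (S ! q ! 1) y mod m0)) = y}"

definition lost0 :: "nat \<Rightarrow> nat list \<Rightarrow> nat list list set" where
  "lost0 j y = {ss. \<not> (content0 j ss (hx (ss ! 1) y mod m0) < N \<and> gk j (content0 j ss (hx (ss ! 1) y mod m0)) = y)}"

definition heavy :: "nat \<Rightarrow> nat list set" where
  "heavy j = {y. heavy_threshold \<le> card {x. x < N \<and> gk j x = y}}"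

lemma heavy_gk: "y \<in> heavy j \<Longrightarrow> \<exists>x<N. gk j x = y"
proof (rule ccontr)
  assume "y \<in> heavy j" "\<not> (\<exists>x<N. gk j x = y)"
  moreover from this have "{x. x < N \<and> gk j x = y} = {}" by blast
  ultimately show False by (simp add: heavy_def heavy_threshold_def)
qed

text \<open>The lower bound is the \<open>1 / 8\<close> of \<open>prob_no_hit\<close>. The upper
  bound serves twice: it is below the \<open>1 / 4\<close> there, and together with slot collisions
  of \<open>1 / 4\<close> it stays below the \<open>1 / 2\<close> of
  \<open>prob_covers\<close>.\<close>

lemma threshold_bounds:
  "1 / 8 \<le> M0 * real heavy_threshold / n" "M0 * real heavy_threshold / n \<le> 3 / 16"
proof -
  have n: "0 < real n" by simp
  have M0: "0 < real M0" using M_le by simp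
  have "n < (n div (8 * M0) + 1) * (8 * M0)"
    using dividend_less_div_times[of "8 * M0" n] M_le(3) by simp
  then have "real n < real heavy_threshold * (8 * M0)"
    unfolding heavy_threshold_def by (metis of_nat_less_iff of_nat_mult of_nat_numeral)
  then show "1 / 8 \<le> M0 * real heavy_threshold / n" using n by (simp add: field_simps)
  have "real (n div (8 * M0)) \<le> real n / real (8 * M0)" by (rule of_nat_div_le_of_nat)
  then have "real heavy_threshold \<le> real n / (8 * M0) + 1" by (simp add: heavy_threshold_def)
  then have "M0 * real heavy_threshold \<le> M0 * (real n / (8 * M0) + 1)" by (intro mult_left_mono) auto
  also have "\<dots> = real n / 8 + M0" using M0 by (simp add: field_simps)
  \<comment> \<open>Rounding the threshold up costs \<open>M0 / n \<le> 1 / 16\<close>, whence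
    \<open>1 / 8 + 1 / 16 = 3 / 16\<close>.\<close>
  also have "\<dots> \<le> real n / 8 + real n / 16"
  proof -
    have "16 * M0 \<le> n" using M_le(5) n_le(1) by linarith
    then have "real (16 * M0) \<le> real n" by (simp only: of_nat_le_iff)
    then show ?thesis by simp
  qed
  finally show "M0 * real heavy_threshold / n \<le> 3 / 16" using n by (simp add: field_simps)
qed

lemma prob_lost0:
  assumes "y \<in> heavy j"
  shows "measure_pmf.prob (replicate_pmf 2 seedp) (lost0 j y) \<le> 31 / 32"
proof -
  have "heavy_threshold \<le> card {x. x < N \<and> gk j x = y}" using assms by (simp add: heavy_def)
  \<comment> \<open>A fibre may be arbitrarily large, but the second moment bound also needs an
    upper bound on the expected number of hits; so exactly \<open>heavy_threshold\<close> preimages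
    are kept.\<close>
  then obtain Y where Y: "Y \<subseteq> {x. x < N \<and> gk j x = y}" "card Y = heavy_threshold"
    by (rule obtain_subset_with_card_n)
  let ?E = "{ss. \<not> ((\<exists>c<M0. hx (ss ! 0) (start_key c) \<in> Y) \<and>
            (\<forall>c<M0. hx (ss ! 0) (start_key c) < N \<longrightarrow> gk j (hx (ss ! 0) (start_key c)) \<noteq> y \<longrightarrow>
               hx (ss ! 1) (gk j (hx (ss ! 0) (start_key c))) mod m0 \<noteq> hx (ss ! 1) y mod m0))}"
  have "lost0 j y \<subseteq> ?E"
  proof (rule ccontr)
    assume "\<not> lost0 j y \<subseteq> ?E"
    then obtain ss where ss: "ss \<in> lost0 j y" "ss \<notin> ?E" by blast
    then obtain c where c: "c < M0" "hx (ss ! 0) (start_key c) \<in> Y" by blast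
    let ?P = "\<lambda>c. hx (ss ! 0) (start_key c) < N \<and> hx (ss ! 1) (gk j (hx (ss ! 0) (start_key c))) mod m0 = hx (ss ! 1) y mod m0"
    have "\<exists>c<M0. ?P c" using c Y(1) by (intro exI[of _ c]) auto
    then obtain c' where c': "c' < M0" "?P c'" "content0 j ss (hx (ss ! 1) y mod m0) = hx (ss ! 0) (start_key c')"
      unfolding content0_def by (rule last_write_cases)
    \<comment> \<open>The last writer to the slot of \<open>y\<close> has value \<open>y\<close>,
      since no other value was hashed there.\<close>
    then have "gk j (hx (ss ! 0) (start_key c')) = y" using ss(2) by auto
    then show False using ss(1) c' by (simp add: lost0_def)
  qed
  then have "measure_pmf.prob (replicate_pmf 2 seedp) (lost0 j y) \<le> measure_pmf.prob (replicate_pmf 2 seedp) ?E"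
    by (intro measure_pmf.finite_measure_mono) auto
  also have "\<dots> \<le> 31 / 32"
  proof (rule fam.prob_sample_lost)
    show "start_key c \<in> Keys" if "c < M0" for c
      by (rule start_key_Keys) (use that M_le(1) in linarith)
    show "inj_on start_key {..<M0}" using M_le by (intro start_key_inj)
    show "Y \<subseteq> {..<n}" using Y(1) n_le(1) by auto
    show "M0 * card Y / n \<le> 1 / 4"
      unfolding Y(2) of_nat_mult using threshold_bounds(2) by linarith
    show "1 / 8 \<le> M0 * card Y / n"
      unfolding Y(2) of_nat_mult by (rule threshold_bounds(1))
    show "y \<in> Keys" using heavy_gk[OF assms] gk_Keys by blast
    show "x < N \<Longrightarrow> gk j x \<in> Keys" for x by (rule gk_Keys)
    show "4 * M0 \<le> m0" "0 < m0" using M_le by (simp_all add: m0_def)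
    show "m0 \<le> n" using guard_bounds(7)[OF guard] n_le(1) by linarith
  qed
  finally show ?thesis .
qed

definition bad0 :: "nat list list list set" where
  "bad0 = {S. \<exists>j<D. \<exists>y\<in>heavy j. \<forall>q<r0. S ! q \<in> lost0 j y}"

lemma prob_bad0: "measure_pmf.prob (replicate_pmf r0 (replicate_pmf 2 seedp)) bad0 \<le> D * N * (31 / 32) ^ r0"
proof -
  let ?P = "measure_pmf.prob (replicate_pmf r0 (replicate_pmf 2 seedp))"
  let ?E = "\<lambda>j y. {S. \<forall>q<r0. S ! q \<in> lost0 j y}"
  let ?I = "SIGMA j:{..<D}. heavy j"
  have heavy: "heavy j \<subseteq> gk j ` {..<N}" for j using heavy_gk by force
  have fin: "finite (heavy j)" for j by (rule finite_subset[OF heavy]) simp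
  have card: "card (heavy j) \<le> N" for j
    using card_mono[OF _ heavy[of j]] card_image_le[of "{..<N}" "gk j"] by simp
  have eq: "bad0 = (\<Union>z\<in>?I. ?E (fst z) (snd z))" by (force simp: bad0_def)
  have "?P bad0 \<le> (\<Sum>z\<in>?I. ?P (?E (fst z) (snd z)))"
    unfolding eq by (intro measure_pmf.finite_measure_subadditive_finite) (use fin in auto)
  also have "\<dots> \<le> (\<Sum>z\<in>?I. (31 / 32) ^ r0)"
  proof (rule sum_mono)
    fix z assume "z \<in> ?I"
    then have "snd z \<in> heavy (fst z)" by auto
    then show "?P (?E (fst z) (snd z)) \<le> (31 / 32) ^ r0"
      unfolding prob_replicate_all by (intro power_mono prob_lost0) auto
  qed
  also have "\<dots> = card ?I * (31 / 32) ^ r0" by simp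
  also have "\<dots> \<le> (D * N) * (31 / 32) ^ r0"
  proof -
    have "card ?I = (\<Sum>j<D. card (heavy j))" using fin by (simp add: card_SigmaI)
    also have "\<dots> \<le> (\<Sum>j<D. N)" by (intro sum_mono card)
    finally have "card ?I \<le> D * N" by simp
    then have "real (card ?I) \<le> real (D * N)" by (simp only: of_nat_le_iff)
    then show ?thesis by (intro mult_right_mono) simp_all
  qed
  finally show ?thesis by simp
qed

text \<open>Outside \<open>bad0\<close>, a value missed by all sample tables is not heavy; this is
  the fibre bound that the chain analysis assumes.\<close>

lemma rainbow_good:
  assumes "S \<notin> bad0" "j < D"
  shows "rainbow seedp hx n Keys N (gk j) (covered0 j S) heavy_threshold"
proof
  show "N \<le> n" by (rule n_le)
  show "x < N \<Longrightarrow> gk j x \<in> Keys" for x by (rule gk_Keys)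
  fix v assume "v \<notin> covered0 j S"
  then have "\<forall>q<r0. S ! q \<in> lost0 j v" by (auto simp: covered0_def lost0_def)
  then have "v \<notin> heavy j" using assms by (auto simp: bad0_def)
  then show "card {x. x < N \<and> gk j x = v} \<le> heavy_threshold" by (simp add: heavy_def)
qed

abbreviation "covers1 j S x ss \<equiv> rainbow.covers hx N (gk j) (covered0 j S) start_key M1 p m1 x ss"

lemma prob_covers1:
  assumes "S \<notin> bad0" "j < D" "x < N" "gk j x \<notin> covered0 j S"
  shows "real M1 * p / (4 * n) \<le> measure_pmf.prob (replicate_pmf (p + 1) seedp) {ss. covers1 j S x ss}"
proof -
  interpret R: rainbow seedp hx n Keys N "gk j" "covered0 j S" heavy_threshold
    by (rule rainbow_good[OF assms(1,2)])
  have "real M1 * p / (4 * n) \<le> measure_pmf.prob (replicate_pmf (Suc p) seedp) {ss. covers1 j S x ss}"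
  proof (rule R.prob_covers)
    show "start_key c \<in> Keys" if "c < M1" for c
      by (rule start_key_Keys) (use that M_le(2) in linarith)
    show "inj_on start_key {..<M1}" using M_le by (intro start_key_inj)
    show "start_key c \<noteq> gk j x" if "c < M1" for c using that M_le by (intro start_neq_gk) simp
    show "0 < m1" using m_pos by simp
    show "m1 \<le> n" using guard_bounds(8)[OF guard] n_le(1) by linarith
    have M1: "0 < real M1" using guard_bounds(9)[OF guard] by simp
    \<comment> \<open>\<open>M0 = 4 * p * M1\<close> turns the merge bound into the expected number
      of sample hits, at most \<open>3 / 16\<close>.\<close>
    have "M1 * (real p * (4 * heavy_threshold / n)) = M0 * real heavy_threshold / n" by (simp add: M0_def)
    moreover have "M1 * (2 / real m1) = 1 / 4" using M1 by (simp add: m1_def)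
    ultimately show "M1 * (real p * (real (4 * heavy_threshold) / n) + 2 / real m1) \<le> 1 / 2"
      using threshold_bounds(2) by (simp only: distrib_left of_nat_mult of_nat_numeral)
    have "M1 * p * 4 \<le> M1 * (64 * (p * p))" using p_props(4) by simp
    then have "M1 * p * 4 \<le> n" using M_le(4) n_le(1) by linarith
    then have "real (M1 * p * 4) \<le> real n" by (simp only: of_nat_le_iff)
    then show "real M1 * p / n \<le> 1 / 4" by (simp add: field_simps)
  qed (use assms in auto)
  then show ?thesis by simp
qed

definition bad1 :: "nat list list list \<Rightarrow> nat list list list set" where
  "bad1 S = {C. \<exists>j<D. \<exists>x<N. gk j x \<notin> covered0 j S \<and> (\<forall>k<r1. \<not> covers1 j S x (C ! k))}"

lemma prob_bad1:
  assumes "S \<notin> bad0"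
  shows "measure_pmf.prob (replicate_pmf r1 (replicate_pmf (p + 1) seedp)) (bad1 S) \<le> D * N * (1 - real M1 * p / (4 * n)) ^ r1"
proof -
  let ?p = "replicate_pmf (p + 1) seedp"
  let ?P = "measure_pmf.prob (replicate_pmf r1 ?p)"
  let ?E = "\<lambda>j x. {C. \<forall>k<r1. C ! k \<in> {ss. \<not> covers1 j S x ss}}"
  let ?I = "SIGMA j:{..<D}. {x. x < N \<and> gk j x \<notin> covered0 j S}"
  let ?b = "(1 - real M1 * p / (4 * n)) ^ r1 :: real"
  have one: "?P (?E j x) \<le> ?b" if "j < D" "x < N" "gk j x \<notin> covered0 j S" for j x
  proof -
    have "measure_pmf.prob ?p {ss. \<not> covers1 j S x ss} = 1 - measure_pmf.prob ?p {ss. covers1 j S x ss}"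
      using measure_pmf.prob_compl[of "{ss. covers1 j S x ss}" ?p] by (simp add: Compl_eq_Diff_UNIV[symmetric] Collect_neg_eq)
    also have "\<dots> \<le> 1 - real M1 * p / (4 * n)" using prob_covers1[OF assms that] by simp
    finally show ?thesis unfolding prob_replicate_all by (intro power_mono) auto
  qed
  have nonneg: "0 \<le> ?b"
  proof -
    have "M1 * p \<le> M1 * (64 * (p * p))" using p_props(4) by simp
    then have "M1 * p \<le> 4 * n" using M_le(4) n_le(1) by linarith
    then have "real (M1 * p) \<le> real (4 * n)" by (simp only: of_nat_le_iff)
    then show ?thesis by (intro zero_le_power) (simp add: field_simps)
  qed
  have eq: "bad1 S = (\<Union>z\<in>?I. ?E (fst z) (snd z))"
  proof (intro equalityI subsetI)
    fix C assume "C \<in> bad1 S"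
    then obtain j x where "(j, x) \<in> ?I" "C \<in> ?E j x" unfolding bad1_def by blast
    then show "C \<in> (\<Union>z\<in>?I. ?E (fst z) (snd z))" by (intro UN_I[of "(j, x)"]) simp_all
  next
    fix C assume "C \<in> (\<Union>z\<in>?I. ?E (fst z) (snd z))"
    then obtain z where "z \<in> ?I" "C \<in> ?E (fst z) (snd z)" by blast
    then show "C \<in> bad1 S" unfolding bad1_def by (cases z) auto
  qed
  have "?P (bad1 S) \<le> (\<Sum>z\<in>?I. ?P (?E (fst z) (snd z)))"
    unfolding eq by (intro measure_pmf.finite_measure_subadditive_finite) auto
  also have "\<dots> \<le> (\<Sum>z\<in>?I. ?b)" by (intro sum_mono) (use one in auto)
  also have "\<dots> = card ?I * ?b" by simp
  also have "\<dots> \<le> (D * N) * ?b"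
  proof -
    have "?I \<subseteq> {..<D} \<times> {..<N}" by auto
    then have "card ?I \<le> card ({..<D} \<times> {..<N})" by (intro card_mono) auto
    then have "card ?I \<le> D * N" by simp
    then have "real (card ?I) \<le> real (D * N)" by (simp only: of_nat_le_iff)
    then show ?thesis using nonneg by (intro mult_right_mono) auto
  qed
  finally show ?thesis by simp
qed

definition bad :: "(nat list list list \<times> nat list list list) set" where
  "bad = {(S, C). S \<in> bad0 \<or> C \<in> bad1 S}"

text \<open>Chains avoid the caught values and so depend on the sample tables \<open>S\<close>. For
  each fixed good \<open>S\<close> the seeds of the rainbow tables are still independent, and
  \<open>prob_bad1\<close> applies.\<close>

lemma prob_bad:
  "measure_pmf.prob (bind_pmf (replicate_pmf r0 (replicate_pmf 2 seedp))
     (\<lambda>S. map_pmf (Pair S) (replicate_pmf r1 (replicate_pmf (p + 1) seedp)))) bad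
   \<le> D * N * (31 / 32) ^ r0 + D * N * (1 - real M1 * p / (4 * n)) ^ r1"
proof -
  have nonneg: "0 \<le> D * N * (1 - real M1 * p / (4 * n)) ^ r1"
  proof -
    have "M1 * p \<le> M1 * (64 * (p * p))" using p_props(4) by simp
    then have "M1 * p \<le> 4 * n" using M_le(4) n_le(1) by linarith
    then have "real (M1 * p) \<le> real (4 * n)" by (simp only: of_nat_le_iff)
    then have "0 \<le> 1 - real M1 * p / (4 * n)" by (simp add: field_simps)
    then show ?thesis by simp
  qed
  have "measure_pmf.prob (bind_pmf (replicate_pmf r0 (replicate_pmf 2 seedp))
     (\<lambda>S. map_pmf (Pair S) (replicate_pmf r1 (replicate_pmf (p + 1) seedp)))) bad
     \<le> measure_pmf.prob (replicate_pmf r0 (replicate_pmf 2 seedp)) bad0 * 1 + D * N * (1 - real M1 * p / (4 * n)) ^ r1"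
  proof (rule prob_bind_le)
    fix S
    have eq: "measure_pmf.prob (map_pmf (Pair S) (replicate_pmf r1 (replicate_pmf (p + 1) seedp))) bad
        = measure_pmf.prob (replicate_pmf r1 (replicate_pmf (p + 1) seedp)) (Pair S -` bad)" by simp
    show "measure_pmf.prob (map_pmf (Pair S) (replicate_pmf r1 (replicate_pmf (p + 1) seedp))) bad
      \<le> (if S \<in> bad0 then 1 else 0) + D * N * (1 - real M1 * p / (4 * n)) ^ r1"
    proof (cases "S \<in> bad0")
      case True
      have "measure_pmf.prob (map_pmf (Pair S) (replicate_pmf r1 (replicate_pmf (p + 1) seedp))) bad \<le> 1"
        by (rule measure_pmf.prob_le_1)
      then show ?thesis unfolding if_P[OF True] using nonneg by linarith
    next
      case False
      have "Pair S -` bad = bad1 S" using False by (auto simp: bad_def)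
      then show ?thesis unfolding eq if_not_P[OF False] using prob_bad1[OF False] by simp
    qed
  qed simp
  then show ?thesis using prob_bad0 by linarith
qed

end

context box_instance
begin

text \<open>Time bounds as plain functions of the parameters, outside the locale of a single run, so
  that their growth in \<open>N\<close> can be estimated.\<close>

definition "step_time = (2 * d + 6) + 1 + 1 + (\<tau> + d + 3) + (3 + r0 * (3 * d + \<tau> + 15)) + 1 + (d + 2)"
definition "fill_time = (d + 2) + (2 + p * (step_time + 4)) + 1 + (2 * d + 6) + 1"
definition "probe_time = (d + 2) + (2 + p * (step_time + 4)) + 1 + (2 * d + 6) + 1 + (d + 2) +
  (2 + p * (step_time + (\<tau> + 5) + 3))"
definition "construct_time = 2 * len + 2 * p + 6 + 1 + (9 + (2 + H * 4) + (2 + D * (1 +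
  (2 + r0 * (2 + M0 * (6 * d + \<tau> + 22 + 2) + 2)) + (2 + r1 * (2 + M1 * (fill_time + 2) + 2)) + 2)) + 1)"
definition "answer_time = 2 * len + 2 * p + 10 + (9 + (2 + D * ((1 + (2 * d + 2) +
  (2 + r0 * (2 * d + (\<tau> + 4) + 11)) + (2 + r1 * (2 + p * (probe_time + 2) + 2))) + 2)))"

end

section \<open>From random words to a complete memory image\<close>

context box_guard
begin

abbreviation "F \<equiv> r0 * 2 + r1 * (p + 1)"

definition tables :: "nat list \<Rightarrow> nat list list list \<times> nat list list list" where
  "tables ws = (let ss = chunks (d + 2) F ws in (chunks 2 r0 ss, chunks (p + 1) r1 (drop (r0 * 2) ss)))"

lemma H_eq: "H = F * (d + 2)"
  by (simp add: H_def mult.commute)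

lemma length_chunks [simp]: "length (chunks n' m xs) = m"
  by (simp add: chunks_def)

text \<open>For an uncaught value some chain \<open>c\<close> covers \<open>x\<close>. A walk from
  \<open>gk j x\<close> after the visiting column follows this chain to its end, and isolation makes
  \<open>c\<close> the only writer of the slot found there.\<close>

lemma complete_if_not_bad:
  assumes ws: "length ws = H" "\<And>a. a < H \<Longrightarrow> h a = ws ! a"
    and built: "\<And>j. j < D \<Longrightarrow> all_built h j" and good: "tables ws \<notin> bad"
  shows "complete h"
proof -
  define ss where "ss = chunks (d + 2) F ws"
  define S where "S = chunks 2 r0 ss"
  define C where "C = chunks (p + 1) r1 (drop (r0 * 2) ss)"
  have bad: "S \<notin> bad0" "C \<notin> bad1 S"
    using good by (auto simp: tables_def bad_def ss_def S_def C_def Let_def)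
  have lenF: "length ss = F" by (simp add: ss_def)
  have seed: "map h [i * (d + 2)..<i * (d + 2) + d + 2] = ss ! i" if "i < F" for i
  proof (rule nth_equalityI)
    have "(i + 1) * (d + 2) \<le> F * (d + 2)" using that by (intro mult_le_mono1) auto
    then have iH: "i * (d + 2) + (d + 2) \<le> H" unfolding H_eq by simp
    show "length (map h [i * (d + 2)..<i * (d + 2) + d + 2]) = length (ss ! i)"
      using that ws(1) by (simp add: ss_def length_chunk H_eq)
    fix a assume "a < length (map h [i * (d + 2)..<i * (d + 2) + d + 2])"
    then have a: "a < d + 2" by simp
    have "map h [i * (d + 2)..<i * (d + 2) + d + 2] ! a = h (i * (d + 2) + a)"
      by (rule nth_map_upt) (use a in simp)
    moreover have "h (i * (d + 2) + a) = ws ! (i * (d + 2) + a)"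
      by (rule ws(2)) (use a iH in linarith)
    moreover have "ss ! i ! a = ws ! (i * (d + 2) + a)"
      unfolding ss_def by (rule nth_chunks[OF that _ a]) (simp only: ws(1) H_eq)
    ultimately show "map h [i * (d + 2)..<i * (d + 2) + d + 2] ! a = ss ! i ! a" by (simp only:)
  qed
  have hv: "hv h (i * (d + 2)) y = hx (ss ! i) y" if "i < F" for i y
    unfolding hv_def seed[OF that] ..
  have S: "S ! q ! 0 = ss ! (2 * q)" "S ! q ! 1 = ss ! (2 * q + 1)" if "q < r0" for q
  proof -
    have "S ! q ! i = ss ! (q * 2 + i)" if "i < 2" for i
    proof -
      have "(q + 1) * 2 \<le> r0 * 2" using \<open>q < r0\<close> by (intro mult_le_mono1) simp
      then have "q * 2 + 2 \<le> length ss" using lenF by simp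
      then show ?thesis using \<open>q < r0\<close> that by (simp add: S_def chunks_def)
    qed
    from this[of 0] this[of 1] show "S ! q ! 0 = ss ! (2 * q)" "S ! q ! 1 = ss ! (2 * q + 1)"
      by (simp_all add: mult.commute)
  qed
  have C: "C ! k ! i = ss ! (2 * r0 + k * (p + 1) + i)" if "k < r1" "i \<le> p" for k i
  proof -
    have "length (drop (r0 * 2) ss) = r1 * (p + 1)" using lenF by simp
    then have "C ! k ! i = drop (r0 * 2) ss ! (k * (p + 1) + i)"
      unfolding C_def using that by (intro nth_chunks) auto
    then show ?thesis using lenF by (simp add: ac_simps)
  qed
  have hv0: "hv h (2 * q * (d + 2)) y = hx (S ! q ! 0) y" "hv h ((2 * q + 1) * (d + 2)) y = hx (S ! q ! 1) y"
    if "q < r0" for q y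
    using that hv[of "2 * q"] hv[of "2 * q + 1"] S[OF that] by simp_all
  have hv1: "hv h (cptr k i) y = hx (C ! k ! i) y" if "k < r1" "i \<le> p" for k i y
  proof -
    have "(k + 1) * (p + 1) \<le> r1 * (p + 1)" using that by (intro mult_le_mono1) simp
    then have "2 * r0 + k * (p + 1) + i < F" using that by simp
    then show ?thesis unfolding cptr_def C[OF that] by (rule hv)
  qed
  have stored: "stored h j = covered0 j S" if j: "j < D" for j
  proof -
    have "h (slot0 h j q y) = content0 j (S ! q) (hx (S ! q ! 1) y mod m0)" if q: "q < r0" for q y
    proof -
      have "built0 h j q" using built[OF j] q by (simp add: all_built_def)
      moreover have "x0 h q = (\<lambda>c. hx (S ! q ! 0) (start_key c))"
        by (intro ext) (simp only: x0_def hv0[OF q])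
      ultimately show ?thesis
        unfolding built0_def slot0_def content0_def using m_pos by (simp only: hv0[OF q] mod_less_divisor)
    qed
    then show ?thesis unfolding stored_def covered0_def by auto
  qed
  show ?thesis
    unfolding complete_def
  proof (intro allI impI)
    fix j x assume j: "j < D" and x: "x < N"
    interpret R: rainbow seedp hx n Keys N "gk j" "covered0 j S" heavy_threshold
      by (rule rainbow_good[OF bad(1) j])
    have stp: "stp h j (cptr k i) = R.step (C ! k ! i)" if "k < r1" "i \<le> p" for k i
      by (intro ext) (simp add: stp_def R.step_def hv1[OF that] stored[OF j])
    have wk: "wk h j k 0 i y = walk R.step (C ! k) i y" if "k < r1" "i \<le> p" for k i y
      unfolding wk_def walk_def by (rule fold_cong) (use that stp in auto)
    show "gk j x \<in> stored h j \<or> (\<exists>k<r1. \<exists>a<p. \<exists>i<p.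
        chain_val h j k (chain_end h j (gk j x) k a) i < N \<and>
        gk j (chain_val h j k (chain_end h j (gk j x) k a) i) = gk j x)"
    proof (cases "gk j x \<in> stored h j")
      case False
      then obtain k where k: "k < r1" "R.covers start_key M1 p m1 x (C ! k)"
        using bad(2) j x unfolding bad1_def stored[OF j] by auto
      then obtain c i where c: "c < M1" "i < p" "R.visits i (C ! k) (start_key c) = x"
        and iso: "\<And>c'. c' < M1 \<Longrightarrow> c' \<noteq> c \<Longrightarrow> R.endslot m1 p (C ! k) (start_key c') \<noteq> R.endslot m1 p (C ! k) (start_key c)"
        unfolding R.covers_def by blast
      have val: "chain_val h j k c i = x"
        using c k hv1[of k i] wk[of k i] by (simp add: chain_val_def R.visits_def)
      have slot: "hv h (cptr k p) (wk h j k 0 p (start_key c')) mod m1 = R.endslot m1 p (C ! k) (start_key c')" for c'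
        using k hv1[of k p] wk[of k p] by (simp add: R.endslot_def)
      \<comment> \<open>The visit of \<open>x\<close> moves the chain to \<open>gk j x\<close>,
        since that value was not caught; from the next column on both walks coincide.\<close>
      have split: "wk h j k 0 p (start_key c) = wk h j k (Suc i) p (gk j x)"
      proof -
        have "[0..<p] = [0..<Suc i] @ [Suc i..<p]"
          using c(2) upt_add_eq_append[of 0 "Suc i" "p - Suc i"] by simp
        then have "wk h j k 0 p (start_key c) = wk h j k (Suc i) p (wk h j k 0 (Suc i) (start_key c))"
          unfolding wk_def by (simp only: fold_append o_apply)
        also have "wk h j k 0 (Suc i) (start_key c) = stp h j (cptr k i) (wk h j k 0 i (start_key c))"
          by (simp add: wk_Suc)
        also have "\<dots> = gk j x"
          using val x False by (simp add: stp_def chain_val_def)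
        finally show ?thesis .
      qed
      let ?P = "\<lambda>c'. hv h (cptr k p) (wk h j k 0 p (start_key c')) mod m1 = R.endslot m1 p (C ! k) (start_key c)"
      \<comment> \<open>\<open>c\<close> is among the writers of this slot, and isolation excludes
        any other.\<close>
      have "\<exists>c'<M1. ?P c'" using c(1) slot by blast
      then obtain c' where c': "c' < M1" "?P c'" "last_write ?P (\<lambda>c. c) M1 = c'"
        by (rule last_write_cases)
      have "c' = c" using iso[of c'] c' slot by auto
      have b1: "built1 h j k" using built[OF j] k by (simp add: all_built_def)
      have "R.endslot m1 p (C ! k) (start_key c) < m1" using m_pos by (simp add: R.endslot_def)
      from b1[unfolded built1_def, rule_format, OF this]
      have h: "h (H + j * Z + r0 * m0 + k * m1 + R.endslot m1 p (C ! k) (start_key c)) = c"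
        unfolding c'(3) \<open>c' = c\<close> .
      have ce: "chain_end h j (gk j x) k i = c"
        unfolding chain_end_def slot1_def split[symmetric] slot by (rule h)
      have "chain_val h j k (chain_end h j (gk j x) k i) i < N \<and>
        gk j (chain_val h j k (chain_end h j (gk j x) k i) i) = gk j x"
        unfolding ce val using x by (rule conjI) (rule refl)
      then show ?thesis using k(1) c(2) by (intro disjI2) blast
    qed simp
  qed
qed

lemma builds_if_not_bad:
  assumes "tables (map (\<lambda>a. \<omega> a mod B) [0..<H]) \<notin> bad"
  shows "builds_box_structure M N [N, w, A] construct answer construct_time (H + D * Z) answer_time \<omega>"
proof -
  have step: "stepT = step_time" by (simp only: stepT_def step_time_def)
  have c: "initT + 1 + (9 + (2 + H * 4) + buildT + 1) = construct_time"
    by (simp only: construct_time_def step fill_time_def)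
  have a: "2 * len + 2 * p + 10 + (9 + ram_query.queryT d \<tau> p r0 r1 D) = answer_time"
    by (simp only: answer_time_def step probe_time_def)
  obtain t s where s: "exec M \<omega> construct (start [N, w, A] (\<lambda>_. 0)) t s" "t \<le> construct_time" "regs s 0 = H + D * Z"
    "\<And>a. a < H \<Longrightarrow> mem s a = \<omega> a mod B" "\<And>j. j < D \<Longrightarrow> all_built (mem s) j"
    using wp_construct unfolding wp_def c by blast
  let ?h = "\<lambda>a. if a < regs s 0 then mem s a else 0"
  have "complete ?h"
  proof (rule complete_if_not_bad[OF _ _ _ assms])
    fix j assume j: "j < D"
    \<comment> \<open>All tables end at or before address \<open>H + D * Z\<close>, so erasing the
      rest of the memory leaves them intact.\<close>
    have "(j + 1) * Z \<le> D * Z" using j by (intro mult_le_mono1) simp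
    then have "all_built ?h j = all_built (mem s) j"
      by (intro all_built_cong) (simp add: s(3))
    then show "all_built ?h j" using s(5) j by simp
  qed (use s(3,4) in auto)
  then show ?thesis
    unfolding builds_box_structure_def using s(1,2,3) answers_box_guard[unfolded a] by fastforce
qed

text \<open>Construction consumes exactly \<open>H\<close> random words, so success is decided by
  them; this makes the success event measurable.\<close>

lemma builds_random_cong:
  assumes "builds_box_structure M N [N, w, A] construct answer T1 T2 T3 \<omega>" "\<And>a. a < H \<Longrightarrow> \<omega> a = \<omega>' a"
  shows "builds_box_structure M N [N, w, A] construct answer T1 T2 T3 \<omega>'"
proof -
  obtain t0 s0 where 0: "exec M \<omega> construct (start [N, w, A] (\<lambda>_. 0)) t0 s0" "rand_used s0 = H"
    using wp_construct unfolding wp_def by blast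
  obtain t s where 1: "exec M \<omega> construct (start [N, w, A] (\<lambda>_. 0)) t s" and 2: "t \<le> T1 \<and> regs s 0 \<le> T2 \<and>
     (\<forall>lo hi. (\<forall>i<fn_dim M. lo i < 2 ^ word_bits M \<and> hi i < 2 ^ word_bits M) \<longrightarrow>
           answers_box M N [N, w, A] answer (\<lambda>a. if a < regs s 0 then mem s a else 0) T3 lo hi)"
    using assms(1) unfolding builds_box_structure_def by blast
  have "s = s0" using exec_deterministic[OF 0(1) 1] by simp
  then have "exec M \<omega>' construct (start [N, w, A] (\<lambda>_. 0)) t s"
    using exec_random_cong[OF 1] assms(2) 0(2) by simp
  then show ?thesis unfolding builds_box_structure_def using 2 by blast
qed

lemma prob_tables_bad:
  "measure_pmf.prob (replicate_pmf H (uniform_words (sh + len))) {ws. tables ws \<in> bad}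
    \<le> D * N * (31 / 32) ^ r0 + D * N * (1 - real M1 * p / (4 * n)) ^ r1"
proof -
  have "measure_pmf.prob (replicate_pmf (F * (d + 2)) (uniform_words (sh + len))) {ws. tables ws \<in> bad}
    = measure_pmf.prob (bind_pmf (replicate_pmf r0 (replicate_pmf 2 seedp))
     (\<lambda>S. map_pmf (Pair S) (replicate_pmf r1 (replicate_pmf (p + 1) seedp)))) bad"
    unfolding tables_def by (subst prob_two_level[symmetric]) (simp only: Let_def)
  then show ?thesis unfolding H_eq using prob_bad by simp
qed

end

context box_instance
begin

lemma builds_prob:
  assumes guard
  defines "\<delta> \<equiv> real (D * N) * (31 / 32) ^ r0 + real (D * N) * (1 - real M1 * p / (4 * 2 ^ len)) ^ r1"
  shows "1 - \<delta> \<le> measure (random_words (sh + len)) {\<omega>. builds_box_structure M N [N, w, A] construct answer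
     construct_time (H + D * Z) answer_time \<omega>}"
    (is "_ \<le> measure ?W {\<omega>. ?builds \<omega>}")
proof -
  have G: "box_guard d e K N w \<tau> A f tm" by (unfold_locales) (rule assms(1))
  interpret G0: box_guard d e K N w \<tau> A f tm "\<lambda>_. 0" by (rule G)
  let ?B = "2 ^ (sh + len) :: nat"
  let ?E = "{ws. G0.tables (map (\<lambda>a. a mod ?B) ws) \<notin> G0.bad}"
  let ?P = "measure_pmf.prob (replicate_pmf H (uniform_words (sh + len)))"
  have sub: "?builds \<omega>" if "map \<omega> [0..<H] \<in> ?E" for \<omega>
  proof -
    interpret G: box_guard d e K N w \<tau> A f tm \<omega> by (rule G)
    show ?thesis by (rule G.builds_if_not_bad) (use that in \<open>simp add: o_def\<close>)
  qed
  have cong: "?builds \<omega>'" if "?builds \<omega>" "map \<omega> [0..<H] = map \<omega>' [0..<H]" for \<omega> \<omega>'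
  proof -
    interpret G: box_guard d e K N w \<tau> A f tm \<omega> by (rule G)
    show ?thesis by (rule G.builds_random_cong[OF that(1)]) (use that(2) in auto)
  qed
  \<comment> \<open>An event on prefixes of length \<open>H\<close>, to which
    \<open>prefix_measurable\<close> applies.\<close>
  have eq: "{\<omega>. ?builds \<omega>} = {\<omega>. map \<omega> [0..<H] \<in> {ws. \<exists>\<omega>. map \<omega> [0..<H] = ws \<and> ?builds \<omega>}}"
    using cong by blast
  have meas: "{\<omega>. ?builds \<omega>} \<in> sets ?W" by (subst eq) (rule prefix_measurable)
  interpret prob_space ?W
    unfolding random_words_def by (intro prob_space_PiM) (rule measure_pmf.prob_space_axioms)
  have "1 - ?P {ws. G0.tables ws \<in> G0.bad} = ?P {ws. G0.tables ws \<notin> G0.bad}"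
    using measure_pmf.prob_compl[of "{ws. G0.tables ws \<in> G0.bad}" "replicate_pmf H (uniform_words (sh + len))"]
    by (simp add: Compl_eq_Diff_UNIV[symmetric] Collect_neg_eq)
  also have "\<dots> \<le> ?P ?E"
  proof (rule measure_pmf.finite_measure_mono_AE)
    show "AE ws in measure_pmf (replicate_pmf H (uniform_words (sh + len))).
        ws \<in> {ws. G0.tables ws \<notin> G0.bad} \<longrightarrow> ws \<in> ?E"
      unfolding AE_measure_pmf_iff
    proof
      fix ws assume "ws \<in> set_pmf (replicate_pmf H (uniform_words (sh + len)))"
      \<comment> \<open>Samples are already below the word size, so the reduction performed by
        \<open>Rand\<close> acts as the identity.\<close>
      then have "map (\<lambda>a. a mod ?B) ws = ws"
        by (intro map_idI) (auto simp: set_replicate_pmf)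
      then show "ws \<in> {ws. G0.tables ws \<notin> G0.bad} \<longrightarrow> ws \<in> ?E" by simp
    qed
  qed simp
  also have "\<dots> = measure ?W {\<omega>. map \<omega> [0..<H] \<in> ?E}" by (rule prob_prefix[symmetric])
  also have "\<dots> \<le> measure ?W {\<omega>. ?builds \<omega>}"
    by (rule finite_measure_mono) (use sub meas in auto)
  finally show ?thesis using G0.prob_tables_bad unfolding \<delta>_def by simp
qed

lemma builds_small:
  assumes "\<not> guard"
  shows "builds_box_structure M N [N, w, A] construct answer (2 * len + 2 * p + 8) 0
    (2 * len + 2 * p + 10 + (2 + N * (\<tau> + 6))) \<omega>"
proof -
  obtain t s where s: "exec M \<omega> construct (start [N, w, A] (\<lambda>_. 0)) t s" "t \<le> 2 * len + 2 * p + 8" "regs s 0 = 0"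
    using wp_construct_small[OF assms, of \<omega> "\<lambda>_. 0"] unfolding wp_def by blast
  then show ?thesis unfolding builds_box_structure_def using answers_box_small[OF assms] by fastforce
qed

end

section \<open>Asymptotics\<close>

text \<open>Keeps only the exponent of a bound, so that time and space estimates become additions of
  exponents.\<close>

definition soft_pow :: "real \<Rightarrow> (nat \<Rightarrow> nat) \<Rightarrow> bool" where
  "soft_pow a F \<longleftrightarrow> (\<lambda>N. real (F N)) \<in> soft_O (\<lambda>N. real N powr a)"

lemma ln_power_bigo: "j \<le> k \<Longrightarrow> (\<lambda>N. ln (real N) ^ j) \<in> O(\<lambda>N. ln (real N) ^ k)"
proof (rule landau_o.big_mono)
  assume "j \<le> k"
  have "eventually (\<lambda>N. 1 \<le> ln (real N)) sequentially"
    using filterlim_compose[OF ln_at_top filterlim_real_sequentially] by (auto simp: filterlim_at_top)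
  then show "eventually (\<lambda>N. norm (ln (real N) ^ j) \<le> norm (ln (real N) ^ k)) sequentially"
    by eventually_elim (use \<open>j \<le> k\<close> in \<open>auto simp: power_abs intro!: power_increasing\<close>)
qed

lemma soft_pow_iff: "soft_pow a F \<longleftrightarrow> (\<exists>k. (\<lambda>N. real (F N)) \<in> O(\<lambda>N. real N powr a * ln (real N) ^ k))"
  by (simp add: soft_pow_def soft_O_def)

lemma soft_powI: "(\<lambda>N. real (F N)) \<in> O(\<lambda>N. real N powr a * ln (real N) ^ k) \<Longrightarrow> soft_pow a F"
  by (auto simp: soft_pow_iff)

lemma soft_pow_mono: "soft_pow a F \<Longrightarrow> a \<le> b \<Longrightarrow> soft_pow b F"
proof -
  assume F: "soft_pow a F" and "a \<le> b"
  have "(\<lambda>N. real N powr a) \<in> O(\<lambda>N. real N powr b)"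
    by (rule landau_o.big_mono, rule eventually_mono[OF eventually_ge_at_top[of 1]])
      (use \<open>a \<le> b\<close> in \<open>auto intro: powr_mono\<close>)
  then have "(\<lambda>N. real N powr a * ln (real N) ^ k) \<in> O(\<lambda>N. real N powr b * ln (real N) ^ k)" for k
    by (rule landau_o.big.mult_right)
  then show ?thesis using F unfolding soft_pow_iff by (meson landau_o.big_trans)
qed

lemma soft_pow_le: "soft_pow a G \<Longrightarrow> (\<And>N. 0 < N \<Longrightarrow> F N \<le> G N) \<Longrightarrow> soft_pow a F"
proof -
  assume G: "soft_pow a G" and "\<And>N. 0 < N \<Longrightarrow> F N \<le> G N"
  then have "(\<lambda>N. real (F N)) \<in> O(\<lambda>N. real (G N))"
    by (intro landau_o.big_mono eventually_mono[OF eventually_gt_at_top[of 0]]) auto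
  then show ?thesis using G unfolding soft_pow_iff by (meson landau_o.big_trans)
qed

text \<open>Growth is insensitive to finitely many \<open>N\<close>, which takes care of those where
  the guard fails.\<close>

lemma soft_pow_eventually: "soft_pow a G \<Longrightarrow> eventually (\<lambda>N. F N = G N) sequentially \<Longrightarrow> soft_pow a F"
proof -
  assume G: "soft_pow a G" and "eventually (\<lambda>N. F N = G N) sequentially"
  then have "eventually (\<lambda>N. real (F N) = real (G N)) sequentially" by (auto elim: eventually_mono)
  from landau_o.big.in_cong[OF this] show ?thesis using G unfolding soft_pow_iff by simp
qed

lemma soft_pow_add: "soft_pow a F \<Longrightarrow> soft_pow a G \<Longrightarrow> soft_pow a (\<lambda>N. F N + G N)"
proof -
  assume "soft_pow a F" "soft_pow a G"
  then obtain j k where jk: "(\<lambda>N. real (F N)) \<in> O(\<lambda>N. real N powr a * ln (real N) ^ j)"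
    "(\<lambda>N. real (G N)) \<in> O(\<lambda>N. real N powr a * ln (real N) ^ k)"
    unfolding soft_pow_iff by blast
  have "(\<lambda>N. real N powr a * ln (real N) ^ i) \<in> O(\<lambda>N. real N powr a * ln (real N) ^ (j + k))"
    if "i \<le> j + k" for i
    by (rule landau_o.big.mult_left[OF ln_power_bigo[OF that]])
  then have "(\<lambda>N. real (F N)) \<in> O(\<lambda>N. real N powr a * ln (real N) ^ (j + k))"
    "(\<lambda>N. real (G N)) \<in> O(\<lambda>N. real N powr a * ln (real N) ^ (j + k))"
    using jk by (auto intro: landau_o.big_trans)
  from sum_in_bigo(1)[OF this] show ?thesis by (intro soft_powI) simp
qed

lemma soft_pow_mult: "soft_pow a F \<Longrightarrow> soft_pow b G \<Longrightarrow> soft_pow (a + b) (\<lambda>N. F N * G N)"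
proof -
  assume "soft_pow a F" "soft_pow b G"
  then obtain j k where jk: "(\<lambda>N. real (F N)) \<in> O(\<lambda>N. real N powr a * ln (real N) ^ j)"
    "(\<lambda>N. real (G N)) \<in> O(\<lambda>N. real N powr b * ln (real N) ^ k)"
    unfolding soft_pow_iff by blast
  have "(\<lambda>N. real (F N) * real (G N)) \<in>
      O(\<lambda>N. (real N powr a * ln (real N) ^ j) * (real N powr b * ln (real N) ^ k))"
    by (rule landau_o.big.mult[OF jk])
  also have "(\<lambda>N. (real N powr a * ln (real N) ^ j) * (real N powr b * ln (real N) ^ k)) =
      (\<lambda>N. real N powr (a + b) * ln (real N) ^ (j + k))"
    by (simp add: powr_add power_add ac_simps)
  finally show ?thesis by (intro soft_powI) simp
qed

lemma soft_pow_mult0: "soft_pow 0 F \<Longrightarrow> soft_pow a G \<Longrightarrow> soft_pow a (\<lambda>N. F N * G N)"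
  using soft_pow_mult[of 0 F a G] by simp

lemma soft_pow_const: "0 \<le> a \<Longrightarrow> soft_pow a (\<lambda>_. k)"
proof -
  have "(\<lambda>N. real k) \<in> O(\<lambda>N. real N powr 0 * ln (real N) ^ 0)"
    by (intro landau_o.bigI[of "real k + 1"] eventually_mono[OF eventually_gt_at_top[of 0]]) auto
  from soft_powI[OF this] show "0 \<le> a \<Longrightarrow> soft_pow a (\<lambda>_. k)" by (rule soft_pow_mono)
qed

lemma soft_pow_power: "soft_pow 0 F \<Longrightarrow> soft_pow 0 (\<lambda>N. F N ^ k)"
  by (induction k) (simp_all add: soft_pow_const soft_pow_mult0)

lemma soft_pow_real:
  assumes "\<And>N. 0 < N \<Longrightarrow> real (F N) \<le> C * real N powr a"
  shows "soft_pow a F"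
proof -
  have "norm (real (F N)) \<le> (\<bar>C\<bar> + 1) * norm (real N powr a * ln (real N) ^ 0)" if "0 < N" for N
  proof -
    have "real (F N) \<le> C * real N powr a" by (rule assms[OF that])
    also have "\<dots> \<le> (\<bar>C\<bar> + 1) * real N powr a" by (intro mult_right_mono) auto
    finally show ?thesis by simp
  qed
  then have "(\<lambda>N. real (F N)) \<in> O(\<lambda>N. real N powr a * ln (real N) ^ 0)"
    by (intro landau_o.bigI[of "\<bar>C\<bar> + 1"] eventually_mono[OF eventually_gt_at_top[of 0]]) auto
  then show ?thesis by (rule soft_powI)
qed

lemma soft_O_one: "(\<lambda>N. real (F N)) \<in> soft_O (\<lambda>_. 1) \<Longrightarrow> soft_pow 0 F"
proof -
  assume "(\<lambda>N. real (F N)) \<in> soft_O (\<lambda>_. 1)"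
  then obtain k where "(\<lambda>N. real (F N)) \<in> O(\<lambda>N. ln (real N) ^ k)" by (auto simp: soft_O_def)
  also have "(\<lambda>N. ln (real N) ^ k) \<in> O(\<lambda>N. real N powr 0 * ln (real N) ^ k)"
    by (intro landau_o.big_mono eventually_mono[OF eventually_gt_at_top[of 0]]) auto
  finally show ?thesis by (rule soft_powI)
qed

lemma soft_pow_one: "soft_pow 1 F \<Longrightarrow> (\<lambda>N. real (F N)) \<in> soft_O (\<lambda>N. real N)"
  by (simp add: soft_pow_def soft_O_def)

lemma soft_pow_floorlog: "soft_pow 0 (floorlog 2)"
proof -
  have "eventually (\<lambda>N. real (floorlog 2 N) \<le> 3 * ln (real N)) sequentially"
  proof (rule eventually_mono[OF eventually_gt_at_top[of 3]])
    fix N :: nat assume N: "3 < N"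
    have "1 \<le> ln (real N)"
      using N exp_le by (subst ln_ge_iff) auto
    moreover have "real (floorlog 2 N) \<le> log 2 (real N) + 1"
      using N by (simp add: floorlog_def) 
    moreover have "log 2 (real N) \<le> 2 * ln (real N)"
    proof -
      have "1 / 2 \<le> ln (2::real)" using ln2_ge_two_thirds by simp
      then have "1 / ln 2 \<le> (2::real)" by (simp add: field_simps)
      then have "ln (real N) * (1 / ln 2) \<le> ln (real N) * 2"
        using N by (intro mult_left_mono) auto
      then show ?thesis by (simp add: log_def mult.commute)
    qed
    ultimately show "real (floorlog 2 N) \<le> 3 * ln (real N)" by linarith
  qed
  then have "eventually (\<lambda>N. norm (real (floorlog 2 N)) \<le> 3 * norm (real N powr 0 * ln (real N) ^ 1)) sequentially"
    using eventually_gt_at_top[of 1] by eventually_elim (simp add: abs_of_nonneg)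
  from soft_powI[OF landau_o.bigI[OF _ this]] show ?thesis by simp
qed

text \<open>Substitute \<open>(1 - a) * ln N\<close> for \<open>x\<close> in
  \<open>x ^ k / exp x\<close>, which tends to 0.\<close>

lemma powr_mult_ln_smallo:
  assumes "a < 1"
  shows "(\<lambda>N. real N powr a * ln (real N) ^ k) \<in> o(\<lambda>N. real N)"
proof (rule smalloI_tendsto)
  let ?b = "1 - a"
  have "filterlim (\<lambda>N. ?b * ln (real N)) at_top sequentially"
    using assms filterlim_compose[OF ln_at_top filterlim_real_sequentially]
    by (intro filterlim_tendsto_pos_mult_at_top[OF tendsto_const]) auto
  from filterlim_compose[OF tendsto_power_div_exp_0 this]
  have "(\<lambda>N. (1 / ?b) ^ k * ((?b * ln (real N)) ^ k / exp (?b * ln (real N)))) \<longlonglongrightarrow> (1 / ?b) ^ k * 0"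
    by (rule tendsto_mult_left)
  then have lim: "(\<lambda>N. (1 / ?b) ^ k * ((?b * ln (real N)) ^ k / exp (?b * ln (real N)))) \<longlonglongrightarrow> 0"
    by (simp only: mult_zero_right)
  show "(\<lambda>N. real N powr a * ln (real N) ^ k / real N) \<longlonglongrightarrow> 0"
  proof (rule Lim_transform_eventually[OF lim], rule eventually_mono[OF eventually_gt_at_top[of 0]])
    fix N :: nat assume "0 < N"
    then have 1: "1 / exp (?b * ln (real N)) = real N powr a / real N"
      by (simp add: powr_def exp_diff left_diff_distrib)
    have 2: "(1 / ?b) ^ k * (?b * ln (real N)) ^ k = ln (real N) ^ k"
      using assms by (simp flip: power_mult_distrib)
    have "(1 / ?b) ^ k * ((?b * ln (real N)) ^ k / exp (?b * ln (real N))) =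
        ((1 / ?b) ^ k * (?b * ln (real N)) ^ k) * (1 / exp (?b * ln (real N)))"
      by (simp only: times_divide_eq_right mult_1_right)
    also have "\<dots> = real N powr a * ln (real N) ^ k / real N"
      unfolding 1 2 by (simp add: mult.commute)
    finally show "(1 / ?b) ^ k * ((?b * ln (real N)) ^ k / exp (?b * ln (real N))) =
        real N powr a * ln (real N) ^ k / real N" .
  qed
next
  show "eventually (\<lambda>N. real N \<noteq> 0) sequentially"
    by (rule eventually_mono[OF eventually_gt_at_top[of 0]]) simp
qed

lemma soft_pow_less:
  assumes "soft_pow a F" "a < 1"
  shows "eventually (\<lambda>N. F N \<le> N) sequentially"
proof -
  obtain k where k: "(\<lambda>N. real (F N)) \<in> O(\<lambda>N. real N powr a * ln (real N) ^ k)"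
    using assms(1) by (auto simp: soft_pow_iff)
  also have "(\<lambda>N. real N powr a * ln (real N) ^ k) \<in> o(\<lambda>N. real N)"
    by (rule powr_mult_ln_smallo) (rule assms(2))
  finally have "eventually (\<lambda>N. norm (real (F N)) \<le> 1 * norm (real N)) sequentially"
    by (rule landau_o.smallD) simp
  then show ?thesis by simp
qed

context box_instance
begin

text \<open>Each of the two powers is at most \<open>1 / N ^ e\<close>. The two union bounds over
  \<open>D * N\<close> events together cost at most \<open>N ^ 3\<close>, which
  \<open>e \<ge> c + 3\<close> absorbs.\<close>

lemma failure_bound:
  assumes guard and e: "c + 3 \<le> real e"
  shows "real (D * N) * (31 / 32) ^ r0 + real (D * N) * (1 - real M1 * p / (4 * 2 ^ len)) ^ r1 \<le> 1 / real N powr c"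
proof -
  have N: "16 \<le> N" "D \<le> N" "64 * (p * p) \<le> N" using assms(1) by (auto simp: guard_def G_def)
  \<comment> \<open>Applied with \<open>1 - y \<le> exp (- y)\<close>; an exponent of
    \<open>e * len\<close> suffices because
    \<open>exp 1 ^ len \<ge> 2 ^ len \<ge> N\<close>.\<close>
  have small: "x ^ r \<le> 1 / real N ^ e" if x: "0 \<le> x" "x \<le> exp (- y)" and r: "real (e * len) \<le> y * r" for x y :: real and r
  proof -
    have "x ^ r \<le> exp (- y) ^ r" using x by (rule power_mono[rotated])
    also have "\<dots> = exp (- (y * r))" by (simp add: exp_of_nat_mult[symmetric] mult.commute)
    also have "\<dots> \<le> exp (- real (e * len))" using r by simp
    also have "\<dots> = 1 / (exp 1 ^ len) ^ e"
      by (simp add: exp_minus exp_of_nat_mult[symmetric] divide_inverse mult.commute)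
    also have "\<dots> \<le> 1 / real N ^ e"
    proof -
      have "real N \<le> 2 ^ len" using len_bounds(1) by (metis less_imp_le of_nat_le_iff of_nat_numeral of_nat_power)
      also have "\<dots> \<le> exp 1 ^ len" using exp_ge_add_one_self[of 1] by (intro power_mono) auto
      finally have "real N ^ e \<le> (exp 1 ^ len) ^ e" by (intro power_mono) auto
      then show ?thesis using N0 by (intro divide_left_mono) auto
    qed
    finally show ?thesis .
  qed
  have 1: "(31 / 32 :: real) ^ r0 \<le> 1 / real N ^ e"
  proof (rule small[where y = "1 / 32"])
    show "(31 / 32 :: real) \<le> exp (- (1 / 32))" using exp_ge_add_one_self[of "- (1 / 32)"] by simp
  qed (simp_all add: r0_def)
  let ?q = "real M1 * p / (4 * 2 ^ len)"
  have n: "real N \<le> 2 ^ len" "2 ^ len \<le> 2 * real N"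
  proof -
    show "real N \<le> 2 ^ len" using len_bounds(1) by (metis less_imp_le of_nat_le_iff of_nat_numeral of_nat_power)
    have "(2::nat) ^ len = 2 * 2 ^ (len - 1)" using len_bounds(3) by (cases len) auto
    then have "2 ^ len \<le> 2 * N" using len_bounds(2) by linarith
    then have "real (2 ^ len) \<le> real (2 * N)" by (rule of_nat_mono)
    then show "2 ^ len \<le> 2 * real N" by simp
  qed
  have 2: "(1 - ?q) ^ r1 \<le> 1 / real N ^ e"
  proof (rule small[where y = ?q])
    show "1 - ?q \<le> exp (- ?q)" using exp_ge_add_one_self[of "- ?q"] by simp
    have "M1 * p \<le> M1 * (64 * (p * p))" using p_props(4) by (intro mult_le_mono) auto
    also have "\<dots> \<le> N" unfolding M1_def by simp
    finally have "real (M1 * p) \<le> real N" by (rule of_nat_mono)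
    then have "real M1 * p \<le> 4 * 2 ^ len" using n(1) unfolding of_nat_mult by linarith
    then show "0 \<le> 1 - ?q" by (simp add: divide_le_eq)
    \<comment> \<open>Rounding down costs at most a factor 2 because \<open>M1 \<ge> 1\<close>. With
      \<open>2 ^ len \<le> 2 * N\<close> this gives \<open>?q \<ge> 1 / (1024 * p)\<close>.\<close>
    have "N \<le> M1 * (128 * (p * p))"
    proof -
      let ?k = "64 * (p * p)"
      have k: "0 < ?k" using p_props(4) by simp
      have "N = M1 * ?k + N mod ?k" unfolding M1_def by (rule div_mult_mod_eq[symmetric])
      moreover have "N mod ?k < ?k" using k by (rule mod_less_divisor)
      moreover have "1 * ?k \<le> M1 * ?k" using guard_bounds(9)[OF assms(1)] by (rule mult_le_mono1)
      ultimately show ?thesis by linarith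
    qed
    then have "real N \<le> real (M1 * (128 * (p * p)))" by (rule of_nat_mono)
    then have "2 ^ len \<le> 256 * (real M1 * (real p * real p))" using n(2) by simp
    then have "real (e * len) * 2 ^ len \<le> real (e * len) * (256 * (real M1 * (real p * real p)))"
      by (rule mult_left_mono) simp
    then show "real (e * len) \<le> ?q * r1" by (simp add: r1_def field_simps)
  qed
  have "real (D * N) * (31 / 32) ^ r0 + real (D * N) * (1 - ?q) ^ r1 \<le>
      real (D * N) * (1 / real N ^ e) + real (D * N) * (1 / real N ^ e)"
    using 1 2 by (intro add_mono mult_left_mono) auto
  also have "\<dots> = 2 * real D * real N / real N ^ e" by simp
  also have "\<dots> \<le> real N ^ 3 / real N ^ e"
  proof (rule divide_right_mono)
    have "2 * D * N \<le> N * N * N" using N by (intro mult_le_mono) auto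
    then have "real (2 * D * N) \<le> real (N * N * N)" by (rule of_nat_mono)
    then show "2 * real D * real N \<le> real N ^ 3" by (simp add: power3_eq_cube)
  qed simp
  also have "\<dots> = real N powr 3 / real N powr e"
    using N0 by (simp add: powr_realpow)
  also have "\<dots> = real N powr (3 - real e)" by (rule powr_diff[symmetric])
  also have "\<dots> \<le> real N powr (- c)" using e N0 by (intro powr_mono) auto
  also have "\<dots> = 1 / real N powr c" by (simp add: powr_minus divide_inverse)
  finally show ?thesis .
qed

end

section \<open>Exponents of the time and space bounds as \<open>N\<close> grows\<close>

locale box_family = box_programs d e K for d e K :: nat +
  fixes \<alpha> :: real and w \<tau> :: "nat \<Rightarrow> nat"
  assumes \<alpha>: "0 < \<alpha>" "\<alpha> < 1" and K: "G + 8 \<le> K" and soft_w: "soft_pow 0 w" and soft_\<tau>: "soft_pow 0 \<tau>"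
begin

abbreviation "A N \<equiv> nat \<lceil>real N powr \<alpha>\<rceil>"

lemma family_instance:
  assumes N: "0 < N" and f: "\<And>x i. x < N \<Longrightarrow> i < d \<Longrightarrow> f x i < 2 ^ w N" and tm: "\<And>x. x < N \<Longrightarrow> tm x \<le> \<tau> N"
  shows "box_instance d e K N (w N) (\<tau> N) (A N) f tm"
proof
  have "1 \<le> real N powr \<alpha>" using N \<alpha> by (intro ge_one_powr_ge_zero) auto
  then show "1 \<le> A N" by linarith
  have "real N powr \<alpha> \<le> real N powr 1" using N \<alpha> by (intro powr_mono) auto
  then show "A N \<le> N" using N by (simp add: nat_le_iff ceiling_le_iff)
qed (use assms K in auto)

lemma inst: "0 < N \<Longrightarrow> box_instance d e K N (w N) (\<tau> N) (A N) (\<lambda>_ _. 0) (\<lambda>_. 0)"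
  by (rule family_instance) auto

lemma soft_len: "soft_pow 0 box_instance.len"
  by (rule soft_pow_le[OF soft_pow_floorlog]) (simp add: box_instance.len_def[OF inst])

text \<open>Rounding up from the real cube root at most doubles it, since the root is at least
  1.\<close>

lemma p_bounds:
  assumes "0 < N"
  shows "real N powr (\<alpha> / 3) \<le> box_instance.p (A N)" "real (box_instance.p (A N)) \<le> 2 * real N powr (\<alpha> / 3)"
proof -
  interpret box_instance d e K N "w N" "\<tau> N" "A N" "\<lambda>_ _. 0" "\<lambda>_. 0" by (rule inst[OF assms])
  have cube: "(real N powr (\<alpha> / 3)) ^ 3 = real N powr \<alpha>"
    using assms by (simp flip: powr_realpow add: powr_powr)
  have "real N powr \<alpha> \<le> real (A N)" by (rule real_nat_ceiling_ge)
  also have "\<dots> \<le> real p ^ 3" using p_props(1) by (metis of_nat_le_iff of_nat_power)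
  finally have "\<not> real p ^ 3 < (real N powr (\<alpha> / 3)) ^ 3" unfolding cube by simp
  then show "real N powr (\<alpha> / 3) \<le> p"
    using power_strict_mono[of "real p" "real N powr (\<alpha> / 3)" 3] by (cases "real p < real N powr (\<alpha> / 3)") auto
  have "real (p - 1) < real N powr (\<alpha> / 3)"
  proof (rule power_less_imp_less_base)
    have "(p - 1) ^ 3 < A N" using p_props(3,4) by simp
    then have "real ((p - 1) ^ 3) < real N powr \<alpha>" by linarith
    then show "real (p - 1) ^ 3 < (real N powr (\<alpha> / 3)) ^ 3" unfolding cube by simp
  qed simp
  moreover have "1 \<le> real N powr (\<alpha> / 3)" using assms \<alpha> by (intro ge_one_powr_ge_zero) auto
  ultimately show "real p \<le> 2 * real N powr (\<alpha> / 3)" using p_props(4) by (simp add: of_nat_diff)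
qed

lemma soft_p: "soft_pow (\<alpha> / 3) (\<lambda>N. box_instance.p (A N))"
  using p_bounds(2) by (rule soft_pow_real)

lemma soft_M1: "soft_pow (1 - 2 * (\<alpha> / 3)) (\<lambda>N. box_instance.M1 N (A N))"
proof (rule soft_pow_real[where C = 1])
  fix N :: nat assume N: "0 < N"
  interpret box_instance d e K N "w N" "\<tau> N" "A N" "\<lambda>_ _. 0" "\<lambda>_. 0" by (rule inst[OF N])
  have "M1 * (p * p) \<le> M1 * (64 * (p * p))" by simp
  also have "\<dots> \<le> N" unfolding M1_def by simp
  finally have *: "real M1 * (real p * real p) \<le> real N" by (metis of_nat_le_iff of_nat_mult)
  have "real N powr (2 * (\<alpha> / 3)) = real N powr (\<alpha> / 3) * real N powr (\<alpha> / 3)"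
    by (simp flip: powr_add)
  also have "\<dots> \<le> real p * real p" using p_bounds(1)[OF N] by (intro mult_mono) auto
  finally have "real M1 * real N powr (2 * (\<alpha> / 3)) \<le> real M1 * (real p * real p)"
    by (rule mult_left_mono) simp
  then have "real M1 * real N powr (2 * (\<alpha> / 3)) \<le> real N" using * by linarith
  then have "real M1 \<le> real N / real N powr (2 * (\<alpha> / 3))"
    using N by (subst pos_le_divide_eq) auto
  also have "\<dots> = 1 * real N powr (1 - 2 * (\<alpha> / 3))" unfolding powr_diff using N by simp
  finally show "real M1 \<le> 1 * real N powr (1 - 2 * (\<alpha> / 3))" .
qed

lemma soft_D: "soft_pow 0 (\<lambda>N. box_instance.D d (w N))"
proof (rule soft_pow_le)
  show "soft_pow 0 (\<lambda>N. (4 * (w N + 1)) ^ d)"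
    by (intro soft_pow_power soft_pow_mult0 soft_pow_add soft_pow_const soft_w order_refl)
qed (simp add: box_instance.D_def[OF inst] box_instance.W_def[OF inst])

lemma soft_r0: "soft_pow 0 (box_instance.r0 e)"
proof (rule soft_pow_le)
  show "soft_pow 0 (\<lambda>N. 32 * e * box_instance.len N)"
    by (intro soft_pow_mult0 soft_pow_const soft_len order_refl)
qed (simp add: box_instance.r0_def[OF inst])

lemma soft_r1: "soft_pow (\<alpha> / 3) (\<lambda>N. box_instance.r1 e N (A N))"
proof (rule soft_pow_le)
  show "soft_pow (\<alpha> / 3) (\<lambda>N. box_instance.len N * (1024 * e * box_instance.p (A N)))"
    by (intro soft_pow_mult0 soft_pow_const soft_len soft_p order_refl)
qed (simp add: box_instance.r1_def[OF inst])

lemma soft_M0: "soft_pow (1 - \<alpha> / 3) (\<lambda>N. box_instance.M0 N (A N))"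
proof (rule soft_pow_le)
  have "soft_pow (\<alpha> / 3 + (1 - 2 * (\<alpha> / 3))) (\<lambda>N. box_instance.p (A N) * box_instance.M1 N (A N))"
    by (rule soft_pow_mult[OF soft_p soft_M1])
  then have "soft_pow (1 - \<alpha> / 3) (\<lambda>N. box_instance.p (A N) * box_instance.M1 N (A N))" by simp
  then show "soft_pow (1 - \<alpha> / 3) (\<lambda>N. 4 * (box_instance.p (A N) * box_instance.M1 N (A N)))"
    by (rule soft_pow_mult0[OF soft_pow_const, rotated]) simp
qed (simp add: box_instance.M0_def[OF inst])

lemma soft_H: "soft_pow (2 * (\<alpha> / 3)) (\<lambda>N. box_instance.H d e N (A N))"
proof (rule soft_pow_le)
  have "soft_pow (\<alpha> / 3) (\<lambda>N. box_instance.p (A N) + 1)"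
    using \<alpha> by (intro soft_pow_add soft_p soft_pow_const) auto
  from soft_pow_mult[OF soft_r1 this]
  have "soft_pow (2 * (\<alpha> / 3)) (\<lambda>N. box_instance.r1 e N (A N) * (box_instance.p (A N) + 1))" by simp
  moreover have "soft_pow (2 * (\<alpha> / 3)) (box_instance.r0 e)" by (rule soft_pow_mono[OF soft_r0]) (use \<alpha> in simp)
  ultimately show "soft_pow (2 * (\<alpha> / 3)) (\<lambda>N. (d + 2) * (2 * box_instance.r0 e N +
      box_instance.r1 e N (A N) * (box_instance.p (A N) + 1)))"
    by (intro soft_pow_mult0[OF soft_pow_const] soft_pow_add order_refl)
qed (simp add: box_instance.H_def[OF inst])

text \<open>Both kinds of tables take the same space up to logarithms: \<open>r1 * M1\<close> and
  \<open>M0\<close> have exponent \<open>1 - \<alpha> / 3\<close>.\<close>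

lemma soft_Z: "soft_pow (1 - \<alpha> / 3) (\<lambda>N. box_instance.Z e N (A N))"
proof (rule soft_pow_le)
  have "soft_pow (\<alpha> / 3 + (1 - 2 * (\<alpha> / 3))) (\<lambda>N. box_instance.r1 e N (A N) * box_instance.M1 N (A N))"
    by (rule soft_pow_mult[OF soft_r1 soft_M1])
  then have "soft_pow (1 - \<alpha> / 3) (\<lambda>N. box_instance.r1 e N (A N) * box_instance.M1 N (A N))" by simp
  then show "soft_pow (1 - \<alpha> / 3) (\<lambda>N. box_instance.r0 e N * (4 * box_instance.M0 N (A N)) +
      8 * (box_instance.r1 e N (A N) * box_instance.M1 N (A N)))"
    by (intro soft_pow_add soft_pow_mult0[OF soft_r0] soft_pow_mult0[OF soft_pow_const] soft_M0 order_refl)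
qed (simp add: box_instance.Z_def[OF inst] box_instance.m0_def[OF inst] box_instance.m1_def[OF inst])

lemma soft_step: "soft_pow 0 (\<lambda>N. box_instance.step_time d e N (\<tau> N))"
proof (rule soft_pow_le)
  show "soft_pow 0 (\<lambda>N. (2 * d + 6) + 1 + 1 + (\<tau> N + d + 3) +
      (3 + box_instance.r0 e N * (3 * d + \<tau> N + 15)) + 1 + (d + 2))"
    by (intro soft_pow_add soft_pow_mult0 soft_pow_const soft_r0 soft_\<tau> order_refl)
qed (simp add: box_instance.step_time_def[OF inst])

lemma soft_walk:
  assumes "soft_pow 0 F"
  shows "soft_pow (\<alpha> / 3) (\<lambda>N. box_instance.p (A N) * (box_instance.step_time d e N (\<tau> N) + F N))"
proof -
  have "soft_pow (\<alpha> / 3 + 0) (\<lambda>N. box_instance.p (A N) * (box_instance.step_time d e N (\<tau> N) + F N))"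
    by (intro soft_pow_mult soft_pow_add soft_p soft_step assms)
  then show ?thesis by simp
qed

lemma soft_fill: "soft_pow (\<alpha> / 3) (\<lambda>N. box_instance.fill_time d e N (\<tau> N) (A N))"
proof (rule soft_pow_le)
  show "soft_pow (\<alpha> / 3) (\<lambda>N. (d + 2) + (2 + box_instance.p (A N) * (box_instance.step_time d e N (\<tau> N) + 4)) +
      1 + (2 * d + 6) + 1)"
    using \<alpha> by (intro soft_pow_add soft_walk soft_pow_const) auto
qed (simp add: box_instance.fill_time_def[OF inst])

lemma soft_probe: "soft_pow (\<alpha> / 3) (\<lambda>N. box_instance.probe_time d e N (\<tau> N) (A N))"
proof (rule soft_pow_le)
  show "soft_pow (\<alpha> / 3) (\<lambda>N. (d + 2) + (2 + box_instance.p (A N) * (box_instance.step_time d e N (\<tau> N) + 4)) +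
      1 + (2 * d + 6) + 1 + (d + 2) +
      (2 + box_instance.p (A N) * (box_instance.step_time d e N (\<tau> N) + (\<tau> N + 8))))"
    using \<alpha> by (intro soft_pow_add soft_walk soft_pow_const soft_\<tau>) auto
qed (simp add: box_instance.probe_time_def[OF inst] add.assoc)

text \<open>The dominant term builds \<open>r1\<close> tables of \<open>M1\<close> chains of length
  \<open>p\<close>, with exponents
  \<open>\<alpha> / 3 + (1 - 2 * (\<alpha> / 3)) + \<alpha> / 3 = 1\<close>.\<close>

lemma soft_construct: "soft_pow 1 (\<lambda>N. box_instance.construct_time d e N (w N) (\<tau> N) (A N))"
proof (rule soft_pow_le)
  have le: "soft_pow a F \<Longrightarrow> a \<le> 1 \<Longrightarrow> soft_pow 1 F" for a F by (rule soft_pow_mono)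
  have "soft_pow (1 - 2 * (\<alpha> / 3) + \<alpha> / 3) (\<lambda>N. box_instance.M1 N (A N) * (box_instance.fill_time d e N (\<tau> N) (A N) + 2))"
    using \<alpha> by (intro soft_pow_mult soft_M1 soft_pow_add soft_fill soft_pow_const) auto
  then have "soft_pow (1 - \<alpha> / 3) (\<lambda>N. box_instance.M1 N (A N) * (box_instance.fill_time d e N (\<tau> N) (A N) + 2))"
    by simp
  then have "soft_pow (\<alpha> / 3 + (1 - \<alpha> / 3)) (\<lambda>N. box_instance.r1 e N (A N) *
      (2 + box_instance.M1 N (A N) * (box_instance.fill_time d e N (\<tau> N) (A N) + 2) + 2))"
    using \<alpha> by (intro soft_pow_mult soft_r1 soft_pow_add soft_pow_const) auto
  then have r1: "soft_pow 1 (\<lambda>N. box_instance.r1 e N (A N) *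
      (2 + box_instance.M1 N (A N) * (box_instance.fill_time d e N (\<tau> N) (A N) + 2) + 2))"
    by simp
  have M0: "soft_pow 1 (\<lambda>N. (6 * d + \<tau> N + 24) * box_instance.M0 N (A N))"
    using \<alpha> by (intro soft_pow_mult0 soft_pow_add soft_pow_const soft_\<tau> le[OF soft_M0]) auto
  show "soft_pow 1 (\<lambda>N. 2 * box_instance.len N + 2 * box_instance.p (A N) + 6 + 1 +
     (9 + (2 + 4 * box_instance.H d e N (A N)) + (2 + box_instance.D d (w N) * (1 +
      (2 + box_instance.r0 e N * (2 + (6 * d + \<tau> N + 24) * box_instance.M0 N (A N) + 2)) +
      (2 + box_instance.r1 e N (A N) *
      (2 + box_instance.M1 N (A N) * (box_instance.fill_time d e N (\<tau> N) (A N) + 2) + 2)) + 2)) + 1))"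
    using \<alpha> by (intro soft_pow_add soft_pow_mult0[OF soft_D] soft_pow_mult0[OF soft_r0] soft_pow_mult0[OF soft_pow_const]
      r1 M0 soft_pow_const le[OF soft_H] le[OF soft_p] le[OF soft_len]) auto
qed (simp add: box_instance.construct_time_def[OF inst] mult.commute)

text \<open>Guessed tables, guessed columns and the length of a walk contribute
  \<open>\<alpha> / 3\<close> each.\<close>

lemma soft_answer: "soft_pow \<alpha> (\<lambda>N. box_instance.answer_time d e N (w N) (\<tau> N) (A N))"
proof (rule soft_pow_le)
  have le: "soft_pow a F \<Longrightarrow> a \<le> \<alpha> \<Longrightarrow> soft_pow \<alpha> F" for a F by (rule soft_pow_mono)
  have "soft_pow (\<alpha> / 3 + \<alpha> / 3) (\<lambda>N. box_instance.p (A N) * (box_instance.probe_time d e N (\<tau> N) (A N) + 2))"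
    using \<alpha> by (intro soft_pow_mult soft_p soft_pow_add soft_probe soft_pow_const) auto
  then have "soft_pow (\<alpha> / 3 + \<alpha> / 3) (\<lambda>N. 2 + box_instance.p (A N) * (box_instance.probe_time d e N (\<tau> N) (A N) + 2) + 2)"
    using \<alpha> by (intro soft_pow_add[OF soft_pow_add] soft_pow_const) (simp_all del: mult_Suc_right add_2_eq_Suc' distrib_left_numeral)
  from soft_pow_mult[OF soft_r1 this] have r1: "soft_pow \<alpha> (\<lambda>N. box_instance.r1 e N (A N) *
      (2 + box_instance.p (A N) * (box_instance.probe_time d e N (\<tau> N) (A N) + 2) + 2))"
    by simp
  show "soft_pow \<alpha> (\<lambda>N. 2 * box_instance.len N + 2 * box_instance.p (A N) + 10 + (9 + (2 + box_instance.D d (w N) *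
      ((1 + (2 * d + 2) + (2 + box_instance.r0 e N * (2 * d + (\<tau> N + 4) + 11)) + (2 + box_instance.r1 e N (A N) *
      (2 + box_instance.p (A N) * (box_instance.probe_time d e N (\<tau> N) (A N) + 2) + 2))) + 2))))"
    using \<alpha> by (intro soft_pow_add soft_pow_mult0[OF soft_D] soft_pow_mult0[OF soft_r0] soft_pow_mult0[OF soft_pow_const]
      r1 soft_pow_const le[OF soft_p] le[OF soft_len] le[OF soft_\<tau>]) auto
qed (simp add: box_instance.answer_time_def[OF inst])

text \<open>The seeds take \<open>H\<close> words, of exponent \<open>2 * (\<alpha> / 3)\<close>;
  this stays within the space bound because \<open>\<alpha> < 1\<close>.\<close>

lemma soft_size: "soft_pow (1 - \<alpha> / 3) (\<lambda>N. box_instance.H d e N (A N) + box_instance.D d (w N) * box_instance.Z e N (A N))"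
  by (intro soft_pow_add soft_pow_mono[OF soft_H] soft_pow_mult0[OF soft_D soft_Z]) (use \<alpha> in simp)

text \<open>All guarded quantities have exponent below 1: \<open>p * p\<close> has
  \<open>2 * (\<alpha> / 3)\<close>, and \<open>D\<close> is polylogarithmic because
  \<open>d\<close> is constant.\<close>

lemma eventually_guard: "eventually (\<lambda>N. box_instance.guard d e N (w N) (A N)) sequentially"
proof -
  have "soft_pow (\<alpha> / 3 + \<alpha> / 3) (\<lambda>N. box_instance.p (A N) * box_instance.p (A N))"
    by (rule soft_pow_mult[OF soft_p soft_p])
  then have "soft_pow (\<alpha> / 3 + \<alpha> / 3) (\<lambda>N. 64 * (box_instance.p (A N) * box_instance.p (A N)))"
    by (rule soft_pow_mult0[OF soft_pow_const, rotated]) simp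
  then have "eventually (\<lambda>N. 64 * (box_instance.p (A N) * box_instance.p (A N)) \<le> N) sequentially"
    by (rule soft_pow_less) (use \<alpha> in simp)
  moreover have "eventually (\<lambda>N. box_instance.D d (w N) \<le> N) sequentially"
    by (rule soft_pow_less[OF soft_D]) simp
  ultimately show ?thesis
    using eventually_ge_at_top[of G] eventually_gt_at_top[of 0]
    by eventually_elim (simp add: box_instance.guard_def[OF inst])
qed

lemma soft_pow_guard:
  assumes "soft_pow a F"
  shows "soft_pow a (\<lambda>N. if box_instance.guard d e N (w N) (A N) then F N else F' N)"
  by (rule soft_pow_eventually[OF assms eventually_mono[OF eventually_guard]]) simp

end

theorem mainTheorem1:
  fixes d :: nat and \<alpha> c :: real
  assumes "0 < \<alpha>" and "\<alpha> < 1" and "0 < c"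
  shows "\<exists>K>0. \<exists>P Q. \<forall>w \<tau> :: nat \<Rightarrow> nat.
    (\<lambda>N. real (w N)) \<in> soft_O (\<lambda>_. 1) \<longrightarrow> (\<lambda>N. real (\<tau> N)) \<in> soft_O (\<lambda>_. 1) \<longrightarrow>
    (\<exists>Tp S Tq :: nat \<Rightarrow> nat.
       (\<lambda>N. real (Tp N)) \<in> soft_O (\<lambda>N. real N) \<and>
       (\<lambda>N. real (S N)) \<in> soft_O (\<lambda>N. real N powr (1 - \<alpha> / 3)) \<and>
       (\<lambda>N. real (Tq N)) \<in> soft_O (\<lambda>N. real N powr \<alpha>) \<and>
       (\<forall>N f tm. 0 < N \<longrightarrow> f \<in> {..<N} \<rightarrow> ({..<d} \<rightarrow> {..<2 ^ w N}) \<longrightarrow> (\<forall>x<N. tm x \<le> \<tau> N) \<longrightarrow>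
          measure (random_words (word_bits (ram K N (w N) d f tm)))
            {\<omega>. builds_box_structure (ram K N (w N) d f tm) N (params \<alpha> N (w N)) P Q
                  (Tp N) (S N) (Tq N) \<omega>}
          \<ge> 1 - 1 / real N powr c))"
proof -
  \<comment> \<open>The 3 pays for the union bounds in \<open>failure_bound\<close>.\<close>
  define e where "e = nat \<lceil>c\<rceil> + 3"
  define K where "K = box_programs.G d e + 8"
  define P where "P = box_programs.construct d e K"
  define Q where "Q = box_programs.answer d e K"
  show ?thesis
  proof (rule exI[of _ K], rule conjI[rotated], rule exI[of _ P], rule exI[of _ Q], intro allI impI)
    fix w \<tau> :: "nat \<Rightarrow> nat"
    assume soft: "(\<lambda>N. real (w N)) \<in> soft_O (\<lambda>_. 1)" "(\<lambda>N. real (\<tau> N)) \<in> soft_O (\<lambda>_. 1)"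
    interpret box_family d e K \<alpha> w \<tau>
      by unfold_locales (use assms soft in \<open>auto simp: K_def soft_O_one\<close>)
    let ?guard = "\<lambda>N. box_instance.guard d e N (w N) (A N)"
    let ?len = box_instance.len and ?p = "\<lambda>N. box_instance.p (A N)"
    \<comment> \<open>The alternatives cover the finitely many \<open>N\<close> outside the guard,
      where the structure is empty and queries search exhaustively; they do not affect
      growth.\<close>
    define Tp where "Tp N = (if ?guard N then box_instance.construct_time d e N (w N) (\<tau> N) (A N)
      else 2 * ?len N + 2 * ?p N + 8)" for N
    define S where "S N = (if ?guard N then box_instance.H d e N (A N) + box_instance.D d (w N) * box_instance.Z e N (A N)
      else 0)" for N
    define Tq where "Tq N = (if ?guard N then box_instance.answer_time d e N (w N) (\<tau> N) (A N)
      else 2 * ?len N + 2 * ?p N + 10 + (2 + N * (\<tau> N + 6)))" for N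
    show "\<exists>Tp S Tq :: nat \<Rightarrow> nat.
       (\<lambda>N. real (Tp N)) \<in> soft_O (\<lambda>N. real N) \<and>
       (\<lambda>N. real (S N)) \<in> soft_O (\<lambda>N. real N powr (1 - \<alpha> / 3)) \<and>
       (\<lambda>N. real (Tq N)) \<in> soft_O (\<lambda>N. real N powr \<alpha>) \<and>
       (\<forall>N f tm. 0 < N \<longrightarrow> f \<in> {..<N} \<rightarrow> ({..<d} \<rightarrow> {..<2 ^ w N}) \<longrightarrow> (\<forall>x<N. tm x \<le> \<tau> N) \<longrightarrow>
          measure (random_words (word_bits (ram K N (w N) d f tm)))
            {\<omega>. builds_box_structure (ram K N (w N) d f tm) N (params \<alpha> N (w N)) P Q
                  (Tp N) (S N) (Tq N) \<omega>}
          \<ge> 1 - 1 / real N powr c)"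
    proof (rule exI[of _ Tp], rule exI[of _ S], rule exI[of _ Tq], intro conjI allI impI)
      have "soft_pow 1 Tp" unfolding Tp_def by (rule soft_pow_guard[OF soft_construct])
      then show "(\<lambda>N. real (Tp N)) \<in> soft_O (\<lambda>N. real N)" by (rule soft_pow_one)
      have "soft_pow (1 - \<alpha> / 3) S" unfolding S_def by (rule soft_pow_guard[OF soft_size])
      then show "(\<lambda>N. real (S N)) \<in> soft_O (\<lambda>N. real N powr (1 - \<alpha> / 3))" by (simp only: soft_pow_def)
      have "soft_pow \<alpha> Tq" unfolding Tq_def by (rule soft_pow_guard[OF soft_answer])
      then show "(\<lambda>N. real (Tq N)) \<in> soft_O (\<lambda>N. real N powr \<alpha>)" by (simp only: soft_pow_def)
    next
      fix N :: nat and f :: "nat \<Rightarrow> nat \<Rightarrow> nat" and tm :: "nat \<Rightarrow> nat"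
      assume N: "0 < N" and f: "f \<in> {..<N} \<rightarrow> ({..<d} \<rightarrow> {..<2 ^ w N})" and tm: "\<forall>x<N. tm x \<le> \<tau> N"
      have "f x i < 2 ^ w N" if "x < N" "i < d" for x i
        using f that by (auto simp: Pi_iff)
      then interpret I: box_instance d e K N "w N" "\<tau> N" "A N" f tm
        using N tm by (intro family_instance) auto
      have bits: "word_bits (ram K N (w N) d f tm) = I.sh + I.len" using I.word_bits_M by (simp only: I.M_def)
      have ps: "params \<alpha> N (w N) = [N, w N, A N]" by (simp add: params_def)
      show "1 - 1 / real N powr c \<le> measure (random_words (word_bits (ram K N (w N) d f tm)))
            {\<omega>. builds_box_structure (ram K N (w N) d f tm) N (params \<alpha> N (w N)) P Q (Tp N) (S N) (Tq N) \<omega>}"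
      proof (cases I.guard)
        case True
        have "c + 3 \<le> real e" unfolding e_def by linarith
        from I.failure_bound[OF True this] I.builds_prob[OF True]
        show ?thesis unfolding bits ps Tp_def S_def Tq_def P_def Q_def I.M_def using True by simp
      next
        case False
        interpret prob_space "random_words (I.sh + I.len)"
          unfolding random_words_def by (intro prob_space_PiM) (rule measure_pmf.prob_space_axioms)
        have "{\<omega>. builds_box_structure (ram K N (w N) d f tm) N (params \<alpha> N (w N)) P Q (Tp N) (S N) (Tq N) \<omega>} = UNIV"
          unfolding ps Tp_def S_def Tq_def P_def Q_def using False I.builds_small[OF False] by (simp add: I.M_def)
        moreover have "space (random_words (I.sh + I.len)) = UNIV"
          by (simp add: random_words_def space_PiM PiE_UNIV_domain)
        ultimately show ?thesis unfolding bits using prob_space by simp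
      qed
    qed
  qed (simp add: K_def)
qed

end
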